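(* Let $K$ be a field, $Q$ a finite quiver with vertex set $I$, $<$ a total ordering on the arrows of the double $\overline{Q}$, $q\in(K^* )^I$, and $\Lambda^q=\Lambda^q(Q,<)$ the multiplicative preprojective algebra. If $X$ and $Y$ are finite-dimensional representations of $\Lambda^q$, then $$\dim\operatorname{Ext}^1_{\Lambda^q}(X,Y)=\dim\operatorname{Hom}_{\Lambda^q}(X,Y)+\dim\operatorname{Hom}_{\Lambda^q}(Y,X)-(\underline{\dim}X,\underline{\dim}Y).$$
   Context: Arrows $a$ have head $h(a)$ and tail $t(a)$. The path algebra $KQ$ has as basis the paths $a_1\cdots a_n$ with $t(a_i)=h(a_{i+1})$ together with trivial paths $e_v$ ($v\in I$). The double $\overline{Q}$ is obtained from $Q$ by adjoining a reverse arrow $a^*$ for each arrow $a\in Q$; $(a^* )^*=a$; $\epsilon(a)=1$ if $a\in Q$ and $\epsilon(a)=-1$ if $a^*\in Q$. With $a_1<a_2<\dots<a_n$ the arrows of $\overline{Q}$, $\Lambda^q$ is the target of the universal $K$-algebra homomorphism $K\overline{Q}\to R$ such that $1+aa^*$ is invertible in $R$ for all $a\in\overline{Q}$ and $(1+a_1a_1^* )^{\epsilon(a_1)}\cdots(1+a_na_n^* )^{\epsilon(a_n)}=\sum_{v\in I}q_ve_v$ in $R$. Representations of $\Lambda^q$ are left $\Lambda^q$-modules. The dimension vector of a finite-dimensional representation $X$ is $\underline{\dim}X\in\mathbb{N}^I$ with $v$-component $\dim e_vX$. The symmetric bilinear form on $\mathbb{Z}^I$ is $(\alpha,\beta)=2\sum_{v\in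 I}\alpha_v\beta_v-\sum_{a\in Q}(\alpha_{h(a)}\beta_{t(a)}+\alpha_{t(a)}\beta_{h(a)})$. Dimensions are over $K$. *)

theory Defs
  imports
    "Graph_Theory.Digraph"
    "HOL-Algebra.QuotRing"
    "HOL-Library.Poly_Mapping"
    "Jordan_Normal_Form.VS_Connect"
begin

section \<open>Quivers, path algebras and doubles\<close>

text \<open>
  A quiver is a \<open>pre_digraph\<close> (parallel arrows and loops are allowed); a finite quiver is one
  satisfying \<open>fin_digraph\<close>, which also says that heads and tails of arrows are vertices.
  The ground field is a type of class \<^class>\<open>field\<close>; \<^term>\<open>class_ring\<close> is that field seen as a
  record, as required by the library's vector spaces.
\<close>

text \<open>
  \<open>Arrows [a1, ..., an]\<close> is the path \<open>a1 ... an\<close> of length \<open>n > 0\<close>, where the tail of each arrow is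
  the head of the next one: its head is the head of \<open>a1\<close>, its tail the tail of \<open>an\<close>.
\<close>

datatype ('v, 'e) qpath = Triv 'v | Arrows "'e list"

definition qpaths :: "('v, 'e) pre_digraph \<Rightarrow> ('v, 'e) qpath set" where
  "qpaths Q = Triv ` verts Q \<union>
     {Arrows as | as. as \<noteq> [] \<and> set as \<subseteq> arcs Q \<and> successively (\<lambda>a b. tail Q a = head Q b) as}"

fun qpath_head :: "('v, 'e) pre_digraph \<Rightarrow> ('v, 'e) qpath \<Rightarrow> 'v" where
  "qpath_head Q (Triv v) = v"
| "qpath_head Q (Arrows as) = head Q (hd as)"

fun qpath_tail :: "('v, 'e) pre_digraph \<Rightarrow> ('v, 'e) qpath \<Rightarrow> 'v" where
  "qpath_tail Q (Triv v) = v"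
| "qpath_tail Q (Arrows as) = tail Q (last as)"

text \<open>Only meaningful if the tail of the first path is the head of the second one.\<close>

fun qpath_comp :: "('v, 'e) qpath \<Rightarrow> ('v, 'e) qpath \<Rightarrow> ('v, 'e) qpath" where
  "qpath_comp (Triv v) p = p"
| "qpath_comp (Arrows as) (Triv v) = Arrows as"
| "qpath_comp (Arrows as) (Arrows bs) = Arrows (as @ bs)"

definition path_mult ::
    "('v, 'e) pre_digraph \<Rightarrow> (('v, 'e) qpath \<Rightarrow>\<^sub>0 'k::field) \<Rightarrow> (('v, 'e) qpath \<Rightarrow>\<^sub>0 'k)
      \<Rightarrow> (('v, 'e) qpath \<Rightarrow>\<^sub>0 'k)" where
  "path_mult Q x y = (\<Sum>p\<in>Poly_Mapping.keys x. \<Sum>p'\<in>Poly_Mapping.keys y.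
     if qpath_tail Q p = qpath_head Q p'
     then Poly_Mapping.single (qpath_comp p p') (Poly_Mapping.lookup x p * Poly_Mapping.lookup y p') else 0)"

definition path_algebra :: "('v, 'e) pre_digraph \<Rightarrow> (('v, 'e) qpath \<Rightarrow>\<^sub>0 'k::field) ring" where
  "path_algebra Q =
    \<lparr>carrier = {x. Poly_Mapping.keys x \<subseteq> qpaths Q}, mult = path_mult Q,
     one = (\<Sum>v\<in>verts Q. Poly_Mapping.single (Triv v) 1), zero = 0, add = (+)\<rparr>"

datatype 'e darrow = Orig 'e | Rev 'e

fun star :: "'e darrow \<Rightarrow> 'e darrow" where
  "star (Orig a) = Rev a"
| "star (Rev a) = Orig a"

definition double :: "('v, 'e) pre_digraph \<Rightarrow> ('v, 'e darrow) pre_digraph" where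
  "double Q = \<lparr>verts = verts Q, arcs = Orig ` arcs Q \<union> Rev ` arcs Q,
     tail = case_darrow (tail Q) (head Q), head = case_darrow (head Q) (tail Q)\<rparr>"

definition quiver_form :: "('v, 'e) pre_digraph \<Rightarrow> ('v \<Rightarrow> int) \<Rightarrow> ('v \<Rightarrow> int) \<Rightarrow> int" where
  "quiver_form Q \<alpha> \<beta> = 2 * (\<Sum>v\<in>verts Q. \<alpha> v * \<beta> v)
     - (\<Sum>a\<in>arcs Q. \<alpha> (head Q a) * \<beta> (tail Q a) + \<alpha> (tail Q a) * \<beta> (head Q a))"


section \<open>Free algebras\<close>

text \<open>
  With words as keys, the library's convolution product on finitely supported functions is the
  multiplication of the free (noncommutative) algebra.
\<close>

datatype 'g word = Word (letters: "'g list")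

instantiation word :: (type) monoid_add
begin
definition "0 = Word []"
definition "u + w = Word (letters u @ letters w)"
instance by standard (auto simp: zero_word_def plus_word_def)
end

definition free_algebra :: "'g set \<Rightarrow> ('g word \<Rightarrow>\<^sub>0 'k::field) ring" where
  "free_algebra G =
    \<lparr>carrier = {x. \<forall>w\<in>Poly_Mapping.keys x. set (letters w) \<subseteq> G}, mult = (*), one = 1, zero = 0, add = (+)\<rparr>"

definition gen :: "'g \<Rightarrow> ('g word \<Rightarrow>\<^sub>0 'k::field)" where
  "gen g = Poly_Mapping.single (Word [g]) 1"

definition scal :: "'k::field \<Rightarrow> ('g word \<Rightarrow>\<^sub>0 'k)" where
  "scal c = Poly_Mapping.single 0 c"


section \<open>Multiplicative preprojective algebras\<close>

text \<open>The finite set \<open>A\<close> listed in increasing order with respect to \<open>r\<close>.\<close>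

definition enum_by :: "'a rel \<Rightarrow> 'a set \<Rightarrow> 'a list" where
  "enum_by r A = (THE xs. set xs = A \<and> distinct xs \<and> sorted_wrt (\<lambda>a b. (a, b) \<in> r) xs)"

text \<open>
  The algebra is the \<open>K\<close>-algebra obtained from the path algebra of the double by adjoining an
  inverse of \<open>1 + a a*\<close> for each arrow \<open>a\<close> of the double and imposing the defining relation.
  It is generated by symbols \<open>Base x\<close>, for \<open>x\<close> in the path algebra, and \<open>Inv a\<close>; the first four
  families of relations say that \<open>x \<mapsto> Base x\<close> is a homomorphism of \<open>K\<close>-algebras. The universal
  property is theorem \<open>mpa_universal\<close> below.
\<close>

datatype ('x, 'a) mpa_gen = Base 'x | Inv 'a

type_synonym ('v, 'e, 'k) dpath_alg = "('v, 'e darrow) qpath \<Rightarrow>\<^sub>0 'k"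
type_synonym ('v, 'e, 'k) mpa_free =
  "(('v, 'e, 'k) dpath_alg, 'e darrow) mpa_gen word \<Rightarrow>\<^sub>0 'k"
type_synonym ('v, 'e, 'k) mpa = "('v, 'e, 'k) mpa_free set"

definition one_plus :: "('v, 'e) pre_digraph \<Rightarrow> 'e darrow \<Rightarrow> ('v, 'e, 'k::field) dpath_alg" where
  "one_plus Q a = \<one>\<^bsub>path_algebra (double Q)\<^esub> \<oplus>\<^bsub>path_algebra (double Q)\<^esub>
     (Poly_Mapping.single (Arrows [a]) 1 \<otimes>\<^bsub>path_algebra (double Q)\<^esub>
      Poly_Mapping.single (Arrows [star a]) 1)"

definition q_elem :: "('v, 'e) pre_digraph \<Rightarrow> ('v \<Rightarrow> 'k::field) \<Rightarrow> ('v, 'e, 'k) dpath_alg" where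
  "q_elem Q q = (\<Sum>v\<in>verts Q. Poly_Mapping.single (Triv v) (q v))"

text \<open>
  The factor \<open>(1 + a a*)\<close> raised to the power \<open>\<epsilon>(a)\<close>, which is \<open>1\<close> on arrows of \<open>Q\<close> and \<open>-1\<close> on
  their reverses.
\<close>

fun mpa_factor :: "('v, 'e) pre_digraph \<Rightarrow> 'e darrow \<Rightarrow> ('v, 'e, 'k::field) mpa_free" where
  "mpa_factor Q (Orig a) = gen (Base (one_plus Q (Orig a)))"
| "mpa_factor Q (Rev a) = gen (Inv (Rev a))"

definition mpa_gens ::
    "('v, 'e) pre_digraph \<Rightarrow> (('v, 'e, 'k::field) dpath_alg, 'e darrow) mpa_gen set" where
  "mpa_gens Q = Base ` carrier (path_algebra (double Q)) \<union> Inv ` arcs (double Q)"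

definition mpa_rels ::
    "('v, 'e) pre_digraph \<Rightarrow> 'e darrow rel \<Rightarrow> ('v \<Rightarrow> 'k::field) \<Rightarrow> ('v, 'e, 'k) mpa_free set" where
  "mpa_rels Q r q = (let A = path_algebra (double Q) in
     {gen (Base (x \<oplus>\<^bsub>A\<^esub> y)) - (gen (Base x) + gen (Base y)) | x y.
        x \<in> carrier A \<and> y \<in> carrier A}
   \<union> {gen (Base (Poly_Mapping.map ((*) c) x)) - scal c * gen (Base x) | c x. x \<in> carrier A}
   \<union> {gen (Base (x \<otimes>\<^bsub>A\<^esub> y)) - gen (Base x) * gen (Base y) | x y.
        x \<in> carrier A \<and> y \<in> carrier A}
   \<union> {gen (Base \<one>\<^bsub>A\<^esub>) - 1}
   \<union> {gen (Base (one_plus Q a)) * gen (Inv a) - 1 | a. a \<in> arcs (double Q)}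
   \<union> {gen (Inv a) * gen (Base (one_plus Q a)) - 1 | a. a \<in> arcs (double Q)}
   \<union> {prod_list (map (mpa_factor Q) (enum_by r (arcs (double Q)))) - gen (Base (q_elem Q q))})"

definition mpa_ideal ::
    "('v, 'e) pre_digraph \<Rightarrow> 'e darrow rel \<Rightarrow> ('v \<Rightarrow> 'k::field) \<Rightarrow> ('v, 'e, 'k) mpa_free set" where
  "mpa_ideal Q r q = genideal (free_algebra (mpa_gens Q)) (mpa_rels Q r q)"

definition mpa ::
    "('v, 'e) pre_digraph \<Rightarrow> 'e darrow rel \<Rightarrow> ('v \<Rightarrow> 'k::field) \<Rightarrow> ('v, 'e, 'k) mpa ring" where
  "mpa Q r q = free_algebra (mpa_gens Q) Quot mpa_ideal Q r q"

definition mpa_map ::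
    "('v, 'e) pre_digraph \<Rightarrow> 'e darrow rel \<Rightarrow> ('v \<Rightarrow> 'k::field)
      \<Rightarrow> ('v, 'e, 'k) dpath_alg \<Rightarrow> ('v, 'e, 'k) mpa" where
  "mpa_map Q r q x = mpa_ideal Q r q +>\<^bsub>free_algebra (mpa_gens Q)\<^esub> gen (Base x)"

definition mpa_scalar ::
    "('v, 'e) pre_digraph \<Rightarrow> 'e darrow rel \<Rightarrow> ('v \<Rightarrow> 'k::field) \<Rightarrow> 'k \<Rightarrow> ('v, 'e, 'k) mpa" where
  "mpa_scalar Q r q c = mpa_ideal Q r q +>\<^bsub>free_algebra (mpa_gens Q)\<^esub> scal c"


subsection \<open>Universal property\<close>

lemma enum_by_ex:
  assumes "finite A" "linear_order_on B r" "A \<subseteq> B"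
  shows "\<exists>xs. set xs = A \<and> distinct xs \<and> sorted_wrt (\<lambda>a b. (a, b) \<in> r) xs"
  using assms
proof (induction "card A" arbitrary: A)
  case 0
  then show ?case by (intro exI[of _ "[]"]) auto
next
  case (Suc n)
  have ne: "A \<noteq> {}" using Suc.hyps(2) by auto
  have "\<exists>m\<in>A. \<forall>a\<in>A. (m, a) \<in> r"
    using \<open>finite A\<close> ne \<open>A \<subseteq> B\<close>
  proof (induction rule: finite_ne_induct)
    case (singleton x)
    then show ?case using assms(2) by (auto simp: order_on_defs refl_on_def)
  next
    case (insert x F)
    then obtain m where m: "m \<in> F" "\<forall>a\<in>F. (m, a) \<in> r" by auto
    show ?case
    proof (cases "(m, x) \<in> r")
      case True
      then show ?thesis using m by auto
    next
      case False
      have "(x, x) \<in> r" using insert assms(2) by (auto simp: order_on_defs refl_on_def)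
      moreover have "(x, m) \<in> r"
        using False m insert assms(2) by (fastforce simp: order_on_defs total_on_def)
      ultimately show ?thesis using m assms(2)
        by (auto simp: order_on_defs intro: transD)
    qed
  qed
  then obtain m where m: "m \<in> A" "\<forall>a\<in>A. (m, a) \<in> r" by auto
  have "n = card (A - {m})" using Suc m by (simp add: card_Diff_singleton)
  then obtain xs where "set xs = A - {m}" "distinct xs" "sorted_wrt (\<lambda>a b. (a, b) \<in> r) xs"
    using Suc.hyps(1)[of "A - {m}"] Suc.prems by blast
  then show ?case using m by (intro exI[of _ "m # xs"]) auto
qed

lemma enum_by:
  assumes "finite A" "linear_order_on A r"
  shows "set (enum_by r A) = A \<and> distinct (enum_by r A) \<and> sorted_wrt (\<lambda>a b. (a, b) \<in> r) (enum_by r A)"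
  unfolding enum_by_def
proof (rule theI')
  have ant: "antisym r" using assms by (auto simp: order_on_defs)
  have "xs = ys" if "set xs = set ys" "distinct xs" "distinct ys"
     "sorted_wrt (\<lambda>a b. (a, b) \<in> r) xs" "sorted_wrt (\<lambda>a b. (a, b) \<in> r) ys" for xs ys
    using that
  proof (induction xs arbitrary: ys)
    case (Cons x xs)
    then obtain y ys' where ys: "ys = y # ys'" by (cases ys) auto
    have "x = y"
    proof (rule ccontr)
      assume ne: "x \<noteq> y"
      then have "y \<in> set xs" "x \<in> set ys'" using Cons.prems ys by auto
      then have "(x, y) \<in> r" "(y, x) \<in> r" using Cons.prems ys by auto
      then show False using ant ne by (auto dest: antisymD)
    qed
    then show ?case using Cons ys by (auto simp: insert_eq_iff)
  qed auto
  with enum_by_ex[OF assms subset_refl]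
  show "\<exists>!xs. set xs = A \<and> distinct xs \<and> sorted_wrt (\<lambda>a b. (a, b) \<in> r) xs"
    by (metis (no_types, lifting))
qed


lemma pm_sum_single: "(\<Sum>w\<in>Poly_Mapping.keys x. Poly_Mapping.single w (Poly_Mapping.lookup x w)) = x"
  by (rule poly_mapping_eqI) (auto simp: lookup_sum lookup_single when_def in_keys_iff)

lemma double_fin_digraph: "fin_digraph Q \<Longrightarrow> fin_digraph (double Q)"
  unfolding fin_digraph_def fin_digraph_axioms_def wf_digraph_def double_def
  by (auto split: darrow.splits)

lemma path_mult_superset:
  assumes "finite S" "finite T" "Poly_Mapping.keys x \<subseteq> S" "Poly_Mapping.keys y \<subseteq> T"
  shows "path_mult Q x y = (\<Sum>p\<in>S. \<Sum>p'\<in>T.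
     if qpath_tail Q p = qpath_head Q p'
     then Poly_Mapping.single (qpath_comp p p') (Poly_Mapping.lookup x p * Poly_Mapping.lookup y p') else 0)"
proof -
  have "path_mult Q x y = (\<Sum>p\<in>Poly_Mapping.keys x. \<Sum>p'\<in>T.
     if qpath_tail Q p = qpath_head Q p'
     then Poly_Mapping.single (qpath_comp p p') (Poly_Mapping.lookup x p * Poly_Mapping.lookup y p') else 0)"
    unfolding path_mult_def
    by (intro sum.cong refl sum.mono_neutral_left assms) (auto simp: in_keys_iff)
  also have "\<dots> = (\<Sum>p\<in>S. \<Sum>p'\<in>T.
     if qpath_tail Q p = qpath_head Q p'
     then Poly_Mapping.single (qpath_comp p p') (Poly_Mapping.lookup x p * Poly_Mapping.lookup y p') else 0)"
    by (intro sum.mono_neutral_left assms) (auto simp: in_keys_iff intro!: sum.neutral)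
  finally show ?thesis .
qed

lemma path_mult_add_left: "path_mult Q (x + x') y = path_mult Q x y + path_mult Q x' y"
proof -
  let ?S = "Poly_Mapping.keys x \<union> Poly_Mapping.keys x'"
  have "Poly_Mapping.keys (x + x') \<subseteq> ?S" by (rule keys_add)
  then show ?thesis
    by (simp add: path_mult_superset[of ?S "Poly_Mapping.keys y"] sum.distrib[symmetric])
       (intro sum.cong refl, auto simp: lookup_add ring_distribs single_add)
qed

lemma path_mult_add_right: "path_mult Q y (x + x') = path_mult Q y x + path_mult Q y x'"
proof -
  let ?S = "Poly_Mapping.keys x \<union> Poly_Mapping.keys x'"
  have "Poly_Mapping.keys (x + x') \<subseteq> ?S" by (rule keys_add)
  then show ?thesis
    by (simp add: path_mult_superset[of "Poly_Mapping.keys y" ?S] sum.distrib[symmetric])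
       (intro sum.cong refl, auto simp: lookup_add ring_distribs single_add)
qed

lemma path_mult_0 [simp]: "path_mult Q 0 y = 0" "path_mult Q y 0 = 0"
  by (simp_all add: path_mult_def)

lemma path_mult_sum_left: "path_mult Q (\<Sum>i\<in>A. f i) y = (\<Sum>i\<in>A. path_mult Q (f i) y)"
  by (induction A rule: infinite_finite_induct) (auto simp: path_mult_add_left)

lemma path_mult_sum_right: "path_mult Q y (\<Sum>i\<in>A. f i) = (\<Sum>i\<in>A. path_mult Q y (f i))"
  by (induction A rule: infinite_finite_induct) (auto simp: path_mult_add_right)

lemma path_mult_single:
  "path_mult Q (Poly_Mapping.single p a) (Poly_Mapping.single p' b) =
     (if qpath_tail Q p = qpath_head Q p' then Poly_Mapping.single (qpath_comp p p') (a * b) else 0)"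
  by (simp add: path_mult_superset[of "{p}" "{p'}"])

lemma qpath_comp_assoc: "qpath_comp (qpath_comp p1 p2) p3 = qpath_comp p1 (qpath_comp p2 p3)"
  by (cases p1; cases p2; cases p3) auto

lemma qpath_comp_props:
  assumes "p \<in> qpaths Q" "p' \<in> qpaths Q" "qpath_tail Q p = qpath_head Q p'"
  shows "qpath_comp p p' \<in> qpaths Q" "qpath_head Q (qpath_comp p p') = qpath_head Q p"
    "qpath_tail Q (qpath_comp p p') = qpath_tail Q p'"
  using assms by (cases p; cases p'; auto simp: qpaths_def successively_append_iff)+

lemma path_algebra_add_closed:
  "\<lbrakk>x \<in> carrier (path_algebra Q); y \<in> carrier (path_algebra Q)\<rbrakk>
    \<Longrightarrow> x + y \<in> carrier (path_algebra Q)"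
  using keys_add[of x y] by (auto simp: path_algebra_def)

lemma path_algebra_sum_closed:
  "(\<And>i. i \<in> A \<Longrightarrow> f i \<in> carrier (path_algebra Q)) \<Longrightarrow> (\<Sum>i\<in>A. f i) \<in> carrier (path_algebra Q)"
proof (induction A rule: infinite_finite_induct)
  case (insert x F)
  then show ?case by (auto intro!: path_algebra_add_closed)
qed (auto simp: path_algebra_def)

lemma path_algebra_single_closed:
  "p \<in> qpaths Q \<Longrightarrow> Poly_Mapping.single p c \<in> carrier (path_algebra Q)"
  by (simp add: path_algebra_def)

lemma path_algebra_mult_closed:
  assumes "x \<in> carrier (path_algebra Q)" "y \<in> carrier (path_algebra Q)"
  shows "path_mult Q x y \<in> carrier (path_algebra Q)"
proof -
  have "Poly_Mapping.keys x \<subseteq> qpaths Q" "Poly_Mapping.keys y \<subseteq> qpaths Q"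
    using assms by (auto simp: path_algebra_def)
  then show ?thesis unfolding path_mult_def
    by (intro path_algebra_sum_closed)
       (auto intro!: path_algebra_single_closed qpath_comp_props simp: path_algebra_def)
qed

lemma path_mult_assoc:
  assumes "x \<in> carrier (path_algebra Q)" "y \<in> carrier (path_algebra Q)" "z \<in> carrier (path_algebra Q)"
  shows "path_mult Q (path_mult Q x y) z = path_mult Q x (path_mult Q y z)"
proof -
  let ?m = "\<lambda>x p. Poly_Mapping.single p (Poly_Mapping.lookup x p)"
  let ?K = "\<lambda>x. \<Sum>p\<in>Poly_Mapping.keys x. ?m x p"
  have sub: "Poly_Mapping.keys x \<subseteq> qpaths Q" "Poly_Mapping.keys y \<subseteq> qpaths Q"
    "Poly_Mapping.keys z \<subseteq> qpaths Q"
    using assms by (auto simp: path_algebra_def)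
  have "path_mult Q (path_mult Q (?m x p1) (?m y p2)) (?m z p3) =
        path_mult Q (?m x p1) (path_mult Q (?m y p2) (?m z p3))"
    if "p1 \<in> Poly_Mapping.keys x" "p2 \<in> Poly_Mapping.keys y" "p3 \<in> Poly_Mapping.keys z" for p1 p2 p3
    using that sub by (auto simp: path_mult_single qpath_comp_props qpath_comp_assoc mult.assoc subset_iff)
  then have "path_mult Q (path_mult Q (?K x) (?K y)) (?K z) =
     path_mult Q (?K x) (path_mult Q (?K y) (?K z))"
    unfolding path_mult_sum_left path_mult_sum_right by (intro sum.cong refl)
  then show ?thesis by (simp only: pm_sum_single)
qed

lemma path_mult_one:
  assumes "fin_digraph Q" "x \<in> carrier (path_algebra Q)"
  shows "path_mult Q \<one>\<^bsub>path_algebra Q\<^esub> x = x" "path_mult Q x \<one>\<^bsub>path_algebra Q\<^esub> = x"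
proof -
  interpret fin_digraph Q by fact
  let ?m = "\<lambda>x p. Poly_Mapping.single p (Poly_Mapping.lookup x p)"
  let ?K = "\<lambda>x. \<Sum>p\<in>Poly_Mapping.keys x. ?m x p"
  have hd: "qpath_head Q p \<in> verts Q" "qpath_tail Q p \<in> verts Q"
     "qpath_comp p (Triv (qpath_tail Q p)) = p" if "p \<in> Poly_Mapping.keys x" for p
    using that assms(2) unfolding path_algebra_def qpaths_def
    by (cases p; force intro: head_in_verts tail_in_verts dest: hd_in_set last_in_set)+
  have "path_mult Q \<one>\<^bsub>path_algebra Q\<^esub> (?K x) = ?K x"
    unfolding path_mult_sum_right
  proof (rule sum.cong[OF refl])
    fix p assume p: "p \<in> Poly_Mapping.keys x"
    have "path_mult Q \<one>\<^bsub>path_algebra Q\<^esub> (?m x p) =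
      (\<Sum>v\<in>verts Q. if v = qpath_head Q p then ?m x p else 0)"
      by (simp add: path_algebra_def path_mult_sum_left path_mult_single)
    then show "path_mult Q \<one>\<^bsub>path_algebra Q\<^esub> (?m x p) = ?m x p"
      using hd[OF p] by simp
  qed
  then show "path_mult Q \<one>\<^bsub>path_algebra Q\<^esub> x = x" by (simp only: pm_sum_single)
  have "path_mult Q (?K x) \<one>\<^bsub>path_algebra Q\<^esub> = ?K x"
    unfolding path_mult_sum_left
  proof (rule sum.cong[OF refl])
    fix p assume p: "p \<in> Poly_Mapping.keys x"
    have "path_mult Q (?m x p) \<one>\<^bsub>path_algebra Q\<^esub> =
      (\<Sum>v\<in>verts Q. if v = qpath_tail Q p then ?m x p else 0)"
      using hd(3)[OF p] by (auto simp: path_algebra_def path_mult_sum_right path_mult_single intro!: sum.cong)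
    then show "path_mult Q (?m x p) \<one>\<^bsub>path_algebra Q\<^esub> = ?m x p"
      using hd[OF p] by simp
  qed
  then show "path_mult Q x \<one>\<^bsub>path_algebra Q\<^esub> = x" by (simp only: pm_sum_single)
qed

lemma ring_path_algebra:
  assumes "fin_digraph Q"
  shows "ring (path_algebra Q :: (('v, 'e) qpath \<Rightarrow>\<^sub>0 'k::field) ring)"
proof (rule ringI)
  let ?A = "path_algebra Q :: (('v, 'e) qpath \<Rightarrow>\<^sub>0 'k) ring"
  have simps: "mult ?A = path_mult Q" "add ?A = (+)" "zero ?A = 0" by (simp_all add: path_algebra_def)
  have one: "\<one>\<^bsub>?A\<^esub> \<in> carrier ?A"
  proof -
    have "(\<Sum>v\<in>verts Q. Poly_Mapping.single (Triv v) 1) \<in> carrier ?A"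
      by (intro path_algebra_sum_closed path_algebra_single_closed) (auto simp: qpaths_def)
    then show ?thesis by (simp add: path_algebra_def)
  qed
  show "abelian_group ?A"
  proof (rule abelian_groupI)
    fix x assume x: "x \<in> carrier ?A"
    have "- x \<in> carrier ?A" using x by (auto simp: path_algebra_def in_keys_iff subset_iff)
    then show "\<exists>y\<in>carrier ?A. y \<oplus>\<^bsub>?A\<^esub> x = \<zero>\<^bsub>?A\<^esub>"
      by (intro bexI[of _ "- x"]) (simp_all add: simps)
  next
    show "x \<oplus>\<^bsub>?A\<^esub> y \<in> carrier ?A" if "x \<in> carrier ?A" "y \<in> carrier ?A" for x y
      using that by (simp only: simps path_algebra_add_closed)
  qed (simp_all add: path_algebra_def add.assoc add.commute)
  show "Group.monoid ?A"
    using path_mult_one[OF assms] one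
    by (intro monoidI) (auto simp: simps path_algebra_mult_closed path_mult_assoc)
qed (simp_all add: path_algebra_def path_mult_add_left path_mult_add_right)

lemma free_algebra_closed:
  fixes x y :: "'a word \<Rightarrow>\<^sub>0 'b::field"
  shows
  "(0 :: 'a word \<Rightarrow>\<^sub>0 'b) \<in> carrier (free_algebra G)" "(1 :: 'a word \<Rightarrow>\<^sub>0 'b) \<in> carrier (free_algebra G)"
  "g \<in> G \<Longrightarrow> (gen g :: 'a word \<Rightarrow>\<^sub>0 'b) \<in> carrier (free_algebra G)"
  "(scal d :: 'a word \<Rightarrow>\<^sub>0 'b) \<in> carrier (free_algebra G)"
  "\<lbrakk>x \<in> carrier (free_algebra G); y \<in> carrier (free_algebra G)\<rbrakk> \<Longrightarrow> x + y \<in> carrier (free_algebra G)"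
  "\<lbrakk>x \<in> carrier (free_algebra G); y \<in> carrier (free_algebra G)\<rbrakk> \<Longrightarrow> x * y \<in> carrier (free_algebra G)"
  "x \<in> carrier (free_algebra G) \<Longrightarrow> - x \<in> carrier (free_algebra G)"
  "\<lbrakk>x \<in> carrier (free_algebra G); y \<in> carrier (free_algebra G)\<rbrakk> \<Longrightarrow> x - y \<in> carrier (free_algebra G)"
proof -
  show add: "x + y \<in> carrier (free_algebra G)"
    if "x \<in> carrier (free_algebra G)" "y \<in> carrier (free_algebra G)" for x y :: "'a word \<Rightarrow>\<^sub>0 'b"
    using that keys_add[of x y] by (auto simp: free_algebra_def)
  show neg: "- x \<in> carrier (free_algebra G)" if "x \<in> carrier (free_algebra G)" for x :: "'a word \<Rightarrow>\<^sub>0 'b"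
    using that by (auto simp: free_algebra_def in_keys_iff)
  show "x - y \<in> carrier (free_algebra G)"
    if "x \<in> carrier (free_algebra G)" "y \<in> carrier (free_algebra G)" for x y :: "'a word \<Rightarrow>\<^sub>0 'b"
    using add[OF that(1) neg[OF that(2)]] by simp
  show "x * y \<in> carrier (free_algebra G)"
    if "x \<in> carrier (free_algebra G)" "y \<in> carrier (free_algebra G)" for x y :: "'a word \<Rightarrow>\<^sub>0 'b"
    using that keys_mult[of x y] by (fastforce simp: free_algebra_def plus_word_def)
qed (auto simp: free_algebra_def gen_def scal_def zero_word_def)

lemma ring_free_algebra: "ring (free_algebra G :: ('g word \<Rightarrow>\<^sub>0 'k::field) ring)"
proof (rule ringI)
  let ?A = "free_algebra G :: ('g word \<Rightarrow>\<^sub>0 'k) ring"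
  have simps: "mult ?A = (*)" "add ?A = (+)" "zero ?A = 0" "one ?A = 1" by (simp_all add: free_algebra_def)
  note cl = free_algebra_closed
  show "abelian_group ?A"
  proof (rule abelian_groupI)
    fix x assume "x \<in> carrier ?A"
    then show "\<exists>y\<in>carrier ?A. y \<oplus>\<^bsub>?A\<^esub> x = \<zero>\<^bsub>?A\<^esub>"
      by (intro bexI[of _ "- x"]) (simp_all add: simps cl)
  qed (simp_all add: simps cl algebra_simps)
  show "Group.monoid ?A"
    by (intro monoidI) (simp_all add: simps cl algebra_simps)
qed (simp_all add: free_algebra_def algebra_simps)


lemma free_algebra_induct_single:
  fixes x :: "'a word \<Rightarrow>\<^sub>0 'k::field"
  assumes x: "x \<in> carrier (free_algebra G)" and "P 0"
    and add: "\<And>x y. \<lbrakk>x \<in> carrier (free_algebra G); y \<in> carrier (free_algebra G); P x; P y\<rbrakk> \<Longrightarrow> P (x + y)"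
    and single: "\<And>w c. set (letters w) \<subseteq> G \<Longrightarrow> P (Poly_Mapping.single w c)"
  shows "P x"
proof -
  have "sum f A \<in> carrier (free_algebra G) \<and> P (sum f A)"
    if "finite A" "\<And>w. w \<in> A \<Longrightarrow> f w \<in> carrier (free_algebra G) \<and> P (f w)"
    for A and f :: "'a word \<Rightarrow> 'a word \<Rightarrow>\<^sub>0 'k"
    using that by (induction A) (auto simp: \<open>P 0\<close> free_algebra_closed intro!: add)
  from this[of "Poly_Mapping.keys x" "\<lambda>w. Poly_Mapping.single w (Poly_Mapping.lookup x w)"]
  show ?thesis using x single by (auto simp: pm_sum_single) (auto simp: free_algebra_def)
qed

lemma free_algebra_induct:
  fixes x :: "'a word \<Rightarrow>\<^sub>0 'k::field"
  assumes x: "x \<in> carrier (free_algebra G)"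
    and scal: "\<And>c. P (scal c)" and gen: "\<And>g. g \<in> G \<Longrightarrow> P (gen g)"
    and add: "\<And>x y. \<lbrakk>x \<in> carrier (free_algebra G); y \<in> carrier (free_algebra G); P x; P y\<rbrakk> \<Longrightarrow> P (x + y)"
    and mult: "\<And>x y. \<lbrakk>x \<in> carrier (free_algebra G); y \<in> carrier (free_algebra G); P x; P y\<rbrakk> \<Longrightarrow> P (x * y)"
  shows "P x"
  using x
proof (rule free_algebra_induct_single)
  show "P 0" using scal[of 0] by (simp add: scal_def)
  fix w :: "'a word" and c :: 'k
  assume w: "set (letters w) \<subseteq> G"
  obtain l where l: "w = Word l" by (cases w)
  have "P (Poly_Mapping.single (Word l) c)" if "set l \<subseteq> G" for l using that
  proof (induction l)
    case Nil
    then show ?case using scal[of c] by (simp add: scal_def zero_word_def)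
  next
    case (Cons g l)
    have "Poly_Mapping.single (Word (g # l)) c = gen g * Poly_Mapping.single (Word l) c"
      by (simp add: gen_def mult_single plus_word_def)
    moreover have "Poly_Mapping.single (Word l) c \<in> carrier (free_algebra G)"
      using Cons by (auto simp: free_algebra_def)
    ultimately show ?case using Cons by (simp add: mult gen free_algebra_closed)
  qed
  then show "P (Poly_Mapping.single w c)" using w l by simp
qed (fact add)

lemma free_algebra_eval:
  fixes \<eta> :: "'k::field \<Rightarrow> 'r" and R :: "('r, 's) ring_scheme"
  assumes "ring R" and \<eta>: "\<eta> \<in> Ring.ring_hom class_ring R"
    and cent: "\<And>c x. x \<in> carrier R \<Longrightarrow> \<eta> c \<otimes>\<^bsub>R\<^esub> x = x \<otimes>\<^bsub>R\<^esub> \<eta> c"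
    and \<gamma>: "\<And>g. g \<in> G \<Longrightarrow> \<gamma> g \<in> carrier R"
  obtains F where "F \<in> Ring.ring_hom (free_algebra G) R" "\<And>c. F (scal c) = \<eta> c"
    "\<And>g. g \<in> G \<Longrightarrow> F (gen g) = \<gamma> g"
proof -
  interpret R: ring R by fact
  define mon where "mon w = foldr (\<lambda>g z. \<gamma> g \<otimes>\<^bsub>R\<^esub> z) (letters w) \<one>\<^bsub>R\<^esub>" for w
  define T where "T x w = \<eta> (Poly_Mapping.lookup x w) \<otimes>\<^bsub>R\<^esub> mon w" for x :: "'a word \<Rightarrow>\<^sub>0 'k" and w
  define F where "F x = (\<Oplus>\<^bsub>R\<^esub>w\<in>Poly_Mapping.keys x. T x w)" for x
  let ?A = "carrier (free_algebra G) :: ('a word \<Rightarrow>\<^sub>0 'k) set"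
  have \<eta>c: "\<eta> c \<in> carrier R" for c using ring_hom_closed[OF \<eta>] by simp
  have \<eta>add: "\<eta> (c + d) = \<eta> c \<oplus>\<^bsub>R\<^esub> \<eta> d" for c d using ring_hom_add[OF \<eta>, of c d] by simp
  have \<eta>mult: "\<eta> (c * d) = \<eta> c \<otimes>\<^bsub>R\<^esub> \<eta> d" for c d using ring_hom_mult[OF \<eta>, of c d] by simp
  have \<eta>1: "\<eta> 1 = \<one>\<^bsub>R\<^esub>" using ring_hom_one[OF \<eta>] by simp
  have \<eta>0: "\<eta> 0 = \<zero>\<^bsub>R\<^esub>" using \<eta>add[of 0 0] \<eta>c[of 0] by (metis R.add.r_cancel_one add_0)
  have mon: "mon w \<in> carrier R" if "set (letters w) \<subseteq> G" for w
  proof -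
    have "foldr (\<lambda>g z. \<gamma> g \<otimes>\<^bsub>R\<^esub> z) l \<one>\<^bsub>R\<^esub> \<in> carrier R" if "set l \<subseteq> G" for l
      using that by (induction l) (auto simp: \<gamma>)
    then show ?thesis using that by (simp add: mon_def)
  qed
  have T: "T x w \<in> carrier R" if "set (letters w) \<subseteq> G" for x w
    using mon[OF that] by (simp add: T_def \<eta>c)
  have lw: "set (letters w) \<subseteq> G" if "x \<in> ?A" "w \<in> Poly_Mapping.keys x" for x w
    using that by (auto simp: free_algebra_def)
  have sup: "F x = (\<Oplus>\<^bsub>R\<^esub>w\<in>S. T x w)"
    if "finite S" "Poly_Mapping.keys x \<subseteq> S" "\<And>w. w \<in> S \<Longrightarrow> set (letters w) \<subseteq> G" for x S
    unfolding F_def using that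
    by (intro R.add.finprod_mono_neutral_cong_left) (auto simp: T mon \<eta>0 T_def in_keys_iff \<eta>c)
  have Fc: "F x \<in> carrier R" if "x \<in> ?A" for x
    unfolding F_def using T lw[OF that] by (intro R.finsum_closed) auto
  have Fadd: "F (x + y) = F x \<oplus>\<^bsub>R\<^esub> F y" if "x \<in> ?A" "y \<in> ?A" for x y
  proof -
    let ?S = "Poly_Mapping.keys x \<union> Poly_Mapping.keys y"
    have S: "finite ?S" "\<And>w. w \<in> ?S \<Longrightarrow> set (letters w) \<subseteq> G" using lw that by auto
    have "F (x + y) = (\<Oplus>\<^bsub>R\<^esub>w\<in>?S. T x w \<oplus>\<^bsub>R\<^esub> T y w)"
      unfolding sup[OF S(1) keys_add S(2), simplified]
      using S(2) by (intro R.finsum_cong' refl) (auto simp: T_def lookup_add \<eta>add R.l_distr \<eta>c mon T)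
    also have "\<dots> = F x \<oplus>\<^bsub>R\<^esub> F y"
      unfolding sup[OF S(1) Un_upper1 S(2), simplified] sup[OF S(1) Un_upper2 S(2), simplified]
      using S(2) by (intro R.finsum_addf) (auto simp: T)
    finally show ?thesis .
  qed
  have Fsingle: "F (Poly_Mapping.single w c) = \<eta> c \<otimes>\<^bsub>R\<^esub> mon w" if "set (letters w) \<subseteq> G" for w c
    using sup[of "{w}" "Poly_Mapping.single w c"] that by (simp add: T_def mon \<eta>c)
  have Fscal: "F (scal c) = \<eta> c" for c
    unfolding scal_def by (subst Fsingle) (auto simp: zero_word_def mon_def \<eta>c)
  have Fgen: "F (gen g) = \<gamma> g" if "g \<in> G" for g
    unfolding gen_def using that by (subst Fsingle) (auto simp: mon_def \<eta>1 \<gamma>)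
  have F0: "F 0 = \<zero>\<^bsub>R\<^esub>" by (simp add: F_def)
  have Fmult: "\<forall>y\<in>?A. F (x * y) = F x \<otimes>\<^bsub>R\<^esub> F y" if "x \<in> ?A" for x
    using that
  proof (rule free_algebra_induct)
    fix c
    show "\<forall>y\<in>?A. F (scal c * y) = F (scal c) \<otimes>\<^bsub>R\<^esub> F y"
    proof
      fix y assume "y \<in> ?A" then show "F (scal c * y) = F (scal c) \<otimes>\<^bsub>R\<^esub> F y"
      proof (rule free_algebra_induct_single)
        fix w and d :: 'k assume w: "set (letters w) \<subseteq> G"
        show "F (scal c * Poly_Mapping.single w d) = F (scal c) \<otimes>\<^bsub>R\<^esub> F (Poly_Mapping.single w d)"
          using w mon[OF w] by (simp add: scal_def[of c] mult_single Fsingle Fscal[unfolded scal_def] \<eta>mult \<eta>c R.m_assoc)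
      qed (simp_all add: F0 Fscal \<eta>c ring_distribs Fadd Fc free_algebra_closed R.r_distr)
    qed
  next
    fix g assume g: "g \<in> G"
    show "\<forall>y\<in>?A. F (gen g * y) = F (gen g) \<otimes>\<^bsub>R\<^esub> F y"
    proof
      fix y assume "y \<in> ?A" then show "F (gen g * y) = F (gen g) \<otimes>\<^bsub>R\<^esub> F y"
      proof (rule free_algebra_induct_single)
        fix w and d :: 'k assume w: "set (letters w) \<subseteq> G"
        have "gen g * Poly_Mapping.single w d = Poly_Mapping.single (Word (g # letters w)) d"
          by (simp add: gen_def mult_single plus_word_def)
        moreover have "mon (Word (g # letters w)) = \<gamma> g \<otimes>\<^bsub>R\<^esub> mon w" by (simp add: mon_def)
        ultimately show "F (gen g * Poly_Mapping.single w d) = F (gen g) \<otimes>\<^bsub>R\<^esub> F (Poly_Mapping.single w d)"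
          using w g mon[OF w] \<gamma>[OF g] \<eta>c[of d] cent[of "\<gamma> g" d]
          by (simp add: Fsingle Fgen R.m_assoc[symmetric])
      qed (simp_all add: F0 Fgen g \<gamma> ring_distribs Fadd Fc free_algebra_closed R.r_distr)
    qed
  qed (simp_all add: Fadd Fc free_algebra_closed ring_distribs R.l_distr R.m_assoc mult.assoc)
  have "F \<in> Ring.ring_hom (free_algebra G) R"
  proof (rule ring_hom_memI)
    show "F \<one>\<^bsub>free_algebra G\<^esub> = \<one>\<^bsub>R\<^esub>" using Fscal[of 1] by (simp add: scal_def free_algebra_def \<eta>1)
  qed (use Fc Fmult Fadd in \<open>simp_all add: free_algebra_def\<close>)
  then show ?thesis using that Fscal Fgen by blast
qed

lemma enum_by_double:
  assumes "fin_digraph Q" "linear_order_on (arcs (double Q)) r"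
  shows "set (enum_by r (arcs (double Q))) = arcs (double Q)"
  using enum_by[of "arcs (double Q)" r] assms fin_digraph.finite_arcs[OF double_fin_digraph] by blast

lemma dpath_closed:
  fixes Q :: "('v, 'e) pre_digraph" and q :: "'v \<Rightarrow> 'k::field"
  assumes "fin_digraph Q"
  shows "a \<in> arcs (double Q) \<Longrightarrow> (one_plus Q a :: ('v, 'e, 'k) dpath_alg) \<in> carrier (path_algebra (double Q))"
    "q_elem Q q \<in> carrier (path_algebra (double Q))"
proof -
  interpret A: ring "path_algebra (double Q) :: ('v, 'e, 'k) dpath_alg ring"
    by (intro ring_path_algebra double_fin_digraph assms)
  assume a: "a \<in> arcs (double Q)"
  have "star a \<in> arcs (double Q)" using a by (auto simp: double_def)
  then have "Arrows [a] \<in> qpaths (double Q)" "Arrows [star a] \<in> qpaths (double Q)"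
    using a by (auto simp: qpaths_def)
  then show "(one_plus Q a :: ('v, 'e, 'k) dpath_alg) \<in> carrier (path_algebra (double Q))"
    unfolding one_plus_def by (intro A.a_closed A.m_closed A.one_closed path_algebra_single_closed)
next
  show "q_elem Q q \<in> carrier (path_algebra (double Q))"
    unfolding q_elem_def
    by (intro path_algebra_sum_closed path_algebra_single_closed) (auto simp: qpaths_def double_def)
qed

lemma path_algebra_scale_closed:
  "x \<in> carrier (path_algebra Q) \<Longrightarrow> Poly_Mapping.map ((*) c) x \<in> carrier (path_algebra Q)"
  by (auto simp: path_algebra_def in_keys_iff map.rep_eq when_def subset_iff split: if_splits)

lemma prod_list_free_closed:
  "(\<And>x. x \<in> set xs \<Longrightarrow> x \<in> carrier (free_algebra G)) \<Longrightarrow> prod_list xs \<in> carrier (free_algebra G)"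
  by (induction xs) (auto simp: free_algebra_closed)

lemma mpa_gens_closed:
  "x \<in> carrier (path_algebra (double Q)) \<Longrightarrow> gen (Base x) \<in> carrier (free_algebra (mpa_gens Q))"
  "a \<in> arcs (double Q) \<Longrightarrow> gen (Inv a) \<in> carrier (free_algebra (mpa_gens Q))"
  by (auto intro!: free_algebra_closed simp: mpa_gens_def)

lemma mpa_factor_closed:
  "\<lbrakk>fin_digraph Q; a \<in> arcs (double Q)\<rbrakk> \<Longrightarrow> mpa_factor Q a \<in> carrier (free_algebra (mpa_gens Q))"
  by (cases a) (auto intro!: mpa_gens_closed dpath_closed)

lemma mpa_rels_closed:
  fixes Q :: "('v, 'e) pre_digraph" and q :: "'v \<Rightarrow> 'k::field"
  assumes "fin_digraph Q" "linear_order_on (arcs (double Q)) r"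
  shows "mpa_rels Q r q \<subseteq> carrier (free_algebra (mpa_gens Q))"
proof -
  interpret A: ring "path_algebra (double Q) :: ('v, 'e, 'k) dpath_alg ring"
    by (intro ring_path_algebra double_fin_digraph assms)
  let ?F = "free_algebra (mpa_gens Q) :: ('v, 'e, 'k) mpa_free ring"
  have B: "gen (Base x) \<in> carrier ?F" if "x \<in> carrier (path_algebra (double Q))" for x
    using that by (rule mpa_gens_closed)
  have O: "gen (Base (one_plus Q a)) \<in> carrier ?F" "gen (Inv a) \<in> carrier ?F" if "a \<in> arcs (double Q)" for a
    by (rule B, rule dpath_closed(1)[OF assms(1) that]) (rule mpa_gens_closed(2)[OF that])
  have P: "prod_list (map (mpa_factor Q) (enum_by r (arcs (double Q)))) \<in> carrier ?F"
    by (intro prod_list_free_closed) (auto simp: enum_by_double assms mpa_factor_closed)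
  note diff = free_algebra_closed(8) and one = free_algebra_closed(2) and mult = free_algebra_closed(6)
  show ?thesis
    unfolding mpa_rels_def Let_def
  proof (intro Un_least subsetI; (elim CollectE exE conjE singletonE)?; hypsubst)
    fix x y :: "('v, 'e, 'k) dpath_alg" assume xy: "x \<in> carrier (path_algebra (double Q))" "y \<in> carrier (path_algebra (double Q))"
    show "gen (Base (x \<oplus>\<^bsub>path_algebra (double Q)\<^esub> y)) - (gen (Base x) + gen (Base y)) \<in> carrier ?F"
      by (rule diff[OF B[OF A.a_closed[OF xy]] free_algebra_closed(5)[OF B[OF xy(1)] B[OF xy(2)]]])
    show "gen (Base (x \<otimes>\<^bsub>path_algebra (double Q)\<^esub> y)) - gen (Base x) * gen (Base y) \<in> carrier ?F"
      by (rule diff[OF B[OF A.m_closed[OF xy]] mult[OF B[OF xy(1)] B[OF xy(2)]]])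
  next
    fix c and x :: "('v, 'e, 'k) dpath_alg" assume x: "x \<in> carrier (path_algebra (double Q))"
    show "gen (Base (Poly_Mapping.map ((*) c) x)) - scal c * gen (Base x) \<in> carrier ?F"
      by (rule diff[OF B[OF path_algebra_scale_closed[OF x]] mult[OF free_algebra_closed(4) B[OF x]]])
  next
    show "gen (Base \<one>\<^bsub>path_algebra (double Q)\<^esub>) - 1 \<in> carrier ?F"
      by (rule diff[OF B[OF A.one_closed] one])
  next
    fix a assume a: "a \<in> arcs (double Q)"
    show "gen (Base (one_plus Q a)) * gen (Inv a) - 1 \<in> carrier ?F"
      by (rule diff[OF mult[OF O(1)[OF a] O(2)[OF a]] one])
    show "gen (Inv a) * gen (Base (one_plus Q a)) - 1 \<in> carrier ?F"
      by (rule diff[OF mult[OF O(2)[OF a] O(1)[OF a]] one])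
  next
    show "prod_list (map (mpa_factor Q) (enum_by r (arcs (double Q)))) - gen (Base (q_elem Q q)) \<in> carrier ?F"
      by (rule diff[OF P B[OF dpath_closed(2)[OF assms(1)]]])
  qed
qed

lemma ideal_mpa:
  fixes Q :: "('v, 'e) pre_digraph" and q :: "'v \<Rightarrow> 'k::field"
  assumes "fin_digraph Q" "linear_order_on (arcs (double Q)) r"
  shows "ideal (mpa_ideal Q r q) (free_algebra (mpa_gens Q))"
  unfolding mpa_ideal_def
  by (rule ring.genideal_ideal[OF ring_free_algebra mpa_rels_closed[OF assms]])

lemma ring_mpa:
  fixes Q :: "('v, 'e) pre_digraph" and q :: "'v \<Rightarrow> 'k::field"
  assumes "fin_digraph Q" "linear_order_on (arcs (double Q)) r"
  shows "ring (mpa Q r q)"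
  unfolding mpa_def by (rule ideal.quotient_is_ring[OF ideal_mpa[OF assms]])

lemma mpa_rel_eq:
  fixes Q :: "('v, 'e) pre_digraph" and q :: "'v \<Rightarrow> 'k::field"
  assumes "fin_digraph Q" "linear_order_on (arcs (double Q)) r" "x - y \<in> mpa_rels Q r q"
    "x \<in> carrier (free_algebra (mpa_gens Q))" "y \<in> carrier (free_algebra (mpa_gens Q))"
  shows "mpa_ideal Q r q +>\<^bsub>free_algebra (mpa_gens Q)\<^esub> x = mpa_ideal Q r q +>\<^bsub>free_algebra (mpa_gens Q)\<^esub> y"
proof -
  let ?F = "free_algebra (mpa_gens Q) :: ('v, 'e, 'k) mpa_free ring"
  interpret F: ring ?F by (rule ring_free_algebra)
  have "x - y \<in> mpa_ideal Q r q" unfolding mpa_ideal_def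
    using F.genideal_self[OF mpa_rels_closed[OF assms(1,2)]] assms by blast
  moreover have "\<ominus>\<^bsub>?F\<^esub> y = - y"
    by (rule F.minus_equality) (auto simp: free_algebra_closed assms, simp add: free_algebra_def)
  then have "x - y = x \<ominus>\<^bsub>?F\<^esub> y"
    by (simp add: a_minus_def free_algebra_def)
  ultimately show ?thesis
    using F.quotient_eq_iff_same_a_r_cos[OF ideal_mpa[OF assms(1,2)] assms(4,5)] by simp
qed

lemma ring_hom_foldr:
  assumes "ring R" "ring S" "h \<in> Ring.ring_hom R S" "\<And>x. x \<in> set xs \<Longrightarrow> f x \<in> carrier R"
  shows "h (foldr (\<lambda>a z. f a \<otimes>\<^bsub>R\<^esub> z) xs \<one>\<^bsub>R\<^esub>) = foldr (\<lambda>a z. h (f a) \<otimes>\<^bsub>S\<^esub> z) xs \<one>\<^bsub>S\<^esub>"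
proof -
  interpret R: ring R by fact
  have "foldr (\<lambda>a z. f a \<otimes>\<^bsub>R\<^esub> z) xs \<one>\<^bsub>R\<^esub> \<in> carrier R \<and>
    h (foldr (\<lambda>a z. f a \<otimes>\<^bsub>R\<^esub> z) xs \<one>\<^bsub>R\<^esub>) = foldr (\<lambda>a z. h (f a) \<otimes>\<^bsub>S\<^esub> z) xs \<one>\<^bsub>S\<^esub>"
    using assms(4) by (induction xs) (auto simp: ring_hom_one[OF assms(3)] ring_hom_mult[OF assms(3)])
  then show ?thesis by blast
qed

lemma prod_list_free_foldr:
  "prod_list (map f xs) = foldr (\<lambda>a z. f a \<otimes>\<^bsub>free_algebra G\<^esub> z) xs \<one>\<^bsub>free_algebra G\<^esub>"
  by (induction xs) (auto simp: free_algebra_def)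

lemma foldr_mult_cong:
  "(\<And>a. a \<in> set xs \<Longrightarrow> f a = g a) \<Longrightarrow> foldr (\<lambda>a z. m (f a) z) xs e = foldr (\<lambda>a z. m (g a) z) xs e"
  by (induction xs) auto

text \<open>
  \<open>mpa_target Q r q R \<eta> \<psi>\<close> says that \<open>R\<close> is a \<open>K\<close>-algebra (with structure map \<open>\<eta>\<close>) and \<open>\<psi>\<close> a
  homomorphism of \<open>K\<close>-algebras from the path algebra of the double to \<open>R\<close> that satisfies the two
  conditions defining the multiplicative preprojective algebra. The algebra \<^const>\<open>mpa\<close> is the
  target of the universal such homomorphism.
\<close>

definition mpa_target ::
    "('v, 'e) pre_digraph \<Rightarrow> 'e darrow rel \<Rightarrow> ('v \<Rightarrow> 'k::field) \<Rightarrow> ('r, 's) ring_scheme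
      \<Rightarrow> ('k \<Rightarrow> 'r) \<Rightarrow> (('v, 'e, 'k) dpath_alg \<Rightarrow> 'r) \<Rightarrow> bool" where
  "mpa_target Q r q R \<eta> \<psi> \<longleftrightarrow> ring R \<and>
     \<eta> \<in> Ring.ring_hom class_ring R \<and> (\<forall>c. \<forall>x\<in>carrier R. \<eta> c \<otimes>\<^bsub>R\<^esub> x = x \<otimes>\<^bsub>R\<^esub> \<eta> c) \<and>
     \<psi> \<in> Ring.ring_hom (path_algebra (double Q)) R \<and>
     (\<forall>c. \<forall>x\<in>carrier (path_algebra (double Q)).
        \<psi> (Poly_Mapping.map ((*) c) x) = \<eta> c \<otimes>\<^bsub>R\<^esub> \<psi> x) \<and>
     (\<forall>a\<in>arcs (double Q). \<psi> (one_plus Q a) \<in> Units R) \<and>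
     foldr (\<lambda>a z. (case a of Orig _ \<Rightarrow> \<psi> (one_plus Q a) | Rev _ \<Rightarrow> inv\<^bsub>R\<^esub> \<psi> (one_plus Q a)) \<otimes>\<^bsub>R\<^esub> z)
       (enum_by r (arcs (double Q))) \<one>\<^bsub>R\<^esub> = \<psi> (q_elem Q q)"

theorem mpa_is_target:
  assumes "fin_digraph Q" "linear_order_on (arcs (double Q)) r"
  shows "mpa_target Q r q (mpa Q r q) (mpa_scalar Q r q) (mpa_map Q r q)"
proof -
  let ?F = "free_algebra (mpa_gens Q)" and ?\<Lambda> = "mpa Q r q" and ?D = "double Q"
  let ?A = "path_algebra ?D :: ('a, 'b, 'c) dpath_alg ring"
  interpret A: ring ?A by (intro ring_path_algebra double_fin_digraph assms)
  interpret F: ring ?F by (rule ring_free_algebra)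
  interpret L: ring ?\<Lambda> by (rule ring_mpa[OF assms])
  interpret I: ideal "mpa_ideal Q r q" ?F by (rule ideal_mpa[OF assms])
  define \<pi> where "\<pi> = (+>\<^bsub>?F\<^esub>) (mpa_ideal Q r q)"
  have \<pi>: "\<pi> \<in> Ring.ring_hom ?F ?\<Lambda>" unfolding \<pi>_def mpa_def by (rule I.rcos_ring_hom)
  note fs = free_algebra_def partial_object.simps monoid.simps ring.simps
  have \<pi>c: "\<pi> x \<in> carrier ?\<Lambda>" if "x \<in> carrier ?F" for x using ring_hom_closed[OF \<pi> that] .
  have \<pi>add: "\<pi> (x + y) = \<pi> x \<oplus>\<^bsub>?\<Lambda>\<^esub> \<pi> y" if "x \<in> carrier ?F" "y \<in> carrier ?F" for x y
    using ring_hom_add[OF \<pi> that] by (simp add: fs)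
  have \<pi>mult: "\<pi> (x * y) = \<pi> x \<otimes>\<^bsub>?\<Lambda>\<^esub> \<pi> y" if "x \<in> carrier ?F" "y \<in> carrier ?F" for x y
    using ring_hom_mult[OF \<pi> that] by (simp add: fs)
  have \<pi>1: "\<pi> 1 = \<one>\<^bsub>?\<Lambda>\<^esub>" using ring_hom_one[OF \<pi>] by (simp add: fs)
  have rel: "\<pi> x = \<pi> y" if "x - y \<in> mpa_rels Q r q" "x \<in> carrier ?F" "y \<in> carrier ?F" for x y
    unfolding \<pi>_def by (rule mpa_rel_eq[OF assms that])
  note fa = free_algebra_closed mpa_gens_closed
  note cl = fa A.a_closed A.m_closed A.one_closed path_algebra_scale_closed dpath_closed assms
  have \<phi>: "mpa_map Q r q x = \<pi> (gen (Base x))" for x by (simp add: mpa_map_def \<pi>_def)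
  have \<eta>: "mpa_scalar Q r q c = \<pi> (scal c)" for c by (simp add: mpa_scalar_def \<pi>_def)
  note mr = mpa_rels_def Let_def
  have plc: "prod_list (map (mpa_factor Q) (enum_by r (arcs ?D))) \<in> carrier ?F"
    by (intro prod_list_free_closed) (auto simp: enum_by_double assms mpa_factor_closed)
  have inv1: "\<pi> (gen (Base (one_plus Q a))) \<otimes>\<^bsub>?\<Lambda>\<^esub> \<pi> (gen (Inv a)) = \<one>\<^bsub>?\<Lambda>\<^esub>" if a: "a \<in> arcs ?D" for a
  proof -
    have c: "gen (Base (one_plus Q a)) \<in> carrier ?F" "gen (Inv a) \<in> carrier ?F"
      using a by (simp_all add: mpa_gens_closed dpath_closed assms)
    have "gen (Base (one_plus Q a)) * gen (Inv a) - 1 \<in> mpa_rels Q r q"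
      using a unfolding mr by blast
    from rel[OF this fa(6)[OF c] fa(2)] show ?thesis by (simp only: \<pi>1 \<pi>mult[OF c])
  qed
  have inv2: "\<pi> (gen (Inv a)) \<otimes>\<^bsub>?\<Lambda>\<^esub> \<pi> (gen (Base (one_plus Q a))) = \<one>\<^bsub>?\<Lambda>\<^esub>" if a: "a \<in> arcs ?D" for a
  proof -
    have c: "gen (Base (one_plus Q a)) \<in> carrier ?F" "gen (Inv a) \<in> carrier ?F"
      using a by (simp_all add: mpa_gens_closed dpath_closed assms)
    have "gen (Inv a) * gen (Base (one_plus Q a)) - 1 \<in> mpa_rels Q r q"
      using a unfolding mr by blast
    from rel[OF this fa(6)[OF c(2,1)] fa(2)] show ?thesis by (simp only: \<pi>1 \<pi>mult[OF c(2,1)])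
  qed
  have inv_c: "\<pi> (gen (Base (one_plus Q a))) \<in> carrier ?\<Lambda>" "\<pi> (gen (Inv a)) \<in> carrier ?\<Lambda>"
    if "a \<in> arcs ?D" for a
    by (rule \<pi>c, rule mpa_gens_closed(1), rule dpath_closed(1)[OF assms(1) that])
       (rule \<pi>c, rule mpa_gens_closed(2)[OF that])
  have unit: "\<pi> (gen (Base (one_plus Q a))) \<in> Units ?\<Lambda>" if a: "a \<in> arcs ?D" for a
    unfolding Units_def using inv1[OF a] inv2[OF a] inv_c[OF a] by blast
  have inv: "inv\<^bsub>?\<Lambda>\<^esub> \<pi> (gen (Base (one_plus Q a))) = \<pi> (gen (Inv a))" if a: "a \<in> arcs ?D" for a
    by (rule L.inv_char[OF inv_c[OF a] inv1[OF a] inv2[OF a]])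
  have "foldr (\<lambda>a z. (case a of Orig _ \<Rightarrow> \<pi> (gen (Base (one_plus Q a)))
            | Rev _ \<Rightarrow> inv\<^bsub>?\<Lambda>\<^esub> \<pi> (gen (Base (one_plus Q a)))) \<otimes>\<^bsub>?\<Lambda>\<^esub> z)
         (enum_by r (arcs ?D)) \<one>\<^bsub>?\<Lambda>\<^esub>
      = foldr (\<lambda>a z. \<pi> (mpa_factor Q a) \<otimes>\<^bsub>?\<Lambda>\<^esub> z) (enum_by r (arcs ?D)) \<one>\<^bsub>?\<Lambda>\<^esub>"
    by (intro foldr_mult_cong) (auto simp: enum_by_double assms inv split: darrow.splits)
  also have "\<dots> = \<pi> (prod_list (map (mpa_factor Q) (enum_by r (arcs ?D))))"
    unfolding prod_list_free_foldr[of _ _ "mpa_gens Q"]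
    by (intro ring_hom_foldr[symmetric] F.ring_axioms L.ring_axioms \<pi>)
       (auto simp: enum_by_double assms mpa_factor_closed)
  also have "\<dots> = \<pi> (gen (Base (q_elem Q q)))"
  proof (rule rel[OF _ plc])
    show "prod_list (map (mpa_factor Q) (enum_by r (arcs ?D))) - gen (Base (q_elem Q q)) \<in> mpa_rels Q r q"
      unfolding mr by blast
  qed (simp add: mpa_gens_closed dpath_closed assms)
  finally have prod: "foldr (\<lambda>a z. (case a of Orig _ \<Rightarrow> \<pi> (gen (Base (one_plus Q a)))
            | Rev _ \<Rightarrow> inv\<^bsub>?\<Lambda>\<^esub> \<pi> (gen (Base (one_plus Q a)))) \<otimes>\<^bsub>?\<Lambda>\<^esub> z)
         (enum_by r (arcs ?D)) \<one>\<^bsub>?\<Lambda>\<^esub> = \<pi> (gen (Base (q_elem Q q)))" .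
  have hom: "(\<lambda>x. \<pi> (gen (Base x))) \<in> Ring.ring_hom ?A ?\<Lambda>"
  proof (rule ring_hom_memI)
    fix x y assume xy: "x \<in> carrier ?A" "y \<in> carrier ?A"
    note gx = mpa_gens_closed(1)[OF xy(1)] and gy = mpa_gens_closed(1)[OF xy(2)]
    have "gen (Base (x \<otimes>\<^bsub>?A\<^esub> y)) - gen (Base x) * gen (Base y) \<in> mpa_rels Q r q"
      using xy unfolding mr by blast
    from rel[OF this mpa_gens_closed(1)[OF A.m_closed[OF xy]] fa(6)[OF gx gy]]
    show "\<pi> (gen (Base (x \<otimes>\<^bsub>?A\<^esub> y))) = \<pi> (gen (Base x)) \<otimes>\<^bsub>?\<Lambda>\<^esub> \<pi> (gen (Base y))"
      by (simp only: \<pi>mult[OF gx gy])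
    have "gen (Base (x \<oplus>\<^bsub>?A\<^esub> y)) - (gen (Base x) + gen (Base y)) \<in> mpa_rels Q r q"
      using xy unfolding mr by blast
    from rel[OF this mpa_gens_closed(1)[OF A.a_closed[OF xy]] fa(5)[OF gx gy]]
    show "\<pi> (gen (Base (x \<oplus>\<^bsub>?A\<^esub> y))) = \<pi> (gen (Base x)) \<oplus>\<^bsub>?\<Lambda>\<^esub> \<pi> (gen (Base y))"
      by (simp only: \<pi>add[OF gx gy])
  next
    have "gen (Base \<one>\<^bsub>?A\<^esub>) - 1 \<in> mpa_rels Q r q" unfolding mr by blast
    from rel[OF this mpa_gens_closed(1)[OF A.one_closed] fa(2)]
    show "\<pi> (gen (Base \<one>\<^bsub>?A\<^esub>)) = \<one>\<^bsub>?\<Lambda>\<^esub>" by (simp only: \<pi>1)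
  next
    show "\<pi> (gen (Base x)) \<in> carrier ?\<Lambda>" if "x \<in> carrier ?A" for x
      using that by (simp add: \<pi>c fa)
  qed
  have lin: "\<pi> (gen (Base (Poly_Mapping.map ((*) c) x))) = \<pi> (scal c) \<otimes>\<^bsub>?\<Lambda>\<^esub> \<pi> (gen (Base x))"
    if x: "x \<in> carrier ?A" for c x
  proof -
    have "gen (Base (Poly_Mapping.map ((*) c) x)) - scal c * gen (Base x) \<in> mpa_rels Q r q"
      using x unfolding mr by blast
    from rel[OF this mpa_gens_closed(1)[OF path_algebra_scale_closed[OF x]]
        fa(6)[OF fa(4) mpa_gens_closed(1)[OF x]]]
    show ?thesis by (simp only: \<pi>mult[OF fa(4) mpa_gens_closed(1)[OF x]])
  qed
  have sc: "(\<lambda>c. \<pi> (scal c)) \<in> Ring.ring_hom class_ring ?\<Lambda>"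
  proof (rule ring_hom_memI)
    fix c d :: 'c
    have "(scal (c * d) :: ('a, 'b, 'c) mpa_free) = scal c * scal d"
      "(scal (c + d) :: ('a, 'b, 'c) mpa_free) = scal c + scal d"
      by (simp_all add: scal_def mult_single single_add)
    then show "\<pi> (scal (c \<otimes>\<^bsub>class_ring\<^esub> d)) = \<pi> (scal c) \<otimes>\<^bsub>?\<Lambda>\<^esub> \<pi> (scal d)"
      "\<pi> (scal (c \<oplus>\<^bsub>class_ring\<^esub> d)) = \<pi> (scal c) \<oplus>\<^bsub>?\<Lambda>\<^esub> \<pi> (scal d)"
      by (simp_all add: \<pi>mult \<pi>add fa)
  next
    show "\<pi> (scal \<one>\<^bsub>class_ring\<^esub>) = \<one>\<^bsub>?\<Lambda>\<^esub>" by (simp add: scal_def \<pi>1)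
  qed (intro \<pi>c fa)
  have cent: "\<pi> (scal c) \<otimes>\<^bsub>?\<Lambda>\<^esub> x = x \<otimes>\<^bsub>?\<Lambda>\<^esub> \<pi> (scal c)" if x: "x \<in> carrier ?\<Lambda>" for c x
  proof -
    obtain y where y: "y \<in> carrier ?F" "x = \<pi> y"
      using x by (auto simp: mpa_def FactRing_def A_RCOSETS_def' \<pi>_def)
    have "scal c * y = y * scal c"
      using y(1) by (rule free_algebra_induct_single)
        (auto simp: ring_distribs scal_def mult_single mult.commute)
    then show ?thesis unfolding y(2) by (simp only: \<pi>mult[OF fa(4) y(1), symmetric] \<pi>mult[OF y(1) fa(4), symmetric])
  qed
  have \<phi>_eq: "mpa_map Q r q = (\<lambda>x. \<pi> (gen (Base x)))" and \<eta>_eq: "mpa_scalar Q r q = (\<lambda>c. \<pi> (scal c))"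
    by (intro ext \<phi> \<eta>)+
  show ?thesis unfolding mpa_target_def \<phi>_eq \<eta>_eq
    by (intro conjI allI ballI L.ring_axioms sc cent hom lin unit prod)
qed

theorem mpa_universal:
  assumes "fin_digraph Q" "linear_order_on (arcs (double Q)) r" "mpa_target Q r q R \<eta> \<psi>"
  shows "\<exists>!f. f \<in> Ring.ring_hom (mpa Q r q) R \<and> f \<in> extensional (carrier (mpa Q r q)) \<and>
    (\<forall>c. f (mpa_scalar Q r q c) = \<eta> c) \<and>
    (\<forall>x\<in>carrier (path_algebra (double Q)). f (mpa_map Q r q x) = \<psi> x)"
proof -
  let ?F = "free_algebra (mpa_gens Q)" and ?\<Lambda> = "mpa Q r q" and ?D = "double Q"
  let ?A = "path_algebra ?D"
  note as = assms(1,2)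
  have R: "ring R" and \<eta>: "\<eta> \<in> Ring.ring_hom class_ring R"
    and cent: "\<And>c x. x \<in> carrier R \<Longrightarrow> \<eta> c \<otimes>\<^bsub>R\<^esub> x = x \<otimes>\<^bsub>R\<^esub> \<eta> c"
    and \<psi>: "\<psi> \<in> Ring.ring_hom ?A R"
    and lin: "\<And>c x. x \<in> carrier ?A \<Longrightarrow> \<psi> (Poly_Mapping.map ((*) c) x) = \<eta> c \<otimes>\<^bsub>R\<^esub> \<psi> x"
    and unit: "\<And>a. a \<in> arcs ?D \<Longrightarrow> \<psi> (one_plus Q a) \<in> Units R"
    and prod: "foldr (\<lambda>a z. (case a of Orig _ \<Rightarrow> \<psi> (one_plus Q a)
         | Rev _ \<Rightarrow> inv\<^bsub>R\<^esub> \<psi> (one_plus Q a)) \<otimes>\<^bsub>R\<^esub> z) (enum_by r (arcs ?D)) \<one>\<^bsub>R\<^esub> = \<psi> (q_elem Q q)"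
    using assms(3) unfolding mpa_target_def by auto
  interpret R: ring R by fact
  interpret A: ring ?A by (intro ring_path_algebra double_fin_digraph as)
  interpret F: ring ?F by (rule ring_free_algebra)
  interpret L: ring ?\<Lambda> by (rule ring_mpa[OF as])
  interpret I: ideal "mpa_ideal Q r q" ?F by (rule ideal_mpa[OF as])
  define \<pi> where "\<pi> = (+>\<^bsub>?F\<^esub>) (mpa_ideal Q r q)"
  have \<pi>: "\<pi> \<in> Ring.ring_hom ?F ?\<Lambda>" unfolding \<pi>_def mpa_def by (rule I.rcos_ring_hom)
  note fs = free_algebra_def partial_object.simps monoid.simps ring.simps
  note fa = free_algebra_closed mpa_gens_closed
  note cl = fa A.a_closed A.m_closed A.one_closed path_algebra_scale_closed dpath_closed as
  have \<phi>': "mpa_map Q r q x = \<pi> (gen (Base x))" for x by (simp add: mpa_map_def \<pi>_def)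
  have \<eta>': "mpa_scalar Q r q c = \<pi> (scal c)" for c by (simp add: mpa_scalar_def \<pi>_def)
  have surj: "\<exists>y\<in>carrier ?F. x = \<pi> y" if "x \<in> carrier ?\<Lambda>" for x
    using that by (auto simp: mpa_def FactRing_def A_RCOSETS_def' \<pi>_def)
  have \<pi>add: "\<pi> (x + y) = \<pi> x \<oplus>\<^bsub>?\<Lambda>\<^esub> \<pi> y" if "x \<in> carrier ?F" "y \<in> carrier ?F" for x y
    using ring_hom_add[OF \<pi> that] by (simp add: fs)
  have \<pi>mult: "\<pi> (x * y) = \<pi> x \<otimes>\<^bsub>?\<Lambda>\<^esub> \<pi> y" if "x \<in> carrier ?F" "y \<in> carrier ?F" for x y
    using ring_hom_mult[OF \<pi> that] by (simp add: fs)
  have \<pi>1: "\<pi> 1 = \<one>\<^bsub>?\<Lambda>\<^esub>" using ring_hom_one[OF \<pi>] by (simp add: fs)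
  have \<pi>c: "\<pi> x \<in> carrier ?\<Lambda>" if "x \<in> carrier ?F" for x using ring_hom_closed[OF \<pi> that] .

  define \<gamma> where "\<gamma> g = (case g of Base x \<Rightarrow> \<psi> x | Inv a \<Rightarrow> inv\<^bsub>R\<^esub> \<psi> (one_plus Q a))" for g
  have "\<gamma> g \<in> carrier R" if "g \<in> mpa_gens Q" for g
    using that ring_hom_closed[OF \<psi>] unit by (auto simp: mpa_gens_def \<gamma>_def)
  then obtain h where h: "h \<in> Ring.ring_hom ?F R" "\<And>c. h (scal c) = \<eta> c"
    "\<And>g. g \<in> mpa_gens Q \<Longrightarrow> h (gen g) = \<gamma> g"
    using free_algebra_eval[OF R \<eta> cent, of "mpa_gens Q" \<gamma>] by blast
  interpret h: ring_hom_ring ?F R h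
    by (intro ring_hom_ringI2 F.ring_axioms R h)
  have hB: "h (gen (Base x)) = \<psi> x" if "x \<in> carrier ?A" for x
    using that by (simp add: h mpa_gens_def \<gamma>_def)
  have hI: "h (gen (Inv a)) = inv\<^bsub>R\<^esub> \<psi> (one_plus Q a)" if "a \<in> arcs ?D" for a
    using that by (simp add: h mpa_gens_def \<gamma>_def)
  have hadd: "h (x + y) = h x \<oplus>\<^bsub>R\<^esub> h y" if "x \<in> carrier ?F" "y \<in> carrier ?F" for x y
    using h.hom_add[OF that] by (simp add: fs)
  have hmult: "h (x * y) = h x \<otimes>\<^bsub>R\<^esub> h y" if "x \<in> carrier ?F" "y \<in> carrier ?F" for x y
    using h.hom_mult[OF that] by (simp add: fs)
  have h1: "h 1 = \<one>\<^bsub>R\<^esub>" using h.hom_one by (simp add: fs)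
  have hdiff: "h (x - y) = \<zero>\<^bsub>R\<^esub>" if "h x = h y" "x \<in> carrier ?F" "y \<in> carrier ?F" for x y
  proof -
    have "h x = h (x - y) \<oplus>\<^bsub>R\<^esub> h y" using hadd[of "x - y" y] that by (simp add: fa)
    then show ?thesis
      using that fa(8)[of x "mpa_gens Q" y] h.hom_closed[of x] h.hom_closed[of "x - y"]
      by (metis R.add.r_cancel_one)
  qed
  have hprod: "h (prod_list (map (mpa_factor Q) (enum_by r (arcs ?D)))) = \<psi> (q_elem Q q)"
  proof -
    have "h (prod_list (map (mpa_factor Q) (enum_by r (arcs ?D)))) =
        foldr (\<lambda>a z. h (mpa_factor Q a) \<otimes>\<^bsub>R\<^esub> z) (enum_by r (arcs ?D)) \<one>\<^bsub>R\<^esub>"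
      unfolding prod_list_free_foldr[of _ _ "mpa_gens Q"]
      by (intro ring_hom_foldr F.ring_axioms R h) (auto simp: enum_by_double as mpa_factor_closed)
    also have "\<dots> = \<psi> (q_elem Q q)"
      unfolding prod[symmetric]
      by (intro foldr_mult_cong) (auto simp: enum_by_double as hB hI dpath_closed split: darrow.splits)
    finally show ?thesis .
  qed
  have "mpa_rels Q r q \<subseteq> a_kernel ?F R h"
  proof
    fix z assume z: "z \<in> mpa_rels Q r q"
    then have zc: "z \<in> carrier ?F" using mpa_rels_closed[OF as] by blast
    have plc: "prod_list (map (mpa_factor Q) (enum_by r (arcs ?D))) \<in> carrier ?F"
      by (intro prod_list_free_closed) (auto simp: enum_by_double as mpa_factor_closed)
    have d: "h (u - v) = \<zero>\<^bsub>R\<^esub>" if "u \<in> carrier ?F" "v \<in> carrier ?F" "h u = h v" for u v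
      using that by (simp add: hdiff)
    consider
        (add) x y where "z = gen (Base (x \<oplus>\<^bsub>?A\<^esub> y)) - (gen (Base x) + gen (Base y))"
          "x \<in> carrier ?A" "y \<in> carrier ?A"
      | (scale) c x where "z = gen (Base (Poly_Mapping.map ((*) c) x)) - scal c * gen (Base x)"
          "x \<in> carrier ?A"
      | (mult) x y where "z = gen (Base (x \<otimes>\<^bsub>?A\<^esub> y)) - gen (Base x) * gen (Base y)"
          "x \<in> carrier ?A" "y \<in> carrier ?A"
      | (one) "z = gen (Base \<one>\<^bsub>?A\<^esub>) - 1"
      | (inv1) a where "z = gen (Base (one_plus Q a)) * gen (Inv a) - 1" "a \<in> arcs ?D"
      | (inv2) a where "z = gen (Inv a) * gen (Base (one_plus Q a)) - 1" "a \<in> arcs ?D"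
      | (prod) "z = prod_list (map (mpa_factor Q) (enum_by r (arcs ?D))) - gen (Base (q_elem Q q))"
      using z unfolding mpa_rels_def Let_def by blast
    then have "h z = \<zero>\<^bsub>R\<^esub>"
    proof cases
      case add
      show ?thesis unfolding add(1)
        using add(2,3) by (intro d) (simp_all add: fa hB hadd ring_hom_add[OF \<psi>])
    next
      case scale
      show ?thesis unfolding scale(1)
        using scale(2) by (intro d) (simp_all add: fa hB hmult lin h(2) path_algebra_scale_closed)
    next
      case mult
      show ?thesis unfolding mult(1)
        using mult(2,3) by (intro d) (simp_all add: fa hB hmult ring_hom_mult[OF \<psi>])
    next
      case one
      show ?thesis unfolding one
        by (intro d) (simp_all add: fa hB h1 ring_hom_one[OF \<psi>])
    next
      case inv1
      show ?thesis unfolding inv1(1)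
        using inv1(2) by (intro d) (simp_all add: fa hB hI h1 hmult dpath_closed as unit)
    next
      case inv2
      show ?thesis unfolding inv2(1)
        using inv2(2) by (intro d) (simp_all add: fa hB hI h1 hmult dpath_closed as unit)
    next
      case prod
      show ?thesis unfolding prod
        by (intro d) (simp_all add: plc fa hB hprod dpath_closed as)
    qed
    then show "z \<in> a_kernel ?F R h" using zc unfolding a_kernel_def' by blast
  qed
  then have ker: "mpa_ideal Q r q \<subseteq> a_kernel ?F R h"
    unfolding mpa_ideal_def by (intro F.genideal_minimal h.kernel_is_ideal)
  define f where "f = (\<lambda>C\<in>carrier ?\<Lambda>. the_elem (h ` C))"
  have f\<pi>: "f (\<pi> y) = h y" if y: "y \<in> carrier ?F" for y
  proof -
    have "h z = h y" if z: "z \<in> \<pi> y" for z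
    proof -
      obtain i where i: "i \<in> mpa_ideal Q r q" "z = i + y"
        using z unfolding \<pi>_def a_r_coset_def' by (auto simp: fs)
      have "h i = \<zero>\<^bsub>R\<^esub>" using ker i unfolding a_kernel_def' by blast
      then show ?thesis using i y I.a_Hcarr[OF i(1)] h.hom_closed[OF y] by (simp add: hadd)
    qed
    moreover have "y \<in> \<pi> y" unfolding \<pi>_def by (rule I.a_rcos_self[OF y])
    ultimately have "h ` \<pi> y = {h y}" by blast
    then show ?thesis using \<pi>c[OF y] by (simp add: f_def)
  qed
  show ?thesis
  proof (rule ex1I[of _ f], intro conjI allI ballI)
    show "f \<in> Ring.ring_hom ?\<Lambda> R"
    proof (rule ring_hom_memI)
      fix x y assume "x \<in> carrier ?\<Lambda>" "y \<in> carrier ?\<Lambda>"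
      then obtain x' y' where "x' \<in> carrier ?F" "x = \<pi> x'" "y' \<in> carrier ?F" "y = \<pi> y'"
        using surj by meson
      then show "f (x \<otimes>\<^bsub>?\<Lambda>\<^esub> y) = f x \<otimes>\<^bsub>R\<^esub> f y" "f (x \<oplus>\<^bsub>?\<Lambda>\<^esub> y) = f x \<oplus>\<^bsub>R\<^esub> f y"
        by (simp_all add: \<pi>mult[symmetric] \<pi>add[symmetric] f\<pi> fa hmult hadd)
    next
      fix x assume "x \<in> carrier ?\<Lambda>"
      then show "f x \<in> carrier R" using surj[of x] f\<pi> by auto
    next
      show "f \<one>\<^bsub>?\<Lambda>\<^esub> = \<one>\<^bsub>R\<^esub>" by (simp add: \<pi>1[symmetric] f\<pi> fa h1)
    qed
    show "f \<in> extensional (carrier ?\<Lambda>)" by (simp add: f_def)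
    show "f (mpa_scalar Q r q c) = \<eta> c" for c by (simp add: \<eta>' f\<pi> fa h)
    show "f (mpa_map Q r q x) = \<psi> x" if "x \<in> carrier ?A" for x
      using that by (simp add: \<phi>' f\<pi> fa hB)
  next
    fix g assume g: "g \<in> Ring.ring_hom ?\<Lambda> R \<and> g \<in> extensional (carrier ?\<Lambda>) \<and>
       (\<forall>c. g (mpa_scalar Q r q c) = \<eta> c) \<and> (\<forall>x\<in>carrier ?A. g (mpa_map Q r q x) = \<psi> x)"
    have gh: "g \<in> Ring.ring_hom ?\<Lambda> R" and gx: "g \<in> extensional (carrier ?\<Lambda>)"
      and g\<eta>: "\<And>c. g (mpa_scalar Q r q c) = \<eta> c"
      and g\<psi>: "\<And>x. x \<in> carrier ?A \<Longrightarrow> g (\<pi> (gen (Base x))) = \<psi> x"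
      using g by (simp_all only: \<phi>')
    have gI: "g (\<pi> (gen (Inv a))) = inv\<^bsub>R\<^esub> \<psi> (one_plus Q a)" if a: "a \<in> arcs ?D" for a
    proof -
      have "\<pi> (gen (Inv a) * gen (Base (one_plus Q a))) = \<pi> 1"
        unfolding \<pi>_def
      proof (rule mpa_rel_eq[OF as])
        show "gen (Inv a) * gen (Base (one_plus Q a)) - 1 \<in> mpa_rels Q r q"
          using a unfolding mpa_rels_def Let_def by blast
        show "gen (Inv a) * gen (Base (one_plus Q a)) \<in> carrier ?F"
          by (intro fa dpath_closed as a)
        show "1 \<in> carrier ?F" by (rule fa)
      qed
      then have "\<pi> (gen (Inv a)) \<otimes>\<^bsub>?\<Lambda>\<^esub> \<pi> (gen (Base (one_plus Q a))) = \<one>\<^bsub>?\<Lambda>\<^esub>"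
        using a by (simp add: \<pi>1 \<pi>mult cl)
      then have "g (\<pi> (gen (Inv a))) \<otimes>\<^bsub>R\<^esub> \<psi> (one_plus Q a) = \<one>\<^bsub>R\<^esub>"
        using ring_hom_mult[OF gh, of "\<pi> (gen (Inv a))" "\<pi> (gen (Base (one_plus Q a)))"] a
          ring_hom_one[OF gh] by (simp add: \<pi>c cl g\<psi>)
      then show ?thesis
        using unit[OF a] ring_hom_closed[OF gh, of "\<pi> (gen (Inv a))"] a
        by (metis R.Units_closed R.Units_inv_closed R.Units_r_inv R.l_one R.m_assoc R.r_one \<pi>c mpa_gens_closed(2))
    qed
    have eq: "g (\<pi> y) = h y" if "y \<in> carrier ?F" for y
      using that
    proof (rule free_algebra_induct)
      show "g (\<pi> (scal c)) = h (scal c)" for c using g\<eta>[of c] by (simp only: \<eta>' h(2))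
      show "g (\<pi> (gen t)) = h (gen t)" if "t \<in> mpa_gens Q" for t
        using that by (auto simp: mpa_gens_def g\<psi> hB hI gI)
    qed (simp_all add: \<pi>add \<pi>mult hadd hmult ring_hom_add[OF gh] ring_hom_mult[OF gh] \<pi>c)
    show "g = f"
    proof (rule extensionalityI[of _ "carrier ?\<Lambda>"])
      fix x assume "x \<in> carrier ?\<Lambda>"
      then show "g x = f x" using surj[of x] eq f\<pi> by auto
    qed (simp_all add: gx f_def)
  qed
qed


section \<open>Left modules, Hom and Ext\<close>

text \<open>The library's locale \<^locale>\<open>module\<close> assumes a commutative ring.\<close>

locale left_module = R?: ring R + M?: abelian_group M
  for R :: "('r, 's) ring_scheme" (structure) and M :: "('r, 'x, 'm) module_scheme" (structure) +
  assumes lsmult_closed: "\<lbrakk>a \<in> carrier R; x \<in> carrier M\<rbrakk> \<Longrightarrow> a \<odot>\<^bsub>M\<^esub> x \<in> carrier M"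
    and lsmult_l_distr: "\<lbrakk>a \<in> carrier R; b \<in> carrier R; x \<in> carrier M\<rbrakk> \<Longrightarrow>
      (a \<oplus>\<^bsub>R\<^esub> b) \<odot>\<^bsub>M\<^esub> x = a \<odot>\<^bsub>M\<^esub> x \<oplus>\<^bsub>M\<^esub> b \<odot>\<^bsub>M\<^esub> x"
    and lsmult_r_distr: "\<lbrakk>a \<in> carrier R; x \<in> carrier M; y \<in> carrier M\<rbrakk> \<Longrightarrow>
      a \<odot>\<^bsub>M\<^esub> (x \<oplus>\<^bsub>M\<^esub> y) = a \<odot>\<^bsub>M\<^esub> x \<oplus>\<^bsub>M\<^esub> a \<odot>\<^bsub>M\<^esub> y"
    and lsmult_assoc: "\<lbrakk>a \<in> carrier R; b \<in> carrier R; x \<in> carrier M\<rbrakk> \<Longrightarrow>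
      (a \<otimes>\<^bsub>R\<^esub> b) \<odot>\<^bsub>M\<^esub> x = a \<odot>\<^bsub>M\<^esub> (b \<odot>\<^bsub>M\<^esub> x)"
    and lsmult_one: "x \<in> carrier M \<Longrightarrow> \<one>\<^bsub>R\<^esub> \<odot>\<^bsub>M\<^esub> x = x"

definition restrict_scalars :: "('k \<Rightarrow> 'r) \<Rightarrow> ('r, 'x) module \<Rightarrow> ('k, 'x) module" where
  "restrict_scalars \<eta> M =
    \<lparr>carrier = carrier M, mult = mult M, one = one M, zero = zero M, add = add M,
     smult = (\<lambda>c x. \<eta> c \<odot>\<^bsub>M\<^esub> x)\<rparr>"

definition lmod_hom ::
    "('r, 's) ring_scheme \<Rightarrow> ('r, 'x) module \<Rightarrow> ('r, 'y) module \<Rightarrow> ('x \<Rightarrow> 'y) set" where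
  "lmod_hom R M N = {f \<in> carrier M \<rightarrow>\<^sub>E carrier N.
     (\<forall>x\<in>carrier M. \<forall>y\<in>carrier M. f (x \<oplus>\<^bsub>M\<^esub> y) = f x \<oplus>\<^bsub>N\<^esub> f y) \<and>
     (\<forall>a\<in>carrier R. \<forall>x\<in>carrier M. f (a \<odot>\<^bsub>M\<^esub> x) = a \<odot>\<^bsub>N\<^esub> f x)}"

text \<open>
  \<open>Hom\<close> as a vector space over the ground field, which acts through the central homomorphism \<open>\<eta>\<close>.
  The fields \<^const>\<open>mult\<close> and \<^const>\<open>one\<close>, which module records inherit from ring records, play
  no role.
\<close>

definition hom_space ::
    "('r, 's) ring_scheme \<Rightarrow> ('k \<Rightarrow> 'r) \<Rightarrow> ('r, 'x) module \<Rightarrow> ('r, 'y) module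
      \<Rightarrow> ('k, 'x \<Rightarrow> 'y) module" where
  "hom_space R \<eta> M N =
    \<lparr>carrier = lmod_hom R M N, mult = undefined, one = undefined,
     zero = (\<lambda>x\<in>carrier M. \<zero>\<^bsub>N\<^esub>),
     add = (\<lambda>f g. \<lambda>x\<in>carrier M. f x \<oplus>\<^bsub>N\<^esub> g x),
     smult = (\<lambda>c f. \<lambda>x\<in>carrier M. \<eta> c \<odot>\<^bsub>N\<^esub> f x)\<rparr>"

definition quotient_space :: "('k, 'x) module \<Rightarrow> 'x set \<Rightarrow> ('k, 'x set) module" where
  "quotient_space V W =
    \<lparr>carrier = a_rcosets\<^bsub>V\<^esub> W, mult = undefined, one = undefined, zero = W, add = set_add V,
     smult = (\<lambda>c C. \<Union>x\<in>C. W +>\<^bsub>V\<^esub> (c \<odot>\<^bsub>V\<^esub> x))\<rparr>"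

text \<open>
  The free module on the underlying set of \<open>M\<close>, its canonical surjection onto \<open>M\<close>, and the kernel
  of the latter. Elements of the free module are finitely supported coefficient functions.
\<close>

definition free_on ::
    "('r, 's) ring_scheme \<Rightarrow> ('r, 'x) module \<Rightarrow> ('r, 'x \<Rightarrow> 'r) module" where
  "free_on R M =
    \<lparr>carrier = {f. f ` carrier M \<subseteq> carrier R \<and> (\<forall>x. x \<notin> carrier M \<longrightarrow> f x = \<zero>\<^bsub>R\<^esub>) \<and>
                   finite {x. f x \<noteq> \<zero>\<^bsub>R\<^esub>}},
     mult = undefined, one = undefined, zero = (\<lambda>_. \<zero>\<^bsub>R\<^esub>),
     add = (\<lambda>f g x. f x \<oplus>\<^bsub>R\<^esub> g x),
     smult = (\<lambda>a f x. a \<otimes>\<^bsub>R\<^esub> f x)\<rparr>"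

definition augmentation ::
    "('r, 's) ring_scheme \<Rightarrow> ('r, 'x) module \<Rightarrow> ('x \<Rightarrow> 'r) \<Rightarrow> 'x" where
  "augmentation R M f = (\<Oplus>\<^bsub>M\<^esub>x\<in>{x. f x \<noteq> \<zero>\<^bsub>R\<^esub>}. f x \<odot>\<^bsub>M\<^esub> x)"

definition syzygy ::
    "('r, 's) ring_scheme \<Rightarrow> ('r, 'x) module \<Rightarrow> ('r, 'x \<Rightarrow> 'r) module" where
  "syzygy R M =
     (free_on R M)\<lparr>carrier := {f \<in> carrier (free_on R M). augmentation R M f = \<zero>\<^bsub>M\<^esub>}\<rparr>"

text \<open>
  \<open>Ext1\<close> is the first cohomology of the complex \<open>Hom(P0,Y) \<rightarrow> Hom(P1,Y) \<rightarrow> Hom(P2,Y)\<close>, where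
  \<open>P2 \<rightarrow> P1 \<rightarrow> P0 \<rightarrow> X \<rightarrow> 0\<close> is the start of the canonical free resolution of \<open>X\<close>:
  \<open>P0\<close>, \<open>P1\<close>, \<open>P2\<close> are the free modules on the underlying sets of \<open>X\<close>, of its syzygy and of its
  second syzygy, and the differentials are the canonical surjections followed by the inclusions
  of the syzygies.
\<close>

definition ext1_cocycles ::
    "('r, 's) ring_scheme \<Rightarrow> ('r, 'x) module \<Rightarrow> ('r, 'y) module
      \<Rightarrow> ((('x \<Rightarrow> 'r) \<Rightarrow> 'r) \<Rightarrow> 'y) set" where
  "ext1_cocycles R X Y =
    (let \<Omega> = syzygy R X; \<Omega>2 = syzygy R \<Omega>
     in {f \<in> lmod_hom R (free_on R \<Omega>) Y.
           \<forall>z\<in>carrier (free_on R \<Omega>2). f (augmentation R \<Omega>2 z) = \<zero>\<^bsub>Y\<^esub>})"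

definition ext1_coboundaries ::
    "('r, 's) ring_scheme \<Rightarrow> ('r, 'x) module \<Rightarrow> ('r, 'y) module
      \<Rightarrow> ((('x \<Rightarrow> 'r) \<Rightarrow> 'r) \<Rightarrow> 'y) set" where
  "ext1_coboundaries R X Y =
    (let \<Omega> = syzygy R X
     in (\<lambda>g. \<lambda>z\<in>carrier (free_on R \<Omega>). g (augmentation R \<Omega> z)) ` lmod_hom R (free_on R X) Y)"

definition Ext1 ::
    "('r, 's) ring_scheme \<Rightarrow> ('k \<Rightarrow> 'r) \<Rightarrow> ('r, 'x) module \<Rightarrow> ('r, 'y) module
      \<Rightarrow> ('k, ((('x \<Rightarrow> 'r) \<Rightarrow> 'r) \<Rightarrow> 'y) set) module" where
  "Ext1 R \<eta> X Y =
     quotient_space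
       ((hom_space R \<eta> (free_on R (syzygy R X)) Y)\<lparr>carrier := ext1_cocycles R X Y\<rparr>)
       (ext1_coboundaries R X Y)"


section \<open>Finite-dimensional representations\<close>

definition fin_dim_rep ::
    "('v, 'e) pre_digraph \<Rightarrow> 'e darrow rel \<Rightarrow> ('v \<Rightarrow> 'k::field)
      \<Rightarrow> (('v, 'e, 'k) mpa, 'x) module \<Rightarrow> bool" where
  "fin_dim_rep Q r q X \<longleftrightarrow> left_module (mpa Q r q) X \<and>
     vectorspace.fin_dim class_ring (restrict_scalars (mpa_scalar Q r q) X)"

definition vertex_space ::
    "('v, 'e) pre_digraph \<Rightarrow> 'e darrow rel \<Rightarrow> ('v \<Rightarrow> 'k::field)
      \<Rightarrow> (('v, 'e, 'k) mpa, 'x) module \<Rightarrow> 'v \<Rightarrow> ('k, 'x) module" where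
  "vertex_space Q r q X v =
     (restrict_scalars (mpa_scalar Q r q) X)
       \<lparr>carrier := {mpa_map Q r q (Poly_Mapping.single (Triv v) 1) \<odot>\<^bsub>X\<^esub> x | x. x \<in> carrier X}\<rparr>"

definition dim_vector ::
    "('v, 'e) pre_digraph \<Rightarrow> 'e darrow rel \<Rightarrow> ('v \<Rightarrow> 'k::field)
      \<Rightarrow> (('v, 'e, 'k) mpa, 'x) module \<Rightarrow> 'v \<Rightarrow> nat" where
  "dim_vector Q r q X v = vectorspace.dim class_ring (vertex_space Q r q X v)"

end

theory Submission
  imports Defs "HOL-Library.Function_Algebras"
begin

text \<open>
  Choose bases of \<open>X\<close> and \<open>Y\<close> adapted to the vertices, and let \<open>M\<close> be the bimodule of matrices
  of linear maps from \<open>X\<close> to \<open>Y\<close>. The group \<open>Ext\<^sup>1(X, Y)\<close> consists of the homomorphisms from the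
  syzygy of \<open>X\<close> to \<open>Y\<close> modulo those that extend to the free module; with a \<open>K\<close>-linear section of
  the augmentation this becomes derivations of \<open>\<Lambda>\<close> in \<open>M\<close> modulo inner ones. A derivation can be
  made to vanish on the \<open>e\<^sub>v\<close>. It is then given by its values on the arrows, an element \<open>D\<close> of
  \<open>C1 = \<Oplus>\<^sub>a Hom(X\<^sub>t\<^sub>(\<^sub>a\<^sub>), Y\<^sub>h\<^sub>(\<^sub>a\<^sub>))\<close>, and \<open>D\<close> occurs precisely when the derivative of the defining
  product in the direction \<open>D\<close>, an element of \<open>C0 = \<Oplus>\<^sub>v Hom(X\<^sub>v, Y\<^sub>v)\<close>, is zero. Hence \<open>Ext\<^sup>1(X, Y)\<close>
  is the middle cohomology of a complex \<open>C0 \<rightarrow> C1 \<rightarrow> C0\<close>. The kernel of the first map is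
  \<open>Hom(X, Y)\<close>; under the trace pairing the cokernel of the second map is dual to \<open>Hom(Y, X)\<close>,
  because \<open>\<theta>\<close> is orthogonal to its image if and only if \<open>q \<theta>\<close> is a homomorphism from \<open>Y\<close> to \<open>X\<close>.
  The formula is the Euler characteristic of this complex.
\<close>

section \<open>Dimensions of vector spaces given as records\<close>

text \<open>The algebra may be infinite-dimensional and is known only by generators and relations,
  so neither a basis nor a resolution of it is computed. Its universal property, applied to
  square-zero extensions, produces derivations; an induction over scalars, vertices, arrows, sums,
  products and inverses of units proves identities. All else happens in matrix spaces of finite
  dimension. The delicate point is the duality. The derivative of the defining product is a sum over
  its factors, each between a prefix and a suffix, and a factor with exponent -1 contributes
  \<open>- u^-1 du u^-1\<close>. Under the trace the suffix can be rotated to the front, so that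
  \<open>\<theta>\<close> appears as suffix times \<open>\<theta>\<close> times prefix. If
  \<open>q \<theta>\<close> is a homomorphism, the prefix can be carried across it, and suffix,
  \<open>q^-1\<close> and prefix multiply to the inverse of the missing factor; this is the source
  of the twist by \<open>q\<close>. The numbers arise because \<open>C0\<close> has dimension \<Sum>
  \<alpha>_v \<beta>_v and occurs twice, while an arrow of \<open>Q\<close> and its reverse give the
  two terms that the form attaches to the arrow.\<close>

definition has_dim :: "('k::field, 'x) module \<Rightarrow> nat \<Rightarrow> bool" where
  "has_dim V n \<longleftrightarrow> vectorspace class_ring V \<and> vectorspace.fin_dim class_ring V \<and>
     vectorspace.dim class_ring V = n"

text \<open>Asks nothing of \<open>V\<close> and \<open>W\<close> beyond the three conditions, so
  that it can be stated for a target whose vector space axioms are still to be derived from the map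
  (\<open>vectorspace_image\<close>).\<close>

definition lin_map :: "('k::field, 'x) module \<Rightarrow> ('k, 'y) module \<Rightarrow> ('x \<Rightarrow> 'y) \<Rightarrow> bool" where
  "lin_map V W f \<longleftrightarrow> f \<in> carrier V \<rightarrow> carrier W \<and>
     (\<forall>x\<in>carrier V. \<forall>y\<in>carrier V. f (x \<oplus>\<^bsub>V\<^esub> y) = f x \<oplus>\<^bsub>W\<^esub> f y) \<and>
     (\<forall>c. \<forall>x\<in>carrier V. f (c \<odot>\<^bsub>V\<^esub> x) = c \<odot>\<^bsub>W\<^esub> f x)"

lemma lin_mapI:
  assumes "\<And>x. x \<in> carrier V \<Longrightarrow> f x \<in> carrier W"
    "\<And>x y. \<lbrakk>x \<in> carrier V; y \<in> carrier V\<rbrakk> \<Longrightarrow> f (x \<oplus>\<^bsub>V\<^esub> y) = f x \<oplus>\<^bsub>W\<^esub> f y"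
    "\<And>c x. x \<in> carrier V \<Longrightarrow> f (c \<odot>\<^bsub>V\<^esub> x) = c \<odot>\<^bsub>W\<^esub> f x"
  shows "lin_map V W f"
  using assms by (auto simp: lin_map_def)

lemma lin_mapD:
  assumes "lin_map V W f"
  shows "x \<in> carrier V \<Longrightarrow> f x \<in> carrier W"
    "\<lbrakk>x \<in> carrier V; y \<in> carrier V\<rbrakk> \<Longrightarrow> f (x \<oplus>\<^bsub>V\<^esub> y) = f x \<oplus>\<^bsub>W\<^esub> f y"
    "x \<in> carrier V \<Longrightarrow> f (c \<odot>\<^bsub>V\<^esub> x) = c \<odot>\<^bsub>W\<^esub> f x"
  using assms by (auto simp: lin_map_def)

lemma field_class_ring: "field (class_ring :: 'k::field ring)"
  by (rule class_field[unfolded class_field_def])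

text \<open>The axioms are equations and existence statements, which pass to the image of a map
  respecting sums and scalars. That zero goes to zero is assumed separately: as long as
  \<open>Z\<close> is not known to be a group, additivity does not give it.\<close>

lemma vectorspace_image:
  fixes V :: "('k::field, 'x) module" and Z :: "('k, 'y) module"
  assumes "vectorspace class_ring V" and T: "lin_map V Z T" and surj: "T ` carrier V = carrier Z"
    and zero: "T \<zero>\<^bsub>V\<^esub> = \<zero>\<^bsub>Z\<^esub>"
  shows "vectorspace class_ring Z"
proof -
  interpret V: vectorspace class_ring V by fact
  note TD = lin_mapD[OF T]
  have ex: "\<exists>x\<in>carrier V. z = T x" if "z \<in> carrier Z" for z using that surj by auto
  have "module class_ring Z"
  proof (rule module_criteria)
    show "cring (class_ring :: 'k ring)" by (rule fieldE(1)[OF field_class_ring])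
    show "\<zero>\<^bsub>Z\<^esub> \<in> carrier Z" unfolding zero[symmetric] by (simp add: TD)
    show "\<forall>v w. v \<in> carrier Z \<and> w \<in> carrier Z \<longrightarrow> v \<oplus>\<^bsub>Z\<^esub> w \<in> carrier Z"
      by (auto dest!: ex simp: TD(2)[symmetric] TD(1))
    show "\<forall>v\<in>carrier Z. \<exists>neg_v\<in>carrier Z. v \<oplus>\<^bsub>Z\<^esub> neg_v = \<zero>\<^bsub>Z\<^esub>"
    proof
      fix v assume "v \<in> carrier Z"
      then obtain x where x: "x \<in> carrier V" "v = T x" using ex by blast
      show "\<exists>neg_v\<in>carrier Z. v \<oplus>\<^bsub>Z\<^esub> neg_v = \<zero>\<^bsub>Z\<^esub>"
        by (rule bexI[of _ "T (\<ominus>\<^bsub>V\<^esub> x)"])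
          (simp_all add: x TD(1) TD(2)[symmetric] V.M.r_neg zero)
    qed
    show "\<forall>c v. c \<in> carrier class_ring \<and> v \<in> carrier Z \<longrightarrow> c \<odot>\<^bsub>Z\<^esub> v \<in> carrier Z"
      by (auto dest!: ex simp: TD(3)[symmetric] intro!: TD(1) V.smult_closed)
    show "\<forall>v w. v \<in> carrier Z \<and> w \<in> carrier Z \<longrightarrow> v \<oplus>\<^bsub>Z\<^esub> w = w \<oplus>\<^bsub>Z\<^esub> v"
      by (auto dest!: ex simp: TD(2)[symmetric] V.M.a_comm)
    show "\<forall>v w x. v \<in> carrier Z \<and> w \<in> carrier Z \<and> x \<in> carrier Z \<longrightarrow>
        v \<oplus>\<^bsub>Z\<^esub> w \<oplus>\<^bsub>Z\<^esub> x = v \<oplus>\<^bsub>Z\<^esub> (w \<oplus>\<^bsub>Z\<^esub> x)"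
      by (auto dest!: ex simp: TD(2)[symmetric] V.M.a_assoc)
    show "\<forall>v\<in>carrier Z. v \<oplus>\<^bsub>Z\<^esub> \<zero>\<^bsub>Z\<^esub> = v"
      unfolding zero[symmetric] by (auto dest!: ex simp: TD(2)[symmetric])
    show "\<forall>a b v. a \<in> carrier class_ring \<and> b \<in> carrier class_ring \<and> v \<in> carrier Z \<longrightarrow>
        a \<otimes>\<^bsub>class_ring\<^esub> b \<odot>\<^bsub>Z\<^esub> v = a \<odot>\<^bsub>Z\<^esub> (b \<odot>\<^bsub>Z\<^esub> v)"
      using V.smult_assoc1 V.smult_closed by (auto dest!: ex simp: TD(3)[symmetric])
    show "\<forall>v\<in>carrier Z. \<one>\<^bsub>class_ring\<^esub> \<odot>\<^bsub>Z\<^esub> v = v"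
      using V.smult_one by (auto dest!: ex simp: TD(3)[symmetric])
    show "\<forall>a b v. a \<in> carrier class_ring \<and> b \<in> carrier class_ring \<and> v \<in> carrier Z \<longrightarrow>
        (a \<oplus>\<^bsub>class_ring\<^esub> b) \<odot>\<^bsub>Z\<^esub> v = a \<odot>\<^bsub>Z\<^esub> v \<oplus>\<^bsub>Z\<^esub> b \<odot>\<^bsub>Z\<^esub> v"
      using V.smult_l_distr V.smult_closed by (auto dest!: ex simp: TD(2,3)[symmetric])
    show "\<forall>a v w. a \<in> carrier class_ring \<and> v \<in> carrier Z \<and> w \<in> carrier Z \<longrightarrow>
        a \<odot>\<^bsub>Z\<^esub> (v \<oplus>\<^bsub>Z\<^esub> w) = a \<odot>\<^bsub>Z\<^esub> v \<oplus>\<^bsub>Z\<^esub> a \<odot>\<^bsub>Z\<^esub> w"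
      using V.smult_r_distr V.smult_closed by (auto dest!: ex simp: TD(2,3)[symmetric])
  qed
  then show ?thesis by (simp add: vectorspace_def field_class_ring)
qed

lemma linear_map_lin_map:
  fixes V :: "('k::field, 'x) module"
  assumes "vectorspace class_ring V" "vectorspace class_ring W" "lin_map V W T"
  shows "linear_map class_ring V W T"
  using assms unfolding linear_map_def mod_hom_def mod_hom_axioms_def vectorspace_def
  by (auto simp: module_hom_def lin_map_def)

text \<open>Independence in \<open>W\<close> is independence in \<open>V\<close>, so the size of an
  independent subset of \<open>W\<close> is bounded by the dimension of \<open>V\<close>; a maximal
  one is then a finite basis.\<close>

lemma subspace_has_dim:
  fixes V :: "('k::field, 'x) module"
  assumes "has_dim V n" "subspace class_ring W V"
  shows "\<exists>k\<le>n. has_dim (V\<lparr>carrier := W\<rparr>) k"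
proof -
  interpret V: vectorspace class_ring V using assms by (simp add: has_dim_def)
  have fd: V.fin_dim using assms by (simp add: has_dim_def)
  interpret W: vectorspace class_ring "V.vs W" by (rule V.subspace_is_vs[OF assms(2)])
  have sm: "submodule class_ring W V" using assms(2) by simp
  have WC: "W \<subseteq> carrier V" using sm by (simp add: submodule_def)
  have "\<exists>A. finite A \<and> maximal A (\<lambda>S. S \<subseteq> carrier (V.vs W) \<and> W.lin_indpt S)"
  proof (rule maximal_exists)
    show "{} \<subseteq> carrier (V.vs W) \<and> W.lin_indpt {}" by (auto simp: W.lin_dep_def)
    fix S assume S: "S \<subseteq> carrier (V.vs W) \<and> W.lin_indpt S"
    then have SW: "S \<subseteq> W" and "\<not> V.lin_dep S"
      using V.span_li_not_depend(2)[OF _ sm, of S] by auto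
    then show "finite S \<and> card S \<le> V.dim"
      using V.li_le_dim[OF fd, of S] WC by auto
  qed
  then obtain A where A: "finite A" "maximal A (\<lambda>S. S \<subseteq> carrier (V.vs W) \<and> W.lin_indpt S)"
    by blast
  have bas: "W.basis A" by (rule W.max_li_is_basis[OF A(2)])
  then have W.fin_dim using A(1) unfolding W.fin_dim_def W.basis_def by blast
  moreover have "A \<subseteq> W" "\<not> V.lin_dep A"
    using V.span_li_not_depend(2)[OF _ sm, of A] bas by (auto simp: W.basis_def)
  then have "card A \<le> n" using V.li_le_dim[OF fd, of A] WC assms(1) by (auto simp: has_dim_def)
  then have "W.dim \<le> n" using W.dim_basis[OF A(1) bas] by simp
  ultimately show ?thesis using W.vectorspace_axioms by (auto simp: has_dim_def)
qed

text \<open>The map is taken onto \<open>Z\<close>, with the carrier of the target cut down to the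
  image where necessary, as for \<open>dprod\<close> and \<open>d0\<close>. The vector space
  structure of \<open>Z\<close> is part of the outcome; \<open>Ext1\<close> gets its own in this
  way.\<close>

lemma has_dim_rank_nullity:
  fixes V :: "('k::field, 'x) module" and Z :: "('k, 'y) module"
  assumes V: "has_dim V n" and T: "lin_map V Z T" and surj: "T ` carrier V = carrier Z"
    and zero: "T \<zero>\<^bsub>V\<^esub> = \<zero>\<^bsub>Z\<^esub>"
  obtains k l where "has_dim (V\<lparr>carrier := {x \<in> carrier V. T x = \<zero>\<^bsub>Z\<^esub>}\<rparr>) k" "has_dim Z l" "k + l = n"
proof -
  interpret V: vectorspace class_ring V using V by (simp add: has_dim_def)
  have fd: V.fin_dim and n: "V.dim = n" using V by (simp_all add: has_dim_def)
  interpret Z: vectorspace class_ring Z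
    by (rule vectorspace_image[OF V.vectorspace_axioms T surj zero])
  interpret L: linear_map class_ring V Z T
    by (rule linear_map_lin_map[OF V.vectorspace_axioms Z.vectorspace_axioms T])
  have ker: "L.kerT = {x \<in> carrier V. T x = \<zero>\<^bsub>Z\<^esub>}" by (simp add: L.ker_def)
  have im: "L.imT = carrier Z" using surj by (simp add: L.im_def)
  obtain k where k: "has_dim (V\<lparr>carrier := L.kerT\<rparr>) k"
    using subspace_has_dim[OF V L.kerT_is_subspace] by blast
  have "Z.dim + vectorspace.dim class_ring (V.vs L.kerT) = V.dim"
    using L.rank_nullity_main(1)[OF fd] by (simp add: im)
  moreover have "has_dim Z Z.dim"
    using L.rank_nullity_main(2)[OF fd surj] Z.vectorspace_axioms by (simp add: has_dim_def)
  ultimately show ?thesis using that[of k Z.dim] k n by (simp add: ker has_dim_def)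
qed

lemma has_dim_unique: "has_dim V m \<Longrightarrow> has_dim V n \<Longrightarrow> m = n"
  by (simp add: has_dim_def)

lemma has_dim_bij:
  fixes V :: "('k::field, 'x) module" and Z :: "('k, 'y) module"
  assumes V: "has_dim V n" and T: "lin_map V Z T" and bij: "bij_betw T (carrier V) (carrier Z)"
    and zero: "T \<zero>\<^bsub>V\<^esub> = \<zero>\<^bsub>Z\<^esub>"
  shows "has_dim Z n"
proof -
  interpret V: vectorspace class_ring V using V by (simp add: has_dim_def)
  have fd: V.fin_dim and n: "V.dim = n" using V by (simp_all add: has_dim_def)
  have surj: "T ` carrier V = carrier Z" using bij by (simp add: bij_betw_def)
  interpret Z: vectorspace class_ring Z
    by (rule vectorspace_image[OF V.vectorspace_axioms T surj zero])
  interpret L: linear_map class_ring V Z T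
    by (rule linear_map_lin_map[OF V.vectorspace_axioms Z.vectorspace_axioms T])
  show ?thesis
    using L.rank_nullity_main(2)[OF fd surj] L.dim_eq[OF fd _ surj] bij Z.vectorspace_axioms n
    by (simp add: has_dim_def bij_betw_def)
qed

lemma lin_map_inv_into:
  assumes V: "vectorspace class_ring V" and T: "lin_map V W T"
    and bij: "bij_betw T (carrier V) (carrier W)"
  shows "lin_map W V (inv_into (carrier V) T)"
proof -
  interpret V: vectorspace class_ring V by fact
  note TD = lin_mapD[OF T]
  have inj: "inj_on T (carrier V)" and im: "T ` carrier V = carrier W"
    using bij by (auto simp: bij_betw_def)
  note f = inv_into_f_f[OF inj]
  show ?thesis
  proof (rule lin_mapI)
    show "inv_into (carrier V) T x \<in> carrier V" if "x \<in> carrier W" for x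
      using that im by (auto intro: inv_into_into)
    show "inv_into (carrier V) T (x \<oplus>\<^bsub>W\<^esub> y) = inv_into (carrier V) T x \<oplus>\<^bsub>V\<^esub> inv_into (carrier V) T y"
      if "x \<in> carrier W" "y \<in> carrier W" for x y
      using that unfolding im[symmetric] by (auto simp: f TD(2)[symmetric])
    show "inv_into (carrier V) T (c \<odot>\<^bsub>W\<^esub> x) = c \<odot>\<^bsub>V\<^esub> inv_into (carrier V) T x"
      if "x \<in> carrier W" for c x
      using that V.smult_closed[of c] unfolding im[symmetric] by (auto simp: f TD(3)[symmetric])
  qed
qed

subsection \<open>Coordinate spaces\<close>

text \<open>Functions on the whole type that vanish off \<open>S\<close>. Spaces with different
  \<open>S\<close> share zero, sum and scaling and differ only in the carrier, so a set of functions
  can be regarded inside any of them (\<open>fun_space_update\<close>).\<close>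

definition fun_space :: "'i set \<Rightarrow> ('k::field, 'i \<Rightarrow> 'k) module" where
  "fun_space S = \<lparr>carrier = {f. \<forall>i. i \<notin> S \<longrightarrow> f i = 0}, mult = undefined, one = undefined,
     zero = 0, add = (+), smult = (\<lambda>c f i. c * f i)\<rparr>"

lemma fun_space_simps [simp]:
  "zero (fun_space S) = 0" "add (fun_space S) = (+)" "smult (fun_space S) = (\<lambda>c f i. c * f i)"
  by (simp_all add: fun_space_def)

lemma carrier_fun_space: "carrier (fun_space S) = {f. \<forall>i. i \<notin> S \<longrightarrow> f i = 0}"
  by (simp add: fun_space_def)

lemma has_dim_fun_space:
  assumes "finite S"
  shows "has_dim (fun_space S :: ('k::field, 'i \<Rightarrow> 'k) module) (card S)"
proof -
  interpret vs: vec_space "TYPE('k)" "card S" .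
  obtain h where h: "bij_betw h S {0..<card S}"
    using ex_bij_betw_finite_nat[OF assms] by blast
  let ?V = "module_vec TYPE('k) (card S)"
  define T where "T v = (\<lambda>i. if i \<in> S then v $ h i else 0)" for v :: "'k vec"
  have hS: "h i < card S" if "i \<in> S" for i using that h by (auto simp: bij_betw_def)
  have V: "has_dim ?V (card S)"
    using vs.vectorspace_axioms vs.fin_dim vs.dim_is_n by (simp add: has_dim_def)
  show ?thesis
  proof (rule has_dim_bij[OF V])
    show "lin_map ?V (fun_space S) T"
      by (rule lin_mapI) (auto simp: T_def module_vec_simps carrier_fun_space hS)
    show "T \<zero>\<^bsub>?V\<^esub> = \<zero>\<^bsub>fun_space S\<^esub>" by (auto simp: T_def module_vec_simps hS)
    show "bij_betw T (carrier ?V) (carrier (fun_space S))"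
    proof (rule bij_betw_byWitness[where f' = "\<lambda>f. vec (card S) (\<lambda>j. f (inv_into S h j))"])
      have inv: "inv_into S h j \<in> S" "h (inv_into S h j) = j" if "j < card S" for j
        using that h by (auto simp: bij_betw_def inv_into_into f_inv_into_f)
      show "\<forall>v\<in>carrier ?V. vec (card S) (\<lambda>j. T v (inv_into S h j)) = v"
        by (auto simp: module_vec_simps T_def inv)
      show "\<forall>f\<in>carrier (fun_space S). T (vec (card S) (\<lambda>j. f (inv_into S h j))) = f"
        using h by (auto simp: carrier_fun_space T_def hS bij_betw_def)
    qed (auto simp: T_def carrier_fun_space module_vec_simps)
  qed
qed

lemma vectorspace_fun_space: "finite S \<Longrightarrow> vectorspace class_ring (fun_space S)"
  by (rule conjunct1[OF has_dim_fun_space[unfolded has_dim_def]])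

text \<open>The inverse of the coordinate map is the one that can be written down: a coefficient
  function goes to its combination of a finite basis. Existence and uniqueness of coefficients make
  it a bijection.\<close>

lemma has_dim_coordinates:
  fixes V :: "('k::field, 'x) module"
  assumes V: "has_dim V n"
  obtains \<kappa> where "lin_map V (fun_space {..<n}) \<kappa>"
    "bij_betw \<kappa> (carrier V) (carrier (fun_space {..<n}))"
proof -
  interpret V: vectorspace class_ring V using V by (simp add: has_dim_def)
  have fd: V.fin_dim and n: "V.dim = n" using V by (simp_all add: has_dim_def)
  obtain B where B: "finite B" "V.basis B" using V.finite_basis_exists[OF fd] by blast
  have BC: "B \<subseteq> carrier V" using B by (simp add: V.basis_def)
  have card: "card B = n" using V.dim_basis[OF B] n by simp
  obtain h where h: "bij_betw h B {0..<n}"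
    using ex_bij_betw_finite_nat[OF B(1)] card by auto
  define T where "T f = V.lincomb (\<lambda>b. f (h b)) B" for f :: "nat \<Rightarrow> 'k"
  let ?F = "fun_space {..<n} :: ('k, nat \<Rightarrow> 'k) module"
  have T: "lin_map ?F V T"
  proof (rule lin_mapI)
    show "T f \<in> carrier V" for f unfolding T_def by (rule V.lincomb_closed[OF BC]) auto
    show "T (f \<oplus>\<^bsub>?F\<^esub> g) = T f \<oplus>\<^bsub>V\<^esub> T g" for f g
      using V.lincomb_sum[OF B(1) BC, of "\<lambda>b. f (h b)" "\<lambda>b. g (h b)"] by (simp add: T_def)
    show "T (c \<odot>\<^bsub>?F\<^esub> f) = c \<odot>\<^bsub>V\<^esub> T f" for c f
      using V.lincomb_smult[OF BC, of "\<lambda>b. f (h b)" c] by (simp add: T_def)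
  qed
  have hB: "h b < n" if "b \<in> B" for b using that h by (auto simp: bij_betw_def)
  have "bij_betw T (carrier ?F) (carrier V)"
  proof (rule bij_betwI')
    fix v assume "v \<in> carrier V"
    then obtain a where a: "a \<in> B \<rightarrow>\<^sub>E carrier class_ring" "V.lincomb a B = v"
      using V.basis_criterion[OF B(1) BC] B(2) by blast
    have "T (\<lambda>j. if j < n then a (inv_into B h j) else 0) = V.lincomb a B"
      unfolding T_def using h
      by (intro V.lincomb_cong[OF refl BC]) (auto simp: bij_betw_def hB inv_into_f_f)
    then show "\<exists>f\<in>carrier ?F. v = T f"
      using a by (intro bexI[of _ "\<lambda>j. if j < n then a (inv_into B h j) else 0"])
        (auto simp: carrier_fun_space)
  next
    fix f g :: "nat \<Rightarrow> 'k" assume fg: "f \<in> carrier ?F" "g \<in> carrier ?F"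
    show "(T f = T g) = (f = g)"
    proof
      assume eq: "T f = T g"
      have r: "T f = V.lincomb (restrict (\<lambda>b. f (h b)) B) B" for f
        unfolding T_def by (intro V.lincomb_cong[OF refl BC]) auto
      have "restrict (\<lambda>b. f (h b)) B = restrict (\<lambda>b. g (h b)) B"
        using V.basis_criterion[OF B(1) BC] B(2) eq[unfolded r] lin_mapD(1)[OF T fg(1)]
        unfolding r by (metis (no_types, lifting) UNIV_I partial_object.simps(1) restrict_PiE_iff)
      then have "f (h b) = g (h b)" if "b \<in> B" for b
        using that by (metis restrict_apply')
      moreover have "\<exists>b\<in>B. j = h b" if "j < n" for j
        using h that by (auto simp: bij_betw_def image_iff set_eq_iff)
      ultimately have "f j = g j" for j
        using fg by (cases "j < n") (fastforce simp: carrier_fun_space)+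
      then show "f = g" by blast
    qed simp
  qed (use lin_mapD(1)[OF T] in auto)
  then have "bij_betw (inv_into (carrier ?F) T) (carrier V) (carrier ?F)"
    "lin_map V ?F (inv_into (carrier ?F) T)"
    by (simp_all add: bij_betw_inv_into lin_map_inv_into[OF vectorspace_fun_space T])
  then show ?thesis using that by blast
qed

text \<open>If \<open>n\<close> were positive, the image of the one-point carrier would have to
  contain both zero and the first unit vector.\<close>

lemma has_dim_trivial:
  fixes V :: "('a::field, 'x) module"
  assumes "has_dim V n" "carrier V = {\<zero>\<^bsub>V\<^esub>}"
  shows "n = 0"
proof (rule ccontr)
  assume n: "n \<noteq> 0"
  obtain \<kappa> where "bij_betw \<kappa> (carrier V) (carrier (fun_space {..<n} :: ('a, nat \<Rightarrow> 'a) module))"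
    using has_dim_coordinates[OF assms(1)] by blast
  then have "\<kappa> ` {\<zero>\<^bsub>V\<^esub>} = carrier (fun_space {..<n} :: ('a, nat \<Rightarrow> 'a) module)"
    using assms(2) by (simp add: bij_betw_def)
  moreover have "(\<lambda>i. 0) \<in> carrier (fun_space {..<n} :: ('a, nat \<Rightarrow> 'a) module)"
    "(\<lambda>i. if i = 0 then 1 else 0) \<in> carrier (fun_space {..<n} :: ('a, nat \<Rightarrow> 'a) module)"
    using n by (auto simp: carrier_fun_space)
  ultimately have "(\<lambda>i. 0 :: 'a) = (\<lambda>i::nat. if i = 0 then 1 else 0)"
    by (metis image_insert image_empty singletonD)
  then show False by (metis zero_neq_one)
qed

text \<open>Applied both to maps into a full coordinate space and to maps into a subspace, hence the
  variable carrier \<open>W\<close> of the target.\<close>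

lemma lin_map_fun_space_expand:
  fixes g :: "('i \<Rightarrow> 'k::field) \<Rightarrow> ('j \<Rightarrow> 'k)"
  assumes g: "lin_map (fun_space I) ((fun_space J)\<lparr>carrier := W\<rparr>) g" and "finite I"
    and h: "h \<in> carrier (fun_space I)"
  shows "g h = (\<lambda>j. \<Sum>i\<in>I. h i * g (\<lambda>l. if l = i then 1 else 0) j)"
proof -
  note gD = lin_mapD[OF g, simplified]
  have sub: "g (\<lambda>l. if l \<in> L then h l else 0) = (\<lambda>j. \<Sum>i\<in>L. h i * g (\<lambda>l. if l = i then 1 else 0) j)"
    if "L \<subseteq> I" for L
    using finite_subset[OF that \<open>finite I\<close>] that
  proof (induction L rule: finite_induct)
    case empty
    have "g (\<lambda>l. 0) = (\<lambda>j. 0 * g (\<lambda>l. 0) j)"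
      using gD(3)[of "\<lambda>l. 0" 0] by (simp add: carrier_fun_space)
    then show ?case by simp
  next
    case (insert a L)
    have "(\<lambda>l. if l \<in> insert a L then h l else 0) =
       (\<lambda>l. h a * (if l = a then 1 else 0)) + (\<lambda>l. if l \<in> L then h l else 0)"
      using insert by (auto simp: fun_eq_iff)
    moreover have "(\<lambda>l. if l = a then 1 else 0) \<in> carrier (fun_space I :: ('k, _) module)"
      "(\<lambda>l. h a * (if l = a then 1 else 0)) \<in> carrier (fun_space I :: ('k, _) module)"
      "(\<lambda>l. if l \<in> L then h l else 0) \<in> carrier (fun_space I :: ('k, _) module)"
      using insert by (auto simp: carrier_fun_space)
    ultimately have "g (\<lambda>l. if l \<in> insert a L then h l else 0) =
        (\<lambda>j. h a * g (\<lambda>l. if l = a then 1 else 0) j) + g (\<lambda>l. if l \<in> L then h l else 0)"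
      by (simp only: gD(2) gD(3))
    then show ?case using insert by (auto simp: fun_eq_iff)
  qed
  have h': "(\<lambda>l. if l \<in> I then h l else 0) = h"
    using h by (auto simp: carrier_fun_space)
  show ?thesis using sub[OF order_refl] unfolding h' .
qed

text \<open>The map \<open>T\<close> pairs \<open>f\<close> with a basis \<open>b\<close> of
  \<open>W\<close>. Its kernel is the orthogonal complement, its image \<open>Z\<close> lies in a
  space of dimension \<open>k\<close>, and rank-nullity gives \<open>m + l = card S\<close>. The
  last conclusion, which serves for the reverse inequality, holds because a \<open>c\<close>
  orthogonal to \<open>Z\<close> is a linear relation between the basis vectors.\<close>

lemma has_dim_orthogonal_bound:
  fixes W :: "('j \<Rightarrow> 'k::field) set"
  assumes S: "finite S" and W: "has_dim ((fun_space S)\<lparr>carrier := W\<rparr>) k"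
    and WS: "W \<subseteq> carrier (fun_space S)"
  obtains m l and Z :: "(nat \<Rightarrow> 'k) set" where "has_dim ((fun_space S)\<lparr>carrier :=
      {f \<in> carrier (fun_space S). \<forall>w\<in>W. (\<Sum>i\<in>S. f i * w i) = 0}\<rparr>) m" "m + l = card S" "l \<le> k"
    "has_dim ((fun_space {..<k})\<lparr>carrier := Z\<rparr>) l" "Z \<subseteq> carrier (fun_space {..<k})"
    "\<forall>c\<in>carrier (fun_space {..<k}). (\<forall>z\<in>Z. (\<Sum>j<k. c j * z j) = 0) \<longrightarrow> c = 0"
proof -
  let ?W = "(fun_space S)\<lparr>carrier := W\<rparr>" and ?F = "fun_space {..<k} :: ('k, nat \<Rightarrow> 'k) module"
  obtain \<kappa> where \<kappa>: "lin_map ?W ?F \<kappa>" "bij_betw \<kappa> W (carrier ?F)"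
    using has_dim_coordinates[OF W] by auto
  define g where "g = inv_into W \<kappa>"
  have vW: "vectorspace class_ring ?W" using W by (simp add: has_dim_def)
  have g: "lin_map ?F ?W g"
    using lin_map_inv_into[OF vW \<kappa>(1)] \<kappa>(2) by (simp add: g_def)
  have g\<kappa>: "g (\<kappa> w) = w" if "w \<in> W" for w
    using that \<kappa>(2) by (auto simp: g_def bij_betw_def inv_into_f_f)
  have \<kappa>g: "\<kappa> (g c) = c" if "c \<in> carrier ?F" for c
    using that \<kappa>(2) by (auto simp: g_def bij_betw_def f_inv_into_f)
  define b where "b i = g (\<lambda>l. if l = i then 1 else 0)" for i
  have gb: "g c = (\<lambda>j. \<Sum>i<k. c i * b i j)" if "c \<in> carrier ?F" for c
    using lin_map_fun_space_expand[OF g _ that] by (simp add: b_def)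
  have bW: "b i \<in> W" if "i < k" for i
    using lin_mapD(1)[OF g] that by (auto simp: b_def carrier_fun_space)
  define T where "T f = (\<lambda>j. if j < k then \<Sum>i\<in>S. f i * b j i else 0)" for f :: "'j \<Rightarrow> 'k"
  define Z where "Z = T ` carrier (fun_space S)"
  have ZF: "Z \<subseteq> carrier ?F" by (auto simp: Z_def T_def carrier_fun_space)
  have T: "lin_map (fun_space S) (?F\<lparr>carrier := Z\<rparr>) T"
    by (rule lin_mapI)
      (auto simp: Z_def T_def algebra_simps sum.distrib sum_distrib_left fun_eq_iff)
  have ker: "{f \<in> carrier (fun_space S). T f = 0} =
     {f \<in> carrier (fun_space S). \<forall>w\<in>W. (\<Sum>i\<in>S. f i * w i) = 0}"
  proof (intro Collect_cong conj_cong refl iffI ballI)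
    fix f w assume "T f = 0" "w \<in> W"
    then have 0: "(\<Sum>i\<in>S. f i * b j i) = 0" if "j < k" for j
      using that by (auto simp: T_def fun_eq_iff split: if_splits)
    have "\<kappa> w \<in> carrier ?F" using lin_mapD(1)[OF \<kappa>(1)] \<open>w \<in> W\<close> by simp
    then have w: "w i = (\<Sum>j<k. \<kappa> w j * b j i)" for i
      using gb[of "\<kappa> w"] g\<kappa>[OF \<open>w \<in> W\<close>] by metis
    have "(\<Sum>i\<in>S. f i * w i) = (\<Sum>i\<in>S. \<Sum>j<k. \<kappa> w j * (f i * b j i))"
      by (intro sum.cong refl, subst w) (simp add: sum_distrib_left mult.left_commute)
    also have "\<dots> = (\<Sum>j<k. \<kappa> w j * (\<Sum>i\<in>S. f i * b j i))"
      unfolding sum_distrib_left by (rule sum.swap)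
    finally show "(\<Sum>i\<in>S. f i * w i) = 0" using 0 by simp
  next
    fix f assume "\<forall>w\<in>W. (\<Sum>i\<in>S. f i * w i) = 0"
    then show "T f = 0" using bW by (auto simp: T_def fun_eq_iff)
  qed
  have T0: "T \<zero>\<^bsub>fun_space S\<^esub> = \<zero>\<^bsub>?F\<lparr>carrier := Z\<rparr>\<^esub>" by (auto simp: T_def fun_eq_iff)
  obtain m l where ml: "has_dim ((fun_space S)\<lparr>carrier := {f \<in> carrier (fun_space S). T f = 0}\<rparr>) m"
    "has_dim (?F\<lparr>carrier := Z\<rparr>) l" "m + l = card S"
    using has_dim_rank_nullity[OF has_dim_fun_space[OF S] T, OF _ T0] by (auto simp: Z_def)
  have "subspace class_ring Z ?F"
  proof -
    have "vectorspace class_ring (?F\<lparr>carrier := Z\<rparr>)" using ml(2) by (simp add: has_dim_def)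
    then interpret Z: vectorspace class_ring "?F\<lparr>carrier := Z\<rparr>" .
    have vF: "vectorspace class_ring ?F" by (rule vectorspace_fun_space) simp
    show ?thesis unfolding subspace_def submodule_def
      using ZF Z.M.a_closed Z.M.zero_closed Z.smult_closed vF by (auto simp: vectorspace_def)
  qed
  then have le: "l \<le> k"
    using subspace_has_dim[OF has_dim_fun_space, of "{..<k}" Z] ml(2) has_dim_unique by fastforce
  have c0: "c = 0" if c: "c \<in> carrier ?F" "\<forall>z\<in>Z. (\<Sum>j<k. c j * z j) = 0" for c
  proof -
    have "g c s = 0" for s
    proof (cases "s \<in> S")
      case True
      \<comment> \<open>\<open>T\<close> of the unit vector at \<open>s\<close> lists the values
        \<open>b j s\<close>, so orthogonality to it says that \<open>g c\<close> vanishes at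
        \<open>s\<close>.\<close>
      let ?e = "\<lambda>i. if i = s then 1 else 0 :: 'k"
      have "?e \<in> carrier (fun_space S)" using True by (auto simp: carrier_fun_space)
      then have "(\<Sum>j<k. c j * T ?e j) = 0" using c(2) by (auto simp: Z_def)
      moreover have "T ?e j = b j s" if "j < k" for j
        using that True S by (simp add: T_def if_distrib[of "\<lambda>x. x * _"] cong: if_cong)
      ultimately show ?thesis by (simp add: gb[OF c(1)])
    next
      case False
      then show ?thesis using lin_mapD(1)[OF g c(1)] WS by (auto simp: carrier_fun_space)
    qed
    then have "g c = g 0"
      using gb[of 0] by (auto simp: fun_eq_iff carrier_fun_space)
    then show ?thesis using \<kappa>g[OF c(1)] \<kappa>g[of 0] by (simp add: carrier_fun_space)
  qed
  show ?thesis using c0 by (intro that[OF ml(1)[unfolded ker] ml(3) le ml(2) ZF]) blast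
qed

text \<open>The pairing with a basis of \<open>W\<close> is surjective: a linear relation between its
  components is one between the basis vectors, and this case of the statement follows from the
  dimension bound alone.\<close>

lemma has_dim_orthogonal:
  fixes W :: "('i \<Rightarrow> 'k::field) set"
  assumes "finite S" and W: "has_dim ((fun_space S)\<lparr>carrier := W\<rparr>) k"
    and WS: "W \<subseteq> carrier (fun_space S)"
  shows "\<exists>m. has_dim ((fun_space S)\<lparr>carrier :=
      {f \<in> carrier (fun_space S). \<forall>w\<in>W. (\<Sum>i\<in>S. f i * w i) = 0}\<rparr>) m \<and> m + k = card S"
proof -
  obtain m l and Z :: "(nat \<Rightarrow> 'k) set" where ml: "has_dim ((fun_space S)\<lparr>carrier :=
      {f \<in> carrier (fun_space S). \<forall>w\<in>W. (\<Sum>i\<in>S. f i * w i) = 0}\<rparr>) m" "m + l = card S" "l \<le> k"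
    and Z: "has_dim ((fun_space {..<k})\<lparr>carrier := Z\<rparr>) l" "Z \<subseteq> carrier (fun_space {..<k})"
      "\<forall>c\<in>carrier (fun_space {..<k}). (\<forall>z\<in>Z. (\<Sum>j<k. c j * z j) = 0) \<longrightarrow> c = 0"
    by (rule has_dim_orthogonal_bound[OF assms])
  \<comment> \<open>The bound once more, for \<open>Z\<close> itself: its complement is zero, so
    \<open>k = l'\<close>, and \<open>l' \<le> l \<le> k\<close> forces
    \<open>l = k\<close>.\<close>
  obtain m' l' where m': "has_dim ((fun_space {..<k})\<lparr>carrier :=
      {f \<in> carrier (fun_space {..<k}). \<forall>w\<in>Z. (\<Sum>i<k. f i * w i) = 0}\<rparr>) m'"
      "m' + l' = card {..<k}" "l' \<le> l"
    by (rule has_dim_orthogonal_bound[OF finite_lessThan Z(1,2)])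
  have "{f \<in> carrier (fun_space {..<k}). \<forall>w\<in>Z. (\<Sum>i<k. f i * w i) = 0} = {0}"
    using Z(3) by (auto simp: carrier_fun_space)
  then have "m' = 0" using has_dim_trivial[OF m'(1)] by simp
  then show ?thesis using ml m' by auto
qed

section \<open>Algebras, modules and free modules\<close>

locale k_algebra = R?: ring R for R :: "('r, 's) ring_scheme" (structure) +
  fixes \<eta> :: "'k::field \<Rightarrow> 'r"
  assumes \<eta>_hom: "\<eta> \<in> Ring.ring_hom class_ring R"
    and \<eta>_central: "x \<in> carrier R \<Longrightarrow> \<eta> c \<otimes> x = x \<otimes> \<eta> c"
begin

lemma \<eta>_closed [simp, intro]: "\<eta> c \<in> carrier R"
  using ring_hom_closed[OF \<eta>_hom] by simp

lemma \<eta>_add: "\<eta> (c + d) = \<eta> c \<oplus> \<eta> d"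
  using ring_hom_add[OF \<eta>_hom, of c d] by simp

lemma \<eta>_mult: "\<eta> (c * d) = \<eta> c \<otimes> \<eta> d"
  using ring_hom_mult[OF \<eta>_hom, of c d] by simp

lemma \<eta>_one: "\<eta> 1 = \<one>"
  using ring_hom_one[OF \<eta>_hom] by simp

lemma \<eta>_zero: "\<eta> 0 = \<zero>"
  using \<eta>_add[of 0 0] by (metis R.add.r_cancel_one \<eta>_closed add_0)

end

lemma (in abelian_group) add_eq_self_iff:
  "\<lbrakk>x \<in> carrier G; y \<in> carrier G\<rbrakk> \<Longrightarrow> x \<oplus> y = x \<longleftrightarrow> y = \<zero>"
  using add.l_cancel_one[of x y] by simp

context left_module
begin

lemmas lsmult_closed' [simp, intro] = lsmult_closed

lemma lsmult_l_zero [simp]: "x \<in> carrier M \<Longrightarrow> \<zero> \<odot>\<^bsub>M\<^esub> x = \<zero>\<^bsub>M\<^esub>"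
  using lsmult_l_distr[of \<zero> \<zero> x] M.add_eq_self_iff[of "\<zero> \<odot>\<^bsub>M\<^esub> x" "\<zero> \<odot>\<^bsub>M\<^esub> x"] by simp

lemma lsmult_r_zero [simp]: "a \<in> carrier R \<Longrightarrow> a \<odot>\<^bsub>M\<^esub> \<zero>\<^bsub>M\<^esub> = \<zero>\<^bsub>M\<^esub>"
  using lsmult_r_distr[of a "\<zero>\<^bsub>M\<^esub>" "\<zero>\<^bsub>M\<^esub>"]
    M.add_eq_self_iff[of "a \<odot>\<^bsub>M\<^esub> \<zero>\<^bsub>M\<^esub>" "a \<odot>\<^bsub>M\<^esub> \<zero>\<^bsub>M\<^esub>"] by simp

lemma lsmult_r_minus: "\<lbrakk>a \<in> carrier R; x \<in> carrier M\<rbrakk> \<Longrightarrow> a \<odot>\<^bsub>M\<^esub> (\<ominus>\<^bsub>M\<^esub> x) = \<ominus>\<^bsub>M\<^esub> (a \<odot>\<^bsub>M\<^esub> x)"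
  by (rule M.minus_equality[symmetric]) (simp_all add: lsmult_r_distr[symmetric] M.l_neg)

lemma lsmult_l_minus: "\<lbrakk>a \<in> carrier R; x \<in> carrier M\<rbrakk> \<Longrightarrow> (\<ominus> a) \<odot>\<^bsub>M\<^esub> x = \<ominus>\<^bsub>M\<^esub> (a \<odot>\<^bsub>M\<^esub> x)"
  by (rule M.minus_equality[symmetric]) (simp_all add: lsmult_l_distr[symmetric] R.l_neg)

end

definition fsingle :: "('r, 's) ring_scheme \<Rightarrow> 'r \<Rightarrow> 'x \<Rightarrow> 'x \<Rightarrow> 'r" where
  "fsingle R a x = (\<lambda>y. if y = x then a else \<zero>\<^bsub>R\<^esub>)"

text \<open>\<open>h\<close> is meant to be additive in the coefficient, not linear over
  \<open>R\<close>: besides the augmentation and module homomorphisms, this covers the maps attached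
  to derivations (\<open>dsum\<close>).\<close>

definition fsum ::
    "('r, 's) ring_scheme \<Rightarrow> ('r, 'y) module \<Rightarrow> ('r \<Rightarrow> 'x \<Rightarrow> 'y) \<Rightarrow> ('x \<Rightarrow> 'r) \<Rightarrow> 'y" where
  "fsum R N h f = (\<Oplus>\<^bsub>N\<^esub>x\<in>{x. f x \<noteq> \<zero>\<^bsub>R\<^esub>}. h (f x) x)"

lemma augmentation_fsum: "augmentation R M = fsum R M (\<lambda>a x. a \<odot>\<^bsub>M\<^esub> x)"
  by (rule ext) (simp add: augmentation_def fsum_def)

lemma free_on_simps [simp]:
  "zero (free_on R M) = (\<lambda>_. \<zero>\<^bsub>R\<^esub>)" "add (free_on R M) = (\<lambda>f g x. f x \<oplus>\<^bsub>R\<^esub> g x)"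
  "smult (free_on R M) = (\<lambda>a f x. a \<otimes>\<^bsub>R\<^esub> f x)"
  by (simp_all add: free_on_def)

context ring
begin

lemma carrier_free_on:
  "carrier (free_on R M) = {f. (\<forall>x. f x \<in> carrier R) \<and> (\<forall>x. x \<notin> carrier M \<longrightarrow> f x = \<zero>) \<and>
     finite {x. f x \<noteq> \<zero>}}"
  unfolding free_on_def by (auto, metis image_subset_iff zero_closed)

lemma left_module_free_on: "left_module R (free_on R M)"
proof -
  let ?F = "carrier (free_on R M)"
  have fin2: "finite {x. h (f x) (g x) \<noteq> \<zero>}"
    if "finite {x. f x \<noteq> \<zero>}" "finite {x. g x \<noteq> \<zero>}" "h \<zero> \<zero> = \<zero>" for f g :: "'x \<Rightarrow> 'a" and h
    by (rule finite_subset[OF _ finite_UnI[OF that(1,2)]]) (use that(3) in auto)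
  have add: "(\<lambda>x. f x \<oplus> g x) \<in> ?F" if "f \<in> ?F" "g \<in> ?F" for f g
    using that fin2[of f g "(\<oplus>)"] by (auto simp: carrier_free_on)
  have smult: "(\<lambda>x. a \<otimes> f x) \<in> ?F" if "f \<in> ?F" "a \<in> carrier R" for f a
    using that fin2[of f f "\<lambda>x y. a \<otimes> x"] by (auto simp: carrier_free_on)
  have mem: "f x \<in> carrier R" if "f \<in> ?F" for f x using that by (auto simp: carrier_free_on)
  show ?thesis
  proof (intro left_module.intro left_module_axioms.intro ring_axioms abelian_groupI)
    fix f assume f: "f \<in> ?F"
    have "(\<lambda>x. \<ominus> f x) \<in> ?F"
      using f fin2[of f f "\<lambda>x y. \<ominus> x"] by (auto simp: carrier_free_on)
    then show "\<exists>g\<in>?F. g \<oplus>\<^bsub>free_on R M\<^esub> f = \<zero>\<^bsub>free_on R M\<^esub>"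
      by (rule rev_bexI) (use f in \<open>simp add: l_neg mem\<close>)
  next
    show "\<zero>\<^bsub>free_on R M\<^esub> \<in> ?F" by (simp add: carrier_free_on)
  qed (simp_all add: add smult mem, simp_all add: mem a_ac l_distr r_distr m_assoc fun_eq_iff)
qed

lemma fsingle_closed:
  "\<lbrakk>a \<in> carrier R; x \<in> carrier M\<rbrakk> \<Longrightarrow> fsingle R a x \<in> carrier (free_on R M)"
  using finite_subset[of "{y. fsingle R a x y \<noteq> \<zero>}" "{x}"]
  by (auto simp: carrier_free_on fsingle_def)

lemma fsingle_mult:
  "b \<in> carrier R \<Longrightarrow> (\<lambda>y. b \<otimes> fsingle R a x y) = fsingle R (b \<otimes> a) x"
  by (auto simp: fsingle_def)

lemma free_on_induct [consumes 1, case_names zero add]: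
  assumes "f \<in> carrier (free_on R M)"
    and "P (\<lambda>_. \<zero>)"
    and add: "\<And>a x g. \<lbrakk>a \<in> carrier R; x \<in> carrier M; g \<in> carrier (free_on R M); P g\<rbrakk>
      \<Longrightarrow> P (\<lambda>y. fsingle R a x y \<oplus> g y)"
  shows "P f"
  using assms(1)
proof (induction "card {x. f x \<noteq> \<zero>}" arbitrary: f)
  case 0
  then have "f = (\<lambda>_. \<zero>)" by (auto simp: carrier_free_on)
  then show ?case using assms(2) by simp
next
  case (Suc n)
  then have "{x. f x \<noteq> \<zero>} \<noteq> {}" by (metis card.empty nat.distinct(1))
  then obtain x where x: "f x \<noteq> \<zero>" by auto
  have xM: "x \<in> carrier M" "f x \<in> carrier R" and fin: "finite {x. f x \<noteq> \<zero>}"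
    and cl: "f y \<in> carrier R" for y
    using Suc.prems x by (auto simp: carrier_free_on)
  let ?g = "f(x := \<zero>)"
  have supp: "{y. ?g y \<noteq> \<zero>} = {y. f y \<noteq> \<zero>} - {x}" by auto
  have g: "?g \<in> carrier (free_on R M)"
    using Suc.prems supp fin by (auto simp: carrier_free_on)
  have "n = card {y. ?g y \<noteq> \<zero>}" unfolding supp using Suc.hyps(2) x fin by simp
  then have "P (\<lambda>y. fsingle R (f x) x y \<oplus> ?g y)"
    using add[OF xM(2,1) g] Suc.hyps(1)[OF _ g] by blast
  moreover have "(\<lambda>y. fsingle R (f x) x y \<oplus> ?g y) = f" by (auto simp: fsingle_def cl)
  ultimately show ?case by metis
qed

text \<open>Sums of elements \<open>fsingle R a x\<close> exhaust the free module, and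
  \<open>a\<close> runs through all of \<open>R\<close>, so additivity alone determines a map.
  Linearity over \<open>R\<close> would exclude maps such as \<open>dsum\<close>.\<close>

lemma free_on_additive_eq:
  assumes N: "abelian_group N" and f: "f \<in> carrier (free_on R M)"
    and F: "\<And>f. f \<in> carrier (free_on R M) \<Longrightarrow> F f \<in> carrier N"
      "\<And>f g. \<lbrakk>f \<in> carrier (free_on R M); g \<in> carrier (free_on R M)\<rbrakk> \<Longrightarrow> F (\<lambda>x. f x \<oplus> g x) = F f \<oplus>\<^bsub>N\<^esub> F g"
    and G: "\<And>f. f \<in> carrier (free_on R M) \<Longrightarrow> G f \<in> carrier N"
      "\<And>f g. \<lbrakk>f \<in> carrier (free_on R M); g \<in> carrier (free_on R M)\<rbrakk> \<Longrightarrow> G (\<lambda>x. f x \<oplus> g x) = G f \<oplus>\<^bsub>N\<^esub> G g"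
    and eq: "\<And>a x. \<lbrakk>a \<in> carrier R; x \<in> carrier M\<rbrakk> \<Longrightarrow> F (fsingle R a x) = G (fsingle R a x)"
  shows "F f = G f"
proof -
  interpret N: abelian_group N by fact
  interpret P: left_module R "free_on R M" by (rule left_module_free_on)
  have z: "(\<lambda>_. \<zero>) \<in> carrier (free_on R M)" using P.M.zero_closed by simp
  have z0: "H (\<lambda>_. \<zero>) = \<zero>\<^bsub>N\<^esub>"
    if "\<And>f. f \<in> carrier (free_on R M) \<Longrightarrow> H f \<in> carrier N"
      "\<And>f g. \<lbrakk>f \<in> carrier (free_on R M); g \<in> carrier (free_on R M)\<rbrakk> \<Longrightarrow> H (\<lambda>x. f x \<oplus> g x) = H f \<oplus>\<^bsub>N\<^esub> H g" for H
    using that(2)[OF z z] that(1)[OF z] N.add_eq_self_iff[of "H (\<lambda>_. \<zero>)" "H (\<lambda>_. \<zero>)"] by simp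
  show ?thesis using f
  proof (induction rule: free_on_induct)
    case zero
    then show ?case using z0[of F] z0[of G] F G by simp
  next
    case (add a x g)
    then show ?case by (simp add: F G eq fsingle_closed)
  qed
qed

text \<open>By additivity \<open>h \<zero> x\<close> is zero, so the sum may be taken over any
  finite subset of \<open>M\<close> that contains the support; for a sum of two elements the union
  of their supports serves.\<close>

lemma fsum_props:
  assumes N: "abelian_group N"
    and h: "\<And>a x. \<lbrakk>a \<in> carrier R; x \<in> carrier M\<rbrakk> \<Longrightarrow> h a x \<in> carrier N"
    and hadd: "\<And>a b x. \<lbrakk>a \<in> carrier R; b \<in> carrier R; x \<in> carrier M\<rbrakk>
      \<Longrightarrow> h (a \<oplus> b) x = h a x \<oplus>\<^bsub>N\<^esub> h b x"
  shows fsum_closed: "f \<in> carrier (free_on R M) \<Longrightarrow> fsum R N h f \<in> carrier N"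
    and fsum_add: "\<lbrakk>f \<in> carrier (free_on R M); g \<in> carrier (free_on R M)\<rbrakk>
      \<Longrightarrow> fsum R N h (\<lambda>x. f x \<oplus> g x) = fsum R N h f \<oplus>\<^bsub>N\<^esub> fsum R N h g"
    and fsum_fsingle: "\<lbrakk>a \<in> carrier R; x \<in> carrier M\<rbrakk> \<Longrightarrow> fsum R N h (fsingle R a x) = h a x"
proof -
  interpret N: abelian_group N by fact
  have h0: "h \<zero> x = \<zero>\<^bsub>N\<^esub>" if "x \<in> carrier M" for x
    using hadd[of \<zero> \<zero> x] h[of \<zero> x] N.add_eq_self_iff[of "h \<zero> x" "h \<zero> x"] that by simp
  have sup: "fsum R N h f = (\<Oplus>\<^bsub>N\<^esub>x\<in>S. h (f x) x)"
    if "f \<in> carrier (free_on R M)" "finite S" "{x. f x \<noteq> \<zero>} \<subseteq> S" "S \<subseteq> carrier M" for f S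
    unfolding fsum_def using that
    by (intro N.add.finprod_mono_neutral_cong_left) (auto simp: h0 carrier_free_on intro!: h)
  have supp: "finite {x. f x \<noteq> \<zero>}" "{x. f x \<noteq> \<zero>} \<subseteq> carrier M" "\<And>x. f x \<in> carrier R"
    if "f \<in> carrier (free_on R M)" for f
    using that by (auto simp: carrier_free_on)
  show "fsum R N h f \<in> carrier N" if "f \<in> carrier (free_on R M)"
    unfolding fsum_def by (rule N.finsum_closed) (use supp[OF that] h in auto)
  show "fsum R N h (\<lambda>x. f x \<oplus> g x) = fsum R N h f \<oplus>\<^bsub>N\<^esub> fsum R N h g"
    if f: "f \<in> carrier (free_on R M)" and g: "g \<in> carrier (free_on R M)"
  proof -
    interpret P: left_module R "free_on R M" by (rule left_module_free_on)
    have fg: "(\<lambda>x. f x \<oplus> g x) \<in> carrier (free_on R M)" using P.M.a_closed[OF f g] by simp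
    let ?S = "{x. f x \<noteq> \<zero>} \<union> {x. g x \<noteq> \<zero>}"
    have S: "finite ?S" "?S \<subseteq> carrier M" using supp[OF f] supp[OF g] by auto
    have m: "x \<in> carrier M" "f x \<in> carrier R" "g x \<in> carrier R" if "x \<in> ?S" for x
      using that S(2) supp(3)[OF f] supp(3)[OF g] by auto
    have "fsum R N h (\<lambda>x. f x \<oplus> g x) = (\<Oplus>\<^bsub>N\<^esub>x\<in>?S. h (f x \<oplus> g x) x)"
      by (rule sup[OF fg S(1) _ S(2)], rule subsetI, rule ccontr) simp
    also have "\<dots> = (\<Oplus>\<^bsub>N\<^esub>x\<in>?S. h (f x) x \<oplus>\<^bsub>N\<^esub> h (g x) x)"
      by (rule N.finsum_cong'[OF refl]) (use m in \<open>blast intro: h N.a_closed\<close>, blast intro: hadd m)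
    also have "\<dots> = (\<Oplus>\<^bsub>N\<^esub>x\<in>?S. h (f x) x) \<oplus>\<^bsub>N\<^esub> (\<Oplus>\<^bsub>N\<^esub>x\<in>?S. h (g x) x)"
      by (rule N.finsum_addf) (use m in \<open>blast intro: h\<close>)+
    finally show ?thesis using sup[OF f S(1) Un_upper1 S(2)] sup[OF g S(1) Un_upper2 S(2)] by metis
  qed
  show "fsum R N h (fsingle R a x) = h a x" if "a \<in> carrier R" "x \<in> carrier M"
  proof -
    have "fsum R N h (fsingle R a x) = (\<Oplus>\<^bsub>N\<^esub>y\<in>{x}. h (fsingle R a x y) y)"
      by (rule sup[OF fsingle_closed[OF that]]) (use that in \<open>auto simp: fsingle_def split: if_splits\<close>)
    also have "\<dots> = h a x"
      using N.finsum_insert[of "{}" x "\<lambda>y. h (fsingle R a x y) y"] h[OF that]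
      by (simp add: fsingle_def)
    finally show ?thesis .
  qed
qed

end

text \<open>\<open>left_module\<close> for records without extension fields, the type on which
  \<open>free_on\<close>, \<open>lmod_hom\<close> and \<open>syzygy\<close> are defined.\<close>

locale lmodule = left_module R M
  for R :: "('r, 's) ring_scheme" (structure) and M :: "('r, 'x) module" (structure)

context lmodule
begin

lemma augmentation_closed: "f \<in> carrier (free_on R M) \<Longrightarrow> augmentation R M f \<in> carrier M"
  unfolding augmentation_fsum
  by (rule R.fsum_closed[OF M.abelian_group_axioms]) (auto simp: lsmult_l_distr)

lemma augmentation_add:
  "\<lbrakk>f \<in> carrier (free_on R M); g \<in> carrier (free_on R M)\<rbrakk> \<Longrightarrow>
    augmentation R M (\<lambda>x. f x \<oplus> g x) = augmentation R M f \<oplus>\<^bsub>M\<^esub> augmentation R M g"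
  unfolding augmentation_fsum
  by (rule R.fsum_add[OF M.abelian_group_axioms]) (auto simp: lsmult_l_distr)

lemma augmentation_fsingle:
  "\<lbrakk>a \<in> carrier R; x \<in> carrier M\<rbrakk> \<Longrightarrow> augmentation R M (fsingle R a x) = a \<odot>\<^bsub>M\<^esub> x"
  unfolding augmentation_fsum
  by (rule R.fsum_fsingle[OF M.abelian_group_axioms]) (auto simp: lsmult_l_distr)

lemma free_on_smult_closed:
  "\<lbrakk>a \<in> carrier R; f \<in> carrier (free_on R N)\<rbrakk> \<Longrightarrow> (\<lambda>x. a \<otimes> f x) \<in> carrier (free_on R N)"
  using left_module.lsmult_closed[OF R.left_module_free_on] by fastforce

lemma free_on_add_closed:
  "\<lbrakk>g \<in> carrier (free_on R N); f \<in> carrier (free_on R N)\<rbrakk> \<Longrightarrow> (\<lambda>x. g x \<oplus> f x) \<in> carrier (free_on R N)"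
  using abelian_monoid.a_closed[OF abelian_group.axioms(1)[OF left_module.axioms(2)[OF R.left_module_free_on]]]
  by fastforce

lemma fsum_smult:
  assumes N: "left_module R N"
    and u: "\<And>x. x \<in> carrier M \<Longrightarrow> u x \<in> carrier N"
    and a: "a \<in> carrier R" and f: "f \<in> carrier (free_on R M)"
  shows "fsum R N (\<lambda>a x. a \<odot>\<^bsub>N\<^esub> u x) (\<lambda>x. a \<otimes> f x) = a \<odot>\<^bsub>N\<^esub> fsum R N (\<lambda>a x. a \<odot>\<^bsub>N\<^esub> u x) f"
proof -
  interpret N: left_module R N by fact
  note p = R.fsum_props[OF N.abelian_group_axioms, where M = M and h = "\<lambda>a x. a \<odot>\<^bsub>N\<^esub> u x"]
  have p': "fsum R N (\<lambda>a x. a \<odot>\<^bsub>N\<^esub> u x) f \<in> carrier N"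
    "fsum R N (\<lambda>a x. a \<odot>\<^bsub>N\<^esub> u x) (\<lambda>x. f x \<oplus> g x) =
      fsum R N (\<lambda>a x. a \<odot>\<^bsub>N\<^esub> u x) f \<oplus>\<^bsub>N\<^esub> fsum R N (\<lambda>a x. a \<odot>\<^bsub>N\<^esub> u x) g"
    "\<lbrakk>b \<in> carrier R; x \<in> carrier M\<rbrakk> \<Longrightarrow> fsum R N (\<lambda>a x. a \<odot>\<^bsub>N\<^esub> u x) (fsingle R b x) = b \<odot>\<^bsub>N\<^esub> u x"
    if "f \<in> carrier (free_on R M)" "g \<in> carrier (free_on R M)" for f g b x
    using that by (auto intro!: p simp: u N.lsmult_l_distr)
  show ?thesis
  proof (rule R.free_on_additive_eq[OF N.abelian_group_axioms f])
    fix f g assume fg: "f \<in> carrier (free_on R M)" "g \<in> carrier (free_on R M)"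
    then have "(\<lambda>x. a \<otimes> (f x \<oplus> g x)) = (\<lambda>x. a \<otimes> f x \<oplus> a \<otimes> g x)"
      using a by (auto simp: R.r_distr R.carrier_free_on)
    then show "fsum R N (\<lambda>a x. a \<odot>\<^bsub>N\<^esub> u x) (\<lambda>x. a \<otimes> (f x \<oplus> g x)) =
        fsum R N (\<lambda>a x. a \<odot>\<^bsub>N\<^esub> u x) (\<lambda>x. a \<otimes> f x) \<oplus>\<^bsub>N\<^esub> fsum R N (\<lambda>a x. a \<odot>\<^bsub>N\<^esub> u x) (\<lambda>x. a \<otimes> g x)"
      using fg a p'(2)[of "\<lambda>x. a \<otimes> f x" "\<lambda>x. a \<otimes> g x"] by (simp add: free_on_smult_closed)
    show "a \<odot>\<^bsub>N\<^esub> fsum R N (\<lambda>a x. a \<odot>\<^bsub>N\<^esub> u x) (\<lambda>x. f x \<oplus> g x) =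
       a \<odot>\<^bsub>N\<^esub> fsum R N (\<lambda>a x. a \<odot>\<^bsub>N\<^esub> u x) f \<oplus>\<^bsub>N\<^esub> a \<odot>\<^bsub>N\<^esub> fsum R N (\<lambda>a x. a \<odot>\<^bsub>N\<^esub> u x) g"
      using fg a p'(1,2) by (simp add: N.lsmult_r_distr)
  next
    fix b x assume b: "b \<in> carrier R" "x \<in> carrier M"
    have s: "fsingle R b x \<in> carrier (free_on R M)" "fsingle R (a \<otimes> b) x \<in> carrier (free_on R M)"
      using a b by (auto intro: R.fsingle_closed)
    show "fsum R N (\<lambda>a x. a \<odot>\<^bsub>N\<^esub> u x) (\<lambda>y. a \<otimes> fsingle R b x y) =
        a \<odot>\<^bsub>N\<^esub> fsum R N (\<lambda>a x. a \<odot>\<^bsub>N\<^esub> u x) (fsingle R b x)"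
      using a b p'(3)[OF s(1) s(1)] by (simp add: R.fsingle_mult N.lsmult_assoc u)
  qed (use a p'(1) in \<open>auto intro!: free_on_smult_closed\<close>)
qed

lemma augmentation_smult:
  "\<lbrakk>a \<in> carrier R; f \<in> carrier (free_on R M)\<rbrakk> \<Longrightarrow>
    augmentation R M (\<lambda>x. a \<otimes> f x) = a \<odot>\<^bsub>M\<^esub> augmentation R M f"
  unfolding augmentation_fsum by (rule fsum_smult[OF left_module_axioms]) auto

lemma fsum_lmod_hom:
  assumes N: "left_module R N" and u: "\<And>x. x \<in> carrier M \<Longrightarrow> u x \<in> carrier N"
  shows "(\<lambda>f\<in>carrier (free_on R M). fsum R N (\<lambda>a x. a \<odot>\<^bsub>N\<^esub> u x) f) \<in> lmod_hom R (free_on R M) N"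
proof -
  interpret N: left_module R N by fact
  have "fsum R N (\<lambda>a x. a \<odot>\<^bsub>N\<^esub> u x) f \<in> carrier N"
    "fsum R N (\<lambda>a x. a \<odot>\<^bsub>N\<^esub> u x) (\<lambda>x. f x \<oplus> g x) =
      fsum R N (\<lambda>a x. a \<odot>\<^bsub>N\<^esub> u x) f \<oplus>\<^bsub>N\<^esub> fsum R N (\<lambda>a x. a \<odot>\<^bsub>N\<^esub> u x) g"
    if "f \<in> carrier (free_on R M)" "g \<in> carrier (free_on R M)" for f g
    using that
    by (auto intro!: R.fsum_closed[OF N.abelian_group_axioms] R.fsum_add[OF N.abelian_group_axioms]
        simp: u N.lsmult_l_distr)
  then show ?thesis
    by (auto simp: lmod_hom_def free_on_smult_closed free_on_add_closed fsum_smult[OF N u])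
qed

end

section \<open>The first extension group\<close>

lemma lmod_homI:
  assumes "\<And>x. x \<in> carrier M \<Longrightarrow> f x \<in> carrier N" "f \<in> extensional (carrier M)"
    "\<And>x y. \<lbrakk>x \<in> carrier M; y \<in> carrier M\<rbrakk> \<Longrightarrow> f (x \<oplus>\<^bsub>M\<^esub> y) = f x \<oplus>\<^bsub>N\<^esub> f y"
    "\<And>a x. \<lbrakk>a \<in> carrier R; x \<in> carrier M\<rbrakk> \<Longrightarrow> f (a \<odot>\<^bsub>M\<^esub> x) = a \<odot>\<^bsub>N\<^esub> f x"
  shows "f \<in> lmod_hom R M N"
  using assms by (auto simp: lmod_hom_def PiE_def)

lemma lmod_homD:
  assumes "f \<in> lmod_hom R M N"
  shows "x \<in> carrier M \<Longrightarrow> f x \<in> carrier N" "f \<in> extensional (carrier M)"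
    "\<lbrakk>x \<in> carrier M; y \<in> carrier M\<rbrakk> \<Longrightarrow> f (x \<oplus>\<^bsub>M\<^esub> y) = f x \<oplus>\<^bsub>N\<^esub> f y"
    "\<lbrakk>a \<in> carrier R; x \<in> carrier M\<rbrakk> \<Longrightarrow> f (a \<odot>\<^bsub>M\<^esub> x) = a \<odot>\<^bsub>N\<^esub> f x"
  using assms by (auto simp: lmod_hom_def PiE_def)

lemma hom_space_simps [simp]:
  "carrier (hom_space R \<eta> M N) = lmod_hom R M N"
  "zero (hom_space R \<eta> M N) = (\<lambda>x\<in>carrier M. \<zero>\<^bsub>N\<^esub>)"
  "add (hom_space R \<eta> M N) = (\<lambda>f g. \<lambda>x\<in>carrier M. f x \<oplus>\<^bsub>N\<^esub> g x)"
  "smult (hom_space R \<eta> M N) = (\<lambda>c f. \<lambda>x\<in>carrier M. \<eta> c \<odot>\<^bsub>N\<^esub> f x)"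
  by (simp_all add: hom_space_def)

lemma lmod_hom_zero:
  assumes "lmodule R M" "lmodule R N" "f \<in> lmod_hom R M N"
  shows "f \<zero>\<^bsub>M\<^esub> = \<zero>\<^bsub>N\<^esub>"
proof -
  interpret M: lmodule R M by fact
  interpret N: lmodule R N by fact
  note fD = lmod_homD[OF assms(3)]
  show ?thesis
    using fD(3)[of "\<zero>\<^bsub>M\<^esub>" "\<zero>\<^bsub>M\<^esub>"] fD(1)[of "\<zero>\<^bsub>M\<^esub>"]
      N.M.add_eq_self_iff[of "f \<zero>\<^bsub>M\<^esub>" "f \<zero>\<^bsub>M\<^esub>"] by simp
qed

lemma lmod_hom_minus:
  assumes "lmodule R M" "lmodule R N" "f \<in> lmod_hom R M N" "x \<in> carrier M" "y \<in> carrier M"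
  shows "f (x \<ominus>\<^bsub>M\<^esub> y) = f x \<ominus>\<^bsub>N\<^esub> f y"
proof -
  interpret M: lmodule R M by fact
  interpret N: lmodule R N by fact
  note fD = lmod_homD[OF assms(3)]
  have "f (\<ominus>\<^bsub>M\<^esub> y) \<oplus>\<^bsub>N\<^esub> f y = \<zero>\<^bsub>N\<^esub>"
    using fD(3)[of "\<ominus>\<^bsub>M\<^esub> y" y] assms(5) lmod_hom_zero[OF assms(1-3)] by (simp add: M.M.l_neg)
  then have "f (\<ominus>\<^bsub>M\<^esub> y) = \<ominus>\<^bsub>N\<^esub> f y"
    using assms(5) fD(1) by (simp add: N.M.minus_equality)
  then show ?thesis using assms(4,5) fD(3)[of x "\<ominus>\<^bsub>M\<^esub> y"] by (simp add: a_minus_def)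
qed

lemma lmodule_iff: "lmodule R M \<longleftrightarrow> left_module R M"
  by (simp add: lmodule_def)

context lmodule
begin

lemma lmodule_free_on: "lmodule R (free_on R N)"
  unfolding lmodule_iff by (rule R.left_module_free_on)

lemma lmodule_sub:
  assumes S: "S \<subseteq> carrier M" "\<zero>\<^bsub>M\<^esub> \<in> S"
    and add: "\<And>x y. \<lbrakk>x \<in> S; y \<in> S\<rbrakk> \<Longrightarrow> x \<oplus>\<^bsub>M\<^esub> y \<in> S"
    and smult: "\<And>a x. \<lbrakk>a \<in> carrier R; x \<in> S\<rbrakk> \<Longrightarrow> a \<odot>\<^bsub>M\<^esub> x \<in> S"
  shows "lmodule R (M\<lparr>carrier := S\<rparr>)"
proof -
  have mem: "x \<in> carrier M" if "x \<in> S" for x using S that by blast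
  show ?thesis unfolding lmodule_iff
  proof (intro left_module.intro left_module_axioms.intro R.ring_axioms abelian_groupI)
    fix x assume "x \<in> carrier (M\<lparr>carrier := S\<rparr>)"
    then have x: "x \<in> S" by simp
    \<comment> \<open>Negatives are multiples by \<open>\<ominus> \<one>\<close>, so closure under
      scalars includes them.\<close>
    have "(\<ominus> \<one>) \<odot>\<^bsub>M\<^esub> x = \<ominus>\<^bsub>M\<^esub> x"
      using lsmult_l_minus[of \<one> x] x by (simp add: lsmult_one mem)
    then have "\<ominus>\<^bsub>M\<^esub> x \<in> S" using smult[of "\<ominus> \<one>" x] x by simp
    then show "\<exists>y\<in>carrier (M\<lparr>carrier := S\<rparr>). y \<oplus>\<^bsub>M\<lparr>carrier := S\<rparr>\<^esub> x = \<zero>\<^bsub>M\<lparr>carrier := S\<rparr>\<^esub>"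
      by (rule_tac bexI[of _ "\<ominus>\<^bsub>M\<^esub> x"]) (simp_all add: M.l_neg x mem)
  qed (simp_all add: add smult S mem M.a_ac lsmult_l_distr lsmult_r_distr lsmult_assoc lsmult_one)
qed

lemma syzygy_simps [simp]:
  "zero (syzygy R M) = (\<lambda>_. \<zero>)" "add (syzygy R M) = (\<lambda>f g x. f x \<oplus> g x)"
  "smult (syzygy R M) = (\<lambda>a f x. a \<otimes> f x)"
  by (simp_all add: syzygy_def)

lemma carrier_syzygy:
  "f \<in> carrier (syzygy R M) \<longleftrightarrow> f \<in> carrier (free_on R M) \<and> augmentation R M f = \<zero>\<^bsub>M\<^esub>"
  by (simp add: syzygy_def)

lemma lmodule_syzygy: "lmodule R (syzygy R M)"
  unfolding syzygy_def
proof (rule lmodule.lmodule_sub[OF lmodule_free_on])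
  interpret P: lmodule R "free_on R M" by (rule lmodule_free_on)
  have z: "(\<lambda>_. \<zero>) \<in> carrier (free_on R M)" using P.M.zero_closed by simp
  have "augmentation R M (\<lambda>_. \<zero>) = \<zero>\<^bsub>M\<^esub>"
    using augmentation_add[OF z z] augmentation_closed[OF z]
      M.add_eq_self_iff[of "augmentation R M (\<lambda>_. \<zero>)" "augmentation R M (\<lambda>_. \<zero>)"] by simp
  then show "\<zero>\<^bsub>free_on R M\<^esub> \<in> {f \<in> carrier (free_on R M). augmentation R M f = \<zero>\<^bsub>M\<^esub>}"
    using z by simp
qed (auto simp: augmentation_add augmentation_smult free_on_add_closed free_on_smult_closed)

end

context k_algebra
begin

lemma hom_space_add_closed:
  assumes "lmodule R M" "lmodule R N" "f \<in> lmod_hom R M N" "g \<in> lmod_hom R M N"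
  shows "(\<lambda>x\<in>carrier M. f x \<oplus>\<^bsub>N\<^esub> g x) \<in> lmod_hom R M N"
proof -
  interpret M: lmodule R M by fact
  interpret N: lmodule R N by fact
  note fD = lmod_homD[OF assms(3)] and gD = lmod_homD[OF assms(4)]
  show ?thesis
    by (rule lmod_homI) (simp_all add: fD gD N.M.a_ac N.lsmult_r_distr)
qed

text \<open>Centrality of \<open>\<eta> c\<close> enters here: it lets \<open>\<eta> c\<close> pass
  the scalars of \<open>R\<close>, so that scaling preserves linearity over
  \<open>R\<close>.\<close>

lemma hom_space_smult_closed:
  assumes "lmodule R M" "lmodule R N" "f \<in> lmod_hom R M N"
  shows "(\<lambda>x\<in>carrier M. \<eta> c \<odot>\<^bsub>N\<^esub> f x) \<in> lmod_hom R M N"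
proof -
  interpret M: lmodule R M by fact
  interpret N: lmodule R N by fact
  note fD = lmod_homD[OF assms(3)]
  show ?thesis
    by (rule lmod_homI)
      (simp_all add: fD N.lsmult_r_distr N.lsmult_assoc[symmetric] \<eta>_central)
qed

lemma abelian_group_hom_space:
  assumes "lmodule R M" "lmodule R N"
  shows "abelian_group (hom_space R \<eta> M N)"
proof -
  interpret M: lmodule R M by fact
  interpret N: lmodule R N by fact
  note D = lmod_homD
  have z: "(\<lambda>x\<in>carrier M. \<zero>\<^bsub>N\<^esub>) \<in> lmod_hom R M N" by (rule lmod_homI) simp_all
  show ?thesis
  proof (rule abelian_groupI)
    fix f assume "f \<in> carrier (hom_space R \<eta> M N)"
    then have f: "f \<in> lmod_hom R M N" by simp
    have "(\<lambda>x\<in>carrier M. \<ominus>\<^bsub>N\<^esub> f x) \<in> lmod_hom R M N"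
      by (rule lmod_homI) (simp_all add: D[OF f] N.M.minus_add N.lsmult_r_minus)
    then show "\<exists>g\<in>carrier (hom_space R \<eta> M N). g \<oplus>\<^bsub>hom_space R \<eta> M N\<^esub> f = \<zero>\<^bsub>hom_space R \<eta> M N\<^esub>"
      by (intro bexI[of _ "\<lambda>x\<in>carrier M. \<ominus>\<^bsub>N\<^esub> f x"])
        (auto simp: D[OF f] N.M.l_neg restrict_def)
  next
    fix f assume "f \<in> carrier (hom_space R \<eta> M N)"
    then have f: "f \<in> lmod_hom R M N" by simp
    show "\<zero>\<^bsub>hom_space R \<eta> M N\<^esub> \<oplus>\<^bsub>hom_space R \<eta> M N\<^esub> f = f"
      by (rule extensionalityI[of _ "carrier M"]) (simp_all add: D[OF f])
  next
    show "f \<oplus>\<^bsub>hom_space R \<eta> M N\<^esub> g \<in> carrier (hom_space R \<eta> M N)"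
      if "f \<in> carrier (hom_space R \<eta> M N)" "g \<in> carrier (hom_space R \<eta> M N)" for f g
      using that hom_space_add_closed[OF assms] by simp
    show "\<zero>\<^bsub>hom_space R \<eta> M N\<^esub> \<in> carrier (hom_space R \<eta> M N)" using z by simp
  qed (simp_all add: D N.M.a_ac restrict_def cong: if_cong)
qed

end

lemma (in abelian_group) abelian_group_sub:
  assumes S: "S \<subseteq> carrier G" "\<zero> \<in> S" "\<And>x y. \<lbrakk>x \<in> S; y \<in> S\<rbrakk> \<Longrightarrow> x \<oplus> y \<in> S"
    "\<And>x. x \<in> S \<Longrightarrow> \<ominus> x \<in> S"
  shows "abelian_group (G\<lparr>carrier := S\<rparr>)"
proof -
  have mem: "x \<in> carrier G" if "x \<in> S" for x using S that by blast
  show ?thesis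
  proof (rule abelian_groupI)
    fix x assume "x \<in> carrier (G\<lparr>carrier := S\<rparr>)"
    then show "\<exists>y\<in>carrier (G\<lparr>carrier := S\<rparr>). y \<oplus>\<^bsub>G\<lparr>carrier := S\<rparr>\<^esub> x = \<zero>\<^bsub>G\<lparr>carrier := S\<rparr>\<^esub>"
      using S(4)[of x] by (intro bexI[of _ "\<ominus> x"]) (simp_all add: l_neg mem)
  qed (simp_all add: S mem a_ac)
qed

lemma (in abelian_group) abelian_subgroup_sub:
  assumes S: "S \<subseteq> carrier G" "\<zero> \<in> S" "\<And>x y. \<lbrakk>x \<in> S; y \<in> S\<rbrakk> \<Longrightarrow> x \<oplus> y \<in> S"
    "\<And>x. x \<in> S \<Longrightarrow> \<ominus> x \<in> S"
  shows "abelian_subgroup S G"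
proof (rule abelian_subgroupI3[OF additive_subgroup.intro abelian_group_axioms])
  show "subgroup S (add_monoid G)"
    using S by (intro subgroup.intro) (auto simp: a_inv_def)
qed

locale ext_pair = k_algebra R \<eta> + X: lmodule R X + Y: lmodule R Y
  for R :: "('r, 's) ring_scheme" (structure) and \<eta> :: "'k::field \<Rightarrow> 'r"
    and X :: "('r, 'x) module" and Y :: "('r, 'y) module"
begin

abbreviation "\<Omega> \<equiv> syzygy R X"
abbreviation "P0 \<equiv> free_on R X"
abbreviation "P1 \<equiv> free_on R \<Omega>"

sublocale \<Omega>: lmodule R \<Omega> by (rule X.lmodule_syzygy)
sublocale \<Omega>2: lmodule R "syzygy R \<Omega>" by (rule \<Omega>.lmodule_syzygy)
sublocale P0: lmodule R P0 by (rule X.lmodule_free_on)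
sublocale P1: lmodule R P1 by (rule X.lmodule_free_on)

definition cocycle_of :: "(('x \<Rightarrow> 'r) \<Rightarrow> 'y) \<Rightarrow> (('x \<Rightarrow> 'r) \<Rightarrow> 'r) \<Rightarrow> 'y" where
  "cocycle_of \<phi> = (\<lambda>z\<in>carrier P1. \<phi> (augmentation R \<Omega> z))"

lemma cocycle_of_hom:
  assumes "\<phi> \<in> lmod_hom R \<Omega> Y"
  shows "cocycle_of \<phi> \<in> lmod_hom R P1 Y"
proof -
  note D = lmod_homD[OF assms]
  have add: "(\<lambda>x. z x \<oplus> w x) \<in> carrier P1" if "z \<in> carrier P1" "w \<in> carrier P1" for z w
    using P1.M.a_closed[OF that] by simp
  have sm: "(\<lambda>x. a \<otimes> z x) \<in> carrier P1" if "a \<in> carrier R" "z \<in> carrier P1" for a z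
    using P1.lsmult_closed[OF that] by simp
  show ?thesis
    by (rule lmod_homI)
      (use \<Omega>.augmentation_add D(3) \<Omega>.augmentation_smult D(4)
        in \<open>simp_all add: cocycle_of_def D(1) \<Omega>.augmentation_closed add sm\<close>)
qed

lemma cocycle_of_cocycle:
  assumes "\<phi> \<in> lmod_hom R \<Omega> Y"
  shows "cocycle_of \<phi> \<in> ext1_cocycles R X Y"
proof -
  have "cocycle_of \<phi> (augmentation R (syzygy R \<Omega>) z) = \<zero>\<^bsub>Y\<^esub>"
    if "z \<in> carrier (free_on R (syzygy R \<Omega>))" for z
    using \<Omega>2.augmentation_closed[OF that]
      lmod_hom_zero[OF \<Omega>.lmodule_axioms Y.lmodule_axioms assms]
    by (simp add: cocycle_of_def \<Omega>.carrier_syzygy)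
  then show ?thesis using cocycle_of_hom[OF assms] by (simp add: ext1_cocycles_def Let_def)
qed

lemma aug_fsingle_one:
  assumes "w \<in> carrier \<Omega>"
  shows "fsingle R \<one> w \<in> carrier P1" "augmentation R \<Omega> (fsingle R \<one> w) = w"
  using assms \<Omega>.augmentation_fsingle[of \<one> w] \<Omega>.lsmult_one[OF assms]
  by (simp_all add: fsingle_closed)

text \<open>An element \<open>z\<close> of the kernel of the augmentation of \<open>P1\<close> is
  the image of the basis element \<open>fsingle R \<one> z\<close> of the next free module. A
  cocycle therefore vanishes on this kernel and factors through the syzygy.\<close>

lemma cocycle_ex:
  assumes "f \<in> ext1_cocycles R X Y"
  shows "\<exists>\<phi>\<in>lmod_hom R \<Omega> Y. f = cocycle_of \<phi>"
proof -
  have f: "f \<in> lmod_hom R P1 Y"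
    and f0: "\<And>z. z \<in> carrier (free_on R (syzygy R \<Omega>)) \<Longrightarrow> f (augmentation R (syzygy R \<Omega>) z) = \<zero>\<^bsub>Y\<^esub>"
    using assms by (auto simp: ext1_cocycles_def Let_def)
  note D = lmod_homD[OF f]
  have ker: "f z = \<zero>\<^bsub>Y\<^esub>" if "z \<in> carrier P1" "augmentation R \<Omega> z = \<zero>\<^bsub>\<Omega>\<^esub>" for z
  proof -
    have z: "z \<in> carrier (syzygy R \<Omega>)" using that by (simp add: \<Omega>.carrier_syzygy)
    have "fsingle R \<one> z \<in> carrier (free_on R (syzygy R \<Omega>))" using z by (simp add: fsingle_closed)
    then show ?thesis
      using f0[of "fsingle R \<one> z"] \<Omega>2.augmentation_fsingle[of \<one> z] \<Omega>2.lsmult_one[OF z] z by simp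
  qed
  have aug_hom: "restrict (augmentation R \<Omega>) (carrier P1) \<in> lmod_hom R P1 \<Omega>"
    by (rule lmod_homI)
      (use \<Omega>.augmentation_add \<Omega>.augmentation_smult P1.M.a_closed P1.lsmult_closed
        in \<open>simp_all add: \<Omega>.augmentation_closed\<close>)
  have eq: "f z = f z'" if "z \<in> carrier P1" "z' \<in> carrier P1" "augmentation R \<Omega> z = augmentation R \<Omega> z'" for z z'
  proof -
    have c: "z \<ominus>\<^bsub>P1\<^esub> z' \<in> carrier P1" using that by (rule_tac P1.M.minus_closed)
    have "augmentation R \<Omega> (z \<ominus>\<^bsub>P1\<^esub> z') = \<zero>\<^bsub>\<Omega>\<^esub>"
    proof -
      have "augmentation R \<Omega> (z \<ominus>\<^bsub>P1\<^esub> z') = augmentation R \<Omega> z \<ominus>\<^bsub>\<Omega>\<^esub> augmentation R \<Omega> z'"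
        using lmod_hom_minus[OF P1.lmodule_axioms \<Omega>.lmodule_axioms aug_hom that(1,2)] that(1,2) c
        by (simp only: restrict_apply' split: if_splits)
      also have "\<dots> = \<zero>\<^bsub>\<Omega>\<^esub>"
        unfolding that(3) a_minus_def
        by (rule \<Omega>.M.r_neg[OF \<Omega>.augmentation_closed[OF that(2)]])
      finally show ?thesis .
    qed
    then have "f z \<ominus>\<^bsub>Y\<^esub> f z' = \<zero>\<^bsub>Y\<^esub>"
      using ker[OF c] lmod_hom_minus[OF P1.lmodule_axioms Y.lmodule_axioms f that(1,2)] by simp
    then have "\<ominus>\<^bsub>Y\<^esub> (\<ominus>\<^bsub>Y\<^esub> f z') = f z"
      using that D(1) by (intro Y.M.minus_equality) (simp_all add: a_minus_def)
    then show ?thesis using that D(1) by simp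
  qed
  \<comment> \<open>\<open>fsingle R \<one> w\<close> is a preimage of \<open>w\<close> that does
    not depend additively on \<open>w\<close>; but by \<open>eq\<close> every other preimage gives
    the same value, and this makes \<open>\<phi>\<close> a homomorphism.\<close>
  define \<phi> where "\<phi> = (\<lambda>w\<in>carrier \<Omega>. f (fsingle R \<one> w))"
  have \<phi>: "\<phi> (augmentation R \<Omega> z) = f z" if "z \<in> carrier P1" for z
  proof -
    note a = \<Omega>.augmentation_closed[OF that]
    have "f (fsingle R \<one> (augmentation R \<Omega> z)) = f z"
      by (rule eq[OF aug_fsingle_one(1)[OF a] that aug_fsingle_one(2)[OF a]])
    then show ?thesis by (simp add: \<phi>_def a)
  qed
  have ex: "\<exists>z\<in>carrier P1. w = augmentation R \<Omega> z" if "w \<in> carrier \<Omega>" for w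
    using aug_fsingle_one[OF that] by metis
  have "\<phi> \<in> lmod_hom R \<Omega> Y"
  proof (rule lmod_homI)
    show "\<phi> w \<in> carrier Y" if "w \<in> carrier \<Omega>" for w
      using ex[OF that] \<phi> D(1) by auto
    show "\<phi> (w \<oplus>\<^bsub>\<Omega>\<^esub> w') = \<phi> w \<oplus>\<^bsub>Y\<^esub> \<phi> w'" if w: "w \<in> carrier \<Omega>" "w' \<in> carrier \<Omega>" for w w'
    proof -
      obtain z z' where z: "z \<in> carrier P1" "w = augmentation R \<Omega> z" "z' \<in> carrier P1" "w' = augmentation R \<Omega> z'"
        using ex[OF w(1)] ex[OF w(2)] by auto
      then show ?thesis
        using \<Omega>.augmentation_add[OF z(1,3)] \<phi>[OF P1.M.a_closed[OF z(1,3)]] D(3)[OF z(1,3)] \<phi>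
        by simp
    qed
    show "\<phi> (a \<odot>\<^bsub>\<Omega>\<^esub> w) = a \<odot>\<^bsub>Y\<^esub> \<phi> w" if w: "a \<in> carrier R" "w \<in> carrier \<Omega>" for a w
    proof -
      obtain z where z: "z \<in> carrier P1" "w = augmentation R \<Omega> z"
        using ex[OF w(2)] by auto
      then show ?thesis
        using \<Omega>.augmentation_smult[OF w(1) z(1)] \<phi>[OF P1.lsmult_closed[OF w(1) z(1)]] D(4)[OF w(1) z(1)] \<phi>
        by simp
    qed
  qed (simp add: \<phi>_def)
  moreover have "f = cocycle_of \<phi>"
    by (rule extensionalityI[of _ "carrier P1"]) (simp_all add: D(2) cocycle_of_def \<phi>)
  ultimately show ?thesis by blast
qed

text \<open>The augmentation of \<open>fsingle R \<one> w\<close> is \<open>w\<close>, so an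
  equation of cocycles on \<open>P1\<close> is an equation on the syzygy.\<close>

lemma coboundary_iff:
  assumes "\<phi> \<in> lmod_hom R \<Omega> Y"
  shows "cocycle_of \<phi> \<in> ext1_coboundaries R X Y \<longleftrightarrow>
    (\<exists>g\<in>lmod_hom R P0 Y. \<forall>w\<in>carrier \<Omega>. \<phi> w = g w)"
proof
  assume "cocycle_of \<phi> \<in> ext1_coboundaries R X Y"
  then obtain g where g: "g \<in> lmod_hom R P0 Y"
    "cocycle_of \<phi> = (\<lambda>z\<in>carrier P1. g (augmentation R \<Omega> z))"
    by (auto simp: ext1_coboundaries_def Let_def)
  have "\<phi> w = g w" if "w \<in> carrier \<Omega>" for w
    using fun_cong[OF g(2), of "fsingle R \<one> w"] aug_fsingle_one[OF that]
    by (simp add: cocycle_of_def)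
  then show "\<exists>g\<in>lmod_hom R P0 Y. \<forall>w\<in>carrier \<Omega>. \<phi> w = g w" using g(1) by blast
next
  assume "\<exists>g\<in>lmod_hom R P0 Y. \<forall>w\<in>carrier \<Omega>. \<phi> w = g w"
  then obtain g where g: "g \<in> lmod_hom R P0 Y" "\<forall>w\<in>carrier \<Omega>. \<phi> w = g w" by blast
  have "cocycle_of \<phi> = (\<lambda>z\<in>carrier P1. g (augmentation R \<Omega> z))"
    unfolding cocycle_of_def by (rule restrict_ext) (simp add: g(2) \<Omega>.augmentation_closed)
  then show "cocycle_of \<phi> \<in> ext1_coboundaries R X Y"
    using g(1) by (auto simp: ext1_coboundaries_def Let_def)
qed

lemma restrict_syzygy_hom:
  assumes "g \<in> lmod_hom R P0 Y"
  shows "restrict g (carrier \<Omega>) \<in> lmod_hom R \<Omega> Y"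
proof -
  note D = lmod_homD[OF assms]
  have "w \<in> carrier P0" if "w \<in> carrier \<Omega>" for w using that by (simp add: X.carrier_syzygy)
  then show ?thesis
    using D \<Omega>.M.a_closed \<Omega>.lsmult_closed by (intro lmod_homI) simp_all
qed

text \<open>\<open>V\<close> is a space of parameters for homomorphisms on the syzygy. Modulo those
  that extend to \<open>P0\<close> every homomorphism is reached, so \<open>V\<close> maps onto
  \<open>Ext1\<close>, and the kernel consists of the parameters whose homomorphism extends.
  Rank-nullity then also supplies the vector space axioms of the quotient.\<close>

lemma Ext1_has_dim:
  fixes V :: "('k, 'd) module" and \<Psi> :: "'d \<Rightarrow> ('x \<Rightarrow> 'r) \<Rightarrow> 'y"
  assumes V: "has_dim V n"
    and \<Psi>: "\<And>D. D \<in> carrier V \<Longrightarrow> \<Psi> D \<in> lmod_hom R \<Omega> Y"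
    and add: "\<And>D E w. \<lbrakk>D \<in> carrier V; E \<in> carrier V; w \<in> carrier \<Omega>\<rbrakk> \<Longrightarrow>
      \<Psi> (D \<oplus>\<^bsub>V\<^esub> E) w = \<Psi> D w \<oplus>\<^bsub>Y\<^esub> \<Psi> E w"
    and smult: "\<And>c D w. \<lbrakk>D \<in> carrier V; w \<in> carrier \<Omega>\<rbrakk> \<Longrightarrow>
      \<Psi> (c \<odot>\<^bsub>V\<^esub> D) w = \<eta> c \<odot>\<^bsub>Y\<^esub> \<Psi> D w"
    and surj: "\<And>\<phi>. \<phi> \<in> lmod_hom R \<Omega> Y \<Longrightarrow>
      \<exists>D\<in>carrier V. \<exists>g\<in>lmod_hom R P0 Y. \<forall>w\<in>carrier \<Omega>. \<phi> w = \<Psi> D w \<oplus>\<^bsub>Y\<^esub> g w"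
  obtains k l where "has_dim (V\<lparr>carrier := {D \<in> carrier V.
        \<exists>g\<in>lmod_hom R P0 Y. \<forall>w\<in>carrier \<Omega>. \<Psi> D w = g w}\<rparr>) k"
    "has_dim (Ext1 R \<eta> X Y) l" "k + l = n"
proof -
  interpret V: vectorspace class_ring V using V by (simp add: has_dim_def)
  let ?H = "hom_space R \<eta> P1 Y"
  let ?Z = "?H\<lparr>carrier := ext1_cocycles R X Y\<rparr>"
  let ?B = "ext1_coboundaries R X Y"
  interpret H: abelian_group ?H
    by (rule abelian_group_hom_space[OF P1.lmodule_axioms Y.lmodule_axioms])
  interpret HO: abelian_group "hom_space R \<eta> \<Omega> Y"
    by (rule abelian_group_hom_space[OF \<Omega>.lmodule_axioms Y.lmodule_axioms])
  interpret HP: abelian_group "hom_space R \<eta> P0 Y"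
    by (rule abelian_group_hom_space[OF P0.lmodule_axioms Y.lmodule_axioms])
  note cD = lmod_homD[where N = Y]
  have ZH: "ext1_cocycles R X Y \<subseteq> carrier ?H" by (auto simp: ext1_cocycles_def Let_def)
  have Zeq: "ext1_cocycles R X Y = cocycle_of ` lmod_hom R \<Omega> Y"
    using cocycle_ex cocycle_of_cocycle by blast
  have cadd: "cocycle_of \<phi> \<oplus>\<^bsub>?H\<^esub> cocycle_of \<psi> = cocycle_of (\<phi> \<oplus>\<^bsub>hom_space R \<eta> \<Omega> Y\<^esub> \<psi>)" for \<phi> \<psi>
    by (auto simp: cocycle_of_def \<Omega>.augmentation_closed)
  have csm: "c \<odot>\<^bsub>?H\<^esub> cocycle_of \<phi> = cocycle_of (c \<odot>\<^bsub>hom_space R \<eta> \<Omega> Y\<^esub> \<phi>)" for c \<phi>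
    by (auto simp: cocycle_of_def \<Omega>.augmentation_closed)
  have czero: "\<zero>\<^bsub>?H\<^esub> = cocycle_of \<zero>\<^bsub>hom_space R \<eta> \<Omega> Y\<^esub>"
    by (auto simp: cocycle_of_def \<Omega>.augmentation_closed)
  \<comment> \<open>Negation is scaling by \<open>-1\<close>, so closure under scalars yields the
    subgroups that are needed to form cosets.\<close>
  have hneg: "\<ominus>\<^bsub>hom_space R \<eta> M Y\<^esub> f = (-1) \<odot>\<^bsub>hom_space R \<eta> M Y\<^esub> f"
    if M: "lmodule R M" and f: "f \<in> lmod_hom R M Y" for M :: "('r, 'z) module" and f
  proof -
    interpret HM: abelian_group "hom_space R \<eta> M Y"
      by (rule abelian_group_hom_space[OF M Y.lmodule_axioms])
    have "(\<lambda>x\<in>carrier M. \<eta> (-1) \<odot>\<^bsub>Y\<^esub> f x) \<in> lmod_hom R M Y"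
      by (rule hom_space_smult_closed[OF M Y.lmodule_axioms f])
    moreover have "\<eta> (-1) \<odot>\<^bsub>Y\<^esub> y \<oplus>\<^bsub>Y\<^esub> y = \<zero>\<^bsub>Y\<^esub>" if "y \<in> carrier Y" for y
    proof -
      have "\<eta> (-1) \<oplus> \<one> = \<zero>" using \<eta>_add[of "-1" 1] by (simp add: \<eta>_zero \<eta>_one)
      then show ?thesis
        using that Y.lsmult_l_distr[of "\<eta> (-1)" \<one> y] by (simp add: Y.lsmult_one)
    qed
    ultimately show ?thesis
      using f by (intro HM.minus_equality) (auto simp: cD[OF f] restrict_def)
  qed
  have Zsub: "abelian_group ?Z"
  proof (rule H.abelian_group_sub[OF ZH])
    show "\<zero>\<^bsub>?H\<^esub> \<in> ext1_cocycles R X Y"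
      unfolding czero Zeq using HO.zero_closed by (simp only: hom_space_simps(1)) (rule imageI)
    show "f \<oplus>\<^bsub>?H\<^esub> g \<in> ext1_cocycles R X Y"
      if "f \<in> ext1_cocycles R X Y" "g \<in> ext1_cocycles R X Y" for f g
      using that HO.a_closed unfolding Zeq by (auto simp only: hom_space_simps(1) cadd)
    show "\<ominus>\<^bsub>?H\<^esub> f \<in> ext1_cocycles R X Y" if f: "f \<in> ext1_cocycles R X Y" for f
    proof -
      have "f \<in> lmod_hom R P1 Y" using f ZH by auto
      then have "\<ominus>\<^bsub>?H\<^esub> f = (-1) \<odot>\<^bsub>?H\<^esub> f" by (rule hneg[OF P1.lmodule_axioms])
      then show ?thesis using f hom_space_smult_closed[OF \<Omega>.lmodule_axioms Y.lmodule_axioms]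
        unfolding Zeq by (auto simp only: csm) (simp only: hom_space_simps imageI)
    qed
  qed
  then interpret Z: abelian_group ?Z .
  \<comment> \<open>The coboundary of \<open>g\<close> is the cocycle of its restriction to the
    syzygy. Coboundaries are thus an image of homomorphisms on \<open>P0\<close>, and their closure
    properties are inherited from there.\<close>
  define b where "b g = cocycle_of (restrict g (carrier \<Omega>))" for g :: "('x \<Rightarrow> 'r) \<Rightarrow> 'y"
  have OP: "w \<in> carrier P0" if "w \<in> carrier \<Omega>" for w using that by (simp add: X.carrier_syzygy)
  have Beq: "?B = b ` lmod_hom R P0 Y"
    unfolding ext1_coboundaries_def Let_def b_def cocycle_of_def
    by (intro image_cong refl restrict_ext) (simp add: \<Omega>.augmentation_closed)
  have BZ: "?B \<subseteq> ext1_cocycles R X Y"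
    unfolding Beq b_def by (auto intro: cocycle_of_cocycle restrict_syzygy_hom)
  have bsm: "c \<odot>\<^bsub>?H\<^esub> b g = b (c \<odot>\<^bsub>hom_space R \<eta> P0 Y\<^esub> g)" for c g
    unfolding b_def csm by (auto simp: OP intro!: arg_cong[of _ _ cocycle_of])
  have Bsm: "c \<odot>\<^bsub>?H\<^esub> f \<in> ?B" if "f \<in> ?B" for c f
  proof -
    obtain g where g: "g \<in> lmod_hom R P0 Y" "f = b g" using \<open>f \<in> ?B\<close> unfolding Beq by blast
    show ?thesis unfolding g(2) bsm Beq
      using hom_space_smult_closed[OF P0.lmodule_axioms Y.lmodule_axioms g(1)]
      by (simp only: hom_space_simps imageI)
  qed
  have Bsub: "abelian_subgroup ?B ?Z"
  proof (rule Z.abelian_subgroup_sub)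
    show "?B \<subseteq> carrier ?Z" using BZ by simp
    have "b \<zero>\<^bsub>hom_space R \<eta> P0 Y\<^esub> = \<zero>\<^bsub>?H\<^esub>"
      unfolding czero b_def by (auto simp: OP intro!: arg_cong[of _ _ cocycle_of])
    then show "\<zero>\<^bsub>?Z\<^esub> \<in> ?B" using HP.zero_closed Beq by (metis hom_space_simps(1) imageI module.update_convs(2) ring.select_convs(1) ring.update_convs(1) partial_object.update_convs(1) ring.surjective)
    show "f \<oplus>\<^bsub>?Z\<^esub> g \<in> ?B" if fgB: "f \<in> ?B" "g \<in> ?B" for f g
    proof -
      obtain f' g' where fg: "f' \<in> lmod_hom R P0 Y" "f = b f'" "g' \<in> lmod_hom R P0 Y" "g = b g'"
        using fgB unfolding Beq by blast
      have "f \<oplus>\<^bsub>?H\<^esub> g = b (f' \<oplus>\<^bsub>hom_space R \<eta> P0 Y\<^esub> g')"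
        unfolding fg b_def cadd by (auto simp: OP intro!: arg_cong[of _ _ cocycle_of])
      moreover have "f' \<oplus>\<^bsub>hom_space R \<eta> P0 Y\<^esub> g' \<in> lmod_hom R P0 Y"
        using HP.a_closed fg by (simp only: hom_space_simps(1))
      ultimately show ?thesis unfolding Beq by simp
    qed
    show "\<ominus>\<^bsub>?Z\<^esub> f \<in> ?B" if f: "f \<in> ?B" for f
    proof -
      have fZ: "f \<in> carrier ?Z" and fH: "f \<in> lmod_hom R P1 Y" using f BZ ZH by auto
      have n: "(-1) \<odot>\<^bsub>?H\<^esub> f \<in> ?B" by (rule Bsm[OF f])
      have "\<ominus>\<^bsub>?Z\<^esub> f = (-1) \<odot>\<^bsub>?H\<^esub> f"
      proof (rule Z.minus_equality[OF _ fZ])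
        show "(-1) \<odot>\<^bsub>?H\<^esub> f \<in> carrier ?Z" using n BZ by auto
        show "((-1) \<odot>\<^bsub>?H\<^esub> f) \<oplus>\<^bsub>?Z\<^esub> f = \<zero>\<^bsub>?Z\<^esub>"
          using hneg[OF P1.lmodule_axioms fH] H.l_neg[of f] fH by simp
      qed
      then show ?thesis using n by simp
    qed
  qed
  then interpret B: abelian_subgroup ?B ?Z .
  define T where "T D = ?B +>\<^bsub>?Z\<^esub> cocycle_of (\<Psi> D)" for D
  have E: "Ext1 R \<eta> X Y = quotient_space ?Z ?B" by (simp add: Ext1_def)
  have \<Psi>Z: "cocycle_of (\<Psi> D) \<in> carrier ?Z" if "D \<in> carrier V" for D
    using cocycle_of_cocycle[OF \<Psi>[OF that]] by simp
  have T\<psi>: "T D = ?B +>\<^bsub>?Z\<^esub> f" if "D \<in> carrier V" "f \<in> carrier ?Z" "g \<in> ?B"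
      "f = g \<oplus>\<^bsub>?Z\<^esub> cocycle_of (\<Psi> D)" for D f g
  proof -
    have "f \<in> ?B +>\<^bsub>?Z\<^esub> cocycle_of (\<Psi> D)" unfolding a_r_coset_def' using that(3,4) by blast
    then show ?thesis unfolding T_def by (rule B.a_repr_independence'[OF _ \<Psi>Z[OF that(1)]])
  qed
  have Tlin: "lin_map V (Ext1 R \<eta> X Y) T"
  proof (rule lin_mapI)
    fix D assume D: "D \<in> carrier V"
    show "T D \<in> carrier (Ext1 R \<eta> X Y)"
      using \<Psi>Z[OF D] by (auto simp: E quotient_space_def T_def A_RCOSETS_def')
    fix E' assume E': "E' \<in> carrier V"
    have "cocycle_of (\<Psi> (D \<oplus>\<^bsub>V\<^esub> E')) = cocycle_of (\<Psi> D) \<oplus>\<^bsub>?Z\<^esub> cocycle_of (\<Psi> E')"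
      by (auto simp: cocycle_of_def \<Omega>.augmentation_closed add D E')
    then show "T (D \<oplus>\<^bsub>V\<^esub> E') = T D \<oplus>\<^bsub>Ext1 R \<eta> X Y\<^esub> T E'"
      using B.a_rcos_sum[OF \<Psi>Z[OF D] \<Psi>Z[OF E']] by (simp add: E quotient_space_def T_def)
  next
    fix c D assume D: "D \<in> carrier V"
    have cD: "c \<odot>\<^bsub>V\<^esub> D \<in> carrier V" using D by (simp add: V.smult_closed)
    have eq: "cocycle_of (\<Psi> (c \<odot>\<^bsub>V\<^esub> D)) = c \<odot>\<^bsub>?H\<^esub> cocycle_of (\<Psi> D)"
      by (auto simp: cocycle_of_def \<Omega>.augmentation_closed smult D)
    \<comment> \<open>Scalar multiplication in \<open>quotient_space\<close> is a union over all
      representatives of the coset, so each of them has to give the same coset.\<close>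
    have "?B +>\<^bsub>?Z\<^esub> (c \<odot>\<^bsub>?Z\<^esub> f) = T (c \<odot>\<^bsub>V\<^esub> D)" if fT: "f \<in> T D" for f
    proof -
      obtain g where g: "g \<in> ?B" "f = g \<oplus>\<^bsub>?Z\<^esub> cocycle_of (\<Psi> D)"
        using fT by (auto simp: T_def a_r_coset_def')
      have gH: "g \<in> lmod_hom R P1 Y" using g(1) BZ ZH by auto
      have dH: "cocycle_of (\<Psi> D) \<in> lmod_hom R P1 Y" using \<Psi>Z[OF D] ZH by auto
      have cf: "c \<odot>\<^bsub>?Z\<^esub> f = c \<odot>\<^bsub>?H\<^esub> g \<oplus>\<^bsub>?Z\<^esub> cocycle_of (\<Psi> (c \<odot>\<^bsub>V\<^esub> D))"
        unfolding eq g(2) by (auto simp: lmod_homD(1)[OF gH] lmod_homD(1)[OF dH] Y.lsmult_r_distr)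
      have "c \<odot>\<^bsub>?Z\<^esub> f \<in> carrier ?Z"
        unfolding cf using Bsm[OF g(1), of c] BZ \<Psi>Z[OF cD] by (intro Z.a_closed) auto
      then show ?thesis using T\<psi>[OF cD _ Bsm[OF g(1)] cf] by simp
    qed
    moreover have "cocycle_of (\<Psi> D) \<in> T D" unfolding T_def by (rule B.a_rcos_self[OF \<Psi>Z[OF D]])
    ultimately show "T (c \<odot>\<^bsub>V\<^esub> D) = c \<odot>\<^bsub>Ext1 R \<eta> X Y\<^esub> T D"
      by (auto simp: E quotient_space_def)
  qed
  have Tsurj: "T ` carrier V = carrier (Ext1 R \<eta> X Y)"
  proof
    show "T ` carrier V \<subseteq> carrier (Ext1 R \<eta> X Y)" using lin_mapD(1)[OF Tlin] by blast
    show "carrier (Ext1 R \<eta> X Y) \<subseteq> T ` carrier V"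
    proof
      fix C assume "C \<in> carrier (Ext1 R \<eta> X Y)"
      then obtain f where f: "f \<in> ext1_cocycles R X Y" "C = ?B +>\<^bsub>?Z\<^esub> f"
        by (auto simp: E quotient_space_def A_RCOSETS_def')
      obtain \<phi> where \<phi>: "\<phi> \<in> lmod_hom R \<Omega> Y" "f = cocycle_of \<phi>" using cocycle_ex[OF f(1)] by blast
      obtain D g where Dg: "D \<in> carrier V" "g \<in> lmod_hom R P0 Y"
        "\<forall>w\<in>carrier \<Omega>. \<phi> w = \<Psi> D w \<oplus>\<^bsub>Y\<^esub> g w"
        using surj[OF \<phi>(1)] by blast
      have "f = b g \<oplus>\<^bsub>?Z\<^esub> cocycle_of (\<Psi> D)"
        unfolding \<phi>(2) b_def using Dg lmod_homD(1)[OF \<Psi>[OF Dg(1)]] lmod_homD(1)[OF Dg(2)]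
        by (auto simp: cocycle_of_def \<Omega>.augmentation_closed OP Y.M.a_comm)
      moreover have "b g \<in> ?B" using Dg(2) by (simp add: Beq)
      ultimately have "T D = C" using T\<psi>[OF Dg(1)] f by simp
      then show "C \<in> T ` carrier V" using Dg(1) by blast
    qed
  qed
  have ker: "T D = ?B \<longleftrightarrow> (\<exists>g\<in>lmod_hom R P0 Y. \<forall>w\<in>carrier \<Omega>. \<Psi> D w = g w)" if D: "D \<in> carrier V" for D
    unfolding coboundary_iff[OF \<Psi>[OF D], symmetric]
    using B.a_rcos_self[OF \<Psi>Z[OF D]] B.a_rcos_const[of "cocycle_of (\<Psi> D)"] by (auto simp: T_def)
  have z0: "\<zero>\<^bsub>Ext1 R \<eta> X Y\<^esub> = ?B" by (simp add: E quotient_space_def)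
  have T0: "T \<zero>\<^bsub>V\<^esub> = \<zero>\<^bsub>Ext1 R \<eta> X Y\<^esub>"
  proof -
    \<comment> \<open>Zero is seen as a multiple by the scalar \<open>0\<close>, so that the
      assumption on scalars shows that \<open>\<Psi>\<close> vanishes there.\<close>
    have z: "\<zero>\<^bsub>V\<^esub> = 0 \<odot>\<^bsub>V\<^esub> \<zero>\<^bsub>V\<^esub>" using V.smult_r_null[of 0] by simp
    have "\<Psi> \<zero>\<^bsub>V\<^esub> w = \<zero>\<^bsub>Y\<^esub>" if "w \<in> carrier \<Omega>" for w
      using smult[OF V.M.zero_closed that, of 0] that lmod_homD(1)[OF \<Psi>[OF V.M.zero_closed] that]
      unfolding z[symmetric] by (simp add: \<eta>_zero)
    moreover have "(\<lambda>x\<in>carrier P0. \<zero>\<^bsub>Y\<^esub>) \<in> lmod_hom R P0 Y" using HP.zero_closed by simp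
    ultimately show ?thesis
      unfolding z0 ker[OF V.M.zero_closed] using OP by (intro bexI) auto
  qed
  obtain k l where "has_dim (V\<lparr>carrier := {D \<in> carrier V. T D = \<zero>\<^bsub>Ext1 R \<eta> X Y\<^esub>}\<rparr>) k"
     "has_dim (Ext1 R \<eta> X Y) l" "k + l = n"
    using has_dim_rank_nullity[OF V Tlin Tsurj, OF T0] by blast
  moreover have "{D \<in> carrier V. T D = \<zero>\<^bsub>Ext1 R \<eta> X Y\<^esub>} =
     {D \<in> carrier V. \<exists>g\<in>lmod_hom R P0 Y. \<forall>w\<in>carrier \<Omega>. \<Psi> D w = g w}"
    using ker by (auto simp: z0)
  ultimately show ?thesis using that by simp
qed

end

section \<open>Matrices and derivations\<close>

text \<open>All matrices are indexed by pairs from one set \<open>U\<close>; smaller ones are padded with zeros.\<close>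

definition mmul :: "'i set \<Rightarrow> ('i \<times> 'i \<Rightarrow> 'k::field) \<Rightarrow> ('i \<times> 'i \<Rightarrow> 'k) \<Rightarrow> 'i \<times> 'i \<Rightarrow> 'k" where
  "mmul U A B = (\<lambda>(i, j). \<Sum>l\<in>U. A (i, l) * B (l, j))"

definition mscale :: "'k::field \<Rightarrow> ('j \<Rightarrow> 'k) \<Rightarrow> 'j \<Rightarrow> 'k" where
  "mscale c A = (\<lambda>p. c * A p)"

text \<open>With zero padding the unit of \<open>mats I I\<close> is the projection onto
  \<open>I\<close>, not the identity matrix of \<open>U\<close>. The same matrices, for smaller
  sets, describe the vertex idempotents.\<close>

definition mdiag :: "'i set \<Rightarrow> 'i \<times> 'i \<Rightarrow> 'k::field" where
  "mdiag I = (\<lambda>(i, j). if i = j \<and> i \<in> I then 1 else 0)"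

definition mtrace :: "'i set \<Rightarrow> ('i \<times> 'i \<Rightarrow> 'k::field) \<Rightarrow> 'k" where
  "mtrace U A = (\<Sum>i\<in>U. A (i, i))"

abbreviation mats :: "'i set \<Rightarrow> 'i set \<Rightarrow> ('i \<times> 'i \<Rightarrow> 'k::field) set" where
  "mats J I \<equiv> carrier (fun_space (J \<times> I))"

lemma mmul_assoc: "mmul U (mmul U A B) C = mmul U A (mmul U B C)"
proof (rule ext, clarify)
  fix i j
  have "(\<Sum>l\<in>U. (\<Sum>k\<in>U. A (i, k) * B (k, l)) * C (l, j)) = (\<Sum>l\<in>U. \<Sum>k\<in>U. A (i, k) * (B (k, l) * C (l, j)))"
    by (simp add: sum_distrib_right mult.assoc)
  also have "\<dots> = (\<Sum>k\<in>U. \<Sum>l\<in>U. A (i, k) * (B (k, l) * C (l, j)))" by (rule sum.swap)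
  finally show "mmul U (mmul U A B) C (i, j) = mmul U A (mmul U B C) (i, j)"
    by (simp add: mmul_def sum_distrib_left)
qed

lemma mmul_distrib:
  "mmul U (A + B) C = mmul U A C + mmul U B C" "mmul U A (B + C) = mmul U A B + mmul U A C"
  "mmul U (A - B) C = mmul U A C - mmul U B C" "mmul U A (B - C) = mmul U A B - mmul U A C"
  "mmul U (- A) C = - mmul U A C" "mmul U A (- C) = - mmul U A C"
  "mmul U 0 C = 0" "mmul U A 0 = 0"
  by (simp_all add: mmul_def fun_eq_iff distrib_left distrib_right left_diff_distrib
      right_diff_distrib sum.distrib sum_subtractf sum_negf)

lemma mmul_mscale:
  "mmul U (mscale c A) B = mscale c (mmul U A B)" "mmul U A (mscale c B) = mscale c (mmul U A B)"
  by (auto simp: mmul_def mscale_def fun_eq_iff sum_distrib_left algebra_simps)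

lemma mscale_simps [simp]:
  "mscale 1 A = A" "mscale 0 A = 0" "mscale c 0 = 0"
  by (auto simp: mscale_def fun_eq_iff)

lemma mscale_distrib:
  "mscale c (A + B) = mscale c A + mscale c B" "mscale c (A - B) = mscale c A - mscale c B"
  "mscale c (- A) = - mscale c A" "mscale c (mscale d A) = mscale (c * d) A"
  by (auto simp: mscale_def fun_eq_iff algebra_simps)

lemma mats_closed:
  "0 \<in> mats J I"
  "\<lbrakk>A \<in> mats J I; B \<in> mats J I\<rbrakk> \<Longrightarrow> A + B \<in> mats J I"
  "\<lbrakk>A \<in> mats J I; B \<in> mats J I\<rbrakk> \<Longrightarrow> A - B \<in> mats J I"
  "A \<in> mats J I \<Longrightarrow> - A \<in> mats J I"
  "A \<in> mats J I \<Longrightarrow> mscale c A \<in> mats J I"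
  "\<lbrakk>A \<in> mats J L; B \<in> mats L' I\<rbrakk> \<Longrightarrow> mmul U A B \<in> mats J I"
  by (auto simp: carrier_fun_space mmul_def mscale_def intro!: sum.neutral)

lemma mmul_mdiag_left:
  assumes "finite U" "A \<in> mats J I" "S \<subseteq> U"
  shows "mmul U (mdiag S) A = (\<lambda>(i, j). if i \<in> S then A (i, j) else 0)"
proof (rule ext, clarify)
  fix i j
  have "mmul U (mdiag S) A (i, j) = (\<Sum>l\<in>U. if l = i then (if i \<in> S then A (i, j) else 0) else 0)"
    unfolding mmul_def mdiag_def by (auto intro!: sum.cong)
  then show "mmul U (mdiag S) A (i, j) = (if i \<in> S then A (i, j) else 0)"
    using assms by auto
qed

lemma mmul_mdiag_right:
  assumes "finite U" "A \<in> mats J I" "S \<subseteq> U"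
  shows "mmul U A (mdiag S) = (\<lambda>(i, j). if j \<in> S then A (i, j) else 0)"
proof (rule ext, clarify)
  fix i j
  have "mmul U A (mdiag S) (i, j) = (\<Sum>l\<in>U. if l = j then (if j \<in> S then A (i, j) else 0) else 0)"
    unfolding mmul_def mdiag_def by (cases "j \<in> S") (auto intro!: sum.cong sum.neutral)
  then show "mmul U A (mdiag S) (i, j) = (if j \<in> S then A (i, j) else 0)"
    using assms by auto
qed

lemma mtrace_mmul: "mtrace U (mmul U A B) = mtrace U (mmul U B A)"
  unfolding mtrace_def mmul_def by (simp, subst sum.swap) (simp add: mult.commute)

lemma mtrace_simps:
  "mtrace U (A + B) = mtrace U A + mtrace U B" "mtrace U (A - B) = mtrace U A - mtrace U B"
  "mtrace U (- A) = - mtrace U A" "mtrace U 0 = 0"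
  by (simp_all add: mtrace_def sum.distrib sum_subtractf sum_negf)

lemma mtrace_nondegenerate:
  assumes "finite U" "I \<subseteq> U" "J \<subseteq> U" "Z \<in> mats I J"
    and tr: "\<And>N. N \<in> mats J I \<Longrightarrow> mtrace U (mmul U Z N) = 0"
  shows "Z = 0"
proof (rule ext, clarify)
  fix i j
  show "Z (i, j) = 0 (i, j)"
  proof (cases "i \<in> I \<and> j \<in> J")
    case True
    \<comment> \<open>The matrix unit at \<open>(j, i)\<close>, whose trace pairing with
      \<open>Z\<close> is the entry \<open>Z (i, j)\<close>.\<close>
    let ?N = "\<lambda>p. if p = (j, i) then 1 else 0 :: 'b"
    have "?N \<in> mats J I" using True by (auto simp: carrier_fun_space)
    then have "mtrace U (mmul U Z ?N) = 0" by (rule tr)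
    moreover have "mmul U Z ?N (l, l) = (if l = i then Z (i, j) else 0)" for l
    proof -
      have "mmul U Z ?N (l, l) = (\<Sum>m\<in>U. if m = j then (if l = i then Z (i, j) else 0) else 0)"
        unfolding mmul_def by (auto intro!: sum.cong)
      then show ?thesis using True assms by auto
    qed
    ultimately show ?thesis using True assms by (auto simp: mtrace_def)
  next
    case False
    then show ?thesis using assms(4) by (auto simp: carrier_fun_space)
  qed
qed

locale mat_rep = k_algebra R \<eta>
  for R :: "('r, 's) ring_scheme" (structure) and \<eta> :: "'k::field \<Rightarrow> 'r" +
  fixes U :: "'i set" and I :: "'i set" and \<rho> :: "'r \<Rightarrow> 'i \<times> 'i \<Rightarrow> 'k"
  assumes fin_U: "finite U" and sub_U: "I \<subseteq> U"
    and rep_closed: "a \<in> carrier R \<Longrightarrow> \<rho> a \<in> mats I I"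
    and rep_add: "\<lbrakk>a \<in> carrier R; b \<in> carrier R\<rbrakk> \<Longrightarrow> \<rho> (a \<oplus> b) = \<rho> a + \<rho> b"
    and rep_mult: "\<lbrakk>a \<in> carrier R; b \<in> carrier R\<rbrakk> \<Longrightarrow> \<rho> (a \<otimes> b) = mmul U (\<rho> a) (\<rho> b)"
    and rep_scalar: "\<rho> (\<eta> c) = mscale c (mdiag I)"
begin

lemma rep_one: "\<rho> \<one> = mdiag I"
  using rep_scalar[of 1] by (simp add: \<eta>_one)

lemma rep_zero: "\<rho> \<zero> = 0"
  using rep_scalar[of 0] by (simp add: \<eta>_zero)

lemma rep_one_left: "A \<in> mats I J \<Longrightarrow> mmul U (\<rho> \<one>) A = A"
  by (subst rep_one, subst mmul_mdiag_left[OF fin_U _ sub_U])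
    (auto simp: carrier_fun_space fun_eq_iff)

lemma rep_one_right: "A \<in> mats J I \<Longrightarrow> mmul U A (\<rho> \<one>) = A"
  by (subst rep_one, subst mmul_mdiag_right[OF fin_U _ sub_U])
    (auto simp: carrier_fun_space fun_eq_iff)

lemma rep_scalar_left: "A \<in> mats I J \<Longrightarrow> mmul U (\<rho> (\<eta> c)) A = mscale c A"
  using rep_one_left[of A J] by (simp add: rep_scalar rep_one mmul_mscale)

lemma rep_scalar_right: "A \<in> mats J I \<Longrightarrow> mmul U A (\<rho> (\<eta> c)) = mscale c A"
  using rep_one_right[of A J] by (simp add: rep_scalar rep_one mmul_mscale)

end

locale mat_reps = X: mat_rep R \<eta> U I \<rho>X + Y: mat_rep R \<eta> U J \<rho>Y
  for R :: "('r, 's) ring_scheme" (structure) and \<eta> :: "'k::field \<Rightarrow> 'r"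
    and U :: "'i set" and I \<rho>X J \<rho>Y
begin

abbreviation mm (infixl "\<star>" 70) where "A \<star> B \<equiv> mmul U A B"

abbreviation "M \<equiv> mats J I"

lemma act_closed [simp]:
  "\<lbrakk>a \<in> carrier R; m \<in> M\<rbrakk> \<Longrightarrow> \<rho>Y a \<star> m \<in> M" "\<lbrakk>a \<in> carrier R; m \<in> M\<rbrakk> \<Longrightarrow> m \<star> \<rho>X a \<in> M"
  using X.rep_closed Y.rep_closed by (auto intro: mats_closed)

lemmas M_closed [simp] = mats_closed(1-5)[where J = J and I = I]

lemmas act_one [simp] = Y.rep_one_left[where J = I] X.rep_one_right[where J = J]
lemmas act_scalar [simp] = Y.rep_scalar_left[where J = I] X.rep_scalar_right[where J = J]

lemma act_mult:
  "\<lbrakk>a \<in> carrier R; b \<in> carrier R\<rbrakk> \<Longrightarrow> \<rho>Y (a \<otimes> b) \<star> m = \<rho>Y a \<star> (\<rho>Y b \<star> m)"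
  "\<lbrakk>a \<in> carrier R; b \<in> carrier R\<rbrakk> \<Longrightarrow> m \<star> \<rho>X (a \<otimes> b) = m \<star> \<rho>X a \<star> \<rho>X b"
  by (simp_all add: X.rep_mult Y.rep_mult mmul_assoc)

text \<open>The square-zero extension of \<open>R\<close> by the bimodule \<open>M\<close>:
  \<open>R\<close> acts from the left through \<open>\<rho>Y\<close> and from the right through
  \<open>\<rho>X\<close>, and elements of \<open>M\<close> multiply to zero.\<close>

definition triv_ext :: "('r \<times> ('i \<times> 'i \<Rightarrow> 'k)) ring" where
  "triv_ext = \<lparr>carrier = carrier R \<times> M,
     mult = (\<lambda>(a, m) (b, n). (a \<otimes> b, \<rho>Y a \<star> n + m \<star> \<rho>X b)), one = (\<one>, 0),
     zero = (\<zero>, 0), add = (\<lambda>(a, m) (b, n). (a \<oplus> b, m + n))\<rparr>"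

lemma triv_ext_simps [simp]:
  "carrier triv_ext = carrier R \<times> M"
  "(a, m) \<otimes>\<^bsub>triv_ext\<^esub> (b, n) = (a \<otimes> b, \<rho>Y a \<star> n + m \<star> \<rho>X b)"
  "\<one>\<^bsub>triv_ext\<^esub> = (\<one>, 0)" "\<zero>\<^bsub>triv_ext\<^esub> = (\<zero>, 0)"
  "(a, m) \<oplus>\<^bsub>triv_ext\<^esub> (b, n) = (a \<oplus> b, m + n)"
  by (simp_all add: triv_ext_def)

lemma ring_triv_ext: "ring triv_ext"
proof (rule ringI)
  show "abelian_group triv_ext"
  proof (rule abelian_groupI)
    show "\<exists>y\<in>carrier triv_ext. y \<oplus>\<^bsub>triv_ext\<^esub> x = \<zero>\<^bsub>triv_ext\<^esub>" if "x \<in> carrier triv_ext" for x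
      using that by (intro bexI[of _ "(\<ominus> fst x, - snd x)"]) (auto simp: X.R.l_neg)
  qed (auto simp: X.R.a_ac add_ac)
  show "Group.monoid triv_ext"
  proof (rule monoidI)
    fix x y z
    assume "x \<in> carrier triv_ext" "y \<in> carrier triv_ext" "z \<in> carrier triv_ext"
    then show "x \<otimes>\<^bsub>triv_ext\<^esub> y \<otimes>\<^bsub>triv_ext\<^esub> z = x \<otimes>\<^bsub>triv_ext\<^esub> (y \<otimes>\<^bsub>triv_ext\<^esub> z)"
      by (cases x; cases y; cases z)
        (simp add: X.R.m_assoc X.rep_mult Y.rep_mult mmul_distrib mmul_assoc add.assoc)
  qed (auto simp: mmul_distrib)
next
  fix x y z
  assume "x \<in> carrier triv_ext" "y \<in> carrier triv_ext" "z \<in> carrier triv_ext"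
  then show "(x \<oplus>\<^bsub>triv_ext\<^esub> y) \<otimes>\<^bsub>triv_ext\<^esub> z = x \<otimes>\<^bsub>triv_ext\<^esub> z \<oplus>\<^bsub>triv_ext\<^esub> y \<otimes>\<^bsub>triv_ext\<^esub> z"
    "z \<otimes>\<^bsub>triv_ext\<^esub> (x \<oplus>\<^bsub>triv_ext\<^esub> y) = z \<otimes>\<^bsub>triv_ext\<^esub> x \<oplus>\<^bsub>triv_ext\<^esub> z \<otimes>\<^bsub>triv_ext\<^esub> y"
    by (cases x; cases y; cases z;
        simp add: X.R.l_distr X.R.r_distr X.rep_add Y.rep_add mmul_distrib add_ac)+
qed

lemma triv_ext_scalar:
  "(\<lambda>c. (\<eta> c, 0)) \<in> Ring.ring_hom class_ring triv_ext"
  "x \<in> carrier triv_ext \<Longrightarrow> (\<eta> c, 0) \<otimes>\<^bsub>triv_ext\<^esub> x = x \<otimes>\<^bsub>triv_ext\<^esub> (\<eta> c, 0)"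
proof -
  show "(\<lambda>c. (\<eta> c, 0)) \<in> Ring.ring_hom class_ring triv_ext"
    by (rule ring_hom_memI) (simp_all add: X.\<eta>_add X.\<eta>_mult X.\<eta>_one mmul_distrib)
  show "(\<eta> c, 0) \<otimes>\<^bsub>triv_ext\<^esub> x = x \<otimes>\<^bsub>triv_ext\<^esub> (\<eta> c, 0)" if "x \<in> carrier triv_ext"
    using that X.\<eta>_central[of "fst x" c]
    by (cases x) (simp add: mmul_distrib)
qed

text \<open>The second component of the inverse is forced by the product being
  \<open>(\<one>, 0)\<close>; it is the formula of \<open>derivation_inv\<close>.\<close>

lemma triv_ext_unit:
  assumes a: "a \<in> Units R" and m: "m \<in> M"
  shows "(a, m) \<in> Units triv_ext"
    "inv\<^bsub>triv_ext\<^esub> (a, m) = (inv a, - (\<rho>Y (inv a) \<star> m \<star> \<rho>X (inv a)))"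
proof -
  interpret T: ring triv_ext by (rule ring_triv_ext)
  have ac: "a \<in> carrier R" "inv a \<in> carrier R" using a by auto
  let ?b = "(inv a, - (\<rho>Y (inv a) \<star> m \<star> \<rho>X (inv a)))"
  have 1: "(a, m) \<in> carrier triv_ext" "?b \<in> carrier triv_ext"
    using ac m by auto
  have "\<rho>Y a \<star> (\<rho>Y (inv a) \<star> m \<star> \<rho>X (inv a)) = m \<star> \<rho>X (inv a)"
    using a ac m by (simp add: mmul_assoc act_mult(1)[symmetric])
  moreover have "\<rho>Y (inv a) \<star> m \<star> \<rho>X (inv a) \<star> \<rho>X a = \<rho>Y (inv a) \<star> m"
    using a ac m by (simp add: act_mult(2)[symmetric])
  ultimately have 2: "(a, m) \<otimes>\<^bsub>triv_ext\<^esub> ?b = \<one>\<^bsub>triv_ext\<^esub>" "?b \<otimes>\<^bsub>triv_ext\<^esub> (a, m) = \<one>\<^bsub>triv_ext\<^esub>"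
    using a ac by (auto simp: mmul_distrib)
  show "(a, m) \<in> Units triv_ext" using 1 2 unfolding Units_def by blast
  show "inv\<^bsub>triv_ext\<^esub> (a, m) = ?b" by (rule T.inv_char[OF 1 2])
qed

text \<open>Together with the product rule, the vanishing on scalars expresses linearity over
  \<open>K\<close>.\<close>

definition derivation :: "('r \<Rightarrow> 'i \<times> 'i \<Rightarrow> 'k) \<Rightarrow> bool" where
  "derivation \<delta> \<longleftrightarrow> (\<forall>a\<in>carrier R. \<delta> a \<in> M) \<and>
     (\<forall>a\<in>carrier R. \<forall>b\<in>carrier R. \<delta> (a \<oplus> b) = \<delta> a + \<delta> b) \<and>
     (\<forall>a\<in>carrier R. \<forall>b\<in>carrier R. \<delta> (a \<otimes> b) = \<rho>Y a \<star> \<delta> b + \<delta> a \<star> \<rho>X b) \<and> (\<forall>c. \<delta> (\<eta> c) = 0)"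

lemma derivationD:
  assumes "derivation \<delta>"
  shows "a \<in> carrier R \<Longrightarrow> \<delta> a \<in> M"
    "\<lbrakk>a \<in> carrier R; b \<in> carrier R\<rbrakk> \<Longrightarrow> \<delta> (a \<oplus> b) = \<delta> a + \<delta> b"
    "\<lbrakk>a \<in> carrier R; b \<in> carrier R\<rbrakk> \<Longrightarrow> \<delta> (a \<otimes> b) = \<rho>Y a \<star> \<delta> b + \<delta> a \<star> \<rho>X b"
    "\<delta> (\<eta> c) = 0" "\<delta> \<one> = 0" "\<delta> \<zero> = 0"
  using assms X.\<eta>_one X.\<eta>_zero unfolding derivation_def by metis+

text \<open>Differentiate \<open>inv a \<otimes> a = \<one>\<close> and multiply by
  \<open>\<rho>X (inv a)\<close> from the right.\<close>

lemma derivation_inv: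
  assumes \<delta>: "derivation \<delta>" and a: "a \<in> Units R"
  shows "\<delta> (inv a) = - (\<rho>Y (inv a) \<star> \<delta> a \<star> \<rho>X (inv a))"
proof -
  note D = derivationD[OF \<delta>]
  have ac: "a \<in> carrier R" "inv a \<in> carrier R" using a by auto
  have "\<rho>Y (inv a) \<star> \<delta> a + \<delta> (inv a) \<star> \<rho>X a = 0"
    using D(3)[of "inv a" a] D(5) a ac by simp
  then have "(\<rho>Y (inv a) \<star> \<delta> a + \<delta> (inv a) \<star> \<rho>X a) \<star> \<rho>X (inv a) = 0"
    by (simp add: mmul_distrib)
  moreover have "\<delta> (inv a) \<star> \<rho>X a \<star> \<rho>X (inv a) = \<delta> (inv a)"
    using a ac D(1) by (simp add: act_mult(2)[symmetric])
  ultimately show ?thesis by (simp add: mmul_distrib eq_neg_iff_add_eq_0 add.commute)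
qed

definition inner_der :: "('i \<times> 'i \<Rightarrow> 'k) \<Rightarrow> 'r \<Rightarrow> 'i \<times> 'i \<Rightarrow> 'k" where
  "inner_der m a = \<rho>Y a \<star> m - m \<star> \<rho>X a"

lemma derivation_inner: "m \<in> M \<Longrightarrow> derivation (inner_der m)"
  by (auto simp: derivation_def inner_der_def X.rep_add Y.rep_add X.rep_mult Y.rep_mult
      mmul_distrib mmul_assoc)

lemma derivation_diff: "\<lbrakk>derivation \<delta>; derivation \<delta>'\<rbrakk> \<Longrightarrow> derivation (\<lambda>a. \<delta> a - \<delta>' a)"
  by (auto simp: derivation_def mmul_distrib)

lemma derivation_add: "\<lbrakk>derivation \<delta>; derivation \<delta>'\<rbrakk> \<Longrightarrow> derivation (\<lambda>a. \<delta> a + \<delta>' a)"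
  by (auto simp: derivation_def mmul_distrib)

lemma derivation_scale: "derivation \<delta> \<Longrightarrow> derivation (\<lambda>a. mscale c (\<delta> a))"
  by (auto simp: derivation_def mmul_mscale mscale_distrib)

end

section \<open>The defining relation and the trace pairing\<close>

lemma star_star [simp]: "star (star a) = a"
  by (cases a) auto

lemma double_simps [simp]:
  "verts (double Q) = verts Q" "star a \<in> arcs (double Q) \<longleftrightarrow> a \<in> arcs (double Q)"
  "head (double Q) (star a) = tail (double Q) a" "tail (double Q) (star a) = head (double Q) a"
  "Orig b \<in> arcs (double Q) \<longleftrightarrow> b \<in> arcs Q" "Rev b \<in> arcs (double Q) \<longleftrightarrow> b \<in> arcs Q"
  by (cases a; auto simp: double_def)+

lemma double_verts:
  assumes "fin_digraph Q" "a \<in> arcs (double Q)"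
  shows "head (double Q) a \<in> verts Q" "tail (double Q) a \<in> verts Q"
proof -
  interpret D: fin_digraph "double Q" by (rule double_fin_digraph[OF assms(1)])
  show "head (double Q) a \<in> verts Q" "tail (double Q) a \<in> verts Q"
    using D.head_in_verts[OF assms(2)] D.tail_in_verts[OF assms(2)] by simp_all
qed

lemma sum_arcs_double:
  assumes "fin_digraph Q"
  shows "(\<Sum>b\<in>arcs (double Q). f b) = (\<Sum>a\<in>arcs Q. f (Orig a) + f (Rev a))"
proof -
  interpret fin_digraph Q by fact
  have "(\<Sum>b\<in>arcs (double Q). f b) = (\<Sum>b\<in>Orig ` arcs Q. f b) + (\<Sum>b\<in>Rev ` arcs Q. f b)"
    unfolding double_def by (simp, rule sum.union_disjoint) auto
  then show ?thesis by (simp add: sum.reindex inj_on_def sum.distrib)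
qed

text \<open>Collects what the matrix computations use of the algebra: orthogonal idempotents,
  arrows, the relation with an invertible right-hand side that commutes with the idempotents, and
  the induction principle \<open>generated\<close>, which includes inverses of units because some
  are adjoined to the path algebra. The universal property is kept apart; it enters in
  \<open>derivation_ex\<close>.\<close>

locale quiver_algebra = k_algebra R \<eta>
  for R :: "('r, 's) ring_scheme" (structure) and \<eta> :: "'k::field \<Rightarrow> 'r" +
  fixes Q :: "('v, 'e) pre_digraph" and e :: "'v \<Rightarrow> 'r" and ar :: "'e darrow \<Rightarrow> 'r"
    and L :: "'e darrow list" and qe qi :: 'r
  assumes fin_Q: "fin_digraph Q"
    and L: "set L = arcs (double Q)" "distinct L"
    and e_closed [simp]: "v \<in> verts Q \<Longrightarrow> e v \<in> carrier R"
    and ar_closed [simp]: "a \<in> arcs (double Q) \<Longrightarrow> ar a \<in> carrier R"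
    and e_mult: "\<lbrakk>v \<in> verts Q; w \<in> verts Q\<rbrakk> \<Longrightarrow> e v \<otimes> e w = (if v = w then e v else \<zero>)"
    and e_head: "a \<in> arcs (double Q) \<Longrightarrow> e (head (double Q) a) \<otimes> ar a = ar a"
    and e_tail: "a \<in> arcs (double Q) \<Longrightarrow> ar a \<otimes> e (tail (double Q) a) = ar a"
    and unit: "a \<in> arcs (double Q) \<Longrightarrow> \<one> \<oplus> ar a \<otimes> ar (star a) \<in> Units R"
    and rel: "foldr (\<lambda>a z. (case a of Orig _ \<Rightarrow> \<one> \<oplus> ar a \<otimes> ar (star a)
        | Rev _ \<Rightarrow> inv (\<one> \<oplus> ar a \<otimes> ar (star a))) \<otimes> z) L \<one> = qe"
    and q_closed [simp]: "qe \<in> carrier R" "qi \<in> carrier R"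
    and q_inv: "qe \<otimes> qi = \<one>" "qi \<otimes> qe = \<one>"
    and q_comm: "v \<in> verts Q \<Longrightarrow> qe \<otimes> e v = e v \<otimes> qe"
    and generated: "\<And>P a. \<lbrakk>a \<in> carrier R; \<And>c. P (\<eta> c); \<And>v. v \<in> verts Q \<Longrightarrow> P (e v);
        \<And>a. a \<in> arcs (double Q) \<Longrightarrow> P (ar a);
        \<And>a b. \<lbrakk>a \<in> carrier R; b \<in> carrier R; P a; P b\<rbrakk> \<Longrightarrow> P (a \<oplus> b);
        \<And>a b. \<lbrakk>a \<in> carrier R; b \<in> carrier R; P a; P b\<rbrakk> \<Longrightarrow> P (a \<otimes> b);
        \<And>a. \<lbrakk>a \<in> Units R; P a\<rbrakk> \<Longrightarrow> P (inv a)\<rbrakk> \<Longrightarrow> P a"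
begin

abbreviation "hd' \<equiv> head (double Q)"
abbreviation "tl' \<equiv> tail (double Q)"
abbreviation "arrows \<equiv> arcs (double Q)"

lemmas hd_tl [simp] = double_verts[OF fin_Q]

definition opl :: "'e darrow \<Rightarrow> 'r" where "opl a = \<one> \<oplus> ar a \<otimes> ar (star a)"

definition fac :: "'e darrow \<Rightarrow> 'r" where
  "fac a = (case a of Orig _ \<Rightarrow> opl a | Rev _ \<Rightarrow> inv (opl a))"

definition fprod :: "'e darrow list \<Rightarrow> 'r" where "fprod as = foldr (\<lambda>a z. fac a \<otimes> z) as \<one>"

lemma fprod_simps [simp]: "fprod [] = \<one>" "fprod (a # as) = fac a \<otimes> fprod as"
  by (simp_all add: fprod_def)

lemma fprod_L: "fprod L = qe"
  using rel unfolding fprod_def fac_def opl_def .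

lemma opl_unit: "a \<in> arrows \<Longrightarrow> opl a \<in> Units R"
  using unit by (simp add: opl_def)

lemma opl_closed [simp]: "a \<in> arrows \<Longrightarrow> opl a \<in> carrier R" "a \<in> arrows \<Longrightarrow> inv (opl a) \<in> carrier R"
  using opl_unit by auto

lemma fac_unit: "a \<in> arrows \<Longrightarrow> fac a \<in> Units R"
  by (auto simp: fac_def opl_unit split: darrow.split)

lemma fac_closed [simp]: "a \<in> arrows \<Longrightarrow> fac a \<in> carrier R"
  using fac_unit by auto

lemma fprod_closed [simp]: "set as \<subseteq> arrows \<Longrightarrow> fprod as \<in> carrier R"
  by (induction as) auto

lemma fprod_unit: "set as \<subseteq> arrows \<Longrightarrow> fprod as \<in> Units R"
  by (induction as) (auto simp: fac_unit)

lemma fprod_append: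
  "\<lbrakk>set as \<subseteq> arrows; set bs \<subseteq> arrows\<rbrakk> \<Longrightarrow> fprod (as @ bs) = fprod as \<otimes> fprod bs"
  by (induction as) (auto simp: m_assoc)

lemma e_ar:
  assumes "v \<in> verts Q" "a \<in> arrows"
  shows "e v \<otimes> ar a = (if v = hd' a then ar a else \<zero>)" "ar a \<otimes> e v = (if v = tl' a then ar a else \<zero>)"
proof -
  have "e v \<otimes> ar a = e v \<otimes> e (hd' a) \<otimes> ar a" using assms e_head by (simp add: m_assoc)
  then show "e v \<otimes> ar a = (if v = hd' a then ar a else \<zero>)" using assms by (simp add: e_mult e_head)
  have "ar a \<otimes> e v = ar a \<otimes> (e (tl' a) \<otimes> e v)" using assms e_tail by (simp add: m_assoc[symmetric])
  then show "ar a \<otimes> e v = (if v = tl' a then ar a else \<zero>)" using assms by (auto simp: e_mult e_tail)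
qed

lemma conj_inv:
  assumes "u \<in> Units R" "w \<in> Units R" "x \<in> carrier R" "u \<otimes> x = x \<otimes> w"
  shows "inv u \<otimes> x = x \<otimes> inv w"
proof -
  have "u \<in> carrier R" "w \<in> carrier R" using assms by auto
  then have "inv u \<otimes> (u \<otimes> x) \<otimes> inv w = x \<otimes> inv w" using assms(1-3) by (simp add: m_assoc[symmetric])
  moreover have "inv u \<otimes> (x \<otimes> w) \<otimes> inv w = inv u \<otimes> x"
    using assms(1-3) \<open>w \<in> carrier R\<close> by (simp add: m_assoc)
  ultimately show ?thesis using assms(4) by simp
qed

lemma fac_e: "\<lbrakk>v \<in> verts Q; a \<in> arrows\<rbrakk> \<Longrightarrow> fac a \<otimes> e v = e v \<otimes> fac a"
proof -
  assume va: "v \<in> verts Q" "a \<in> arrows"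
  have "ar a \<otimes> ar (star a) \<otimes> e v = e v \<otimes> (ar a \<otimes> ar (star a))"
    using va by (simp add: m_assoc e_ar) (simp add: m_assoc[symmetric] e_ar)
  then have "opl a \<otimes> e v = e v \<otimes> opl a"
    using va by (simp add: opl_def l_distr r_distr)
  then show "fac a \<otimes> e v = e v \<otimes> fac a"
    using va conj_inv[OF opl_unit opl_unit] by (auto simp: fac_def split: darrow.split)
qed

lemma fprod_e: "\<lbrakk>v \<in> verts Q; set as \<subseteq> arrows\<rbrakk> \<Longrightarrow> fprod as \<otimes> e v = e v \<otimes> fprod as"
proof (induction as)
  case (Cons a as)
  then have "fac a \<otimes> fprod as \<otimes> e v = fac a \<otimes> e v \<otimes> fprod as" by (simp add: m_assoc)
  then show ?case using Cons.prems by (simp add: fac_e m_assoc)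
qed simp

text \<open>With \<open>s = star a\<close>, both \<open>opl s \<otimes> ar s\<close> and
  \<open>ar s \<otimes> opl a\<close> expand to
  \<open>ar s \<oplus> ar s \<otimes> ar a \<otimes> ar s\<close>; \<open>conj_inv\<close> passes to
  the inverses. This is how inverses are moved across arrows when homomorphisms are compared with
  the coefficients \<open>Z\<close>.\<close>

lemma ar_inv_opl:
  assumes a: "a \<in> arrows"
  shows "ar (star a) \<otimes> inv (opl a) = inv (opl (star a)) \<otimes> ar (star a)"
proof -
  have "opl (star a) \<otimes> ar (star a) = ar (star a) \<otimes> opl a"
    using a by (simp add: opl_def l_distr r_distr m_assoc)
  then show ?thesis using conj_inv[of "opl (star a)" "opl a" "ar (star a)"] a opl_unit by simp
qed

end

section \<open>Two representations in coordinates adapted to the vertices, and the linearised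
  relation\<close>

locale quiver_reps = quiver_algebra R \<eta> Q e ar L qe qi + mat_reps R \<eta> U I \<rho>X J \<rho>Y
  for R :: "('r, 's) ring_scheme" (structure) and \<eta> :: "'k::field \<Rightarrow> 'r"
    and Q :: "('v, 'e) pre_digraph" and e ar L qe qi
    and U :: "'i set" and I \<rho>X J \<rho>Y +
  fixes vtx :: "'i \<Rightarrow> 'v"
  assumes repX_e: "v \<in> verts Q \<Longrightarrow> \<rho>X (e v) = mdiag {i \<in> I. vtx i = v}"
    and repY_e: "v \<in> verts Q \<Longrightarrow> \<rho>Y (e v) = mdiag {i \<in> J. vtx i = v}"
    and vtx: "i \<in> I \<Longrightarrow> vtx i \<in> verts Q" "i \<in> J \<Longrightarrow> vtx i \<in> verts Q"
begin

text \<open>\<open>C0\<close> and \<open>C1\<close> are the direct sums of \<open>Hom(X\<^sub>v, Y\<^sub>v)\<close> over the vertices and of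
  \<open>Hom(X\<^sub>t\<^sub>(\<^sub>a\<^sub>), Y\<^sub>h\<^sub>(\<^sub>a\<^sub>))\<close> over the arrows \<open>a\<close> of the double.\<close>

definition "S0 = {(y, x). y \<in> J \<and> x \<in> I \<and> vtx y = vtx x}"
definition "S1 = {(a, y, x). a \<in> arrows \<and> y \<in> J \<and> x \<in> I \<and> vtx y = hd' a \<and> vtx x = tl' a}"

abbreviation "C0 \<equiv> carrier (fun_space S0) :: ('i \<times> 'i \<Rightarrow> 'k) set"
abbreviation "C1 \<equiv> carrier (fun_space S1) :: ('e darrow \<times> 'i \<times> 'i \<Rightarrow> 'k) set"

lemma e_act:
  assumes "v \<in> verts Q" "m \<in> M"
  shows "\<rho>Y (e v) \<star> m = (\<lambda>(y, x). if y \<in> J \<and> vtx y = v then m (y, x) else 0)"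
    "m \<star> \<rho>X (e v) = (\<lambda>(y, x). if x \<in> I \<and> vtx x = v then m (y, x) else 0)"
  unfolding repX_e[OF assms(1)] repY_e[OF assms(1)]
  using X.sub_U Y.sub_U
  by (subst mmul_mdiag_left[OF X.fin_U assms(2)], auto,
      subst mmul_mdiag_right[OF X.fin_U assms(2)], auto)

lemma C0_M: "m \<in> C0 \<Longrightarrow> m \<in> M"
  by (auto simp: carrier_fun_space S0_def)

text \<open>Compare the entries at \<open>(y, x)\<close> for \<open>v = vtx y\<close>: on the left
  stands the entry itself, on the right the entry if \<open>vtx x = vtx y\<close> and zero
  otherwise.\<close>

lemma C0_iff:
  assumes m: "m \<in> M"
  shows "m \<in> C0 \<longleftrightarrow> (\<forall>v\<in>verts Q. \<rho>Y (e v) \<star> m = m \<star> \<rho>X (e v))"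
proof
  show "\<forall>v\<in>verts Q. \<rho>Y (e v) \<star> m = m \<star> \<rho>X (e v)" if "m \<in> C0"
  proof -
    have "m (y, x) = 0" if "\<not> (y \<in> J \<and> x \<in> I \<and> vtx y = vtx x)" for y x
      using \<open>m \<in> C0\<close> that by (auto simp: carrier_fun_space S0_def)
    then show ?thesis by (auto simp: e_act[OF _ m] fun_eq_iff)
  qed
  assume c: "\<forall>v\<in>verts Q. \<rho>Y (e v) \<star> m = m \<star> \<rho>X (e v)"
  have "m (y, x) = 0" if "\<not> (y \<in> J \<and> x \<in> I \<and> vtx y = vtx x)" for y x
  proof (cases "y \<in> J \<and> x \<in> I")
    case True
    then have "vtx y \<in> verts Q" using vtx by simp
    then have "(\<rho>Y (e (vtx y)) \<star> m) (y, x) = (m \<star> \<rho>X (e (vtx y))) (y, x)" using c by simp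
    then show ?thesis using True that \<open>vtx y \<in> verts Q\<close> by (auto simp: e_act m split: if_splits)
  next
    case False
    then show ?thesis using m by (auto simp: carrier_fun_space)
  qed
  then show "m \<in> C0" by (auto simp: carrier_fun_space S0_def)
qed

definition blk :: "('e darrow \<times> 'i \<times> 'i \<Rightarrow> 'k) \<Rightarrow> 'e darrow \<Rightarrow> 'i \<times> 'i \<Rightarrow> 'k" where
  "blk D a = (\<lambda>p. D (a, p))"

lemma blk_closed: "D \<in> C1 \<Longrightarrow> blk D a \<in> M"
  by (auto simp: blk_def carrier_fun_space S1_def)

lemma blk_lin: "blk (D + E) a = blk D a + blk E a" "blk (\<lambda>i. c * D i) a = mscale c (blk D a)"
  by (auto simp: blk_def mscale_def)

lemma C1_iff:
  assumes "\<And>a. blk D a \<in> M" "\<And>a. a \<notin> arrows \<Longrightarrow> blk D a = 0"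
    and "\<And>a. a \<in> arrows \<Longrightarrow> \<rho>Y (e (hd' a)) \<star> blk D a = blk D a \<and> blk D a \<star> \<rho>X (e (tl' a)) = blk D a"
  shows "D \<in> C1"
proof -
  have "D (a, y, x) = 0" if n: "\<not> (a \<in> arrows \<and> y \<in> J \<and> x \<in> I \<and> vtx y = hd' a \<and> vtx x = tl' a)" for a y x
  proof (cases "a \<in> arrows")
    case True
    have "blk D a (y, x) = (\<rho>Y (e (hd' a)) \<star> blk D a) (y, x)" "blk D a (y, x) = (blk D a \<star> \<rho>X (e (tl' a))) (y, x)"
      using assms(3)[OF True] by simp_all
    then have "blk D a (y, x) = 0" using n True by (auto simp: e_act assms(1) split: if_splits)
    then show ?thesis by (simp add: blk_def)
  next
    case False
    then show ?thesis using assms(2)[OF False] by (auto simp: blk_def fun_eq_iff)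
  qed
  then show ?thesis by (auto simp: carrier_fun_space S1_def)
qed

lemma blk_e:
  assumes D: "D \<in> C1" and "v \<in> verts Q" "a \<in> arrows"
  shows "\<rho>Y (e v) \<star> blk D a = (if v = hd' a then blk D a else 0)"
    "blk D a \<star> \<rho>X (e v) = (if v = tl' a then blk D a else 0)"
  unfolding e_act[OF assms(2) blk_closed[OF D]]
  using D by (auto simp: blk_def carrier_fun_space S1_def fun_eq_iff)

text \<open>\<open>dopl D a\<close>, \<open>dfac D a\<close> and \<open>dprod D as\<close> are the values on \<open>opl a\<close>, \<open>fac a\<close> and \<open>fprod as\<close> of a
  derivation that kills the \<open>e v\<close> and takes the arrows to the blocks of \<open>D\<close>.\<close>

definition dopl :: "('e darrow \<times> 'i \<times> 'i \<Rightarrow> 'k) \<Rightarrow> 'e darrow \<Rightarrow> 'i \<times> 'i \<Rightarrow> 'k" where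
  "dopl D a = \<rho>Y (ar a) \<star> blk D (star a) + blk D a \<star> \<rho>X (ar (star a))"

definition dfac :: "('e darrow \<times> 'i \<times> 'i \<Rightarrow> 'k) \<Rightarrow> 'e darrow \<Rightarrow> 'i \<times> 'i \<Rightarrow> 'k" where
  "dfac D a = (case a of Orig _ \<Rightarrow> dopl D a
     | Rev _ \<Rightarrow> - (\<rho>Y (inv (opl a)) \<star> dopl D a \<star> \<rho>X (inv (opl a))))"

fun dprod :: "('e darrow \<times> 'i \<times> 'i \<Rightarrow> 'k) \<Rightarrow> 'e darrow list \<Rightarrow> 'i \<times> 'i \<Rightarrow> 'k" where
  "dprod D [] = 0"
| "dprod D (a # as) = \<rho>Y (fac a) \<star> dprod D as + dfac D a \<star> \<rho>X (fprod as)"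

lemma dopl_closed [simp]: "\<lbrakk>D \<in> C1; a \<in> arrows\<rbrakk> \<Longrightarrow> dopl D a \<in> M"
  by (simp add: dopl_def blk_closed)

lemma dfac_closed [simp]: "\<lbrakk>D \<in> C1; a \<in> arrows\<rbrakk> \<Longrightarrow> dfac D a \<in> M"
  by (auto simp: dfac_def split: darrow.split)

lemma dprod_closed [simp]: "\<lbrakk>D \<in> C1; set as \<subseteq> arrows\<rbrakk> \<Longrightarrow> dprod D as \<in> M"
  by (induction as) auto

lemma dprod_lin:
  "dprod (D + E) as = dprod D as + dprod E as"
  "dprod (\<lambda>i. c * D i) as = mscale c (dprod D as)"
proof -
  have o: "dopl (D + E) a = dopl D a + dopl E a" "dopl (\<lambda>i. c * D i) a = mscale c (dopl D a)" for a
    by (simp_all add: dopl_def blk_lin mmul_distrib mmul_mscale mscale_distrib)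
  have f: "dfac (D + E) a = dfac D a + dfac E a" "dfac (\<lambda>i. c * D i) a = mscale c (dfac D a)" for a
    by (auto simp: dfac_def o mmul_distrib mmul_mscale mscale_distrib split: darrow.split)
  show "dprod (D + E) as = dprod D as + dprod E as"
    by (induction as) (simp, simp only: dprod.simps f mmul_distrib add_ac)
  show "dprod (\<lambda>i. c * D i) as = mscale c (dprod D as)"
    by (induction as) (simp_all only: dprod.simps f mmul_mscale mscale_distrib mscale_simps)
qed

text \<open>Both terms of \<open>dopl D a\<close> go along \<open>star a\<close> and return along
  \<open>a\<close>, one of the two steps being a block of \<open>D\<close>. They start and end at
  the head of \<open>a\<close> and so commute with the \<open>e v\<close>, as do the other factors
  of the product.\<close>

lemma dprod_C0:
  assumes D: "D \<in> C1" and as: "set as \<subseteq> arrows"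
  shows "dprod D as \<in> C0"
proof -
  have comm: "\<rho>Y (e v) \<star> (\<rho>Y u \<star> m) = \<rho>Y u \<star> (\<rho>Y (e v) \<star> m)"
      "m \<star> \<rho>X u \<star> \<rho>X (e v) = m \<star> \<rho>X (e v) \<star> \<rho>X u"
    if "u \<in> carrier R" "u \<otimes> e v = e v \<otimes> u" "v \<in> verts Q" for u v m
    using that by (simp_all add: act_mult[symmetric])
  have o: "\<rho>Y (e v) \<star> dopl D a = dopl D a \<star> \<rho>X (e v)" if v: "v \<in> verts Q" and a: "a \<in> arrows" for v a
  proof -
    have "\<rho>Y (e v) \<star> (\<rho>Y (ar a) \<star> blk D (star a)) = (\<rho>Y (ar a) \<star> blk D (star a)) \<star> \<rho>X (e v)"
      using v a by (simp add: act_mult(1)[symmetric] mmul_assoc blk_e[OF D] e_ar X.rep_zero Y.rep_zero mmul_distrib)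
    moreover have "\<rho>Y (e v) \<star> (blk D a \<star> \<rho>X (ar (star a))) = blk D a \<star> \<rho>X (ar (star a)) \<star> \<rho>X (e v)"
      using v a by (simp add: act_mult(2)[symmetric] mmul_assoc[symmetric] blk_e[OF D] e_ar X.rep_zero Y.rep_zero mmul_distrib)
    ultimately show ?thesis by (simp add: dopl_def mmul_distrib)
  qed
  have f: "\<rho>Y (e v) \<star> dfac D a = dfac D a \<star> \<rho>X (e v)" if v: "v \<in> verts Q" and a: "a \<in> arrows" for v a
  proof (cases a)
    case (Rev b)
    have i: "inv (opl a) \<otimes> e v = e v \<otimes> inv (opl a)" using fac_e[OF v a] Rev by (simp add: fac_def)
    have "\<rho>Y (e v) \<star> (\<rho>Y (inv (opl a)) \<star> dopl D a \<star> \<rho>X (inv (opl a))) =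
       \<rho>Y (inv (opl a)) \<star> (\<rho>Y (e v) \<star> dopl D a) \<star> \<rho>X (inv (opl a))"
      using comm(1)[OF _ i v] a by (simp add: mmul_assoc)
    also have "\<dots> = \<rho>Y (inv (opl a)) \<star> dopl D a \<star> \<rho>X (inv (opl a)) \<star> \<rho>X (e v)"
      using comm(2)[OF _ i v] a by (simp add: o[OF v a] mmul_assoc)
    finally show ?thesis by (simp add: dfac_def Rev mmul_distrib)
  qed (use o[OF v a] in \<open>simp add: dfac_def\<close>)
  have "\<rho>Y (e v) \<star> dprod D as = dprod D as \<star> \<rho>X (e v)" if v: "v \<in> verts Q" for v
    using as
  proof (induction as)
    case (Cons a as)
    have "\<rho>Y (e v) \<star> (\<rho>Y (fac a) \<star> dprod D as) = \<rho>Y (fac a) \<star> dprod D as \<star> \<rho>X (e v)"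
      using Cons comm(1)[OF _ fac_e[OF v]] v by (simp add: mmul_assoc)
    moreover have "\<rho>Y (e v) \<star> (dfac D a \<star> \<rho>X (fprod as)) = dfac D a \<star> \<rho>X (fprod as) \<star> \<rho>X (e v)"
      using Cons comm(2)[OF _ fprod_e[OF v]] v f[OF v, of a] by (simp add: mmul_assoc[symmetric])
    ultimately show ?case by (simp only: dprod.simps mmul_distrib)
  qed (simp only: dprod.simps mmul_distrib)
  then show ?thesis by (simp add: C0_iff D as)
qed

section \<open>The trace pairing with matrices from Y to X\<close>

abbreviation "N \<equiv> mats I J"

lemma adj_closed [simp]:
  "\<lbrakk>a \<in> carrier R; n \<in> N\<rbrakk> \<Longrightarrow> \<rho>X a \<star> n \<in> N" "\<lbrakk>a \<in> carrier R; n \<in> N\<rbrakk> \<Longrightarrow> n \<star> \<rho>Y a \<in> N"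
  using X.rep_closed Y.rep_closed by (auto intro: mats_closed)

lemmas N_closed [simp] = mats_closed(1-5)[where J = I and I = J]
lemmas adj_one [simp] = X.rep_one_left[where J = J] Y.rep_one_right[where J = I]

lemma adj_mult:
  "\<lbrakk>a \<in> carrier R; b \<in> carrier R\<rbrakk> \<Longrightarrow> \<rho>X a \<star> (\<rho>X b \<star> n) = \<rho>X (a \<otimes> b) \<star> n"
  "\<lbrakk>a \<in> carrier R; b \<in> carrier R\<rbrakk> \<Longrightarrow> n \<star> \<rho>Y a \<star> \<rho>Y b = n \<star> \<rho>Y (a \<otimes> b)"
  by (simp_all add: X.rep_mult Y.rep_mult mmul_assoc)

text \<open>The product rule written out, with one summand for each factor that is
  differentiated.\<close>

lemma dprod_sum:
  assumes D: "D \<in> C1" and "set as \<subseteq> arrows"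
  shows "dprod D as =
    (\<Sum>k<length as. \<rho>Y (fprod (take k as)) \<star> dfac D (as ! k) \<star> \<rho>X (fprod (drop (Suc k) as)))"
  using assms(2)
proof (induction as)
  case (Cons a as)
  have a: "a \<in> arrows" "set as \<subseteq> arrows" using Cons.prems by auto
  have t: "\<rho>Y (fprod (take (Suc k) (a # as))) \<star> m = \<rho>Y (fac a) \<star> (\<rho>Y (fprod (take k as)) \<star> m)" for k m
    using a by (simp add: act_mult set_take_subset[THEN subset_trans])
  have s: "A \<star> (\<Sum>k\<in>T. f k) = (\<Sum>k\<in>T. A \<star> f k)" for A and f :: "nat \<Rightarrow> 'i \<times> 'i \<Rightarrow> 'k" and T
    by (induction T rule: infinite_finite_induct) (simp_all only: sum.infinite sum.empty sum.insert mmul_distrib not_False_eq_True)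
  have "dprod D (a # as) = dfac D a \<star> \<rho>X (fprod as) + \<rho>Y (fac a) \<star> dprod D as"
    by (simp only: dprod.simps add.commute)
  also have "\<rho>Y (fac a) \<star> dprod D as = (\<Sum>k<length as.
      \<rho>Y (fprod (take (Suc k) (a # as))) \<star> dfac D ((a # as) ! Suc k) \<star> \<rho>X (fprod (drop (Suc (Suc k)) (a # as))))"
    unfolding Cons.IH[OF a(2)] s t mmul_assoc by (simp only: nth_Cons_Suc drop_Suc_Cons mmul_assoc)
  also have "dfac D a \<star> \<rho>X (fprod as) =
      \<rho>Y (fprod (take 0 (a # as))) \<star> dfac D ((a # as) ! 0) \<star> \<rho>X (fprod (drop (Suc 0) (a # as)))"
    using a D by simp
  finally show ?case by (simp only: list.size(4) add_Suc_right add_0_right sum.lessThan_Suc_shift)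
qed simp

definition pos :: "'e darrow \<Rightarrow> nat" where "pos = inv_into {..<length L} ((!) L)"

lemma bij_nth_L: "bij_betw ((!) L) {..<length L} arrows"
  using bij_betw_nth[OF L(2) refl refl] L(1) by simp

lemma pos: "b \<in> arrows \<Longrightarrow> pos b < length L" "b \<in> arrows \<Longrightarrow> L ! pos b = b"
  using bij_nth_L inv_into_into[of b "(!) L" "{..<length L}"] f_inv_into_f[of b "(!) L" "{..<length L}"]
  by (auto simp: pos_def bij_betw_def)

lemma pos_nth: "k < length L \<Longrightarrow> pos (L ! k) = k"
  using bij_nth_L by (auto simp: pos_def bij_betw_def inv_into_f_f)

definition pre :: "'e darrow \<Rightarrow> 'r" where "pre b = fprod (take (pos b) L)"
definition suf :: "'e darrow \<Rightarrow> 'r" where "suf b = fprod (drop (Suc (pos b)) L)"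

lemma take_drop_arrows [simp]: "set (take k L) \<subseteq> arrows" "set (drop k L) \<subseteq> arrows"
  using L(1) set_take_subset[of k L] set_drop_subset[of k L] by auto

lemma pre_suf_closed [simp]: "pre b \<in> carrier R" "suf b \<in> carrier R"
  by (simp_all add: pre_def suf_def)

lemma pre_unit: "pre b \<in> Units R" by (simp add: pre_def fprod_unit)

lemma pre_suf_e: "v \<in> verts Q \<Longrightarrow> pre b \<otimes> e v = e v \<otimes> pre b" "v \<in> verts Q \<Longrightarrow> suf b \<otimes> e v = e v \<otimes> suf b"
  by (simp_all add: pre_def suf_def fprod_e)

lemma pre_fac_suf: "b \<in> arrows \<Longrightarrow> pre b \<otimes> (fac b \<otimes> suf b) = qe"
proof -
  assume b: "b \<in> arrows"
  have "L = take (pos b) L @ b # drop (Suc (pos b)) L"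
    using id_take_nth_drop[OF pos(1)[OF b]] pos(2)[OF b] by simp
  then have "fprod L = fprod (take (pos b) L) \<otimes> fprod (b # drop (Suc (pos b)) L)"
    using fprod_append[of "take (pos b) L" "b # drop (Suc (pos b)) L"] b by simp
  then show ?thesis by (simp add: fprod_L pre_def suf_def)
qed

text \<open>The coefficient of \<open>dfac D b\<close> in the trace of
  \<open>\<theta> \<star> dprod D L\<close>: in the summand that differentiates the factor of
  \<open>b\<close>, cyclicity moves the suffix from the right end to the front of
  \<open>\<theta>\<close>.\<close>

definition G :: "('i \<times> 'i \<Rightarrow> 'k) \<Rightarrow> 'e darrow \<Rightarrow> 'i \<times> 'i \<Rightarrow> 'k" where
  "G \<theta> b = \<rho>X (suf b) \<star> \<theta> \<star> \<rho>Y (pre b)"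

lemma G_closed [simp]: "\<theta> \<in> N \<Longrightarrow> G \<theta> b \<in> N"
  by (simp add: G_def)

lemma trace_dprod:
  assumes D: "D \<in> C1" and \<theta>: "\<theta> \<in> N"
  shows "mtrace U (\<theta> \<star> dprod D L) = (\<Sum>b\<in>arrows. mtrace U (G \<theta> b \<star> dfac D b))"
proof -
  have lin: "mtrace U (\<theta> \<star> (\<Sum>k\<in>T. f k)) = (\<Sum>k\<in>T. mtrace U (\<theta> \<star> f k))" for f :: "nat \<Rightarrow> 'i \<times> 'i \<Rightarrow> 'k" and T
    by (induction T rule: infinite_finite_induct)
      (simp_all only: sum.infinite sum.empty sum.insert mmul_distrib mtrace_simps not_False_eq_True)
  have "mtrace U (\<theta> \<star> dprod D L) = (\<Sum>k<length L. mtrace U (\<theta> \<star>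
      (\<rho>Y (fprod (take k L)) \<star> dfac D (L ! k) \<star> \<rho>X (fprod (drop (Suc k) L)))))"
    using dprod_sum[OF D, of L] L(1) lin by simp
  also have "\<dots> = (\<Sum>k<length L. mtrace U (G \<theta> (L ! k) \<star> dfac D (L ! k)))"
  proof (rule sum.cong[OF refl])
    fix k assume "k \<in> {..<length L}"
    then have k: "pos (L ! k) = k" by (simp add: pos_nth)
    have "mtrace U (\<theta> \<star> (\<rho>Y (fprod (take k L)) \<star> dfac D (L ! k) \<star> \<rho>X (fprod (drop (Suc k) L)))) =
       mtrace U ((\<theta> \<star> \<rho>Y (fprod (take k L)) \<star> dfac D (L ! k)) \<star> \<rho>X (fprod (drop (Suc k) L)))"
      by (simp only: mmul_assoc)
    also have "\<dots> = mtrace U (\<rho>X (fprod (drop (Suc k) L)) \<star> (\<theta> \<star> \<rho>Y (fprod (take k L)) \<star> dfac D (L ! k)))"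
      by (rule mtrace_mmul)
    finally show "mtrace U (\<theta> \<star> (\<rho>Y (fprod (take k L)) \<star> dfac D (L ! k) \<star> \<rho>X (fprod (drop (Suc k) L)))) =
        mtrace U (G \<theta> (L ! k) \<star> dfac D (L ! k))"
      by (simp only: G_def pre_def suf_def k mmul_assoc)
  qed
  also have "\<dots> = (\<Sum>b\<in>arrows. mtrace U (G \<theta> b \<star> dfac D b))"
    by (rule sum.reindex_bij_betw[OF bij_nth_L])
  finally show ?thesis .
qed

text \<open>Up to sign the coefficient of \<open>dopl D (Rev a)\<close> in the same trace: the two
  inverses that surround it in \<open>dfac D (Rev a)\<close> have been rotated into
  \<open>G\<close>.\<close>

definition H :: "('i \<times> 'i \<Rightarrow> 'k) \<Rightarrow> 'e \<Rightarrow> 'i \<times> 'i \<Rightarrow> 'k" where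
  "H \<theta> a = \<rho>X (inv (opl (Rev a))) \<star> G \<theta> (Rev a) \<star> \<rho>Y (inv (opl (Rev a)))"

text \<open>\<open>Z \<theta> b\<close> is the coefficient of the component \<open>D b\<close> in the linear form
  \<open>D \<mapsto> tr (\<theta> \<cdot> dprod D L)\<close>.\<close>

fun Z :: "('i \<times> 'i \<Rightarrow> 'k) \<Rightarrow> 'e darrow \<Rightarrow> 'i \<times> 'i \<Rightarrow> 'k" where
  "Z \<theta> (Orig a) = \<rho>X (ar (Rev a)) \<star> G \<theta> (Orig a) - H \<theta> a \<star> \<rho>Y (ar (Rev a))"
| "Z \<theta> (Rev a) = G \<theta> (Orig a) \<star> \<rho>Y (ar (Orig a)) - \<rho>X (ar (Orig a)) \<star> H \<theta> a"

lemma H_closed [simp]: "\<lbrakk>\<theta> \<in> N; a \<in> arcs Q\<rbrakk> \<Longrightarrow> H \<theta> a \<in> N"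
  by (simp add: H_def)

lemma Z_closed [simp]: "\<lbrakk>\<theta> \<in> N; b \<in> arrows\<rbrakk> \<Longrightarrow> Z \<theta> b \<in> N"
  by (cases b) simp_all

text \<open>The component \<open>D b\<close> occurs in the derivatives of two factors, those of
  \<open>b\<close> and of \<open>star b\<close>, once before and once after an arrow. Grouping the
  sum by arrows of \<open>Q\<close> and rotating each trace until the component stands at the end
  gives the two terms of \<open>Z\<close>.\<close>

lemma trace_Z:
  assumes D: "D \<in> C1" and \<theta>: "\<theta> \<in> N"
  shows "mtrace U (\<theta> \<star> dprod D L) = (\<Sum>b\<in>arrows. mtrace U (Z \<theta> b \<star> blk D b))"
  unfolding trace_dprod[OF assms] sum_arcs_double[OF fin_Q]
proof (rule sum.cong[OF refl])
  fix a assume a: "a \<in> arcs Q"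
  let ?o = "Orig a" and ?s = "Rev a"
  have cyc: "mtrace U (A \<star> (B \<star> C)) = mtrace U (C \<star> A \<star> B)" for A B C :: "'i \<times> 'i \<Rightarrow> 'k"
    using mtrace_mmul[of U "A \<star> B" C] by (simp only: mmul_assoc)
  let ?h = "H \<theta> a" and ?g = "G \<theta> ?o"
  have 1: "mtrace U (?g \<star> dfac D ?o) = mtrace U (?g \<star> \<rho>Y (ar ?o) \<star> blk D ?s) + mtrace U (\<rho>X (ar ?s) \<star> ?g \<star> blk D ?o)"
  proof -
    have "mtrace U (?g \<star> dfac D ?o) =
        mtrace U (?g \<star> (\<rho>Y (ar ?o) \<star> blk D ?s)) + mtrace U (?g \<star> (blk D ?o \<star> \<rho>X (ar ?s)))"
      by (simp add: dfac_def dopl_def mmul_distrib mtrace_simps)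
    also have "mtrace U (?g \<star> (blk D ?o \<star> \<rho>X (ar ?s))) = mtrace U (\<rho>X (ar ?s) \<star> ?g \<star> blk D ?o)"
      by (rule cyc)
    finally show ?thesis by (simp only: mmul_assoc)
  qed
  have "mtrace U (G \<theta> ?s \<star> dfac D ?s) = - mtrace U ((G \<theta> ?s \<star> \<rho>Y (inv (opl ?s)) \<star> dopl D ?s) \<star> \<rho>X (inv (opl ?s)))"
    by (simp add: dfac_def mmul_distrib mtrace_simps) (simp only: mmul_assoc)
  also have "\<dots> = - mtrace U (\<rho>X (inv (opl ?s)) \<star> (G \<theta> ?s \<star> \<rho>Y (inv (opl ?s)) \<star> dopl D ?s))"
    by (simp only: mtrace_mmul[of U "G \<theta> ?s \<star> \<rho>Y (inv (opl ?s)) \<star> dopl D ?s"])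
  also have "\<dots> = - mtrace U (?h \<star> dopl D ?s)"
    by (simp only: H_def mmul_assoc)
  also have "\<dots> = - (mtrace U (?h \<star> \<rho>Y (ar ?s) \<star> blk D ?o) + mtrace U (\<rho>X (ar ?o) \<star> ?h \<star> blk D ?s))"
  proof -
    have "mtrace U (?h \<star> dopl D ?s) =
        mtrace U (?h \<star> (\<rho>Y (ar ?s) \<star> blk D ?o)) + mtrace U (?h \<star> (blk D ?s \<star> \<rho>X (ar ?o)))"
      by (simp add: dopl_def mmul_distrib mtrace_simps)
    also have "mtrace U (?h \<star> (blk D ?s \<star> \<rho>X (ar ?o))) = mtrace U (\<rho>X (ar ?o) \<star> ?h \<star> blk D ?s)"
      by (rule cyc)
    finally show ?thesis by (simp only: mmul_assoc)
  qed
  finally show "mtrace U (?g \<star> dfac D ?o) + mtrace U (G \<theta> ?s \<star> dfac D ?s) =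
      mtrace U (Z \<theta> ?o \<star> blk D ?o) + mtrace U (Z \<theta> ?s \<star> blk D ?s)"
    unfolding 1 by (simp add: mmul_distrib mtrace_simps)
qed

text \<open>The maps from \<open>Y\<close> to \<open>X\<close> that preserve the vertices, expressed
  by products instead of entries because \<open>\<theta>\<close> is going to be multiplied by
  prefixes and suffixes. \<open>ecomm_iff_C0\<close> identifies them with the transposes of
  \<open>C0\<close>.\<close>

definition ecomm :: "('i \<times> 'i \<Rightarrow> 'k) \<Rightarrow> bool" where
  "ecomm \<theta> \<longleftrightarrow> \<theta> \<in> N \<and> (\<forall>v\<in>verts Q. \<rho>X (e v) \<star> \<theta> = \<theta> \<star> \<rho>Y (e v))"

lemma ecomm_mult:
  assumes "ecomm \<theta>" "u \<in> carrier R" "\<And>v. v \<in> verts Q \<Longrightarrow> u \<otimes> e v = e v \<otimes> u"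
  shows "ecomm (\<rho>X u \<star> \<theta>)" "ecomm (\<theta> \<star> \<rho>Y u)"
proof -
  have \<theta>: "\<theta> \<in> N" "\<And>v. v \<in> verts Q \<Longrightarrow> \<rho>X (e v) \<star> \<theta> = \<theta> \<star> \<rho>Y (e v)"
    using assms(1) by (auto simp: ecomm_def)
  have "\<rho>X (e v) \<star> (\<rho>X u \<star> \<theta>) = \<rho>X u \<star> \<theta> \<star> \<rho>Y (e v)" if v: "v \<in> verts Q" for v
  proof -
    have "\<rho>X (e v) \<star> (\<rho>X u \<star> \<theta>) = \<rho>X u \<star> (\<rho>X (e v) \<star> \<theta>)"
      using assms(2) assms(3)[OF v] v by (simp add: adj_mult)
    then show ?thesis by (simp only: \<theta>(2)[OF v] mmul_assoc)
  qed
  then show "ecomm (\<rho>X u \<star> \<theta>)" using \<theta> assms(2) by (simp add: ecomm_def)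
  have "\<rho>X (e v) \<star> (\<theta> \<star> \<rho>Y u) = \<theta> \<star> \<rho>Y u \<star> \<rho>Y (e v)" if v: "v \<in> verts Q" for v
  proof -
    have "\<theta> \<star> \<rho>Y u \<star> \<rho>Y (e v) = \<theta> \<star> \<rho>Y (e v) \<star> \<rho>Y u"
      using assms(2) assms(3)[OF v] v by (simp add: adj_mult)
    then show ?thesis by (simp only: \<theta>(2)[OF v, symmetric] mmul_assoc)
  qed
  then show "ecomm (\<theta> \<star> \<rho>Y u)" using \<theta> assms(2) by (simp add: ecomm_def)
qed

lemma ecomm_G: "ecomm \<theta> \<Longrightarrow> ecomm (G \<theta> b)"
  unfolding G_def by (intro ecomm_mult) (simp_all add: pre_suf_e)

lemma ecomm_H: "\<lbrakk>ecomm \<theta>; a \<in> arcs Q\<rbrakk> \<Longrightarrow> ecomm (H \<theta> a)"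
  unfolding H_def using fac_e[of _ "Rev a"]
  by (intro ecomm_mult ecomm_G) (simp_all add: fac_def)

text \<open>\<open>Z \<theta> b\<close> leads from \<open>Y\<close> at the head of \<open>b\<close>
  to \<open>X\<close> at its tail, opposite to the block of \<open>D\<close> at \<open>b\<close>.
  Testing it against blocks is therefore as good as testing it against arbitrary matrices.\<close>

lemma Z_block:
  assumes \<theta>: "ecomm \<theta>" and b: "b \<in> arrows"
  shows "\<rho>X (e (tl' b)) \<star> Z \<theta> b \<star> \<rho>Y (e (hd' b)) = Z \<theta> b"
proof -
  have \<theta>N: "\<theta> \<in> N" using \<theta> by (simp add: ecomm_def)
  have c: "\<rho>X (e v) \<star> n = n \<star> \<rho>Y (e v)" if "ecomm n" "v \<in> verts Q" for n v
    using that by (auto simp: ecomm_def)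
  have hts: "hd' (Rev a) = tl' (Orig a)" "tl' (Rev a) = hd' (Orig a)" for a
    using double_simps(3,4)[of Q "Orig a"] by simp_all
  have 1: "\<rho>X (e (hd' a)) \<star> (\<rho>X (ar a) \<star> n) = \<rho>X (ar a) \<star> n"
    "n \<star> \<rho>Y (ar a) \<star> \<rho>Y (e (tl' a)) = n \<star> \<rho>Y (ar a)"
    "\<rho>X (ar a) \<star> (\<rho>X (e (tl' a)) \<star> n) = \<rho>X (ar a) \<star> n"
    "n \<star> \<rho>Y (e (hd' a)) \<star> \<rho>Y (ar a) = n \<star> \<rho>Y (ar a)"
    if "a \<in> arrows" for a n
    using that by (simp_all add: adj_mult e_head e_tail)
  have left: "\<rho>X (e (hd' a)) \<star> (\<rho>X (ar a) \<star> n) \<star> \<rho>Y (e (tl' a)) = \<rho>X (ar a) \<star> n"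
    if "a \<in> arrows" "ecomm n" for a n
  proof -
    have "\<rho>X (e (hd' a)) \<star> (\<rho>X (ar a) \<star> n) \<star> \<rho>Y (e (tl' a)) = \<rho>X (ar a) \<star> (n \<star> \<rho>Y (e (tl' a)))"
      using that by (simp only: 1 mmul_assoc)
    also have "n \<star> \<rho>Y (e (tl' a)) = \<rho>X (e (tl' a)) \<star> n" using c[OF that(2)] that(1) by simp
    finally show ?thesis using that by (simp only: 1)
  qed
  have right: "\<rho>X (e (hd' a)) \<star> (n \<star> \<rho>Y (ar a)) \<star> \<rho>Y (e (tl' a)) = n \<star> \<rho>Y (ar a)"
    if "a \<in> arrows" "ecomm n" for a n
  proof -
    have "\<rho>X (e (hd' a)) \<star> (n \<star> \<rho>Y (ar a)) \<star> \<rho>Y (e (tl' a)) = \<rho>X (e (hd' a)) \<star> n \<star> \<rho>Y (ar a)"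
      using 1(2)[OF that(1)] by (simp only: mmul_assoc)
    also have "\<rho>X (e (hd' a)) \<star> n = n \<star> \<rho>Y (e (hd' a))" using c[OF that(2)] that(1) by simp
    finally show ?thesis using that by (simp only: 1)
  qed
  show ?thesis
  proof (cases b)
    case (Orig a)
    have s: "Rev a \<in> arrows" "a \<in> arcs Q" using b Orig by auto
    show ?thesis
      using left[OF s(1) ecomm_G[OF \<theta>, of "Orig a"]] right[OF s(1) ecomm_H[OF \<theta> s(2)]]
      unfolding Orig hts Z.simps mmul_distrib by simp
  next
    case (Rev a)
    have s: "Orig a \<in> arrows" "a \<in> arcs Q" using b Rev by auto
    show ?thesis
      using right[OF s(1) ecomm_G[OF \<theta>, of "Orig a"]] left[OF s(1) ecomm_H[OF \<theta> s(2)]]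
      unfolding Rev hts Z.simps mmul_distrib by simp
  qed
qed

lemma orthogonal_iff_Z:
  assumes \<theta>: "ecomm \<theta>"
  shows "(\<forall>D\<in>C1. mtrace U (\<theta> \<star> dprod D L) = 0) \<longleftrightarrow> (\<forall>b\<in>arrows. Z \<theta> b = 0)"
proof
  have \<theta>N: "\<theta> \<in> N" using \<theta> by (simp add: ecomm_def)
  assume "\<forall>b\<in>arrows. Z \<theta> b = 0"
  then show "\<forall>D\<in>C1. mtrace U (\<theta> \<star> dprod D L) = 0"
    using trace_Z[OF _ \<theta>N] by (auto simp: mmul_distrib mtrace_simps)
next
  have \<theta>N: "\<theta> \<in> N" using \<theta> by (simp add: ecomm_def)
  assume orth: "\<forall>D\<in>C1. mtrace U (\<theta> \<star> dprod D L) = 0"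
  have fin: "finite arrows" using fin_digraph.finite_arcs[OF double_fin_digraph[OF fin_Q]] .
  show "\<forall>b\<in>arrows. Z \<theta> b = 0"
  proof
    fix b assume b: "b \<in> arrows"
    show "Z \<theta> b = 0"
    proof (rule mtrace_nondegenerate[OF X.fin_U X.sub_U Y.sub_U Z_closed[OF \<theta>N b]])
      fix n :: "'i \<times> 'i \<Rightarrow> 'k" assume n: "n \<in> M"
      \<comment> \<open>An arbitrary \<open>n\<close> is cut down to the block of \<open>b\<close>
        and becomes the only nonzero component of \<open>D\<close>. By cyclicity the cut moves over
        to \<open>Z \<theta> b\<close>, which \<open>Z_block\<close> leaves unchanged.\<close>
      define n' where "n' = \<rho>Y (e (hd' b)) \<star> n \<star> \<rho>X (e (tl' b))"
      define D where "D = (\<lambda>(a, p). if a = b then n' p else 0)"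
      have n': "n' \<in> M" using n b by (simp add: n'_def)
      have Db: "blk D a = (if a = b then n' else 0)" for a by (auto simp: blk_def D_def)
      have "D \<in> C1"
      proof (rule C1_iff)
        have "\<rho>Y (e (hd' b)) \<star> n' = n'"
          unfolding n'_def using b by (simp add: mmul_assoc act_mult(1)[symmetric] e_mult)
        moreover have "n' \<star> \<rho>X (e (tl' b)) = n'"
          unfolding n'_def using b by (simp add: act_mult(2)[symmetric] e_mult)
        ultimately show "\<rho>Y (e (hd' a)) \<star> blk D a = blk D a \<and> blk D a \<star> \<rho>X (e (tl' a)) = blk D a" for a
          by (simp add: Db mmul_distrib)
      qed (use n' b in \<open>auto simp: Db\<close>)
      then have "(\<Sum>a\<in>arrows. mtrace U (Z \<theta> a \<star> blk D a)) = 0" using orth trace_Z[OF _ \<theta>N] by simp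
      moreover have "mtrace U (Z \<theta> a \<star> blk D a) = (if a = b then mtrace U (Z \<theta> b \<star> n') else 0)" for a
        by (simp add: Db mmul_distrib mtrace_simps)
      ultimately have "mtrace U (Z \<theta> b \<star> n') = 0" using fin b by simp
      moreover have "mtrace U (Z \<theta> b \<star> n') = mtrace U ((Z \<theta> b \<star> \<rho>Y (e (hd' b)) \<star> n) \<star> \<rho>X (e (tl' b)))"
        by (simp only: n'_def mmul_assoc)
      moreover have "\<dots> = mtrace U (\<rho>X (e (tl' b)) \<star> Z \<theta> b \<star> \<rho>Y (e (hd' b)) \<star> n)"
        unfolding mtrace_mmul[of U "Z \<theta> b \<star> \<rho>Y (e (hd' b)) \<star> n"] by (simp only: mmul_assoc)
      ultimately show "mtrace U (Z \<theta> b \<star> n) = 0" by (simp add: Z_block[OF \<theta> b])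
    qed
  qed
qed

section \<open>Matrices orthogonal to the linearised relation, and homomorphisms from Y to X\<close>

definition homs_XY :: "('i \<times> 'i \<Rightarrow> 'k) set" where
  "homs_XY = {m \<in> M. \<forall>a\<in>carrier R. \<rho>Y a \<star> m = m \<star> \<rho>X a}"

definition homs_YX :: "('i \<times> 'i \<Rightarrow> 'k) set" where
  "homs_YX = {n \<in> N. \<forall>a\<in>carrier R. \<rho>X a \<star> n = n \<star> \<rho>Y a}"

lemma intertwine_inv:
  assumes "u \<in> Units R" "n \<in> N" "\<rho>X u \<star> n = n \<star> \<rho>Y u"
  shows "\<rho>X (inv u) \<star> n = n \<star> \<rho>Y (inv u)"
proof -
  have u: "u \<in> carrier R" "inv u \<in> carrier R" using assms by auto
  have "\<rho>X (inv u) \<star> (\<rho>X u \<star> n) \<star> \<rho>Y (inv u) = n \<star> \<rho>Y (inv u)"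
    using u assms(1,2) by (simp add: adj_mult)
  moreover have "\<rho>X (inv u) \<star> (n \<star> \<rho>Y u) \<star> \<rho>Y (inv u) = \<rho>X (inv u) \<star> n"
  proof -
    have "\<rho>X (inv u) \<star> (n \<star> \<rho>Y u) \<star> \<rho>Y (inv u) = \<rho>X (inv u) \<star> (n \<star> \<rho>Y u \<star> \<rho>Y (inv u))"
      by (simp only: mmul_assoc)
    then show ?thesis using u assms(1,2) by (simp add: adj_mult)
  qed
  ultimately show ?thesis using assms(3) by simp
qed

text \<open>The elements of \<open>R\<close> that \<open>n\<close> intertwines form a subalgebra
  closed under inverses of units, so \<open>generated\<close> reduces the claim to vertices and
  arrows.\<close>

lemma homs_YX_I:
  assumes n: "n \<in> N" "ecomm n" and ar: "\<And>a. a \<in> arrows \<Longrightarrow> \<rho>X (ar a) \<star> n = n \<star> \<rho>Y (ar a)"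
  shows "n \<in> homs_YX"
proof -
  have "\<rho>X a \<star> n = n \<star> \<rho>Y a" if "a \<in> carrier R" for a
    using that
  proof (rule generated)
    show "\<rho>X (\<eta> c) \<star> n = n \<star> \<rho>Y (\<eta> c)" for c
      using n(1) X.rep_scalar_left[of n J c] Y.rep_scalar_right[of n I c] by simp
    show "\<rho>X (a \<otimes> b) \<star> n = n \<star> \<rho>Y (a \<otimes> b)"
      if "a \<in> carrier R" "b \<in> carrier R" "\<rho>X a \<star> n = n \<star> \<rho>Y a" "\<rho>X b \<star> n = n \<star> \<rho>Y b" for a b
      using that by (metis X.rep_mult Y.rep_mult mmul_assoc)
    show "\<rho>X (a \<oplus> b) \<star> n = n \<star> \<rho>Y (a \<oplus> b)"
      if "a \<in> carrier R" "b \<in> carrier R" "\<rho>X a \<star> n = n \<star> \<rho>Y a" "\<rho>X b \<star> n = n \<star> \<rho>Y b" for a b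
      using that by (simp only: X.rep_add Y.rep_add mmul_distrib)
  qed (use n ar in \<open>auto simp: ecomm_def intertwine_inv\<close>)
  then show ?thesis using n by (simp add: homs_YX_def)
qed

text \<open>If \<open>Z \<theta>\<close> vanishes, \<open>fac b\<close> commutes with \<open>G \<theta> b\<close>, so the products
  \<open>\<rho>X (fprod (drop k L)) \<star> \<theta> \<star> \<rho>Y (fprod (take k L))\<close> do not depend on \<open>k\<close>; their common
  value \<open>\<rho>X qe \<star> \<theta>\<close> is the homomorphism.\<close>

lemma Z_zero_imp_hom:
  assumes \<theta>: "ecomm \<theta>" and Z: "\<And>b. b \<in> arrows \<Longrightarrow> Z \<theta> b = 0"
  shows "\<rho>X qe \<star> \<theta> \<in> homs_YX"
proof -
  define \<theta>' where "\<theta>' = \<rho>X qe \<star> \<theta>"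
  have \<theta>N [simp]: "\<theta> \<in> N" using \<theta> by (simp add: ecomm_def)
  have \<theta>'N [simp]: "\<theta>' \<in> N" by (simp add: \<theta>'_def)
  have Z1: "\<rho>X (ar (Rev a)) \<star> G \<theta> (Orig a) = H \<theta> a \<star> \<rho>Y (ar (Rev a))"
    and Z2: "G \<theta> (Orig a) \<star> \<rho>Y (ar (Orig a)) = \<rho>X (ar (Orig a)) \<star> H \<theta> a" if "a \<in> arcs Q" for a
    using Z[of "Orig a"] Z[of "Rev a"] that by simp_all
  \<comment> \<open>By \<open>Z1\<close> and \<open>Z2\<close>, moving an arrow from one side to the
    other exchanges \<open>G \<theta> (Orig a)\<close> and \<open>H \<theta> a\<close>; after two
    moves the same matrix is back. The same argument starting from \<open>H \<theta> a\<close> gives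
    \<open>cH\<close>.\<close>
  have cO: "\<rho>X (opl (Orig a)) \<star> G \<theta> (Orig a) = G \<theta> (Orig a) \<star> \<rho>Y (opl (Orig a))" if a: "a \<in> arcs Q" for a
  proof -
    have "\<rho>X (ar (Orig a)) \<star> (\<rho>X (ar (Rev a)) \<star> G \<theta> (Orig a)) = G \<theta> (Orig a) \<star> \<rho>Y (ar (Orig a)) \<star> \<rho>Y (ar (Rev a))"
      by (simp only: Z1[OF a] Z2[OF a] mmul_assoc)
    then show ?thesis using a
      by (simp add: opl_def X.rep_add Y.rep_add mmul_distrib adj_mult)
  qed
  have cH: "\<rho>X (opl (Rev a)) \<star> H \<theta> a = H \<theta> a \<star> \<rho>Y (opl (Rev a))" if a: "a \<in> arcs Q" for a
  proof -
    have "\<rho>X (ar (Rev a)) \<star> (\<rho>X (ar (Orig a)) \<star> H \<theta> a) = H \<theta> a \<star> \<rho>Y (ar (Rev a)) \<star> \<rho>Y (ar (Orig a))"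
      by (simp only: Z1[OF a, symmetric] Z2[OF a, symmetric] mmul_assoc)
    then show ?thesis using a
      by (simp add: opl_def X.rep_add Y.rep_add mmul_distrib adj_mult)
  qed
  have HG: "\<rho>X (opl (Rev a)) \<star> H \<theta> a = G \<theta> (Rev a) \<star> \<rho>Y (inv (opl (Rev a)))"
    "H \<theta> a \<star> \<rho>Y (opl (Rev a)) = \<rho>X (inv (opl (Rev a))) \<star> G \<theta> (Rev a)" if a: "a \<in> arcs Q" for a
  proof -
    show "\<rho>X (opl (Rev a)) \<star> H \<theta> a = G \<theta> (Rev a) \<star> \<rho>Y (inv (opl (Rev a)))"
      using a opl_unit[of "Rev a"] by (simp add: H_def mmul_assoc adj_mult)
    have "H \<theta> a \<star> \<rho>Y (opl (Rev a)) =
        \<rho>X (inv (opl (Rev a))) \<star> (G \<theta> (Rev a) \<star> \<rho>Y (inv (opl (Rev a))) \<star> \<rho>Y (opl (Rev a)))"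
      by (simp only: H_def mmul_assoc)
    then show "H \<theta> a \<star> \<rho>Y (opl (Rev a)) = \<rho>X (inv (opl (Rev a))) \<star> G \<theta> (Rev a)"
      using a opl_unit[of "Rev a"] by (simp add: adj_mult)
  qed
  have fG: "\<rho>X (fac b) \<star> G \<theta> b = G \<theta> b \<star> \<rho>Y (fac b)" if b: "b \<in> arrows" for b
    using b cO cH HG by (cases b) (simp_all add: fac_def)
  define W where "W k = \<rho>X (fprod (drop k L)) \<star> \<theta> \<star> \<rho>Y (fprod (take k L))" for k
  have W: "\<rho>X (fac (L ! k)) \<star> G \<theta> (L ! k) = W k" "G \<theta> (L ! k) \<star> \<rho>Y (fac (L ! k)) = W (Suc k)"
    if k: "k < length L" for k
  proof -
    have b: "L ! k \<in> arrows" using k L(1) by (metis nth_mem)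
    have d: "fac (L ! k) \<otimes> suf (L ! k) = fprod (drop k L)"
      using k by (simp add: suf_def pos_nth Cons_nth_drop_Suc[symmetric])
    have t: "pre (L ! k) \<otimes> fac (L ! k) = fprod (take (Suc k) L)"
      using k b fprod_append[of "take k L" "[L ! k]"]
      by (simp add: pre_def pos_nth take_Suc_conv_app_nth)
    show "\<rho>X (fac (L ! k)) \<star> G \<theta> (L ! k) = W k"
      using b k by (simp add: G_def W_def mmul_assoc adj_mult d) (simp add: pre_def pos_nth)
    show "G \<theta> (L ! k) \<star> \<rho>Y (fac (L ! k)) = W (Suc k)"
      using b k by (simp add: G_def W_def adj_mult t) (simp add: suf_def pos_nth)
  qed
  have Wk: "W k = \<theta>'" if "k \<le> length L" for k
    using that
  proof (induction k)
    case 0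
    show ?case by (simp add: W_def \<theta>'_def fprod_L)
  next
    case (Suc k)
    have "L ! k \<in> arrows" using Suc.prems L(1) by (metis Suc_le_lessD nth_mem)
    then show ?case using W[of k] fG[of "L ! k"] Suc by simp
  qed
  have fG': "\<rho>X (fac b) \<star> G \<theta> b = \<theta>'" "G \<theta> b \<star> \<rho>Y (fac b) = \<theta>'" if b: "b \<in> arrows" for b
    using W[OF pos(1)[OF b]] Wk pos[OF b] fG[OF b] by simp_all
  have \<theta>'e: "ecomm \<theta>'"
    unfolding \<theta>'_def by (intro ecomm_mult[OF \<theta>]) (simp_all add: q_comm)
  have orig_rev: "\<rho>X (ar (Orig a)) \<star> \<theta>' = \<theta>' \<star> \<rho>Y (ar (Orig a))"
      "\<rho>X (ar (Rev a)) \<star> \<theta>' = \<theta>' \<star> \<rho>Y (ar (Rev a))" if a: "a \<in> arcs Q" for a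
  proof -
    let ?o = "Orig a" and ?s = "Rev a"
    \<comment> \<open>Once \<open>G\<close> and \<open>H\<close> are expressed by the common value
      \<open>\<theta>'\<close>, the equations \<open>Z1\<close> and \<open>Z2\<close> concern
      \<open>\<theta>'\<close> alone; \<open>ar_inv_opl\<close> brings the inverses to the far left,
      where they cancel.\<close>
    have G\<theta>: "G \<theta> ?o = \<rho>X (inv (opl ?o)) \<star> \<theta>'"
    proof -
      have "G \<theta> ?o = \<rho>X (inv (opl ?o)) \<star> (\<rho>X (opl ?o) \<star> G \<theta> ?o)"
        using a opl_unit[of ?o] by (simp add: adj_mult)
      then show ?thesis using fG'(1)[of ?o] a by (simp add: fac_def)
    qed
    have H\<theta>: "H \<theta> a = \<rho>X (inv (opl ?s)) \<star> \<theta>'"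
    proof -
      have "H \<theta> a = \<rho>X (inv (opl ?s)) \<star> (\<rho>X (opl ?s) \<star> H \<theta> a)"
        using a opl_unit[of ?s] by (simp add: adj_mult)
      then show ?thesis using fG'(2)[of ?s] a by (simp add: HG fac_def)
    qed
    have H\<theta>2: "H \<theta> a = \<theta>' \<star> \<rho>Y (inv (opl ?s))"
      using fG'(1)[of ?s] a by (simp add: H_def fac_def)
    have u: "\<rho>X (opl b) \<star> (\<rho>X (inv (opl b)) \<star> n) = n" if "b \<in> arrows" "n \<in> N" for b n
      using that opl_unit[of b] by (simp add: adj_mult)
    have "\<rho>X (inv (opl ?s)) \<star> (\<rho>X (ar ?s) \<star> \<theta>') = \<rho>X (inv (opl ?s)) \<star> (\<theta>' \<star> \<rho>Y (ar ?s))"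
      using Z1[OF a] ar_inv_opl[of ?o] a unfolding G\<theta> H\<theta> by (simp add: adj_mult mmul_assoc)
    then have "\<rho>X (opl ?s) \<star> (\<rho>X (inv (opl ?s)) \<star> (\<rho>X (ar ?s) \<star> \<theta>')) =
        \<rho>X (opl ?s) \<star> (\<rho>X (inv (opl ?s)) \<star> (\<theta>' \<star> \<rho>Y (ar ?s)))" by simp
    then show "\<rho>X (ar ?s) \<star> \<theta>' = \<theta>' \<star> \<rho>Y (ar ?s)" using a by (simp add: u)
    have "\<rho>X (inv (opl ?o)) \<star> (\<rho>X (ar ?o) \<star> \<theta>') = \<rho>X (inv (opl ?o)) \<star> (\<theta>' \<star> \<rho>Y (ar ?o))"
      using Z2[OF a] ar_inv_opl[of ?s] a unfolding G\<theta> H\<theta> by (simp add: adj_mult mmul_assoc)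
    then have "\<rho>X (opl ?o) \<star> (\<rho>X (inv (opl ?o)) \<star> (\<rho>X (ar ?o) \<star> \<theta>')) =
        \<rho>X (opl ?o) \<star> (\<rho>X (inv (opl ?o)) \<star> (\<theta>' \<star> \<rho>Y (ar ?o)))" by simp
    then show "\<rho>X (ar ?o) \<star> \<theta>' = \<theta>' \<star> \<rho>Y (ar ?o)" using a by (simp add: u)
  qed
  have "\<theta>' \<in> homs_YX"
  proof (rule homs_YX_I[OF \<theta>'N \<theta>'e])
    show "\<rho>X (ar b) \<star> \<theta>' = \<theta>' \<star> \<rho>Y (ar b)" if "b \<in> arrows" for b
      using that orig_rev by (cases b) auto
  qed
  then show ?thesis by (simp add: \<theta>'_def)
qed

text \<open>Since \<open>\<theta>'\<close> intertwines everything, the prefix in \<open>G\<close>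
  can be carried to the left of it; what then stands there is
  \<open>suf b \<otimes> qi \<otimes> pre b\<close>, the inverse of the factor of \<open>b\<close>.
  The two terms of \<open>Z\<close> become equal by \<open>ar_inv_opl\<close>.\<close>

lemma hom_imp_Z_zero:
  assumes \<theta>': "\<theta>' \<in> homs_YX" and b: "b \<in> arrows"
  shows "Z (\<rho>X qi \<star> \<theta>') b = 0"
proof -
  let ?\<theta> = "\<rho>X qi \<star> \<theta>'"
  have N [simp]: "\<theta>' \<in> N" using \<theta>' by (simp add: homs_YX_def)
  have c: "\<rho>X a \<star> \<theta>' = \<theta>' \<star> \<rho>Y a" if "a \<in> carrier R" for a
    using \<theta>' that by (auto simp: homs_YX_def)
  have G: "G ?\<theta> b = \<rho>X (inv (fac b)) \<star> \<theta>'" if b: "b \<in> arrows" for b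
  proof -
    \<comment> \<open>The product is rotated: the relation
      \<open>pre \<otimes> fac \<otimes> suf = qe\<close> gives
      \<open>fac \<otimes> (suf \<otimes> qi \<otimes> pre) = \<one>\<close> after cancelling the
      unit \<open>pre b\<close> on the left.\<close>
    have "pre b \<otimes> (fac b \<otimes> (suf b \<otimes> qi \<otimes> pre b)) = pre b \<otimes> (fac b \<otimes> suf b) \<otimes> qi \<otimes> pre b"
      using b by (simp add: m_assoc)
    also have "\<dots> = pre b \<otimes> \<one>" by (simp add: pre_fac_suf[OF b] q_inv)
    finally have "fac b \<otimes> (suf b \<otimes> qi \<otimes> pre b) = \<one>"
      using Units_l_cancel[OF pre_unit[of b], of "fac b \<otimes> (suf b \<otimes> qi \<otimes> pre b)" \<one>] b by simp
    then have "inv (fac b) \<otimes> (fac b \<otimes> (suf b \<otimes> qi \<otimes> pre b)) = inv (fac b)"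
      using fac_unit[OF b] by simp
    then have *: "suf b \<otimes> qi \<otimes> pre b = inv (fac b)"
      using fac_unit[OF b] b by (simp add: m_assoc[symmetric])
    have "G ?\<theta> b = \<rho>X (suf b) \<star> (\<rho>X qi \<star> (\<theta>' \<star> \<rho>Y (pre b)))"
      by (simp only: G_def mmul_assoc)
    also have "\<theta>' \<star> \<rho>Y (pre b) = \<rho>X (pre b) \<star> \<theta>'" by (simp add: c)
    finally show ?thesis by (simp add: adj_mult * m_assoc[symmetric])
  qed
  have "Z ?\<theta> (Orig a) = 0 \<and> Z ?\<theta> (Rev a) = 0" if a: "a \<in> arcs Q" for a
  proof -
    let ?o = "Orig a" and ?s = "Rev a"
    have Go: "G ?\<theta> ?o = \<rho>X (inv (opl ?o)) \<star> \<theta>'" and Gs: "G ?\<theta> ?s = \<rho>X (opl ?s) \<star> \<theta>'"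
      using G[of ?o] G[of ?s] a opl_unit[of ?s] by (simp_all add: fac_def)
    have H: "H ?\<theta> a = \<rho>X (inv (opl ?s)) \<star> \<theta>'"
      unfolding H_def Gs using a opl_unit[of ?s] by (simp add: adj_mult) (simp add: c)
    have "\<rho>X (ar ?s) \<star> G ?\<theta> ?o = H ?\<theta> a \<star> \<rho>Y (ar ?s)"
      using ar_inv_opl[of ?o] a unfolding Go H by (simp add: adj_mult mmul_assoc c[symmetric])
    moreover have "G ?\<theta> ?o \<star> \<rho>Y (ar ?o) = \<rho>X (ar ?o) \<star> H ?\<theta> a"
      using ar_inv_opl[of ?s] a unfolding Go H by (simp add: adj_mult mmul_assoc c[symmetric])
    ultimately show ?thesis by simp
  qed
  then show ?thesis using b by (cases b) auto
qed

lemma ecomm_iff_C0: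
  assumes n: "n \<in> N"
  shows "ecomm n \<longleftrightarrow> n \<circ> prod.swap \<in> C0"
proof -
  \<comment> \<open>The assumptions are symmetric in \<open>X\<close> and \<open>Y\<close>; the
    space \<open>C0\<close> of the exchanged pair consists of maps from \<open>Y\<close> to
    \<open>X\<close>, and transposition leads back.\<close>
  interpret op: quiver_reps R \<eta> Q e ar L qe qi U J \<rho>Y I \<rho>X vtx
    by unfold_locales (use repX_e repY_e vtx in auto)
  have "ecomm n \<longleftrightarrow> n \<in> carrier (fun_space op.S0)"
    using op.C0_iff[OF n] n by (simp add: ecomm_def)
  also have "\<dots> \<longleftrightarrow> n \<circ> prod.swap \<in> C0"
    by (auto simp: carrier_fun_space op.S0_def S0_def)
  finally show ?thesis .
qed

lemma swap_C0: "f \<in> C0 \<Longrightarrow> f \<circ> prod.swap \<in> N" "f \<in> C0 \<Longrightarrow> ecomm (f \<circ> prod.swap)"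
proof -
  assume f: "f \<in> C0"
  show n: "f \<circ> prod.swap \<in> N" using f by (auto simp: carrier_fun_space S0_def)
  have "f \<circ> prod.swap \<circ> prod.swap = f" by auto
  then show "ecomm (f \<circ> prod.swap)" using f by (simp add: ecomm_iff_C0[OF n])
qed

lemma fin_S: "finite S0" "finite S1"
proof -
  have fin: "finite I" "finite J" using X.fin_U X.sub_U Y.sub_U by (auto intro: finite_subset)
  have "S0 \<subseteq> J \<times> I" by (auto simp: S0_def)
  then show "finite S0" by (rule finite_subset) (simp add: fin)
  have "S1 \<subseteq> arrows \<times> J \<times> I" by (auto simp: S1_def)
  moreover have "finite arrows" using fin_digraph.finite_arcs[OF double_fin_digraph[OF fin_Q]] .
  ultimately show "finite S1" by (auto intro: finite_subset simp: fin)
qed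

text \<open>Links the two forms of the pairing: cyclicity is available for traces, the dimension of
  an orthogonal complement (\<open>has_dim_orthogonal\<close>) for sums over coordinates.\<close>

lemma trace_pairing:
  assumes f: "f \<in> C0"
  shows "mtrace U ((f \<circ> prod.swap) \<star> w) = (\<Sum>i\<in>S0. f i * w i)"
proof -
  have "mtrace U ((f \<circ> prod.swap) \<star> w) = (\<Sum>i\<in>U. \<Sum>l\<in>U. f (l, i) * w (l, i))"
    by (simp add: mtrace_def mmul_def)
  also have "\<dots> = (\<Sum>l\<in>U. \<Sum>i\<in>U. f (l, i) * w (l, i))" by (rule sum.swap)
  also have "\<dots> = (\<Sum>p\<in>U \<times> U. f p * w p)" by (simp add: sum.cartesian_product)
  also have "\<dots> = (\<Sum>p\<in>S0. f p * w p)"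
    using X.fin_U X.sub_U Y.sub_U f
    by (intro sum.mono_neutral_right) (auto simp: S0_def carrier_fun_space)
  finally show ?thesis .
qed

text \<open>Transposition followed by multiplication with \<open>qe\<close> carries the orthogonal
  complement of the image of \<open>dprod\<close> to the homomorphisms; multiplication with
  \<open>qi\<close> and transposition lead back.\<close>

lemma has_dim_homs_YX:
  assumes "has_dim ((fun_space S0)\<lparr>carrier :=
     {f \<in> C0. \<forall>w\<in>(\<lambda>D. dprod D L) ` C1. (\<Sum>i\<in>S0. f i * w i) = 0}\<rparr>) m"
  shows "has_dim ((fun_space (I \<times> J))\<lparr>carrier := homs_YX\<rparr>) m"
proof (rule has_dim_bij[OF assms])
  let ?P = "{f \<in> C0. \<forall>w\<in>(\<lambda>D. dprod D L) ` C1. (\<Sum>i\<in>S0. f i * w i) = 0}"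
  let ?T = "\<lambda>f. \<rho>X qe \<star> (f \<circ> prod.swap)"
  let ?V = "(fun_space S0)\<lparr>carrier := ?P\<rparr>" and ?W = "(fun_space (I \<times> J))\<lparr>carrier := homs_YX\<rparr>"
  have P: "f \<in> ?P \<longleftrightarrow> f \<in> C0 \<and> (\<forall>b\<in>arrows. Z (f \<circ> prod.swap) b = 0)" for f
  proof (cases "f \<in> C0")
    case True
    then show ?thesis
      using orthogonal_iff_Z[OF swap_C0(2)[OF True]] by (simp add: trace_pairing[OF True])
  qed simp
  have TW: "?T f \<in> homs_YX" if "f \<in> ?P" for f
    using that Z_zero_imp_hom[OF swap_C0(2)] unfolding P by blast
  show "lin_map ?V ?W ?T"
  proof (rule lin_mapI)
    show "?T f \<in> carrier ?W" if "f \<in> carrier ?V" for f using TW that by simp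
    have "(f + g) \<circ> prod.swap = (f \<circ> prod.swap) + (g \<circ> prod.swap)" for f g :: "'i \<times> 'i \<Rightarrow> 'k"
      by auto
    then show "?T (f \<oplus>\<^bsub>?V\<^esub> g) = ?T f \<oplus>\<^bsub>?W\<^esub> ?T g" for f g
      by (simp add: mmul_distrib)
    have "(\<lambda>i. c * f i) \<circ> prod.swap = mscale c (f \<circ> prod.swap)" for c and f :: "'i \<times> 'i \<Rightarrow> 'k"
      by (auto simp: mscale_def)
    then show "?T (c \<odot>\<^bsub>?V\<^esub> f) = c \<odot>\<^bsub>?W\<^esub> ?T f" for c f
      by (simp add: mmul_mscale) (simp add: mscale_def)
  qed
  have swap0: "(0 :: 'i \<times> 'i \<Rightarrow> 'k) \<circ> prod.swap = 0" by auto
  show "?T \<zero>\<^bsub>?V\<^esub> = \<zero>\<^bsub>?W\<^esub>" by (simp add: swap0 mmul_distrib)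
  have inv1: "(\<rho>X qi \<star> ?T f) \<circ> prod.swap = f" if "f \<in> C0" for f
  proof -
    have "\<rho>X qi \<star> ?T f = f \<circ> prod.swap" using swap_C0(1)[OF that] by (simp add: adj_mult q_inv)
    then show ?thesis by auto
  qed
  have inv2: "?T ((\<rho>X qi \<star> n) \<circ> prod.swap) = n" if "n \<in> homs_YX" for n
  proof -
    have "(\<rho>X qi \<star> n) \<circ> prod.swap \<circ> prod.swap = \<rho>X qi \<star> n" by auto
    moreover have "n \<in> N" using that by (simp add: homs_YX_def)
    ultimately show ?thesis by (simp add: adj_mult q_inv)
  qed
  have bwd: "(\<rho>X qi \<star> n) \<circ> prod.swap \<in> ?P" if n: "n \<in> homs_YX" for n
  proof -
    have nN: "n \<in> N" and ne: "ecomm n" using n by (auto simp: homs_YX_def ecomm_def)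
    have "qi \<otimes> e v = e v \<otimes> qi" if "v \<in> verts Q" for v
    proof -
      have "qi \<otimes> e v = qi \<otimes> (e v \<otimes> qe) \<otimes> qi" using that by (simp add: m_assoc q_inv)
      also have "\<dots> = qi \<otimes> (qe \<otimes> e v) \<otimes> qi" using that by (simp add: q_comm)
      also have "\<dots> = e v \<otimes> qi" using that by (simp add: m_assoc[symmetric] q_inv)
      finally show ?thesis .
    qed
    then have ec: "ecomm (\<rho>X qi \<star> n)" by (intro ecomm_mult[OF ne]) simp_all
    have "(\<rho>X qi \<star> n) \<circ> prod.swap \<circ> prod.swap = \<rho>X qi \<star> n" by auto
    then show ?thesis unfolding P
      using ec hom_imp_Z_zero[OF n] ecomm_iff_C0[of "\<rho>X qi \<star> n"] nN by simp
  qed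
  show "bij_betw ?T (carrier ?V) (carrier ?W)"
    by (rule bij_betw_byWitness[where f' = "\<lambda>n. (\<rho>X qi \<star> n) \<circ> prod.swap"])
      (use inv1 inv2 TW bwd in \<open>simp_all add: image_subset_iff\<close>)
qed

section \<open>The complex and the count of its dimensions\<close>

definition d0 :: "('i \<times> 'i \<Rightarrow> 'k) \<Rightarrow> 'e darrow \<times> 'i \<times> 'i \<Rightarrow> 'k" where
  "d0 m = (\<lambda>(a, p). if a \<in> arrows then inner_der m (ar a) p else 0)"

lemma blk_d0: "blk (d0 m) a = (if a \<in> arrows then inner_der m (ar a) else 0)"
  by (auto simp: blk_def d0_def)

lemma derivation_C1:
  assumes \<delta>: "derivation \<delta>" and e0: "\<And>v. v \<in> verts Q \<Longrightarrow> \<delta> (e v) = 0"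
  shows "(\<lambda>(a, p). if a \<in> arrows then \<delta> (ar a) p else 0) \<in> C1"
proof (rule C1_iff)
  let ?D = "\<lambda>(a, p). if a \<in> arrows then \<delta> (ar a) p else 0"
  have b: "blk ?D a = (if a \<in> arrows then \<delta> (ar a) else 0)" for a by (auto simp: blk_def)
  note d = derivationD[OF \<delta>]
  show "blk ?D a \<in> M" "a \<notin> arrows \<Longrightarrow> blk ?D a = 0" for a by (simp_all add: b d)
  show "\<rho>Y (e (hd' a)) \<star> blk ?D a = blk ?D a \<and> blk ?D a \<star> \<rho>X (e (tl' a)) = blk ?D a" if "a \<in> arrows" for a
    using that d(3)[of "e (hd' a)" "ar a"] d(3)[of "ar a" "e (tl' a)"]
    by (simp add: b e_head e_tail e0 mmul_distrib)
qed

lemma inner_e: "\<lbrakk>m \<in> C0; v \<in> verts Q\<rbrakk> \<Longrightarrow> inner_der m (e v) = 0"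
  using C0_iff[OF C0_M] by (simp add: inner_der_def)

lemma d0_C1: "m \<in> C0 \<Longrightarrow> d0 m \<in> C1"
  unfolding d0_def by (rule derivation_C1[OF derivation_inner[OF C0_M] inner_e])

text \<open>Two derivations agree on a set closed under sums, products and, by
  \<open>derivation_inv\<close>, inverses, so \<open>generated\<close> applies.\<close>

lemma derivation_eqI:
  assumes "derivation \<delta>" "derivation \<delta>'" "\<And>v. v \<in> verts Q \<Longrightarrow> \<delta> (e v) = \<delta>' (e v)"
    "\<And>a. a \<in> arrows \<Longrightarrow> \<delta> (ar a) = \<delta>' (ar a)" "a \<in> carrier R"
  shows "\<delta> a = \<delta>' a"
  using assms(5)
  by (rule generated)
    (simp_all add: assms(3,4) derivationD[OF assms(1)] derivationD[OF assms(2)]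
      derivation_inv[OF assms(1)] derivation_inv[OF assms(2)])

lemma ker_d0: "{m \<in> C0. d0 m = 0} = homs_XY"
proof
  show "homs_XY \<subseteq> {m \<in> C0. d0 m = 0}"
  proof
    fix m assume m: "m \<in> homs_XY"
    then have "m \<in> C0" by (simp add: homs_XY_def C0_iff)
    moreover have "inner_der m (ar a) = 0" if "a \<in> arrows" for a
      using m that by (simp add: homs_XY_def inner_der_def)
    ultimately show "m \<in> {m \<in> C0. d0 m = 0}" by (auto simp: d0_def fun_eq_iff)
  qed
  show "{m \<in> C0. d0 m = 0} \<subseteq> homs_XY"
  proof clarify
    fix m assume m: "m \<in> C0" and z: "d0 m = 0"
    have "inner_der m (ar a) = 0" if "a \<in> arrows" for a
      using that blk_d0[of m a] by (auto simp: z blk_def fun_eq_iff)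
    moreover have "derivation (\<lambda>_. 0)" by (simp add: derivation_def mmul_distrib)
    ultimately have "inner_der m a = 0" if "a \<in> carrier R" for a
      using derivation_eqI[OF derivation_inner[OF C0_M[OF m]], of "\<lambda>_. 0" a] inner_e[OF m] that by simp
    then show "m \<in> homs_XY" using C0_M[OF m] by (simp add: homs_XY_def inner_der_def)
  qed
qed

lemma fun_space_update: "(fun_space S)\<lparr>carrier := W\<rparr> = (fun_space T)\<lparr>carrier := W\<rparr>"
  by (simp add: fun_space_def)

text \<open>With \<open>k\<close> the dimension of the image of \<open>dprod\<close>, rank-nullity
  gives \<open>p + k = card S1\<close> and \<open>h + i = card S0\<close>, and orthogonality gives
  \<open>m + k = card S0\<close>; then \<open>k\<close> is eliminated. The difference
  \<open>p - i\<close> becomes the dimension of \<open>Ext1\<close> once the image of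
  \<open>d0\<close> is identified inside the kernel of \<open>dprod\<close>.\<close>

theorem dim_count:
  obtains h m p i where "has_dim ((fun_space (J \<times> I))\<lparr>carrier := homs_XY\<rparr>) h"
    "has_dim ((fun_space (I \<times> J))\<lparr>carrier := homs_YX\<rparr>) m"
    "has_dim ((fun_space S1)\<lparr>carrier := {D \<in> C1. dprod D L = 0}\<rparr>) p"
    "has_dim ((fun_space S1)\<lparr>carrier := d0 ` C0\<rparr>) i"
    "int p - int i = int h + int m + int (card S1) - 2 * int (card S0)"
proof -
  let ?B = "(\<lambda>D. dprod D L) ` C1"
  have 1: "lin_map (fun_space S1) ((fun_space S0)\<lparr>carrier := ?B\<rparr>) (\<lambda>D. dprod D L)"
    by (rule lin_mapI) (auto simp: dprod_lin mscale_def)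
  have d0: "dprod 0 as = 0" for as using dprod_lin(2)[of 0 0 as] by (simp add: zero_fun_def[symmetric])
  obtain p k where pk: "has_dim ((fun_space S1)\<lparr>carrier := {D \<in> C1. dprod D L = 0}\<rparr>) p"
    "has_dim ((fun_space S0)\<lparr>carrier := ?B\<rparr>) k" "p + k = card S1"
  proof (rule has_dim_rank_nullity[OF has_dim_fun_space[OF fin_S(2)] 1])
    show "dprod \<zero>\<^bsub>fun_space S1\<^esub> L = \<zero>\<^bsub>(fun_space S0)\<lparr>carrier := ?B\<rparr>\<^esub>"
      using d0 by simp
  qed simp_all
  have "?B \<subseteq> C0" using dprod_C0 L(1) by auto
  then obtain m where m: "has_dim ((fun_space (I \<times> J))\<lparr>carrier := homs_YX\<rparr>) m" "m + k = card S0"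
    using has_dim_orthogonal[OF fin_S(1) pk(2)] has_dim_homs_YX by blast
  have 2: "lin_map (fun_space S0) ((fun_space S1)\<lparr>carrier := d0 ` C0\<rparr>) d0"
  proof (rule lin_mapI)
    have "inner_der (m + n) a = inner_der m a + inner_der n a" for m n a
      by (simp add: inner_der_def mmul_distrib)
    then have "d0 (m + n) = d0 m + d0 n" for m n by (auto simp: d0_def)
    then show "d0 (m \<oplus>\<^bsub>fun_space S0\<^esub> n) = d0 m \<oplus>\<^bsub>(fun_space S1)\<lparr>carrier := d0 ` C0\<rparr>\<^esub> d0 n" for m n
      by simp
    have "inner_der (mscale c m) a = mscale c (inner_der m a)" for c m a
      by (simp add: inner_der_def mmul_mscale mscale_distrib)
    then have "d0 (mscale c m) = mscale c (d0 m)" for c m by (auto simp: d0_def mscale_def)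
    then show "d0 (c \<odot>\<^bsub>fun_space S0\<^esub> m) = c \<odot>\<^bsub>(fun_space S1)\<lparr>carrier := d0 ` C0\<rparr>\<^esub> d0 m" for c m
      by (simp add: mscale_def)
  qed simp
  have d00: "d0 0 = 0" by (auto simp: d0_def inner_der_def mmul_distrib fun_eq_iff)
  obtain h i where hi: "has_dim ((fun_space S0)\<lparr>carrier := {m \<in> C0. d0 m = 0}\<rparr>) h"
    "has_dim ((fun_space S1)\<lparr>carrier := d0 ` C0\<rparr>) i" "h + i = card S0"
  proof (rule has_dim_rank_nullity[OF has_dim_fun_space[OF fin_S(1)] 2])
    show "d0 \<zero>\<^bsub>fun_space S0\<^esub> = \<zero>\<^bsub>(fun_space S1)\<lparr>carrier := d0 ` C0\<rparr>\<^esub>"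
      using d00 by simp
  qed simp_all
  have "has_dim ((fun_space (J \<times> I))\<lparr>carrier := homs_XY\<rparr>) h"
    using hi(1) unfolding ker_d0 fun_space_update[where S = S0 and T = "J \<times> I"] .
  moreover have "int p - int i = int h + int m + int (card S1) - 2 * int (card S0)"
    using pk(3) m(2) hi(3) by simp
  ultimately show ?thesis using that m(1) pk(1) hi(2) by blast
qed

text \<open>The matrix is \<open>m = - (\<Sum>v. \<delta> (e v) \<star> \<rho>X (e v))\<close>, written out entrywise.\<close>

lemma derivation_normalise:
  assumes \<delta>: "derivation \<delta>"
  shows "\<exists>m\<in>M. \<forall>v\<in>verts Q. \<delta> (e v) = inner_der m (e v)"
proof (intro bexI ballI)
  note d = derivationD[OF \<delta>]
  let ?m = "\<lambda>(y, x). if y \<in> J \<and> x \<in> I then - \<delta> (e (vtx x)) (y, x) else 0"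
  show mM: "?m \<in> M" by (auto simp: carrier_fun_space)
  fix w assume w: "w \<in> verts Q"
  have dM: "\<delta> (e v) \<in> M" if "v \<in> verts Q" for v using that by (simp add: d)
  have out: "\<delta> (e v) (y, x) = 0" if "v \<in> verts Q" "\<not> (y \<in> J \<and> x \<in> I)" for v y x
    using dM[OF that(1)] that(2) by (auto simp: carrier_fun_space)
  \<comment> \<open>The product rule at the entry \<open>(y, x)\<close>. For \<open>u = w\<close>
    and \<open>v = vtx x\<close> the second term is the entry of \<open>\<delta> (e w)\<close>; the
    product on the left is zero if \<open>w\<close> differs from \<open>vtx x\<close>, and otherwise
    it is \<open>e w\<close> and the first term must vanish.\<close>
  have ent: "\<delta> (e u \<otimes> e v) (y, x) = (if vtx y = u then \<delta> (e v) (y, x) else 0) + (if vtx x = v then \<delta> (e u) (y, x) else 0)"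
    if "u \<in> verts Q" "v \<in> verts Q" "y \<in> J" "x \<in> I" for u v y x
    using that d(3)[OF e_closed e_closed, OF that(1,2)]
    by (simp add: e_act[OF that(1) dM[OF that(2)]] e_act[OF that(2) dM[OF that(1)]])
  show "\<delta> (e w) = inner_der ?m (e w)"
  proof (rule ext, clarify)
    fix y x
    show "\<delta> (e w) (y, x) = inner_der ?m (e w) (y, x)"
    proof (cases "y \<in> J \<and> x \<in> I")
      case True
      then have vx: "vtx x \<in> verts Q" and vy: "vtx y \<in> verts Q" using vtx by auto
      show ?thesis
        using True ent[OF w w, of y x] ent[OF w vx, of y x] e_mult[OF w w] e_mult[OF w vx] d(6)
        by (auto simp: inner_der_def e_act[OF w mM] eq_neg_iff_add_eq_0 add.commute split: if_splits)
    next
      case False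
      then show ?thesis using out[OF w, of y x] by (auto simp: inner_der_def e_act[OF w mM])
    qed
  qed
qed

lemma derivation_fprod:
  assumes \<delta>: "derivation \<delta>" and b: "\<And>a. a \<in> arrows \<Longrightarrow> blk D a = \<delta> (ar a)"
  shows "set as \<subseteq> arrows \<Longrightarrow> \<delta> (fprod as) = dprod D as"
proof (induction as)
  case (Cons a as)
  note d = derivationD[OF \<delta>]
  have a: "a \<in> arrows" "star a \<in> arrows" using Cons.prems by auto
  have o: "\<delta> (opl a) = dopl D a" using a by (simp add: opl_def dopl_def d b)
  have "\<delta> (fac a) = dfac D a"
    using o derivation_inv[OF \<delta> unit[OF a(1), folded opl_def]] unfolding fac_def dfac_def by (cases a) simp_all
  then show ?case
    using Cons a by (simp only: dprod.simps fprod_simps d(3) fac_closed fprod_closed set_simps insert_subset)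
qed (simp add: derivationD[OF \<delta>])

end

section \<open>Universal properties\<close>

lemma path_algebra_induct:
  assumes x: "x \<in> carrier (path_algebra Q)" and "P 0"
    and add: "\<And>x y. \<lbrakk>x \<in> carrier (path_algebra Q); y \<in> carrier (path_algebra Q); P x; P y\<rbrakk> \<Longrightarrow> P (x + y)"
    and single: "\<And>p c. p \<in> qpaths Q \<Longrightarrow> P (Poly_Mapping.single p c)"
  shows "P x"
proof -
  have "sum f A \<in> carrier (path_algebra Q) \<and> P (sum f A)"
    if "finite A" "\<And>p. p \<in> A \<Longrightarrow> f p \<in> carrier (path_algebra Q) \<and> P (f p)" for A and f :: "_ \<Rightarrow> _ \<Rightarrow>\<^sub>0 _"
    using that
  proof (induction A)
    case empty
    then show ?case using \<open>P 0\<close> by (simp add: path_algebra_def)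
  next
    case (insert p A)
    then show ?case by (auto intro: add path_algebra_add_closed)
  qed
  note sum_closed = this
  have "p \<in> qpaths Q" if "p \<in> Poly_Mapping.keys x" for p using x that by (auto simp: path_algebra_def)
  then have "P (\<Sum>p\<in>Poly_Mapping.keys x. Poly_Mapping.single p (Poly_Mapping.lookup x p))"
    using sum_closed[of "Poly_Mapping.keys x" "\<lambda>p. Poly_Mapping.single p (Poly_Mapping.lookup x p)"]
    by (simp add: single path_algebra_single_closed)
  then show ?thesis by (simp only: pm_sum_single)
qed

lemma qpaths_Arrows_Cons:
  assumes "Arrows (a # as) \<in> qpaths Q" "as \<noteq> []"
  shows "a \<in> arcs Q" "Arrows as \<in> qpaths Q" "tail Q a = head Q (hd as)"
  using assms by (auto simp: qpaths_def successively_Cons)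

context k_algebra
begin

definition plin :: "('p \<Rightarrow> 'r) \<Rightarrow> ('p \<Rightarrow>\<^sub>0 'k) \<Rightarrow> 'r" where
  "plin pv x = (\<Oplus>p\<in>Poly_Mapping.keys x. \<eta> (Poly_Mapping.lookup x p) \<otimes> pv p)"

lemma plin_superset:
  assumes "finite S" "Poly_Mapping.keys x \<subseteq> S" "\<And>p. p \<in> S \<Longrightarrow> pv p \<in> carrier R"
  shows "plin pv x = (\<Oplus>p\<in>S. \<eta> (Poly_Mapping.lookup x p) \<otimes> pv p)"
  unfolding plin_def using assms
  by (intro add.finprod_mono_neutral_cong_left) (auto simp: in_keys_iff \<eta>_zero)

lemma plin_closed:
  assumes "\<And>p. p \<in> Poly_Mapping.keys x \<Longrightarrow> pv p \<in> carrier R"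
  shows "plin pv x \<in> carrier R"
  unfolding plin_def by (rule finsum_closed) (use assms in auto)

lemma plin_add:
  assumes "\<And>p. p \<in> Poly_Mapping.keys x \<union> Poly_Mapping.keys y \<Longrightarrow> pv p \<in> carrier R"
  shows "plin pv (x + y) = plin pv x \<oplus> plin pv y"
proof -
  let ?S = "Poly_Mapping.keys x \<union> Poly_Mapping.keys y"
  have "plin pv (x + y) = (\<Oplus>p\<in>?S. \<eta> (Poly_Mapping.lookup (x + y) p) \<otimes> pv p)"
    by (rule plin_superset) (use keys_add[of x y] assms in auto)
  also have "\<dots> = (\<Oplus>p\<in>?S. \<eta> (Poly_Mapping.lookup x p) \<otimes> pv p \<oplus> \<eta> (Poly_Mapping.lookup y p) \<otimes> pv p)"
    by (rule finsum_cong'[OF refl]) (use assms in \<open>auto simp: lookup_add \<eta>_add l_distr\<close>)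
  also have "\<dots> = (\<Oplus>p\<in>?S. \<eta> (Poly_Mapping.lookup x p) \<otimes> pv p) \<oplus> (\<Oplus>p\<in>?S. \<eta> (Poly_Mapping.lookup y p) \<otimes> pv p)"
    by (rule finsum_addf) (use assms in auto)
  also have "\<dots> = plin pv x \<oplus> plin pv y"
    by (intro arg_cong2[of _ _ _ _ "(\<oplus>)"] plin_superset[symmetric]) (use assms in auto)
  finally show ?thesis .
qed

lemma plin_single: "pv p \<in> carrier R \<Longrightarrow> plin pv (Poly_Mapping.single p c) = \<eta> c \<otimes> pv p"
  using plin_superset[of "{p}" "Poly_Mapping.single p c" pv] finsum_insert[of "{}" p "\<lambda>_. \<eta> c \<otimes> pv p"]
  by simp

lemma plin_zero: "plin pv 0 = \<zero>"
  by (simp add: plin_def)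

lemma scalar_mult_swap:
  "\<lbrakk>x \<in> carrier R; y \<in> carrier R\<rbrakk> \<Longrightarrow> \<eta> c \<otimes> x \<otimes> (\<eta> d \<otimes> y) = \<eta> (c * d) \<otimes> (x \<otimes> y)"
proof -
  assume xy: "x \<in> carrier R" "y \<in> carrier R"
  have "\<eta> c \<otimes> x \<otimes> (\<eta> d \<otimes> y) = \<eta> c \<otimes> (x \<otimes> \<eta> d) \<otimes> y" using xy by (simp add: m_assoc)
  also have "x \<otimes> \<eta> d = \<eta> d \<otimes> x" using \<eta>_central[OF xy(1)] by simp
  finally show ?thesis using xy by (simp add: \<eta>_mult m_assoc)
qed

fun pval :: "('v \<Rightarrow> 'r) \<Rightarrow> ('e \<Rightarrow> 'r) \<Rightarrow> ('v, 'e) qpath \<Rightarrow> 'r" where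
  "pval e ar (Triv v) = e v"
| "pval e ar (Arrows as) = foldr (\<lambda>a z. ar a \<otimes> z) as \<one>"

text \<open>The universal property of the path algebra. For paths that do not compose, the
  idempotents at the tail of the first and the head of the second can be inserted between their
  values, and these are orthogonal. The sum of the idempotents being one gives the unit.\<close>

lemma path_algebra_lift:
  fixes Q :: "('v, 'e) pre_digraph" and e :: "'v \<Rightarrow> 'r" and ar :: "'e \<Rightarrow> 'r"
  assumes Q: "fin_digraph Q"
    and e: "\<And>v. v \<in> verts Q \<Longrightarrow> e v \<in> carrier R" and ar: "\<And>a. a \<in> arcs Q \<Longrightarrow> ar a \<in> carrier R"
    and ee: "\<And>v w. \<lbrakk>v \<in> verts Q; w \<in> verts Q\<rbrakk> \<Longrightarrow> e v \<otimes> e w = (if v = w then e v else \<zero>)"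
    and ha: "\<And>a. a \<in> arcs Q \<Longrightarrow> e (head Q a) \<otimes> ar a = ar a"
    and ta: "\<And>a. a \<in> arcs Q \<Longrightarrow> ar a \<otimes> e (tail Q a) = ar a"
    and one: "(\<Oplus>v\<in>verts Q. e v) = \<one>"
  shows "plin (pval e ar) \<in> Ring.ring_hom (path_algebra Q) R"
    "x \<in> carrier (path_algebra Q) \<Longrightarrow>
      plin (pval e ar) (Poly_Mapping.map ((*) c) x) = \<eta> c \<otimes> plin (pval e ar) x"
    "p \<in> qpaths Q \<Longrightarrow> plin (pval e ar) (Poly_Mapping.single p c) = \<eta> c \<otimes> pval e ar p"
proof -
  interpret Q: fin_digraph Q by fact
  let ?A = "path_algebra Q :: (('v, 'e) qpath \<Rightarrow>\<^sub>0 'k) ring"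
  let ?\<psi> = "plin (pval e ar)"
  let ?f = "\<lambda>as. foldr (\<lambda>a z. ar a \<otimes> z) as \<one>"
  have fc: "?f as \<in> carrier R" if "set as \<subseteq> arcs Q" for as using that by (induction as) (auto simp: ar)
  have pc: "pval e ar p \<in> carrier R" if "p \<in> qpaths Q" for p
    using that fc by (auto simp: qpaths_def e)
  have keys: "p \<in> qpaths Q" if "x \<in> carrier ?A" "p \<in> Poly_Mapping.keys x" for x p
    using that by (auto simp: path_algebra_def)
  have \<psi>c: "?\<psi> x \<in> carrier R" if "x \<in> carrier ?A" for x
    by (rule plin_closed) (use pc keys[OF that] in blast)
  have \<psi>add: "?\<psi> (x + y) = ?\<psi> x \<oplus> ?\<psi> y" if "x \<in> carrier ?A" "y \<in> carrier ?A" for x y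
    by (rule plin_add) (use pc keys that in blast)
  have \<psi>s: "?\<psi> (Poly_Mapping.single p c) = \<eta> c \<otimes> pval e ar p" if "p \<in> qpaths Q" for p c
    by (rule plin_single) (rule pc[OF that])
  have f_app: "?f (as @ bs) = ?f as \<otimes> ?f bs" if "set as \<subseteq> arcs Q" "set bs \<subseteq> arcs Q" for as bs
    using that by (induction as) (auto simp: fc ar m_assoc)
  have hd: "qpath_head Q p \<in> verts Q" "e (qpath_head Q p) \<otimes> pval e ar p = pval e ar p"
    and tl: "qpath_tail Q p \<in> verts Q" "pval e ar p \<otimes> e (qpath_tail Q p) = pval e ar p"
    if p: "p \<in> qpaths Q" for p
  proof -
    have "qpath_head Q p \<in> verts Q \<and> e (qpath_head Q p) \<otimes> pval e ar p = pval e ar p"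
    proof (cases p)
      case (Arrows as)
      then obtain a bs where as: "as = a # bs" "a \<in> arcs Q" "set bs \<subseteq> arcs Q"
        using p by (cases as) (auto simp: qpaths_def)
      have "e (head Q a) \<otimes> (ar a \<otimes> ?f bs) = e (head Q a) \<otimes> ar a \<otimes> ?f bs"
        using as e[OF Q.head_in_verts[OF as(2)]] by (simp add: m_assoc ar fc)
      then show ?thesis using as Arrows ha by simp
    qed (use p ee in \<open>auto simp: qpaths_def\<close>)
    moreover have "qpath_tail Q p \<in> verts Q \<and> pval e ar p \<otimes> e (qpath_tail Q p) = pval e ar p"
    proof (cases p)
      case (Arrows as)
      then obtain a bs where as: "as = bs @ [a]" "a \<in> arcs Q" "set bs \<subseteq> arcs Q"
        using p by (cases as rule: rev_cases) (auto simp: qpaths_def)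
      have "?f as = ?f bs \<otimes> ar a" using f_app[of bs "[a]"] as by (simp add: ar)
      then show ?thesis
        using as Arrows ta e[OF Q.tail_in_verts[OF as(2)]] by (simp add: m_assoc ar fc)
    qed (use p ee in \<open>auto simp: qpaths_def\<close>)
    ultimately show "qpath_head Q p \<in> verts Q" "e (qpath_head Q p) \<otimes> pval e ar p = pval e ar p"
      "qpath_tail Q p \<in> verts Q" "pval e ar p \<otimes> e (qpath_tail Q p) = pval e ar p" by auto
  qed
  have comp: "pval e ar p \<otimes> pval e ar p' =
      (if qpath_tail Q p = qpath_head Q p' then pval e ar (qpath_comp p p') else \<zero>)"
    if p: "p \<in> qpaths Q" and p': "p' \<in> qpaths Q" for p p'
  proof (cases "qpath_tail Q p = qpath_head Q p'")
    case True
    then show ?thesis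
      using hd(2)[OF p'] tl(2)[OF p] p p'
      by (cases p; cases p') (auto simp: qpaths_def f_app simp del: foldr_append)
  next
    case False
    have "pval e ar p \<otimes> pval e ar p' = pval e ar p \<otimes> e (qpath_tail Q p) \<otimes> (e (qpath_head Q p') \<otimes> pval e ar p')"
      by (simp add: hd(2)[OF p'] tl(2)[OF p])
    also have "\<dots> = pval e ar p \<otimes> (e (qpath_tail Q p) \<otimes> e (qpath_head Q p')) \<otimes> pval e ar p'"
      using pc[OF p] pc[OF p'] e[OF tl(1)[OF p]] e[OF hd(1)[OF p']] by (simp add: m_assoc)
    also have "\<dots> = \<zero>" using False pc[OF p] pc[OF p'] by (simp add: ee hd(1)[OF p'] tl(1)[OF p])
    finally show ?thesis using False by simp
  qed
  have zA: "0 \<in> carrier ?A" by (simp add: path_algebra_def)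
  have \<psi>mult: "?\<psi> (path_mult Q x y) = ?\<psi> x \<otimes> ?\<psi> y" if x: "x \<in> carrier ?A" and y: "y \<in> carrier ?A" for x y
    using x
  proof (rule path_algebra_induct)
    show "?\<psi> (path_mult Q 0 y) = ?\<psi> 0 \<otimes> ?\<psi> y" using \<psi>c[OF y] by (simp add: plin_zero)
    show "?\<psi> (path_mult Q (x + x') y) = ?\<psi> (x + x') \<otimes> ?\<psi> y"
      if "x \<in> carrier ?A" "x' \<in> carrier ?A" "?\<psi> (path_mult Q x y) = ?\<psi> x \<otimes> ?\<psi> y"
        "?\<psi> (path_mult Q x' y) = ?\<psi> x' \<otimes> ?\<psi> y" for x x'
      using that y by (simp add: path_mult_add_left \<psi>add \<psi>c l_distr path_algebra_mult_closed)
    show "?\<psi> (path_mult Q (Poly_Mapping.single p c) y) = ?\<psi> (Poly_Mapping.single p c) \<otimes> ?\<psi> y"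
      if p: "p \<in> qpaths Q" for p c
      using y
    proof (rule path_algebra_induct)
      show "?\<psi> (path_mult Q (Poly_Mapping.single p c) 0) = ?\<psi> (Poly_Mapping.single p c) \<otimes> ?\<psi> 0"
        using \<psi>c[OF path_algebra_single_closed[OF p]] by (simp add: plin_zero)
      show "?\<psi> (path_mult Q (Poly_Mapping.single p c) (y + y')) =
          ?\<psi> (Poly_Mapping.single p c) \<otimes> ?\<psi> (y + y')"
        if "y \<in> carrier ?A" "y' \<in> carrier ?A"
          "?\<psi> (path_mult Q (Poly_Mapping.single p c) y) = ?\<psi> (Poly_Mapping.single p c) \<otimes> ?\<psi> y"
          "?\<psi> (path_mult Q (Poly_Mapping.single p c) y') = ?\<psi> (Poly_Mapping.single p c) \<otimes> ?\<psi> y'" for y y'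
        using that path_algebra_single_closed[OF p, of c]
        by (simp add: path_mult_add_right \<psi>add \<psi>c r_distr path_algebra_mult_closed)
      show "?\<psi> (path_mult Q (Poly_Mapping.single p c) (Poly_Mapping.single p' d)) =
          ?\<psi> (Poly_Mapping.single p c) \<otimes> ?\<psi> (Poly_Mapping.single p' d)"
        if p': "p' \<in> qpaths Q" for p' d
      proof -
        have "?\<psi> (Poly_Mapping.single p c) \<otimes> ?\<psi> (Poly_Mapping.single p' d) =
           \<eta> (c * d) \<otimes> (pval e ar p \<otimes> pval e ar p')"
          by (simp add: \<psi>s p p' scalar_mult_swap pc)
        then show ?thesis
          using qpath_comp_props(1)[OF p p'] by (simp add: path_mult_single comp p p' \<psi>s plin_zero)
      qed
    qed
  qed
  have \<psi>one: "?\<psi> (\<Sum>v\<in>S. Poly_Mapping.single (Triv v) 1) = (\<Oplus>v\<in>S. e v)" if "S \<subseteq> verts Q" for S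
    using finite_subset[OF that Q.finite_verts] that
  proof (induction S rule: finite_induct)
    case (insert v S)
    have t: "Triv w \<in> qpaths Q" if "w \<in> insert v S" for w using insert.prems that by (auto simp: qpaths_def)
    have "(\<Sum>v\<in>S. Poly_Mapping.single (Triv v) 1) \<in> carrier ?A"
      by (intro path_algebra_sum_closed path_algebra_single_closed t) auto
    then have "?\<psi> (Poly_Mapping.single (Triv v) 1 + (\<Sum>v\<in>S. Poly_Mapping.single (Triv v) 1)) = e v \<oplus> (\<Oplus>v\<in>S. e v)"
      using insert t by (simp add: \<psi>add path_algebra_single_closed \<psi>s \<eta>_one e)
    moreover have "(\<Oplus>v\<in>insert v S. e v) = e v \<oplus> (\<Oplus>v\<in>S. e v)"
      by (rule finsum_insert) (use insert e in auto)
    ultimately show ?case using insert by simp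
  qed (simp add: plin_zero)
  show "plin (pval e ar) (Poly_Mapping.single p c) = \<eta> c \<otimes> pval e ar p" if "p \<in> qpaths Q"
    by (rule \<psi>s[OF that])
  show "?\<psi> \<in> Ring.ring_hom ?A R"
  proof (rule ring_hom_memI)
    show "?\<psi> \<one>\<^bsub>?A\<^esub> = \<one>" using \<psi>one[OF order_refl] one by (simp add: path_algebra_def)
    show "?\<psi> (x \<otimes>\<^bsub>?A\<^esub> y) = ?\<psi> x \<otimes> ?\<psi> y" if "x \<in> carrier ?A" "y \<in> carrier ?A" for x y
      using \<psi>mult[OF that] by (simp add: path_algebra_def)
    show "?\<psi> (x \<oplus>\<^bsub>?A\<^esub> y) = ?\<psi> x \<oplus> ?\<psi> y" if "x \<in> carrier ?A" "y \<in> carrier ?A" for x y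
      using \<psi>add[OF that] by (simp add: path_algebra_def)
  qed (rule \<psi>c)
  show "?\<psi> (Poly_Mapping.map ((*) c) x) = \<eta> c \<otimes> ?\<psi> x" if x: "x \<in> carrier ?A"
    using x
  proof (rule path_algebra_induct)
    have m0: "Poly_Mapping.map ((*) c) 0 = 0" by (rule poly_mapping_eqI) (simp add: map.rep_eq)
    show "?\<psi> (Poly_Mapping.map ((*) c) 0) = \<eta> c \<otimes> ?\<psi> 0" by (simp add: m0 plin_zero)
    have madd: "Poly_Mapping.map ((*) c) (x + y) = Poly_Mapping.map ((*) c) x + Poly_Mapping.map ((*) c) y"
      for x y :: "('v, 'e) qpath \<Rightarrow>\<^sub>0 'k"
      by (rule poly_mapping_eqI) (auto simp: map.rep_eq lookup_add when_def distrib_left[symmetric])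
    show "?\<psi> (Poly_Mapping.map ((*) c) (x + y)) = \<eta> c \<otimes> ?\<psi> (x + y)"
      if "x \<in> carrier ?A" "y \<in> carrier ?A" "?\<psi> (Poly_Mapping.map ((*) c) x) = \<eta> c \<otimes> ?\<psi> x"
        "?\<psi> (Poly_Mapping.map ((*) c) y) = \<eta> c \<otimes> ?\<psi> y" for x y
      using that by (simp add: madd \<psi>add path_algebra_scale_closed \<psi>c r_distr)
    have ms: "Poly_Mapping.map ((*) c) (Poly_Mapping.single p d) = Poly_Mapping.single p (c * d)"
      for p :: "('v, 'e) qpath" and d
      by (rule poly_mapping_eqI) (simp add: map.rep_eq lookup_single when_def)
    show "?\<psi> (Poly_Mapping.map ((*) c) (Poly_Mapping.single p d)) = \<eta> c \<otimes> ?\<psi> (Poly_Mapping.single p d)"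
      if "p \<in> qpaths Q" for p d
      using that pc by (simp add: ms \<psi>s \<eta>_mult m_assoc)
  qed
qed

end

section \<open>The multiplicative preprojective algebra as a quiver algebra\<close>

definition mpa_vert ::
    "('v, 'e) pre_digraph \<Rightarrow> 'e darrow rel \<Rightarrow> ('v \<Rightarrow> 'k::field) \<Rightarrow> 'v \<Rightarrow> ('v, 'e, 'k) mpa" where
  "mpa_vert Q r q v = mpa_map Q r q (Poly_Mapping.single (Triv v) 1)"

definition mpa_arrow ::
    "('v, 'e) pre_digraph \<Rightarrow> 'e darrow rel \<Rightarrow> ('v \<Rightarrow> 'k::field) \<Rightarrow> 'e darrow \<Rightarrow> ('v, 'e, 'k) mpa" where
  "mpa_arrow Q r q a = mpa_map Q r q (Poly_Mapping.single (Arrows [a]) 1)"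

lemma qpaths_double:
  "v \<in> verts Q \<Longrightarrow> Triv v \<in> qpaths (double Q)" "a \<in> arcs (double Q) \<Longrightarrow> Arrows [a] \<in> qpaths (double Q)"
  by (auto simp: qpaths_def)

lemma mpa_target_k_algebra: "mpa_target Q r q R \<eta> \<psi> \<Longrightarrow> k_algebra R \<eta>"
  by (simp add: mpa_target_def k_algebra_def k_algebra_axioms_def)

lemma q_elem_mult:
  assumes "fin_digraph Q"
  shows "path_mult (double Q) (q_elem Q q) (q_elem Q q') = q_elem Q (\<lambda>v. q v * q' v)"
    "v \<in> verts Q \<Longrightarrow> path_mult (double Q) (q_elem Q q) (Poly_Mapping.single (Triv v) c) = Poly_Mapping.single (Triv v) (q v * c)"
    "v \<in> verts Q \<Longrightarrow> path_mult (double Q) (Poly_Mapping.single (Triv v) c) (q_elem Q q) = Poly_Mapping.single (Triv v) (c * q v)"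
proof -
  interpret fin_digraph Q by fact
  show l: "path_mult (double Q) (q_elem Q q) (Poly_Mapping.single (Triv v) c) = Poly_Mapping.single (Triv v) (q v * c)"
    if "v \<in> verts Q" for v c
  proof -
    have "path_mult (double Q) (q_elem Q q) (Poly_Mapping.single (Triv v) c) =
        (\<Sum>w\<in>verts Q. if w = v then Poly_Mapping.single (Triv v) (q v * c) else 0)"
      unfolding q_elem_def path_mult_sum_left by (rule sum.cong) (auto simp: path_mult_single)
    then show ?thesis using that by simp
  qed
  show "path_mult (double Q) (Poly_Mapping.single (Triv v) c) (q_elem Q q) = Poly_Mapping.single (Triv v) (c * q v)"
    if "v \<in> verts Q" for v c
  proof -
    have "path_mult (double Q) (Poly_Mapping.single (Triv v) c) (q_elem Q q) =
        (\<Sum>w\<in>verts Q. if w = v then Poly_Mapping.single (Triv v) (c * q v) else 0)"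
      unfolding q_elem_def path_mult_sum_right by (rule sum.cong) (auto simp: path_mult_single)
    then show ?thesis using that by simp
  qed
  show "path_mult (double Q) (q_elem Q q) (q_elem Q q') = q_elem Q (\<lambda>v. q v * q' v)"
    unfolding q_elem_def[of Q q'] path_mult_sum_right
    by (simp add: l q_elem_def[of Q "\<lambda>v. q v * q' v"])
qed

text \<open>The algebra is a quotient of a free algebra on symbols \<open>Base x\<close> and
  \<open>Inv a\<close>. The image of \<open>Base x\<close> is a combination of products of arrows
  and of vertices, and that of \<open>Inv a\<close> is the inverse of the unit belonging to
  \<open>a\<close>, for which the case of inverses is there.\<close>

lemma mpa_induct:
  fixes Q :: "('v, 'e) pre_digraph" and q :: "'v \<Rightarrow> 'k::field"
  assumes as: "fin_digraph Q" "linear_order_on (arcs (double Q)) r"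
    and a: "a \<in> carrier (mpa Q r q)"
    and scal: "\<And>c. P (mpa_scalar Q r q c)"
    and vert: "\<And>v. v \<in> verts Q \<Longrightarrow> P (mpa_vert Q r q v)"
    and arrow: "\<And>a. a \<in> arcs (double Q) \<Longrightarrow> P (mpa_arrow Q r q a)"
    and add: "\<And>a b. \<lbrakk>a \<in> carrier (mpa Q r q); b \<in> carrier (mpa Q r q); P a; P b\<rbrakk> \<Longrightarrow> P (a \<oplus>\<^bsub>mpa Q r q\<^esub> b)"
    and mult: "\<And>a b. \<lbrakk>a \<in> carrier (mpa Q r q); b \<in> carrier (mpa Q r q); P a; P b\<rbrakk> \<Longrightarrow> P (a \<otimes>\<^bsub>mpa Q r q\<^esub> b)"
    and inv: "\<And>a. \<lbrakk>a \<in> Units (mpa Q r q); P a\<rbrakk> \<Longrightarrow> P (inv\<^bsub>mpa Q r q\<^esub> a)"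
  shows "P a"
proof -
  let ?F = "free_algebra (mpa_gens Q) :: ('v, 'e, 'k) mpa_free ring" and ?L = "mpa Q r q" and ?D = "double Q"
  let ?A = "path_algebra ?D :: ('v, 'e, 'k) dpath_alg ring"
  let ?\<phi> = "mpa_map Q r q" and ?\<eta> = "mpa_scalar Q r q"
  interpret F: ring ?F by (rule ring_free_algebra)
  interpret L: ring ?L by (rule ring_mpa[OF as])
  interpret A: ring ?A by (intro ring_path_algebra double_fin_digraph as)
  interpret I: ideal "mpa_ideal Q r q" ?F by (rule ideal_mpa[OF as])
  note target = mpa_is_target[OF as, of q]
  have \<phi>: "?\<phi> \<in> Ring.ring_hom ?A ?L"
    and lin: "\<And>c x. x \<in> carrier ?A \<Longrightarrow> ?\<phi> (Poly_Mapping.map ((*) c) x) = ?\<eta> c \<otimes>\<^bsub>?L\<^esub> ?\<phi> x"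
    and unit: "\<And>a. a \<in> arcs ?D \<Longrightarrow> ?\<phi> (one_plus Q a) \<in> Units ?L"
    and \<eta>: "?\<eta> \<in> Ring.ring_hom class_ring ?L"
    using target unfolding mpa_target_def by auto
  have \<eta>c: "?\<eta> c \<in> carrier ?L" for c using ring_hom_closed[OF \<eta>] by simp
  define \<pi> where "\<pi> = (+>\<^bsub>?F\<^esub>) (mpa_ideal Q r q)"
  have \<pi>: "\<pi> \<in> Ring.ring_hom ?F ?L" unfolding \<pi>_def mpa_def by (rule I.rcos_ring_hom)
  note fs = free_algebra_def partial_object.simps monoid.simps ring.simps
  have \<pi>c: "\<pi> x \<in> carrier ?L" if "x \<in> carrier ?F" for x using ring_hom_closed[OF \<pi> that] .
  have \<pi>add: "\<pi> (x + y) = \<pi> x \<oplus>\<^bsub>?L\<^esub> \<pi> y" if "x \<in> carrier ?F" "y \<in> carrier ?F" for x y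
    using ring_hom_add[OF \<pi> that] by (simp add: fs)
  have \<pi>mult: "\<pi> (x * y) = \<pi> x \<otimes>\<^bsub>?L\<^esub> \<pi> y" if "x \<in> carrier ?F" "y \<in> carrier ?F" for x y
    using ring_hom_mult[OF \<pi> that] by (simp add: fs)
  have \<phi>\<pi>: "?\<phi> x = \<pi> (gen (Base x))" for x by (simp add: mpa_map_def \<pi>_def)
  have \<eta>\<pi>: "?\<eta> c = \<pi> (scal c)" for c by (simp add: mpa_scalar_def \<pi>_def)
  have single: "Poly_Mapping.single p c = Poly_Mapping.map ((*) c) (Poly_Mapping.single p 1)"
    for p :: "('v, 'e darrow) qpath" and c :: 'k
    by (rule poly_mapping_eqI) (simp add: map.rep_eq lookup_single when_def)
  have Ps: "P (?\<phi> (Poly_Mapping.single p 1))" if "p \<in> qpaths ?D" for p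
  proof (cases p)
    case (Triv v)
    then show ?thesis using vert that by (auto simp: mpa_vert_def qpaths_def)
  next
    case (Arrows as)
    have "P (?\<phi> (Poly_Mapping.single (Arrows as) 1))" if "Arrows as \<in> qpaths ?D" for as
      using that
    proof (induction as)
      case (Cons a as)
      show ?case
      proof (cases "as = []")
        case True
        then show ?thesis using arrow Cons.prems by (auto simp: mpa_arrow_def qpaths_def)
      next
        case False
        note q = qpaths_Arrows_Cons[OF Cons.prems False]
        have m: "Poly_Mapping.single (Arrows [a]) 1 \<otimes>\<^bsub>?A\<^esub> Poly_Mapping.single (Arrows as) (1::'k) =
           Poly_Mapping.single (Arrows (a # as)) 1"
          using q(3) by (simp add: path_algebra_def path_mult_single)
        have c: "Poly_Mapping.single (Arrows [a]) 1 \<in> carrier ?A" "Poly_Mapping.single (Arrows as) 1 \<in> carrier ?A"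
          by (rule path_algebra_single_closed[OF qpaths_double(2)[OF q(1)]])
            (rule path_algebra_single_closed[OF q(2)])
        have "?\<phi> (Poly_Mapping.single (Arrows (a # as)) 1) =
            mpa_arrow Q r q a \<otimes>\<^bsub>?L\<^esub> ?\<phi> (Poly_Mapping.single (Arrows as) 1)"
          using ring_hom_mult[OF \<phi> c] unfolding m mpa_arrow_def .
        then show ?thesis
          using Cons.IH[OF q(2)] arrow[OF q(1)] ring_hom_closed[OF \<phi> c(1)] ring_hom_closed[OF \<phi> c(2)]
          by (simp add: mult mpa_arrow_def)
      qed
    qed (auto simp: qpaths_def)
    then show ?thesis using that Arrows by simp
  qed
  \<comment> \<open>The empty combination of paths has the same image as the scalar
    \<open>0\<close>, so the scalar case covers it.\<close>
  have zero: "?\<phi> 0 = ?\<eta> 0"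
  proof -
    have z: "0 \<in> carrier ?A" by (simp add: path_algebra_def)
    have "0 \<oplus>\<^bsub>?A\<^esub> (0 :: ('v, 'e, 'k) dpath_alg) = 0" by (simp add: path_algebra_def)
    then have "?\<phi> 0 \<oplus>\<^bsub>?L\<^esub> ?\<phi> 0 = ?\<phi> 0" using ring_hom_add[OF \<phi> z z] by simp
    moreover have "?\<eta> 0 \<oplus>\<^bsub>?L\<^esub> ?\<eta> 0 = ?\<eta> 0" using ring_hom_add[OF \<eta>, of 0 0] by simp
    ultimately show ?thesis
      using ring_hom_closed[OF \<phi> z] \<eta>c[of 0] L.add_eq_self_iff by metis
  qed
  have PB: "P (?\<phi> x)" if x: "x \<in> carrier ?A" for x
    using x
  proof (rule path_algebra_induct)
    show "P (?\<phi> 0)" unfolding zero by (rule scal)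
    show "P (?\<phi> (x + y))" if "x \<in> carrier ?A" "y \<in> carrier ?A" "P (?\<phi> x)" "P (?\<phi> y)" for x y
    proof -
      have "?\<phi> (x + y) = ?\<phi> x \<oplus>\<^bsub>?L\<^esub> ?\<phi> y"
        using ring_hom_add[OF \<phi> that(1,2)] by (simp add: path_algebra_def)
      then show ?thesis using that ring_hom_closed[OF \<phi>] by (simp add: add)
    qed
    show "P (?\<phi> (Poly_Mapping.single p c))" if p: "p \<in> qpaths ?D" for p c
    proof -
      have c: "Poly_Mapping.single p (1::'k) \<in> carrier ?A" by (rule path_algebra_single_closed[OF p])
      show ?thesis unfolding single[of p c] lin[OF c]
        by (rule mult[OF \<eta>c ring_hom_closed[OF \<phi> c] scal Ps[OF p]])
    qed
  qed
  obtain x where x: "x \<in> carrier ?F" "a = \<pi> x"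
    using a by (auto simp: mpa_def FactRing_def A_RCOSETS_def' \<pi>_def)
  have "P (\<pi> x)"
    using x(1)
  proof (rule free_algebra_induct)
    show "P (\<pi> (scal c))" for c using scal[of c] by (simp add: \<eta>\<pi>)
    show "P (\<pi> (gen g))" if "g \<in> mpa_gens Q" for g
      using that unfolding mpa_gens_def
    proof (elim UnE imageE)
      show "P (\<pi> (gen g))" if "g = Base y" "y \<in> carrier ?A" for y
        using PB[OF that(2)] that by (simp add: \<phi>\<pi>)
      show "P (\<pi> (gen g))" if g: "g = Inv b" and b: "b \<in> arcs ?D" for b
      proof -
        have ic: "gen (Inv b) \<in> carrier ?F" by (rule mpa_gens_closed(2)[OF b])
        have oc: "one_plus Q b \<in> carrier ?A" by (rule dpath_closed(1)[OF as(1) b])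
        note bc = mpa_gens_closed(1)[OF oc]
        have "gen (Inv b) * gen (Base (one_plus Q b)) - 1 \<in> mpa_rels Q r q"
          using b unfolding mpa_rels_def Let_def by blast
        then have "\<pi> (gen (Inv b) * gen (Base (one_plus Q b))) = \<pi> 1"
          unfolding \<pi>_def using mpa_rel_eq[OF as _ free_algebra_closed(6)[OF ic bc] free_algebra_closed(2)] by blast
        moreover have "\<pi> 1 = \<one>\<^bsub>?L\<^esub>" using ring_hom_one[OF \<pi>] by (simp add: fs)
        ultimately have "\<pi> (gen (Inv b)) \<otimes>\<^bsub>?L\<^esub> ?\<phi> (one_plus Q b) = \<one>\<^bsub>?L\<^esub>"
          by (simp add: \<pi>mult[OF ic bc] \<phi>\<pi>)
        then have "inv\<^bsub>?L\<^esub> ?\<phi> (one_plus Q b) = \<pi> (gen (Inv b))"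
          using L.inv_unique[OF _ L.Units_r_inv[OF unit[OF b]] ring_hom_closed[OF \<phi> oc] \<pi>c[OF ic]
              L.Units_inv_closed[OF unit[OF b]]] by simp
        then show ?thesis using inv[OF unit[OF b] PB[OF oc]] g by simp
      qed
    qed
    show "P (\<pi> (x + y))" if "x \<in> carrier ?F" "y \<in> carrier ?F" "P (\<pi> x)" "P (\<pi> y)" for x y
      using that by (simp add: \<pi>add \<pi>c add)
    show "P (\<pi> (x * y))" if "x \<in> carrier ?F" "y \<in> carrier ?F" "P (\<pi> x)" "P (\<pi> y)" for x y
      using that by (simp add: \<pi>mult \<pi>c mult)
  qed
  then show ?thesis using x(2) by simp
qed

lemma mpa_sum_vert:
  fixes Q :: "('v, 'e) pre_digraph" and q :: "'v \<Rightarrow> 'k::field"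
  assumes as: "fin_digraph Q" "linear_order_on (arcs (double Q)) r"
  shows "(\<Oplus>\<^bsub>mpa Q r q\<^esub>v\<in>verts Q. mpa_vert Q r q v) = \<one>\<^bsub>mpa Q r q\<^esub>"
    (is "(\<Oplus>\<^bsub>?L\<^esub>v\<in>verts Q. ?e v) = _")
proof -
  interpret F: fin_digraph Q by (rule as)
  let ?A = "path_algebra (double Q) :: ('v, 'e, 'k) dpath_alg ring"
  have \<phi>: "mpa_map Q r q \<in> Ring.ring_hom ?A ?L"
    using mpa_is_target[OF as, of q] unfolding mpa_target_def by auto
  interpret k_algebra ?L "mpa_scalar Q r q"
    by (rule mpa_target_k_algebra[OF mpa_is_target[OF as]])
  have t: "Poly_Mapping.single (Triv v) 1 \<in> carrier ?A" if "v \<in> verts Q" for v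
    using that by (intro path_algebra_single_closed qpaths_double)
  have ec: "?e v \<in> carrier ?L" if "v \<in> verts Q" for v
    using ring_hom_closed[OF \<phi> t[OF that]] by (simp add: mpa_vert_def)
  have S: "S \<subseteq> verts Q \<Longrightarrow> S \<noteq> {} \<Longrightarrow>
      mpa_map Q r q (\<Sum>v\<in>S. Poly_Mapping.single (Triv v) 1) = (\<Oplus>\<^bsub>?L\<^esub>v\<in>S. ?e v)" if "finite S" for S
    using that
  proof (induction S rule: finite_induct)
    case (insert v S)
    have i: "(\<Oplus>\<^bsub>?L\<^esub>v\<in>insert v S. ?e v) = ?e v \<oplus>\<^bsub>?L\<^esub> (\<Oplus>\<^bsub>?L\<^esub>v\<in>S. ?e v)"
      by (rule finsum_insert) (use insert ec in auto)
    show ?case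
    proof (cases "S = {}")
      case True
      then show ?thesis using insert.prems ec by (simp add: mpa_vert_def)
    next
      case False
      have "(\<Sum>v\<in>S. Poly_Mapping.single (Triv v) 1) \<in> carrier ?A"
        using insert.prems by (intro path_algebra_sum_closed t) auto
      from ring_hom_add[OF \<phi> t[of v] this] show ?thesis
        using insert False by (simp add: i[unfolded mpa_vert_def] mpa_vert_def path_algebra_def)
    qed
  qed simp
  show ?thesis
  proof (cases "verts Q = {}")
    case True
    \<comment> \<open>Without vertices the unit of the path algebra is the empty sum. It is
      idempotent for addition, so the unit of the quotient is zero, as is the empty sum
      there.\<close>
    have "\<one>\<^bsub>?A\<^esub> \<oplus>\<^bsub>?A\<^esub> \<one>\<^bsub>?A\<^esub> = \<one>\<^bsub>?A\<^esub>" using True by (simp add: path_algebra_def)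
    moreover have "\<one>\<^bsub>?A\<^esub> \<in> carrier ?A" using True by (simp add: path_algebra_def)
    ultimately have "\<one>\<^bsub>?L\<^esub> \<oplus>\<^bsub>?L\<^esub> \<one>\<^bsub>?L\<^esub> = \<one>\<^bsub>?L\<^esub>"
      using ring_hom_add[OF \<phi>, of "\<one>\<^bsub>?A\<^esub>" "\<one>\<^bsub>?A\<^esub>"] ring_hom_one[OF \<phi>] by simp
    then have "\<one>\<^bsub>?L\<^esub> = \<zero>\<^bsub>?L\<^esub>" using add_eq_self_iff[of "\<one>\<^bsub>?L\<^esub>" "\<one>\<^bsub>?L\<^esub>"] by simp
    then show ?thesis using True by simp
  next
    case False
    then show ?thesis
      using S[OF F.finite_verts order_refl] ring_hom_one[OF \<phi>] by (simp add: path_algebra_def)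
  qed
qed

text \<open>The products of vertices and arrows are computed in the path algebra of the double;
  units and relation are imposed. The right-hand side of the relation is inverted by the combination
  with coefficients \<open>inverse (q v)\<close>, and here all \<open>q v\<close> have to be
  nonzero.\<close>

theorem quiver_algebra_mpa:
  fixes Q :: "('v, 'e) pre_digraph" and q :: "'v \<Rightarrow> 'k::field"
  assumes as: "fin_digraph Q" "linear_order_on (arcs (double Q)) r" and q: "\<forall>v\<in>verts Q. q v \<noteq> 0"
  shows "quiver_algebra (mpa Q r q) (mpa_scalar Q r q) Q (mpa_vert Q r q) (mpa_arrow Q r q)
     (enum_by r (arcs (double Q))) (mpa_map Q r q (q_elem Q q))
     (mpa_map Q r q (q_elem Q (\<lambda>v. inverse (q v))))"
proof -
  let ?L = "mpa Q r q" and ?D = "double Q" and ?\<phi> = "mpa_map Q r q" and ?\<eta> = "mpa_scalar Q r q"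
  let ?A = "path_algebra ?D :: ('v, 'e, 'k) dpath_alg ring"
  let ?e = "mpa_vert Q r q" and ?ar = "mpa_arrow Q r q"
  let ?te = "\<lambda>v. Poly_Mapping.single (Triv v) 1 :: ('v, 'e, 'k) dpath_alg"
  let ?ta = "\<lambda>a. Poly_Mapping.single (Arrows [a]) 1 :: ('v, 'e, 'k) dpath_alg"
  note target = mpa_is_target[OF as, of q]
  interpret K: k_algebra ?L ?\<eta> by (rule mpa_target_k_algebra[OF target])
  have \<phi>: "?\<phi> \<in> Ring.ring_hom ?A ?L"
    and unit: "\<And>a. a \<in> arcs ?D \<Longrightarrow> ?\<phi> (one_plus Q a) \<in> Units ?L"
    and rel: "foldr (\<lambda>a z. (case a of Orig _ \<Rightarrow> ?\<phi> (one_plus Q a) | Rev _ \<Rightarrow> inv\<^bsub>?L\<^esub> ?\<phi> (one_plus Q a)) \<otimes>\<^bsub>?L\<^esub> z)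
       (enum_by r (arcs ?D)) \<one>\<^bsub>?L\<^esub> = ?\<phi> (q_elem Q q)"
    using target unfolding mpa_target_def by auto
  interpret A: ring ?A by (intro ring_path_algebra double_fin_digraph as)
  have tc: "?te v \<in> carrier ?A" if "v \<in> verts Q" for v
    by (rule path_algebra_single_closed[OF qpaths_double(1)[OF that]])
  have ac: "?ta a \<in> carrier ?A" if "a \<in> arcs ?D" for a
    by (rule path_algebra_single_closed[OF qpaths_double(2)[OF that]])
  have qc: "q_elem Q q' \<in> carrier ?A" for q' :: "'v \<Rightarrow> 'k" by (rule dpath_closed(2)[OF as(1)])
  have Am: "x \<otimes>\<^bsub>?A\<^esub> y = path_mult ?D x y" for x y by (simp add: path_algebra_def)
  have \<phi>m: "?\<phi> (path_mult ?D x y) = ?\<phi> x \<otimes>\<^bsub>?L\<^esub> ?\<phi> y" if "x \<in> carrier ?A" "y \<in> carrier ?A" for x y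
    using ring_hom_mult[OF \<phi> that] by (simp add: Am)
  have zero: "?\<phi> 0 = \<zero>\<^bsub>?L\<^esub>"
  proof -
    have z: "0 \<in> carrier ?A" by (simp add: path_algebra_def)
    have "0 \<oplus>\<^bsub>?A\<^esub> (0 :: ('v, 'e, 'k) dpath_alg) = 0" by (simp add: path_algebra_def)
    then have "?\<phi> 0 \<oplus>\<^bsub>?L\<^esub> ?\<phi> 0 = ?\<phi> 0" using ring_hom_add[OF \<phi> z z] by simp
    then show ?thesis using ring_hom_closed[OF \<phi> z] K.R.add_eq_self_iff by blast
  qed
  have one: "q_elem Q (\<lambda>_. 1) = \<one>\<^bsub>?A\<^esub>" by (simp add: q_elem_def path_algebra_def)
  have op: "?\<phi> (one_plus Q a) = \<one>\<^bsub>?L\<^esub> \<oplus>\<^bsub>?L\<^esub> ?ar a \<otimes>\<^bsub>?L\<^esub> ?ar (star a)" if a: "a \<in> arcs ?D" for a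
  proof -
    have "star a \<in> arcs ?D" using a by simp
    then show ?thesis
      using ring_hom_add[OF \<phi> A.one_closed A.m_closed[OF ac[OF a] ac]] ring_hom_mult[OF \<phi> ac[OF a] ac] ring_hom_one[OF \<phi>]
      by (simp add: one_plus_def mpa_arrow_def)
  qed
  have enum: "set (enum_by r (arcs ?D)) = arcs ?D" "distinct (enum_by r (arcs ?D))"
    using enum_by[of "arcs ?D" r] as fin_digraph.finite_arcs[OF double_fin_digraph] by blast+
  have q1: "q_elem Q (\<lambda>v. q v * inverse (q v)) = \<one>\<^bsub>?A\<^esub>" "q_elem Q (\<lambda>v. inverse (q v) * q v) = \<one>\<^bsub>?A\<^esub>"
    unfolding one[symmetric] q_elem_def using q by (auto intro!: sum.cong)
  show ?thesis
  proof (intro quiver_algebra.intro quiver_algebra_axioms.intro)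
    show "k_algebra ?L ?\<eta>" "fin_digraph Q" by (fact K.k_algebra_axioms as(1))+
    show "set (enum_by r (arcs ?D)) = arcs ?D" "distinct (enum_by r (arcs ?D))" by (fact enum)+
    show "?e v \<in> carrier ?L" if "v \<in> verts Q" for v
      unfolding mpa_vert_def by (rule ring_hom_closed[OF \<phi> tc[OF that]])
    show "?ar a \<in> carrier ?L" if "a \<in> arcs ?D" for a
      unfolding mpa_arrow_def by (rule ring_hom_closed[OF \<phi> ac[OF that]])
    show "?e v \<otimes>\<^bsub>?L\<^esub> ?e w = (if v = w then ?e v else \<zero>\<^bsub>?L\<^esub>)" if "v \<in> verts Q" "w \<in> verts Q" for v w
      using \<phi>m[OF tc[OF that(1)] tc[OF that(2)]] by (cases "v = w") (simp_all add: mpa_vert_def path_mult_single zero)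
    show "?e (head ?D a) \<otimes>\<^bsub>?L\<^esub> ?ar a = ?ar a" if "a \<in> arcs ?D" for a
      using \<phi>m[OF tc[OF double_verts(1)[OF as(1) that]] ac[OF that]]
      by (simp add: mpa_vert_def mpa_arrow_def path_mult_single)
    show "?ar a \<otimes>\<^bsub>?L\<^esub> ?e (tail ?D a) = ?ar a" if "a \<in> arcs ?D" for a
      using \<phi>m[OF ac[OF that] tc[OF double_verts(2)[OF as(1) that]]]
      by (simp add: mpa_vert_def mpa_arrow_def path_mult_single)
    show "\<one>\<^bsub>?L\<^esub> \<oplus>\<^bsub>?L\<^esub> ?ar a \<otimes>\<^bsub>?L\<^esub> ?ar (star a) \<in> Units ?L" if "a \<in> arcs ?D" for a
      using unit[OF that] by (simp add: op[OF that])
    show "foldr (\<lambda>a z. (case a of Orig _ \<Rightarrow> \<one>\<^bsub>?L\<^esub> \<oplus>\<^bsub>?L\<^esub> ?ar a \<otimes>\<^bsub>?L\<^esub> ?ar (star a)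
        | Rev _ \<Rightarrow> inv\<^bsub>?L\<^esub> (\<one>\<^bsub>?L\<^esub> \<oplus>\<^bsub>?L\<^esub> ?ar a \<otimes>\<^bsub>?L\<^esub> ?ar (star a))) \<otimes>\<^bsub>?L\<^esub> z) (enum_by r (arcs ?D)) \<one>\<^bsub>?L\<^esub>
      = ?\<phi> (q_elem Q q)"
      unfolding rel[symmetric]
      by (rule foldr_mult_cong) (auto simp: enum op split: darrow.split)
    show "?\<phi> (q_elem Q q) \<in> carrier ?L" "?\<phi> (q_elem Q (\<lambda>v. inverse (q v))) \<in> carrier ?L"
      by (rule ring_hom_closed[OF \<phi> qc])+
    show "?\<phi> (q_elem Q q) \<otimes>\<^bsub>?L\<^esub> ?\<phi> (q_elem Q (\<lambda>v. inverse (q v))) = \<one>\<^bsub>?L\<^esub>"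
      using \<phi>m[OF qc qc, of q "\<lambda>v. inverse (q v)"] ring_hom_one[OF \<phi>] by (simp add: q_elem_mult[OF as(1)] q1)
    show "?\<phi> (q_elem Q (\<lambda>v. inverse (q v))) \<otimes>\<^bsub>?L\<^esub> ?\<phi> (q_elem Q q) = \<one>\<^bsub>?L\<^esub>"
      using \<phi>m[OF qc qc, of "\<lambda>v. inverse (q v)" q] ring_hom_one[OF \<phi>] by (simp add: q_elem_mult[OF as(1)] q1)
    show "?\<phi> (q_elem Q q) \<otimes>\<^bsub>?L\<^esub> ?e v = ?e v \<otimes>\<^bsub>?L\<^esub> ?\<phi> (q_elem Q q)" if "v \<in> verts Q" for v
      using \<phi>m[OF qc tc[OF that], of q] \<phi>m[OF tc[OF that] qc, of q] that
      by (simp add: q_elem_mult[OF as(1)] mpa_vert_def)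
  next
    fix P and a assume "a \<in> carrier ?L" "\<And>c. P (?\<eta> c)" "\<And>v. v \<in> verts Q \<Longrightarrow> P (?e v)"
      "\<And>a. a \<in> arcs ?D \<Longrightarrow> P (?ar a)"
      "\<And>a b. \<lbrakk>a \<in> carrier ?L; b \<in> carrier ?L; P a; P b\<rbrakk> \<Longrightarrow> P (a \<oplus>\<^bsub>?L\<^esub> b)"
      "\<And>a b. \<lbrakk>a \<in> carrier ?L; b \<in> carrier ?L; P a; P b\<rbrakk> \<Longrightarrow> P (a \<otimes>\<^bsub>?L\<^esub> b)"
      "\<And>a. \<lbrakk>a \<in> Units ?L; P a\<rbrakk> \<Longrightarrow> P (inv\<^bsub>?L\<^esub> a)"
    then show "P a" by (rule mpa_induct[OF as])
  qed
qed

section \<open>Derivations of the multiplicative preprojective algebra\<close>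

locale mpa_reps =
  quiver_reps "mpa Q r q" "mpa_scalar Q r q" Q "mpa_vert Q r q" "mpa_arrow Q r q"
    "enum_by r (arcs (double Q))" "mpa_map Q r q (q_elem Q q)"
    "mpa_map Q r q (q_elem Q (\<lambda>v. inverse (q v)))" U I \<rho>X J \<rho>Y vtx
  for Q :: "('v, 'e) pre_digraph" and r and q :: "'v \<Rightarrow> 'k::field"
    and U :: "'i set" and I \<rho>X J \<rho>Y vtx +
  assumes lin_r: "linear_order_on (arcs (double Q)) r"
begin

text \<open>A derivation \<open>\<delta>\<close> is the same as an algebra homomorphism \<open>a \<mapsto> (a, \<delta> a)\<close> to the trivial
  extension by \<open>M\<close>, so the universal property applies.\<close>

lemma derivation_ex:
  assumes D: "D \<in> C1" and rel0: "dprod D (enum_by r (arcs (double Q))) = 0"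
  shows "\<exists>\<delta>. derivation \<delta> \<and> (\<forall>v\<in>verts Q. \<delta> (mpa_vert Q r q v) = 0) \<and>
    (\<forall>a\<in>arrows. \<delta> (mpa_arrow Q r q a) = blk D a)"
proof -
  let ?L = "mpa Q r q" and ?\<eta> = "mpa_scalar Q r q" and ?e = "mpa_vert Q r q" and ?ar = "mpa_arrow Q r q"
  let ?D = "double Q" and ?\<phi> = "mpa_map Q r q"
  let ?A = "path_algebra ?D :: ('v, 'e, 'k) dpath_alg ring"
  interpret F: fin_digraph Q by (rule fin_Q)
  have \<phi>: "?\<phi> \<in> Ring.ring_hom ?A ?L"
    and lin: "\<And>c x. x \<in> carrier ?A \<Longrightarrow> ?\<phi> (Poly_Mapping.map ((*) c) x) = ?\<eta> c \<otimes>\<^bsub>?L\<^esub> ?\<phi> x"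
    using mpa_is_target[OF fin_Q lin_r, of q] unfolding mpa_target_def by auto
  have TK: "k_algebra triv_ext (\<lambda>c. (?\<eta> c, 0))"
    by (rule k_algebra.intro[OF ring_triv_ext k_algebra_axioms.intro[OF triv_ext_scalar]])
  interpret T: k_algebra triv_ext "\<lambda>c. (?\<eta> c, 0)" by (rule TK)
  let ?e' = "\<lambda>v. (?e v, 0 :: 'i \<times> 'i \<Rightarrow> 'k)" and ?ar' = "\<lambda>a. (?ar a, blk D a)"
  define \<psi> where "\<psi> = T.plin (T.pval ?e' ?ar')"
  have arM: "blk D a \<in> M" for a by (rule blk_closed[OF D])
  have sumS: "finsum triv_ext ?e' S = (finsum ?L ?e S, 0)" if "S \<subseteq> verts Q" for S
    using finite_subset[OF that F.finite_verts] that
  proof (induction S rule: finite_induct)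
    case (insert v S)
    have "finsum triv_ext ?e' (insert v S) = ?e' v \<oplus>\<^bsub>triv_ext\<^esub> finsum triv_ext ?e' S"
      by (rule T.R.finsum_insert) (use insert in auto)
    moreover have "finsum ?L ?e (insert v S) = ?e v \<oplus>\<^bsub>?L\<^esub> finsum ?L ?e S"
      by (rule R.finsum_insert) (use insert in auto)
    ultimately show ?case using insert by (simp del: zero_fun_apply)
  qed simp
  have \<psi>: "\<psi> \<in> Ring.ring_hom ?A triv_ext"
    "\<And>c x. x \<in> carrier ?A \<Longrightarrow> \<psi> (Poly_Mapping.map ((*) c) x) = (?\<eta> c, 0) \<otimes>\<^bsub>triv_ext\<^esub> \<psi> x"
    "\<And>p c. p \<in> qpaths ?D \<Longrightarrow> \<psi> (Poly_Mapping.single p c) = (?\<eta> c, 0) \<otimes>\<^bsub>triv_ext\<^esub> T.pval ?e' ?ar' p"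
  proof -
    note l = T.path_algebra_lift[of ?D ?e' ?ar', folded \<psi>_def, OF double_fin_digraph[OF fin_Q]]
    have c: "\<And>v. v \<in> verts ?D \<Longrightarrow> ?e' v \<in> carrier triv_ext" "\<And>a. a \<in> arcs ?D \<Longrightarrow> ?ar' a \<in> carrier triv_ext"
      "\<And>v w. \<lbrakk>v \<in> verts ?D; w \<in> verts ?D\<rbrakk> \<Longrightarrow> ?e' v \<otimes>\<^bsub>triv_ext\<^esub> ?e' w = (if v = w then ?e' v else \<zero>\<^bsub>triv_ext\<^esub>)"
      "\<And>a. a \<in> arcs ?D \<Longrightarrow> ?e' (head ?D a) \<otimes>\<^bsub>triv_ext\<^esub> ?ar' a = ?ar' a"
      "\<And>a. a \<in> arcs ?D \<Longrightarrow> ?ar' a \<otimes>\<^bsub>triv_ext\<^esub> ?e' (tail ?D a) = ?ar' a"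
      "finsum triv_ext ?e' (verts ?D) = \<one>\<^bsub>triv_ext\<^esub>"
      using arM by (auto simp: e_mult e_head e_tail mmul_distrib blk_e[OF D] sumS mpa_sum_vert[OF fin_Q lin_r])
    show "\<psi> \<in> Ring.ring_hom ?A triv_ext" by (rule l(1)) (fact c)+
    show "\<psi> (Poly_Mapping.map ((*) c) x) = (?\<eta> c, 0) \<otimes>\<^bsub>triv_ext\<^esub> \<psi> x" if "x \<in> carrier ?A" for c x
      by (rule l(2)[OF _ _ _ _ _ _ that]) (fact c)+
    show "\<psi> (Poly_Mapping.single p c) = (?\<eta> c, 0) \<otimes>\<^bsub>triv_ext\<^esub> T.pval ?e' ?ar' p" if "p \<in> qpaths ?D" for p c
      by (rule l(3)[OF _ _ _ _ _ _ that]) (fact c)+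
  qed
  have \<psi>e: "\<psi> (Poly_Mapping.single (Triv v) c) = (?\<eta> c \<otimes>\<^bsub>?L\<^esub> ?e v, 0)" if "v \<in> verts Q" for v c
    using \<psi>(3)[OF qpaths_double(1)[OF that], of c] by (simp add: mmul_distrib)
  have \<psi>a: "\<psi> (Poly_Mapping.single (Arrows [a]) 1) = (?ar a, blk D a)" if a: "a \<in> arrows" for a
  proof -
    have "\<psi> (Poly_Mapping.single (Arrows [a]) 1) = (?\<eta> 1, 0) \<otimes>\<^bsub>triv_ext\<^esub> ((?ar a, blk D a) \<otimes>\<^bsub>triv_ext\<^esub> \<one>\<^bsub>triv_ext\<^esub>)"
      using \<psi>(3)[OF qpaths_double(2)[OF a], of 1] by simp
    moreover have "(?ar a, blk D a) \<in> carrier triv_ext" using a arM by simp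
    ultimately show ?thesis
      using T.R.r_one[of "(?ar a, blk D a)"] T.R.l_one[of "(?ar a, blk D a)"] T.\<eta>_one by metis
  qed
  have ac: "Poly_Mapping.single (Arrows [a]) 1 \<in> carrier ?A" if "a \<in> arrows" for a
    by (rule path_algebra_single_closed[OF qpaths_double(2)[OF that]])
  interpret A: ring ?A by (intro ring_path_algebra double_fin_digraph fin_Q)
  have \<psi>op: "\<psi> (one_plus Q a) = (opl a, dopl D a)" if a: "a \<in> arrows" for a
  proof -
    have s: "star a \<in> arrows" using a by simp
    have "\<psi> (one_plus Q a) = \<one>\<^bsub>triv_ext\<^esub> \<oplus>\<^bsub>triv_ext\<^esub> \<psi> (Poly_Mapping.single (Arrows [a]) 1) \<otimes>\<^bsub>triv_ext\<^esub> \<psi> (Poly_Mapping.single (Arrows [star a]) 1)"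
      unfolding one_plus_def
      using ring_hom_add[OF \<psi>(1) A.one_closed A.m_closed[OF ac[OF a] ac[OF s]]]
        ring_hom_mult[OF \<psi>(1) ac[OF a] ac[OF s]] ring_hom_one[OF \<psi>(1)] by simp
    then show ?thesis by (simp add: \<psi>a[OF a] \<psi>a[OF s] opl_def dopl_def)
  qed
  have unit: "\<psi> (one_plus Q a) \<in> Units triv_ext" if a: "a \<in> arrows" for a
    unfolding \<psi>op[OF a] by (rule triv_ext_unit(1)[OF opl_unit[OF a] dopl_closed[OF D a]])
  \<comment> \<open>For a reversed arrow the inverse is taken in the trivial extension, and its
    second component is \<open>dfac\<close>, with the sign and the two outer inverses.\<close>
  have fac_eq: "(case a of Orig _ \<Rightarrow> \<psi> (one_plus Q a) | Rev _ \<Rightarrow> inv\<^bsub>triv_ext\<^esub> \<psi> (one_plus Q a)) = (fac a, dfac D a)"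
    if a: "a \<in> arrows" for a
    using \<psi>op[OF a] triv_ext_unit(2)[OF opl_unit[OF a] dopl_closed[OF D a]]
    by (cases a) (simp_all add: fac_def dfac_def)
  \<comment> \<open>The recursion for \<open>dprod\<close> is multiplication in the trivial
    extension, seen in the second component.\<close>
  have fold: "foldr (\<lambda>a z. (fac a, dfac D a) \<otimes>\<^bsub>triv_ext\<^esub> z) as \<one>\<^bsub>triv_ext\<^esub> = (fprod as, dprod D as)" for as
    by (induction as) (simp_all only: foldr.simps o_apply id_apply triv_ext_simps fprod_simps dprod.simps)
  \<comment> \<open>Vertices have second component zero, hence so has the right-hand side of the
    relation. In the trivial extension the relation thus says exactly that \<open>dprod\<close>
    vanishes.\<close>
  have \<psi>q: "\<psi> (\<Sum>v\<in>S. Poly_Mapping.single (Triv v) (q v)) = (?\<phi> (\<Sum>v\<in>S. Poly_Mapping.single (Triv v) (q v)), 0)"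
    if "S \<subseteq> verts Q" for S
    using finite_subset[OF that F.finite_verts] that
  proof (induction S rule: finite_induct)
    case empty
    have z: "0 \<in> carrier ?A" and 00: "0 \<oplus>\<^bsub>?A\<^esub> 0 = (0 :: ('v, 'e, 'k) dpath_alg)"
      by (simp_all add: path_algebra_def)
    have "\<psi> 0 = \<zero>\<^bsub>triv_ext\<^esub>"
      using ring_hom_add[OF \<psi>(1) z z] ring_hom_closed[OF \<psi>(1) z] T.R.add_eq_self_iff unfolding 00 by metis
    moreover have "?\<phi> 0 = \<zero>\<^bsub>?L\<^esub>"
      using ring_hom_add[OF \<phi> z z] ring_hom_closed[OF \<phi> z] R.add_eq_self_iff unfolding 00 by metis
    ultimately show ?case by (simp del: zero_fun_apply)
  next
    case (insert v S)
    have t: "Poly_Mapping.single (Triv w) (c::'k) \<in> carrier ?A" if "w \<in> insert v S" for w c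
      using insert.prems that by (intro path_algebra_single_closed qpaths_double) auto
    have t2: "(\<Sum>v\<in>S. Poly_Mapping.single (Triv v) (q v)) \<in> carrier ?A"
      by (intro path_algebra_sum_closed t) auto
    have v: "v \<in> verts Q" using insert by simp
    have "Poly_Mapping.map ((*) (q v)) (Poly_Mapping.single (Triv v) 1 :: ('v, 'e, 'k) dpath_alg) = Poly_Mapping.single (Triv v) (q v)"
      by (rule poly_mapping_eqI) (simp add: map.rep_eq lookup_single when_def)
    then have "?\<phi> (Poly_Mapping.single (Triv v) (q v)) = ?\<eta> (q v) \<otimes>\<^bsub>?L\<^esub> ?e v"
      using lin[OF t[of v 1], of "q v"] by (simp add: mpa_vert_def)
    then show ?case
      using ring_hom_add[OF \<psi>(1) t[of v "q v"] t2] ring_hom_add[OF \<phi> t[of v "q v"] t2] insert \<psi>e[OF v]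
      by (simp add: path_algebra_def)
  qed
  have "mpa_target Q r q triv_ext (\<lambda>c. (?\<eta> c, 0)) \<psi>"
    unfolding mpa_target_def
  proof (intro conjI allI ballI ring_triv_ext triv_ext_scalar \<psi>(1) \<psi>(2) unit)
    have "foldr (\<lambda>a z. (case a of Orig _ \<Rightarrow> \<psi> (one_plus Q a) | Rev _ \<Rightarrow> inv\<^bsub>triv_ext\<^esub> \<psi> (one_plus Q a)) \<otimes>\<^bsub>triv_ext\<^esub> z)
        (enum_by r arrows) \<one>\<^bsub>triv_ext\<^esub> = foldr (\<lambda>a z. (fac a, dfac D a) \<otimes>\<^bsub>triv_ext\<^esub> z) (enum_by r arrows) \<one>\<^bsub>triv_ext\<^esub>"
      by (rule foldr_mult_cong) (simp only: L(1) fac_eq)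
    also have "\<dots> = \<psi> (q_elem Q q)"
      unfolding fold rel0 fprod_L q_elem_def using \<psi>q[OF order_refl] by simp
    finally show "foldr (\<lambda>a z. (case a of Orig _ \<Rightarrow> \<psi> (one_plus Q a) | Rev _ \<Rightarrow> inv\<^bsub>triv_ext\<^esub> \<psi> (one_plus Q a)) \<otimes>\<^bsub>triv_ext\<^esub> z)
        (enum_by r arrows) \<one>\<^bsub>triv_ext\<^esub> = \<psi> (q_elem Q q)" .
  qed
  from mpa_universal[OF fin_Q lin_r this]
  obtain f where f: "f \<in> Ring.ring_hom ?L triv_ext" "\<And>c. f (?\<eta> c) = (?\<eta> c, 0)"
    "\<And>x. x \<in> carrier ?A \<Longrightarrow> f (?\<phi> x) = \<psi> x" by blast
  have fe: "f (?e v) = (?e v, 0)" if "v \<in> verts Q" for v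
    using f(3)[OF path_algebra_single_closed[OF qpaths_double(1)[OF that]], of 1] \<psi>e[OF that, of 1]
      R.l_one[OF e_closed[OF that]] by (simp add: mpa_vert_def \<eta>_one)
  have fa: "f (?ar a) = (?ar a, blk D a)" if "a \<in> arrows" for a
    using f(3)[OF ac[OF that]] \<psi>a[OF that] by (simp add: mpa_arrow_def)
  \<comment> \<open>The first component of \<open>f\<close> is multiplicative and additive and fixes
    the generators, so it is the identity; only then is the second component a derivation for the
    given actions.\<close>
  have fst: "fst (f a) = a" if "a \<in> carrier ?L" for a
    using that
  proof (rule generated)
    show "fst (f (a \<oplus>\<^bsub>?L\<^esub> b)) = a \<oplus>\<^bsub>?L\<^esub> b"
      if "a \<in> carrier ?L" "b \<in> carrier ?L" "fst (f a) = a" "fst (f b) = b" for a b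
      using that ring_hom_add[OF f(1) that(1,2)] by (cases "f a"; cases "f b") simp
    show "fst (f (a \<otimes>\<^bsub>?L\<^esub> b)) = a \<otimes>\<^bsub>?L\<^esub> b"
      if "a \<in> carrier ?L" "b \<in> carrier ?L" "fst (f a) = a" "fst (f b) = b" for a b
      using that ring_hom_mult[OF f(1) that(1,2)] by (cases "f a"; cases "f b") simp
    show "fst (f (inv\<^bsub>?L\<^esub> a)) = inv\<^bsub>?L\<^esub> a" if a: "a \<in> Units ?L" "fst (f a) = a" for a
    proof -
      have ac: "a \<in> carrier ?L" "inv\<^bsub>?L\<^esub> a \<in> carrier ?L" using a by auto
      have c: "fst (f (inv\<^bsub>?L\<^esub> a)) \<in> carrier ?L"
        using ring_hom_closed[OF f(1) ac(2)] by (cases "f (inv\<^bsub>?L\<^esub> a)") simp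
      have "a \<otimes>\<^bsub>?L\<^esub> fst (f (inv\<^bsub>?L\<^esub> a)) = \<one>\<^bsub>?L\<^esub>"
        using ring_hom_mult[OF f(1) ac] ring_hom_one[OF f(1)] a
        by (cases "f a"; cases "f (inv\<^bsub>?L\<^esub> a)") simp
      then show ?thesis
        using R.inv_unique[OF _ _ ac(1) _ c, of "inv\<^bsub>?L\<^esub> a"] a ac by simp
    qed
  qed (simp_all add: f(2) fe fa)
  have fpair: "f a = (a, snd (f a))" "snd (f a) \<in> M" if "a \<in> carrier ?L" for a
    using fst[OF that] ring_hom_closed[OF f(1) that] by (cases "f a"; simp)+
  have "derivation (\<lambda>a. snd (f a))"
    unfolding derivation_def
  proof (intro conjI ballI allI)
    fix a b assume ab: "a \<in> carrier ?L" "b \<in> carrier ?L"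
    show "snd (f (a \<oplus>\<^bsub>?L\<^esub> b)) = snd (f a) + snd (f b)"
      using ring_hom_add[OF f(1) ab] fpair(1)[OF ab(1)] fpair(1)[OF ab(2)] by (metis snd_conv triv_ext_simps(5))
    show "snd (f (a \<otimes>\<^bsub>?L\<^esub> b)) = \<rho>Y a \<star> snd (f b) + snd (f a) \<star> \<rho>X b"
      using ring_hom_mult[OF f(1) ab] fpair(1)[OF ab(1)] fpair(1)[OF ab(2)] by (metis snd_conv triv_ext_simps(2))
  qed (simp_all add: fpair(2) f(2))
  then show ?thesis using fe fa by (intro exI[of _ "\<lambda>a. snd (f a)"]) simp
qed

text \<open>The right-hand side of the relation is a combination of the \<open>e v\<close> with
  scalar coefficients. With \<open>fprod_L\<close> this makes the linearised relation necessary, as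
  \<open>derivation_ex\<close> makes it sufficient.\<close>

lemma derivation_q_elem:
  assumes \<delta>: "derivation \<delta>" and e0: "\<And>v. v \<in> verts Q \<Longrightarrow> \<delta> (mpa_vert Q r q v) = 0"
  shows "\<delta> (mpa_map Q r q (q_elem Q q)) = 0"
proof -
  let ?A = "path_algebra (double Q) :: ('v, 'e, 'k) dpath_alg ring" and ?\<phi> = "mpa_map Q r q"
  interpret F: fin_digraph Q by (rule fin_Q)
  note d = derivationD[OF \<delta>]
  have \<phi>: "?\<phi> \<in> Ring.ring_hom ?A (mpa Q r q)"
    and lin: "\<And>c x. x \<in> carrier ?A \<Longrightarrow> ?\<phi> (Poly_Mapping.map ((*) c) x) = mpa_scalar Q r q c \<otimes>\<^bsub>mpa Q r q\<^esub> ?\<phi> x"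
    using mpa_is_target[OF fin_Q lin_r, of q] unfolding mpa_target_def by auto
  have t: "Poly_Mapping.single (Triv v) c \<in> carrier ?A" if "v \<in> verts Q" for v c
    using that by (intro path_algebra_single_closed qpaths_double) auto
  have s: "\<delta> (?\<phi> (Poly_Mapping.single (Triv v) c)) = 0" if v: "v \<in> verts Q" for v c
  proof -
    have "Poly_Mapping.map ((*) c) (Poly_Mapping.single (Triv v) 1) = (Poly_Mapping.single (Triv v) c :: ('v, 'e, 'k) dpath_alg)"
      by (rule poly_mapping_eqI) (simp add: map.rep_eq lookup_single when_def)
    then have "?\<phi> (Poly_Mapping.single (Triv v) c) = mpa_scalar Q r q c \<otimes>\<^bsub>mpa Q r q\<^esub> mpa_vert Q r q v"
      using lin[OF t[OF v, of 1], of c] by (simp add: mpa_vert_def)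
    then show ?thesis using v by (simp add: d e0) (simp add: mmul_def fun_eq_iff)
  qed
  have "\<delta> (?\<phi> (\<Sum>v\<in>S. Poly_Mapping.single (Triv v) (q v))) = 0" if "finite S" "S \<subseteq> verts Q" for S
    using that
  proof (induction S rule: finite_induct)
    case empty
    have "(0 :: ('v, 'e, 'k) dpath_alg) \<in> carrier ?A" by (simp add: path_algebra_def)
    moreover have "Poly_Mapping.map ((*) 0) 0 = (0 :: ('v, 'e, 'k) dpath_alg)"
      by (rule poly_mapping_eqI) (simp add: map.rep_eq)
    ultimately have "?\<phi> 0 = \<zero>\<^bsub>mpa Q r q\<^esub>"
      using lin[of 0 0] ring_hom_closed[OF \<phi>, of 0] by (simp add: \<eta>_zero)
    then show ?case by (simp add: d)
  next
    case (insert v S)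
    have c: "(\<Sum>v\<in>S. Poly_Mapping.single (Triv v) (q v)) \<in> carrier ?A"
      using insert by (intro path_algebra_sum_closed t) auto
    from ring_hom_add[OF \<phi> t[of v] c] insert show ?case
      using d(2)[OF ring_hom_closed[OF \<phi> t[of v "q v"]] ring_hom_closed[OF \<phi> c]] s[of v]
      by (simp add: path_algebra_def)
  qed
  then show ?thesis using F.finite_verts by (simp add: q_elem_def)
qed

end

section \<open>Modules in coordinates\<close>

text \<open>The common ground of homomorphisms, augmentations, the section \<open>sect\<close> and
  the maps \<open>dsum\<close>, of which the last two are in general not linear over
  \<open>R\<close>.\<close>

definition addmap :: "('r, 'x, 'm) module_scheme \<Rightarrow> ('r, 'y, 'n) module_scheme \<Rightarrow> ('x \<Rightarrow> 'y) \<Rightarrow> bool" where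
  "addmap P N F \<longleftrightarrow> (\<forall>f\<in>carrier P. F f \<in> carrier N) \<and>
     (\<forall>f\<in>carrier P. \<forall>g\<in>carrier P. F (f \<oplus>\<^bsub>P\<^esub> g) = F f \<oplus>\<^bsub>N\<^esub> F g)"

lemma addmapI:
  assumes "\<And>f. f \<in> carrier P \<Longrightarrow> F f \<in> carrier N"
    "\<And>f g. \<lbrakk>f \<in> carrier P; g \<in> carrier P\<rbrakk> \<Longrightarrow> F (f \<oplus>\<^bsub>P\<^esub> g) = F f \<oplus>\<^bsub>N\<^esub> F g"
  shows "addmap P N F"
  using assms by (simp add: addmap_def)

lemma addmapD:
  assumes "addmap P N F"
  shows "f \<in> carrier P \<Longrightarrow> F f \<in> carrier N"
    "\<lbrakk>f \<in> carrier P; g \<in> carrier P\<rbrakk> \<Longrightarrow> F (f \<oplus>\<^bsub>P\<^esub> g) = F f \<oplus>\<^bsub>N\<^esub> F g"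
  using assms by (simp_all add: addmap_def)

lemma lmod_hom_addmap: "f \<in> lmod_hom R M N \<Longrightarrow> addmap M N f"
  by (auto simp: addmap_def lmod_hom_def)

lemma addmap_zero:
  assumes "abelian_group P" "abelian_group N" "addmap P N F"
  shows "F \<zero>\<^bsub>P\<^esub> = \<zero>\<^bsub>N\<^esub>"
proof -
  interpret P: abelian_group P by fact
  interpret N: abelian_group N by fact
  show ?thesis
    using addmapD(2)[OF assms(3), of "\<zero>\<^bsub>P\<^esub>" "\<zero>\<^bsub>P\<^esub>"] addmapD(1)[OF assms(3), of "\<zero>\<^bsub>P\<^esub>"]
      N.add_eq_self_iff[of "F \<zero>\<^bsub>P\<^esub>" "F \<zero>\<^bsub>P\<^esub>"] by simp
qed

lemma addmap_diff:
  assumes "abelian_group P" "abelian_group N" "addmap P N F" "f \<in> carrier P" "g \<in> carrier P"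
  shows "F (f \<ominus>\<^bsub>P\<^esub> g) = F f \<ominus>\<^bsub>N\<^esub> F g"
proof -
  interpret P: abelian_group P by fact
  interpret N: abelian_group N by fact
  have "F (\<ominus>\<^bsub>P\<^esub> g) \<oplus>\<^bsub>N\<^esub> F g = \<zero>\<^bsub>N\<^esub>"
    using addmapD(2)[OF assms(3), of "\<ominus>\<^bsub>P\<^esub> g" g] assms(5) addmap_zero[OF assms(1-3)] by (simp add: P.l_neg)
  then have "F (\<ominus>\<^bsub>P\<^esub> g) = \<ominus>\<^bsub>N\<^esub> F g"
    using assms(5) addmapD(1)[OF assms(3)] by (simp add: N.minus_equality)
  then show ?thesis using assms(4,5) addmapD(2)[OF assms(3), of f "\<ominus>\<^bsub>P\<^esub> g"] by (simp add: a_minus_def)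
qed

lemma (in abelian_group) minus_add_minus:
  "\<lbrakk>a \<in> carrier G; b \<in> carrier G; c \<in> carrier G; d \<in> carrier G\<rbrakk> \<Longrightarrow>
    (a \<oplus> b) \<ominus> (c \<oplus> d) = (a \<ominus> c) \<oplus> (b \<ominus> d)"
  by (simp add: a_minus_def minus_add a_ac)

lemma (in abelian_group) minus_add_telescope:
  "\<lbrakk>a \<in> carrier G; b \<in> carrier G; c \<in> carrier G\<rbrakk> \<Longrightarrow> (a \<ominus> b) \<oplus> (b \<ominus> c) = a \<ominus> c"
proof -
  assume abc: "a \<in> carrier G" "b \<in> carrier G" "c \<in> carrier G"
  then have "(a \<ominus> b) \<oplus> (b \<ominus> c) = a \<oplus> (\<ominus> b \<oplus> b) \<oplus> \<ominus> c"
    by (simp only: a_minus_def a_assoc a_closed a_inv_closed)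
  then show ?thesis using abc by (simp add: l_neg a_minus_def)
qed

lemma (in abelian_group) eq_if_minus_zero:
  assumes "a \<in> carrier G" "b \<in> carrier G" "a \<ominus> b = \<zero>"
  shows "a = b"
proof -
  have "\<ominus> (\<ominus> b) = a" using assms by (intro minus_equality) (simp_all add: a_minus_def)
  then show ?thesis using assms by simp
qed

lemma addmap_comp: "\<lbrakk>addmap P N F; addmap N L G\<rbrakk> \<Longrightarrow> addmap P L (\<lambda>f. G (F f))"
  by (simp add: addmap_def)

lemma addmap_add:
  assumes "abelian_group N" "addmap P N F" "addmap P N G"
  shows "addmap P N (\<lambda>f. F f \<oplus>\<^bsub>N\<^esub> G f)"
proof -
  interpret N: abelian_group N by fact
  show ?thesis by (rule addmapI) (simp_all add: addmapD[OF assms(2)] addmapD[OF assms(3)] N.a_ac)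
qed

lemma addmap_minus:
  assumes "abelian_group N" "addmap P N F" "addmap P N G"
  shows "addmap P N (\<lambda>f. F f \<ominus>\<^bsub>N\<^esub> G f)"
proof -
  interpret N: abelian_group N by fact
  show ?thesis
    by (rule addmapI) (simp_all add: addmapD[OF assms(2)] addmapD[OF assms(3)] N.minus_add_minus)
qed

context ring
begin

lemma addmap_free_eq:
  assumes N: "abelian_group N" and F: "addmap (free_on R M) N F" and G: "addmap (free_on R M) N G"
    and eq: "\<And>a x. \<lbrakk>a \<in> carrier R; x \<in> carrier M\<rbrakk> \<Longrightarrow> F (fsingle R a x) = G (fsingle R a x)"
    and f: "f \<in> carrier (free_on R M)"
  shows "F f = G f"
  by (rule free_on_additive_eq[OF N f, where F = F and G = G])
    (use addmapD[OF F] addmapD[OF G] eq in simp_all)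

lemma fsum_addmap:
  assumes "abelian_group N" "\<And>a x. \<lbrakk>a \<in> carrier R; x \<in> carrier M\<rbrakk> \<Longrightarrow> h a x \<in> carrier N"
    "\<And>a b x. \<lbrakk>a \<in> carrier R; b \<in> carrier R; x \<in> carrier M\<rbrakk> \<Longrightarrow> h (a \<oplus> b) x = h a x \<oplus>\<^bsub>N\<^esub> h b x"
  shows "addmap (free_on R M) N (fsum R N h)"
proof (rule addmapI)
  show "fsum R N h f \<in> carrier N" if "f \<in> carrier (free_on R M)" for f
    by (rule fsum_closed[where M = M and h = h]) (fact assms that)+
  show "fsum R N h (f \<oplus>\<^bsub>free_on R M\<^esub> g) = fsum R N h f \<oplus>\<^bsub>N\<^esub> fsum R N h g"
    if "f \<in> carrier (free_on R M)" "g \<in> carrier (free_on R M)" for f g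
    unfolding free_on_simps by (rule fsum_add[where M = M and h = h]) (fact assms that)+
qed

end

lemma (in lmodule) augmentation_addmap: "addmap (free_on R M) M (augmentation R M)"
  by (simp add: addmap_def augmentation_closed augmentation_add)

section \<open>Matrices acting on coordinate vectors\<close>

definition vact :: "'i set \<Rightarrow> ('i \<times> 'i \<Rightarrow> 'k::field) \<Rightarrow> ('i \<Rightarrow> 'k) \<Rightarrow> 'i \<Rightarrow> 'k" where
  "vact U A f = (\<lambda>i. \<Sum>j\<in>U. A (i, j) * f j)"

definition uvec :: "'i \<Rightarrow> 'i \<Rightarrow> 'k::field" where
  "uvec j = (\<lambda>i. if i = j then 1 else 0)"

definition matrix_of :: "'i set \<Rightarrow> (('i \<Rightarrow> 'k::field) \<Rightarrow> 'i \<Rightarrow> 'k) \<Rightarrow> 'i \<times> 'i \<Rightarrow> 'k" where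
  "matrix_of I g = (\<lambda>(i, j). if j \<in> I then g (uvec j) i else 0)"

lemma vact_mmul: "vact U (mmul U A B) f = vact U A (vact U B f)"
proof
  fix i
  have "(\<Sum>j\<in>U. (\<Sum>l\<in>U. A (i, l) * B (l, j)) * f j) = (\<Sum>j\<in>U. \<Sum>l\<in>U. A (i, l) * (B (l, j) * f j))"
    by (simp add: sum_distrib_right mult.assoc)
  also have "\<dots> = (\<Sum>l\<in>U. \<Sum>j\<in>U. A (i, l) * (B (l, j) * f j))" by (rule sum.swap)
  finally show "vact U (mmul U A B) f i = vact U A (vact U B f) i"
    by (simp add: vact_def mmul_def sum_distrib_left)
qed

lemma vact_lin:
  "vact U (A + B) f = vact U A f + vact U B f" "vact U A (f + g) = vact U A f + vact U A g"
  "vact U (mscale c A) f = mscale c (vact U A f)" "vact U A (mscale c f) = mscale c (vact U A f)"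
  by (simp_all add: vact_def mscale_def fun_eq_iff distrib_left distrib_right sum.distrib
      sum_distrib_left mult.assoc mult.left_commute)

lemma vact_closed: "A \<in> mats J I \<Longrightarrow> vact U A f \<in> carrier (fun_space J)"
  by (auto simp: vact_def carrier_fun_space intro!: sum.neutral)

lemma uvec_closed: "i \<in> I \<Longrightarrow> uvec i \<in> carrier (fun_space I)"
  by (auto simp: uvec_def carrier_fun_space)

lemma vact_uvec: "finite U \<Longrightarrow> j \<in> U \<Longrightarrow> vact U A (uvec j) = (\<lambda>i. A (i, j))"
  by (auto simp: vact_def uvec_def if_distrib cong: if_cong)

lemma vact_eqI:
  assumes "finite U" "I \<subseteq> U" "A \<in> mats J I" "B \<in> mats J I"
    and eq: "\<And>f. f \<in> carrier (fun_space I) \<Longrightarrow> vact U A f = vact U B f"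
  shows "A = B"
proof (rule ext, clarify)
  fix i j
  show "A (i, j) = B (i, j)"
  proof (cases "j \<in> I")
    case True
    then show ?thesis
      using eq[OF uvec_closed[OF True]] assms(1,2) by (auto simp: vact_uvec fun_eq_iff)
  qed (use assms(3,4) in \<open>auto simp: carrier_fun_space\<close>)
qed

lemma vact_mdiag:
  assumes "finite U" "S \<subseteq> U"
  shows "vact U (mdiag S) f = (\<lambda>i. if i \<in> S then f i else 0)"
proof
  fix i
  have "vact U (mdiag S) f i = (\<Sum>j\<in>U. if j = i then (if i \<in> S then f i else 0) else 0)"
    unfolding vact_def mdiag_def by (auto intro!: sum.cong)
  then show "vact U (mdiag S) f i = (if i \<in> S then f i else 0)" using assms by auto
qed

lemma matrix_of:
  assumes "finite U" "I \<subseteq> U" and g: "lin_map (fun_space I) (fun_space J) g"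
  shows "matrix_of I g \<in> mats J I"
    "f \<in> carrier (fun_space I) \<Longrightarrow> vact U (matrix_of I g) f = g f"
proof -
  show "matrix_of I g \<in> mats J I"
    using lin_mapD(1)[OF g uvec_closed] by (auto simp: matrix_of_def carrier_fun_space)
  assume f: "f \<in> carrier (fun_space I)"
  have fin: "finite I" using assms(1,2) by (rule rev_finite_subset)
  have "(fun_space J)\<lparr>carrier := carrier (fun_space J)\<rparr> = fun_space J" by simp
  then have "lin_map (fun_space I) ((fun_space J)\<lparr>carrier := carrier (fun_space J)\<rparr>) g" using g by simp
  then have "g f = (\<lambda>j. \<Sum>i\<in>I. f i * g (uvec i) j)"
    unfolding uvec_def by (rule lin_map_fun_space_expand[OF _ fin f])
  also have "\<dots> = vact U (matrix_of I g) f"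
    unfolding vact_def matrix_of_def using assms(1,2) f
    by (intro ext sum.mono_neutral_cong_left) (auto simp: carrier_fun_space)
  finally show "vact U (matrix_of I g) f = g f" by simp
qed

lemma fun_space_smult: "c \<odot>\<^bsub>fun_space S\<^esub> f = mscale c f"
  by (simp add: mscale_def)

text \<open>\<open>I\<close> indexes the coordinates of \<open>X\<close>, while \<open>U\<close>
  only has to be large enough for all modules in play, so that matrices between them can be
  multiplied over one index set.\<close>

locale coord_module = k_algebra R \<eta> + X: lmodule R X
  for R :: "('r, 's) ring_scheme" (structure) and \<eta> :: "'k::field \<Rightarrow> 'r" and X :: "('r, 'x) module" +
  fixes U I :: "'i set" and \<xi> :: "'x \<Rightarrow> 'i \<Rightarrow> 'k"
  assumes fin_U: "finite U" and sub_U: "I \<subseteq> U"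
    and \<xi>_bij: "bij_betw \<xi> (carrier X) (carrier (fun_space I))"
    and \<xi>_add: "\<lbrakk>x \<in> carrier X; y \<in> carrier X\<rbrakk> \<Longrightarrow> \<xi> (x \<oplus>\<^bsub>X\<^esub> y) = \<xi> x + \<xi> y"
    and \<xi>_smult: "x \<in> carrier X \<Longrightarrow> \<xi> (\<eta> c \<odot>\<^bsub>X\<^esub> x) = mscale c (\<xi> x)"
begin

definition "\<xi>i = inv_into (carrier X) \<xi>"

lemma \<xi>_closed [simp]: "x \<in> carrier X \<Longrightarrow> \<xi> x \<in> carrier (fun_space I)"
  and \<xi>i_closed [simp]: "f \<in> carrier (fun_space I) \<Longrightarrow> \<xi>i f \<in> carrier X"
  and \<xi>_\<xi>i [simp]: "f \<in> carrier (fun_space I) \<Longrightarrow> \<xi> (\<xi>i f) = f"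
  and \<xi>i_\<xi> [simp]: "x \<in> carrier X \<Longrightarrow> \<xi>i (\<xi> x) = x"
  using \<xi>_bij unfolding \<xi>i_def
  by (auto simp: bij_betw_def inv_into_into f_inv_into_f inv_into_f_f)

lemma \<xi>_eqI: "\<lbrakk>x \<in> carrier X; y \<in> carrier X; \<xi> x = \<xi> y\<rbrakk> \<Longrightarrow> x = y"
  using \<xi>i_\<xi> by metis

lemma \<xi>i_add:
  "\<lbrakk>f \<in> carrier (fun_space I); g \<in> carrier (fun_space I)\<rbrakk> \<Longrightarrow> \<xi>i (f + g) = \<xi>i f \<oplus>\<^bsub>X\<^esub> \<xi>i g"
proof -
  assume fg: "f \<in> carrier (fun_space I)" "g \<in> carrier (fun_space I)"
  then have "f + g \<in> carrier (fun_space I)" by (auto simp: carrier_fun_space)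
  then show ?thesis using fg by (intro \<xi>_eqI) (simp_all add: \<xi>_add)
qed

lemma \<xi>i_smult: "f \<in> carrier (fun_space I) \<Longrightarrow> \<xi>i (mscale c f) = \<eta> c \<odot>\<^bsub>X\<^esub> \<xi>i f"
proof -
  assume f: "f \<in> carrier (fun_space I)"
  then have "mscale c f \<in> carrier (fun_space I)" by (auto simp: carrier_fun_space mscale_def)
  then show ?thesis using f by (intro \<xi>_eqI) (simp_all add: \<xi>_smult)
qed

definition \<rho> :: "'r \<Rightarrow> 'i \<times> 'i \<Rightarrow> 'k" where
  "\<rho> a = matrix_of I (\<lambda>f. \<xi> (a \<odot>\<^bsub>X\<^esub> \<xi>i f))"

lemma smult_comm: "\<lbrakk>a \<in> carrier R; x \<in> carrier X\<rbrakk> \<Longrightarrow> a \<odot>\<^bsub>X\<^esub> (\<eta> c \<odot>\<^bsub>X\<^esub> x) = \<eta> c \<odot>\<^bsub>X\<^esub> (a \<odot>\<^bsub>X\<^esub> x)"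
  by (simp add: X.lsmult_assoc[symmetric] \<eta>_central)

lemma \<rho>_act:
  assumes a: "a \<in> carrier R"
  shows "\<rho> a \<in> mats I I" "x \<in> carrier X \<Longrightarrow> vact U (\<rho> a) (\<xi> x) = \<xi> (a \<odot>\<^bsub>X\<^esub> x)"
proof -
  have l: "lin_map (fun_space I) (fun_space I) (\<lambda>f. \<xi> (a \<odot>\<^bsub>X\<^esub> \<xi>i f))"
  proof (rule lin_mapI)
    show "\<xi> (a \<odot>\<^bsub>X\<^esub> \<xi>i (c \<odot>\<^bsub>fun_space I\<^esub> f)) = c \<odot>\<^bsub>fun_space I\<^esub> \<xi> (a \<odot>\<^bsub>X\<^esub> \<xi>i f)"
      if "f \<in> carrier (fun_space I)" for c f
      using that a \<xi>i_smult[OF that, of c] smult_comm[OF a, of "\<xi>i f" c]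
      by (simp add: \<xi>_smult fun_space_smult del: fun_space_simps(3))
  qed (use a in \<open>simp_all add: \<xi>i_add \<xi>_add X.lsmult_r_distr\<close>)
  show "\<rho> a \<in> mats I I" unfolding \<rho>_def by (rule matrix_of(1)[OF fin_U sub_U l])
  show "vact U (\<rho> a) (\<xi> x) = \<xi> (a \<odot>\<^bsub>X\<^esub> x)" if "x \<in> carrier X"
    unfolding \<rho>_def using matrix_of(2)[OF fin_U sub_U l, of "\<xi> x"] that by simp
qed

lemma \<rho>_eqI:
  assumes "A \<in> mats J I" "B \<in> mats J I" "\<And>x. x \<in> carrier X \<Longrightarrow> vact U A (\<xi> x) = vact U B (\<xi> x)"
  shows "A = B"
  using vact_eqI[OF fin_U sub_U assms(1,2)] assms(3) \<xi>_\<xi>i \<xi>i_closed by metis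

lemma mat_rep: "mat_rep R \<eta> U I \<rho>"
proof (intro mat_rep.intro mat_rep_axioms.intro k_algebra_axioms fin_U sub_U)
  show "\<rho> a \<in> mats I I" if "a \<in> carrier R" for a using \<rho>_act(1)[OF that] .
  show "\<rho> (a \<oplus> b) = \<rho> a + \<rho> b" if "a \<in> carrier R" "b \<in> carrier R" for a b
    using that by (intro \<rho>_eqI[of _ I]) (simp_all add: \<rho>_act vact_lin X.lsmult_l_distr \<xi>_add mats_closed)
  show "\<rho> (a \<otimes> b) = mmul U (\<rho> a) (\<rho> b)" if "a \<in> carrier R" "b \<in> carrier R" for a b
    using that by (intro \<rho>_eqI[of _ I])
      (simp_all add: \<rho>_act vact_mmul X.lsmult_assoc, rule mats_closed(6)[OF \<rho>_act(1) \<rho>_act(1)])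
  show "\<rho> (\<eta> c) = mscale c (mdiag I)" for c
  proof (rule \<rho>_eqI)
    show "\<rho> (\<eta> c) \<in> mats I I" by (simp add: \<rho>_act)
    show "mscale c (mdiag I) \<in> mats I I" by (auto simp: mscale_def mdiag_def carrier_fun_space)
    show "vact U (\<rho> (\<eta> c)) (\<xi> x) = vact U (mscale c (mdiag I)) (\<xi> x)" if "x \<in> carrier X" for x
    proof -
      have "\<xi> x i = 0" if "i \<notin> I" for i
        using \<xi>_closed[OF \<open>x \<in> carrier X\<close>] that by (simp add: carrier_fun_space)
      then have "(\<lambda>i. if i \<in> I then \<xi> x i else 0) = \<xi> x" by auto
      then show ?thesis
        using that by (simp add: \<rho>_act \<xi>_smult vact_lin vact_mdiag fin_U sub_U)
    qed
  qed
qed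

definition bvec :: "'i \<Rightarrow> 'x" where "bvec i = \<xi>i (uvec i)"

lemma bvec_closed [simp]: "i \<in> I \<Longrightarrow> bvec i \<in> carrier X"
  by (simp add: bvec_def uvec_closed)

lemma \<xi>_bvec: "i \<in> I \<Longrightarrow> \<xi> (bvec i) = uvec i"
  by (simp add: bvec_def uvec_closed)

lemma inj_bvec: "inj_on bvec I"
proof (rule inj_onI)
  fix i j assume "i \<in> I" "j \<in> I" "bvec i = bvec j"
  then have "(uvec i :: 'i \<Rightarrow> 'k) = uvec j" using \<xi>_bvec by metis
  then show "i = j" by (metis uvec_def zero_neq_one)
qed

text \<open>Expands \<open>x\<close> in the basis \<open>bvec\<close> and reads the coefficients as
  elements of \<open>R\<close>. It is linear over \<open>K\<close>; its failure to be linear over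
  \<open>R\<close> is what the derivation of an extension measures.\<close>

definition sect :: "'x \<Rightarrow> 'x \<Rightarrow> 'r" where
  "sect x = (\<lambda>y. if y \<in> bvec ` I then \<eta> (\<xi> x (inv_into I bvec y)) else \<zero>)"

lemma sect_closed: "sect x \<in> carrier (free_on R X)"
proof -
  have "finite I" using fin_U sub_U by (rule rev_finite_subset)
  then have "finite {y. sect x y \<noteq> \<zero>}" by (rule finite_subset[rotated, OF finite_imageI[of I bvec]]) (auto simp: sect_def)
  moreover have "sect x y \<in> carrier R" for y by (simp add: sect_def)
  moreover have "sect x y = \<zero>" if "y \<notin> carrier X" for y using that by (auto simp: sect_def)
  ultimately show ?thesis by (simp add: carrier_free_on)
qed

lemma sect_add: "\<lbrakk>x \<in> carrier X; y \<in> carrier X\<rbrakk> \<Longrightarrow> sect (x \<oplus>\<^bsub>X\<^esub> y) = sect x \<oplus>\<^bsub>free_on R X\<^esub> sect y"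
  by (auto simp: sect_def \<xi>_add \<eta>_add)

lemma sect_smult: "x \<in> carrier X \<Longrightarrow> sect (\<eta> c \<odot>\<^bsub>X\<^esub> x) = \<eta> c \<odot>\<^bsub>free_on R X\<^esub> sect x"
  by (auto simp: sect_def \<xi>_smult mscale_def \<eta>_mult)

lemma sect_bvec: "i \<in> I \<Longrightarrow> sect (bvec i) = fsingle R \<one> (bvec i)"
  using inj_bvec by (auto simp: sect_def fsingle_def \<xi>_bvec uvec_def \<eta>_one \<eta>_zero inj_on_def fun_eq_iff)

text \<open>Both sides are linear over \<open>K\<close>. In coordinates the left side becomes a map
  \<open>g\<close> that fixes the unit vectors, hence has the matrix of the identity.\<close>

lemma aug_sect:
  assumes x: "x \<in> carrier X"
  shows "augmentation R X (sect x) = x"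
proof -
  define g where "g f = \<xi> (augmentation R X (sect (\<xi>i f)))" for f
  have l: "lin_map (fun_space I) (fun_space I) g"
  proof (rule lin_mapI)
    show "g f \<in> carrier (fun_space I)" if "f \<in> carrier (fun_space I)" for f
      by (simp add: g_def X.augmentation_closed sect_closed)
    show "g (f \<oplus>\<^bsub>fun_space I\<^esub> h) = g f \<oplus>\<^bsub>fun_space I\<^esub> g h"
      if "f \<in> carrier (fun_space I)" "h \<in> carrier (fun_space I)" for f h
      using X.augmentation_add[OF sect_closed sect_closed] that
      by (simp add: g_def \<xi>i_add sect_add \<xi>_add X.augmentation_closed sect_closed)
    show "g (c \<odot>\<^bsub>fun_space I\<^esub> f) = c \<odot>\<^bsub>fun_space I\<^esub> g f" if "f \<in> carrier (fun_space I)" for c f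
      using X.augmentation_smult[OF \<eta>_closed sect_closed] that \<xi>i_smult[OF that, of c]
      by (simp add: g_def sect_smult \<xi>_smult X.augmentation_closed sect_closed fun_space_smult
          del: fun_space_simps(3))
  qed
  have "g (uvec i) = uvec i" if "i \<in> I" for i
    using that X.augmentation_fsingle[of \<one> "bvec i"]
    by (simp add: g_def bvec_def[symmetric] sect_bvec X.lsmult_one \<xi>_bvec)
  then have "matrix_of I g = matrix_of I (\<lambda>f. f)" by (auto simp: matrix_of_def)
  moreover have "lin_map (fun_space I) (fun_space I) (\<lambda>f :: 'i \<Rightarrow> 'k. f)" by (simp add: lin_map_def)
  ultimately have "g f = f" if "f \<in> carrier (fun_space I)" for f
    using matrix_of(2)[OF fin_U sub_U l that] matrix_of(2)[OF fin_U sub_U _ that] by metis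
  from this[OF \<xi>_closed[OF x]] show ?thesis
    using x by (intro \<xi>_eqI) (simp_all add: g_def X.augmentation_closed sect_closed)
qed

lemma \<rho>_mdiag:
  assumes a: "a \<in> carrier R" and S: "S \<subseteq> I"
    and eq: "\<And>x. x \<in> carrier X \<Longrightarrow> \<xi> (a \<odot>\<^bsub>X\<^esub> x) = (\<lambda>i. if i \<in> S then \<xi> x i else 0)"
  shows "\<rho> a = mdiag S"
proof (rule \<rho>_eqI[OF \<rho>_act(1)[OF a]])
  show "mdiag S \<in> mats I I" using S by (auto simp: mdiag_def carrier_fun_space)
  show "vact U (\<rho> a) (\<xi> x) = vact U (mdiag S) (\<xi> x)" if "x \<in> carrier X" for x
    using that S sub_U by (simp add: \<rho>_act(2)[OF a] eq vact_mdiag[OF fin_U])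
qed

end

section \<open>Extensions and derivations\<close>

locale coord_pair = k_algebra R \<eta> + CX: coord_module R \<eta> X U I \<xi>X + CY: coord_module R \<eta> Y U J \<xi>Y
  for R :: "('r, 's) ring_scheme" (structure) and \<eta> :: "'k::field \<Rightarrow> 'r"
    and X :: "('r, 'x) module" and Y :: "('r, 'y) module" and U I J :: "'i set" and \<xi>X \<xi>Y
begin

sublocale ext_pair R \<eta> X Y
  by (rule ext_pair.intro[OF k_algebra_axioms CX.X.lmodule_axioms CY.X.lmodule_axioms])

sublocale mat_reps R \<eta> U I CX.\<rho> J CY.\<rho>
  by (rule mat_reps.intro[OF CX.mat_rep CY.mat_rep])

definition app :: "('i \<times> 'i \<Rightarrow> 'k) \<Rightarrow> 'x \<Rightarrow> 'y" where
  "app m x = CY.\<xi>i (vact U m (\<xi>X x))"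

lemma \<xi>_app: "m \<in> M \<Longrightarrow> \<xi>Y (app m x) = vact U m (\<xi>X x)"
  by (simp add: app_def vact_closed)

lemma app_closed [simp]: "m \<in> M \<Longrightarrow> app m x \<in> carrier Y"
  by (simp add: app_def vact_closed)

lemma app_lin:
  "\<lbrakk>m \<in> M; n \<in> M\<rbrakk> \<Longrightarrow> app (m + n) x = app m x \<oplus>\<^bsub>Y\<^esub> app n x"
  "\<lbrakk>m \<in> M; x \<in> carrier X; y \<in> carrier X\<rbrakk> \<Longrightarrow> app m (x \<oplus>\<^bsub>X\<^esub> y) = app m x \<oplus>\<^bsub>Y\<^esub> app m y"
  "m \<in> M \<Longrightarrow> app (mscale c m) x = \<eta> c \<odot>\<^bsub>Y\<^esub> app m x"
  "\<lbrakk>m \<in> M; x \<in> carrier X\<rbrakk> \<Longrightarrow> app m (\<eta> c \<odot>\<^bsub>X\<^esub> x) = \<eta> c \<odot>\<^bsub>Y\<^esub> app m x"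
  "\<lbrakk>a \<in> carrier R; m \<in> M\<rbrakk> \<Longrightarrow> app (CY.\<rho> a \<star> m) x = a \<odot>\<^bsub>Y\<^esub> app m x"
  "\<lbrakk>a \<in> carrier R; m \<in> M; x \<in> carrier X\<rbrakk> \<Longrightarrow> app (m \<star> CX.\<rho> a) x = app m (a \<odot>\<^bsub>X\<^esub> x)"
  "app 0 x = \<zero>\<^bsub>Y\<^esub>"
proof -
  show "app 0 x = \<zero>\<^bsub>Y\<^esub>"
  proof (rule CY.\<xi>_eqI)
    have "\<xi>Y \<zero>\<^bsub>Y\<^esub> = \<xi>Y \<zero>\<^bsub>Y\<^esub> + \<xi>Y \<zero>\<^bsub>Y\<^esub>" using CY.\<xi>_add[of "\<zero>\<^bsub>Y\<^esub>" "\<zero>\<^bsub>Y\<^esub>"] by simp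
    then have "\<xi>Y \<zero>\<^bsub>Y\<^esub> = 0" by simp
    then show "\<xi>Y (app 0 x) = \<xi>Y \<zero>\<^bsub>Y\<^esub>" by (simp add: \<xi>_app) (simp add: vact_def fun_eq_iff)
  qed simp_all
  show "m \<in> M \<Longrightarrow> app m (\<eta> c \<odot>\<^bsub>X\<^esub> x) = \<eta> c \<odot>\<^bsub>Y\<^esub> app m x" if "x \<in> carrier X"
    using that by (intro CY.\<xi>_eqI) (simp_all add: \<xi>_app CY.\<xi>_smult CX.\<xi>_smult vact_lin)
  show "m \<in> M \<Longrightarrow> app (mscale c m) x = \<eta> c \<odot>\<^bsub>Y\<^esub> app m x"
    by (intro CY.\<xi>_eqI) (simp_all add: \<xi>_app CY.\<xi>_smult vact_lin)
  show "\<lbrakk>a \<in> carrier R; m \<in> M\<rbrakk> \<Longrightarrow> app (CY.\<rho> a \<star> m) x = a \<odot>\<^bsub>Y\<^esub> app m x"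
    using CY.\<rho>_act(2)[of a "app m x"]
    by (intro CY.\<xi>_eqI) (simp_all add: \<xi>_app vact_mmul)
  show "\<lbrakk>a \<in> carrier R; m \<in> M; x \<in> carrier X\<rbrakk> \<Longrightarrow> app (m \<star> CX.\<rho> a) x = app m (a \<odot>\<^bsub>X\<^esub> x)"
    by (intro CY.\<xi>_eqI) (simp_all add: \<xi>_app vact_mmul CX.\<rho>_act)
  show "\<lbrakk>m \<in> M; n \<in> M\<rbrakk> \<Longrightarrow> app (m + n) x = app m x \<oplus>\<^bsub>Y\<^esub> app n x"
    by (intro CY.\<xi>_eqI) (simp_all add: \<xi>_app CY.\<xi>_add vact_lin)
  show "\<lbrakk>m \<in> M; x \<in> carrier X; y \<in> carrier X\<rbrakk> \<Longrightarrow> app m (x \<oplus>\<^bsub>X\<^esub> y) = app m x \<oplus>\<^bsub>Y\<^esub> app m y"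
    by (intro CY.\<xi>_eqI) (simp_all add: \<xi>_app CY.\<xi>_add CX.\<xi>_add vact_lin)
qed

lemma app_inject: "\<lbrakk>m \<in> M; n \<in> M; \<And>x. x \<in> carrier X \<Longrightarrow> app m x = app n x\<rbrakk> \<Longrightarrow> m = n"
  by (rule CX.\<rho>_eqI[of _ J]) (metis \<xi>_app)+

lemma app_ex:
  assumes u: "\<And>x. x \<in> carrier X \<Longrightarrow> u x \<in> carrier Y"
    and add: "\<And>x y. \<lbrakk>x \<in> carrier X; y \<in> carrier X\<rbrakk> \<Longrightarrow> u (x \<oplus>\<^bsub>X\<^esub> y) = u x \<oplus>\<^bsub>Y\<^esub> u y"
    and smult: "\<And>c x. x \<in> carrier X \<Longrightarrow> u (\<eta> c \<odot>\<^bsub>X\<^esub> x) = \<eta> c \<odot>\<^bsub>Y\<^esub> u x"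
  shows "\<exists>m\<in>M. \<forall>x\<in>carrier X. u x = app m x"
proof -
  let ?g = "\<lambda>f. \<xi>Y (u (CX.\<xi>i f))"
  have l: "lin_map (fun_space I) (fun_space J) ?g"
  proof (rule lin_mapI)
    show "?g (c \<odot>\<^bsub>fun_space I\<^esub> f) = c \<odot>\<^bsub>fun_space J\<^esub> ?g f" if "f \<in> carrier (fun_space I)" for c f
      using that CX.\<xi>i_smult[OF that, of c] by (simp add: smult u CY.\<xi>_smult fun_space_smult del: fun_space_simps(3))
  qed (simp_all add: u add CX.\<xi>i_add CY.\<xi>_add)
  note m = matrix_of[OF CX.fin_U CX.sub_U l]
  have "u x = app (matrix_of I ?g) x" if "x \<in> carrier X" for x
    using m(2)[OF CX.\<xi>_closed[OF that]] that by (simp add: app_def u)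
  then show ?thesis using m(1) by blast
qed

definition hom_mats :: "('i \<times> 'i \<Rightarrow> 'k) set" where
  "hom_mats = {m \<in> M. \<forall>a\<in>carrier R. CY.\<rho> a \<star> m = m \<star> CX.\<rho> a}"

lemma app_hom_iff:
  assumes m: "m \<in> M"
  shows "m \<in> hom_mats \<longleftrightarrow> restrict (app m) (carrier X) \<in> lmod_hom R X Y"
proof
  assume h: "m \<in> hom_mats"
  show "restrict (app m) (carrier X) \<in> lmod_hom R X Y"
  proof (rule lmod_homI)
    fix a x assume ax: "a \<in> carrier R" "x \<in> carrier X"
    have "CY.\<rho> a \<star> m = m \<star> CX.\<rho> a" using h ax by (simp add: hom_mats_def)
    then have "a \<odot>\<^bsub>Y\<^esub> app m x = app m (a \<odot>\<^bsub>X\<^esub> x)"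
      using app_lin(5)[OF ax(1) m, of x] app_lin(6)[OF ax(1) m ax(2)] by simp
    then show "restrict (app m) (carrier X) (a \<odot>\<^bsub>X\<^esub> x) = a \<odot>\<^bsub>Y\<^esub> restrict (app m) (carrier X) x"
      using ax by simp
  qed (simp_all add: m app_lin)
next
  assume h: "restrict (app m) (carrier X) \<in> lmod_hom R X Y"
  have "CY.\<rho> a \<star> m = m \<star> CX.\<rho> a" if a: "a \<in> carrier R" for a
  proof (rule app_inject)
    show "app (CY.\<rho> a \<star> m) x = app (m \<star> CX.\<rho> a) x" if x: "x \<in> carrier X" for x
      using lmod_homD(4)[OF h a x] a x m by (simp add: app_lin)
  qed (simp_all add: a m)
  then show "m \<in> hom_mats" using m by (simp add: hom_mats_def)
qed

lemma has_dim_hom_space: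
  assumes "has_dim ((fun_space (J \<times> I))\<lparr>carrier := hom_mats\<rparr>) h"
  shows "has_dim (hom_space R \<eta> X Y) h"
proof (rule has_dim_bij[OF assms])
  let ?V = "(fun_space (J \<times> I))\<lparr>carrier := hom_mats\<rparr>"
  let ?T = "\<lambda>m. restrict (app m) (carrier X)"
  have hM: "m \<in> M" if "m \<in> hom_mats" for m using that by (simp add: hom_mats_def)
  show "lin_map ?V (hom_space R \<eta> X Y) ?T"
  proof (rule lin_mapI)
    show "?T m \<in> carrier (hom_space R \<eta> X Y)" if "m \<in> carrier ?V" for m
      using that hM app_hom_iff[of m] by simp
    show "?T (m \<oplus>\<^bsub>?V\<^esub> n) = ?T m \<oplus>\<^bsub>hom_space R \<eta> X Y\<^esub> ?T n" if "m \<in> carrier ?V" "n \<in> carrier ?V" for m n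
      using that hM by (auto simp: app_lin)
    show "?T (c \<odot>\<^bsub>?V\<^esub> m) = c \<odot>\<^bsub>hom_space R \<eta> X Y\<^esub> ?T m" if "m \<in> carrier ?V" for c m
      using that hM app_lin(3)[of m c] by (auto simp: mscale_def)
  qed
  show "?T \<zero>\<^bsub>?V\<^esub> = \<zero>\<^bsub>hom_space R \<eta> X Y\<^esub>" by (auto simp: app_lin)
  show "bij_betw ?T (carrier ?V) (carrier (hom_space R \<eta> X Y))"
    unfolding bij_betw_def
  proof
    show "inj_on ?T (carrier ?V)"
    proof (rule inj_onI)
      fix m n assume mn: "m \<in> carrier ?V" "n \<in> carrier ?V" "?T m = ?T n"
      show "m = n"
      proof (rule app_inject)
        show "app m x = app n x" if "x \<in> carrier X" for x
          using fun_cong[OF mn(3), of x] that by simp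
      qed (use mn hM in auto)
    qed
    show "?T ` carrier ?V = carrier (hom_space R \<eta> X Y)"
    proof
      show "?T ` carrier ?V \<subseteq> carrier (hom_space R \<eta> X Y)" using hM app_hom_iff by auto
      show "carrier (hom_space R \<eta> X Y) \<subseteq> ?T ` carrier ?V"
      proof
        fix f assume "f \<in> carrier (hom_space R \<eta> X Y)"
        then have f: "f \<in> lmod_hom R X Y" by simp
        note D = lmod_homD[OF f]
        obtain m where m: "m \<in> M" "\<forall>x\<in>carrier X. f x = app m x"
          using app_ex[of f] D by auto
        have "f = ?T m" by (rule extensionalityI[OF D(2)]) (use m(2) in auto)
        then show "f \<in> ?T ` carrier ?V" using m(1) f app_hom_iff by auto
      qed
    qed
  qed
qed

text \<open>The pointwise simplification rules would destroy the group structure of \<open>P0\<close> and \<open>\<Omega>\<close>.\<close>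

declare free_on_simps [simp del] CX.X.syzygy_simps [simp del]

lemma \<Omega>_ops: "add \<Omega> = add P0" "smult \<Omega> = smult P0" "zero \<Omega> = zero P0"
  by (simp_all add: syzygy_def)

lemma \<Omega>_P0: "w \<in> carrier \<Omega> \<Longrightarrow> w \<in> carrier P0"
  by (simp add: CX.X.carrier_syzygy)

text \<open>The additive extension of \<open>fsingle R a x \<mapsto> \<delta> a x\<close>. It fails
  to be linear by a term that only involves the augmentation (\<open>dsum_smult\<close>), so its
  restriction to the syzygy is a homomorphism; this is how a derivation gives a class in
  \<open>Ext1\<close>.\<close>

definition dsum :: "('r \<Rightarrow> 'i \<times> 'i \<Rightarrow> 'k) \<Rightarrow> ('x \<Rightarrow> 'r) \<Rightarrow> 'y" where
  "dsum \<delta> = fsum R Y (\<lambda>a x. app (\<delta> a) x)"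

lemma dsum_addmap:
  assumes \<delta>: "derivation \<delta>"
  shows "addmap P0 Y (dsum \<delta>)"
  unfolding dsum_def
  by (rule fsum_addmap[OF CY.X.M.abelian_group_axioms]) (simp_all add: derivationD[OF \<delta>] app_lin)

lemma dsum_fsingle:
  assumes \<delta>: "derivation \<delta>" and "a \<in> carrier R" "x \<in> carrier X"
  shows "dsum \<delta> (fsingle R a x) = app (\<delta> a) x"
  unfolding dsum_def
  by (rule fsum_fsingle[OF CY.X.M.abelian_group_axioms, where M = X]) (simp_all add: derivationD[OF \<delta>] app_lin assms)

lemma smult_addmap:
  assumes "left_module R N" "a \<in> carrier R"
  shows "addmap N N (\<lambda>x. a \<odot>\<^bsub>N\<^esub> x)"
proof -
  interpret N: left_module R N by fact
  show ?thesis using assms(2) by (simp add: addmap_def N.lsmult_r_distr)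
qed

lemma smult_fsingle: "b \<in> carrier R \<Longrightarrow> b \<odot>\<^bsub>P0\<^esub> fsingle R a x = fsingle R (b \<otimes> a) x"
  by (simp add: free_on_simps fsingle_mult)

lemma app_addmap: "m \<in> M \<Longrightarrow> addmap X Y (app m)"
  by (simp add: addmap_def app_lin)

text \<open>On \<open>fsingle R a x\<close> this is the product rule for
  \<open>\<delta> (b \<otimes> a)\<close>, the augmentation being \<open>a x\<close> in the last
  term.\<close>

lemma dsum_smult:
  assumes \<delta>: "derivation \<delta>" and b: "b \<in> carrier R" and w: "w \<in> carrier P0"
  shows "dsum \<delta> (b \<odot>\<^bsub>P0\<^esub> w) = b \<odot>\<^bsub>Y\<^esub> dsum \<delta> w \<oplus>\<^bsub>Y\<^esub> app (\<delta> b) (augmentation R X w)"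
proof (rule addmap_free_eq[OF CY.X.M.abelian_group_axioms _ _ _ w])
  show "addmap P0 Y (\<lambda>w. dsum \<delta> (b \<odot>\<^bsub>P0\<^esub> w))"
    by (rule addmap_comp[OF smult_addmap[OF P0.left_module_axioms b] dsum_addmap[OF \<delta>]])
  show "addmap P0 Y (\<lambda>w. b \<odot>\<^bsub>Y\<^esub> dsum \<delta> w \<oplus>\<^bsub>Y\<^esub> app (\<delta> b) (augmentation R X w))"
    by (intro addmap_add[OF CY.X.M.abelian_group_axioms] addmap_comp[OF dsum_addmap[OF \<delta>] smult_addmap[OF CY.X.left_module_axioms b]]
        addmap_comp[OF CX.X.augmentation_addmap app_addmap]) (rule derivationD(1)[OF \<delta> b])
  show "dsum \<delta> (b \<odot>\<^bsub>P0\<^esub> fsingle R a x) =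
     b \<odot>\<^bsub>Y\<^esub> dsum \<delta> (fsingle R a x) \<oplus>\<^bsub>Y\<^esub> app (\<delta> b) (augmentation R X (fsingle R a x))"
    if "a \<in> carrier R" "x \<in> carrier X" for a x
    using that b by (simp add: smult_fsingle dsum_fsingle[OF \<delta>] derivationD[OF \<delta>] app_lin CX.X.augmentation_fsingle)
qed

lemma dsum_hom:
  assumes \<delta>: "derivation \<delta>"
  shows "restrict (dsum \<delta>) (carrier \<Omega>) \<in> lmod_hom R \<Omega> Y"
proof (rule lmod_homI)
  note A = addmapD[OF dsum_addmap[OF \<delta>]]
  show "restrict (dsum \<delta>) (carrier \<Omega>) w \<in> carrier Y" if "w \<in> carrier \<Omega>" for w
    using that A(1) \<Omega>_P0 by simp
  show "restrict (dsum \<delta>) (carrier \<Omega>) (w \<oplus>\<^bsub>\<Omega>\<^esub> w') =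
      restrict (dsum \<delta>) (carrier \<Omega>) w \<oplus>\<^bsub>Y\<^esub> restrict (dsum \<delta>) (carrier \<Omega>) w'"
    if "w \<in> carrier \<Omega>" "w' \<in> carrier \<Omega>" for w w'
    using that \<Omega>.M.a_closed[OF that] A(2)[OF \<Omega>_P0 \<Omega>_P0, of w w'] by (simp add: \<Omega>_ops)
  show "restrict (dsum \<delta>) (carrier \<Omega>) (b \<odot>\<^bsub>\<Omega>\<^esub> w) = b \<odot>\<^bsub>Y\<^esub> restrict (dsum \<delta>) (carrier \<Omega>) w"
    if b: "b \<in> carrier R" and w: "w \<in> carrier \<Omega>" for b w
  proof -
    have "app (\<delta> b) \<zero>\<^bsub>X\<^esub> = \<zero>\<^bsub>Y\<^esub>"
      by (rule addmap_zero[OF CX.X.M.abelian_group_axioms CY.X.M.abelian_group_axioms app_addmap[OF derivationD(1)[OF \<delta> b]]])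
    then show ?thesis
      using dsum_smult[OF \<delta> b \<Omega>_P0[OF w]] w b \<Omega>.lsmult_closed[OF b w] A(1)[OF \<Omega>_P0[OF w]]
      by (simp add: CX.X.carrier_syzygy \<Omega>_ops)
  qed
qed simp

lemma free_hom:
  assumes "\<And>x. x \<in> carrier X \<Longrightarrow> u x \<in> carrier Y"
  shows "addmap P0 Y (fsum R Y (\<lambda>a x. a \<odot>\<^bsub>Y\<^esub> u x))"
    "\<lbrakk>a \<in> carrier R; x \<in> carrier X\<rbrakk> \<Longrightarrow> fsum R Y (\<lambda>a x. a \<odot>\<^bsub>Y\<^esub> u x) (fsingle R a x) = a \<odot>\<^bsub>Y\<^esub> u x"
    "restrict (fsum R Y (\<lambda>a x. a \<odot>\<^bsub>Y\<^esub> u x)) (carrier P0) \<in> lmod_hom R P0 Y"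
proof -
  show "addmap P0 Y (fsum R Y (\<lambda>a x. a \<odot>\<^bsub>Y\<^esub> u x))"
    by (rule fsum_addmap[OF CY.X.M.abelian_group_axioms]) (simp_all add: assms CY.X.lsmult_l_distr)
  show "\<lbrakk>a \<in> carrier R; x \<in> carrier X\<rbrakk> \<Longrightarrow> fsum R Y (\<lambda>a x. a \<odot>\<^bsub>Y\<^esub> u x) (fsingle R a x) = a \<odot>\<^bsub>Y\<^esub> u x"
    by (rule fsum_fsingle[OF CY.X.M.abelian_group_axioms, where M = X]) (simp_all add: assms CY.X.lsmult_l_distr)
  show "restrict (fsum R Y (\<lambda>a x. a \<odot>\<^bsub>Y\<^esub> u x)) (carrier P0) \<in> lmod_hom R P0 Y"
    by (rule CX.X.fsum_lmod_hom[OF CY.X.left_module_axioms assms])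
qed

text \<open>On all of \<open>P0\<close> the two sides differ by \<open>app m\<close> after the
  augmentation, because \<open>inner_der m a + m \<star> \<rho> a = \<rho> a \<star> m\<close> with
  the matrices of \<open>X\<close> on the left and of \<open>Y\<close> on the right. On the syzygy
  the difference vanishes, and what remains extends to a homomorphism on \<open>P0\<close>.\<close>

lemma dsum_inner:
  assumes m: "m \<in> M" and w: "w \<in> carrier \<Omega>"
  shows "dsum (inner_der m) w = fsum R Y (\<lambda>a x. a \<odot>\<^bsub>Y\<^esub> app m x) w"
proof -
  note \<delta> = derivation_inner[OF m]
  have wP: "w \<in> carrier P0" by (rule \<Omega>_P0[OF w])
  have am: "app m x \<in> carrier Y" for x using m by simp
  note fh = free_hom[of "app m", OF am]
  have "dsum (inner_der m) w \<oplus>\<^bsub>Y\<^esub> app m (augmentation R X w) = fsum R Y (\<lambda>a x. a \<odot>\<^bsub>Y\<^esub> app m x) w"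
  proof (rule addmap_free_eq[OF CY.X.M.abelian_group_axioms _ fh(1) _ wP])
    show "addmap P0 Y (\<lambda>w. dsum (inner_der m) w \<oplus>\<^bsub>Y\<^esub> app m (augmentation R X w))"
      by (intro addmap_add[OF CY.X.M.abelian_group_axioms] dsum_addmap[OF \<delta>]
          addmap_comp[OF CX.X.augmentation_addmap app_addmap[OF m]])
    show "dsum (inner_der m) (fsingle R a x) \<oplus>\<^bsub>Y\<^esub> app m (augmentation R X (fsingle R a x)) =
        fsum R Y (\<lambda>a x. a \<odot>\<^bsub>Y\<^esub> app m x) (fsingle R a x)" if "a \<in> carrier R" "x \<in> carrier X" for a x
    proof -
      have "app (inner_der m a) x \<oplus>\<^bsub>Y\<^esub> app (m \<star> CX.\<rho> a) x = app (inner_der m a + m \<star> CX.\<rho> a) x"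
        using that m derivationD(1)[OF \<delta>] by (simp only: app_lin(1) act_closed)
      also have "inner_der m a + m \<star> CX.\<rho> a = CY.\<rho> a \<star> m" by (simp add: inner_der_def)
      finally show ?thesis
        using that m by (simp add: dsum_fsingle[OF \<delta>] CX.X.augmentation_fsingle fh(2) app_lin)
    qed
  qed
  moreover have "app m \<zero>\<^bsub>X\<^esub> = \<zero>\<^bsub>Y\<^esub>"
    by (rule addmap_zero[OF CX.X.M.abelian_group_axioms CY.X.M.abelian_group_axioms app_addmap[OF m]])
  ultimately show ?thesis
    using w addmapD(1)[OF dsum_addmap[OF \<delta>] wP] by (simp add: CX.X.carrier_syzygy)
qed

lemma sect_addmap: "addmap X P0 CX.sect"
  by (simp add: addmap_def CX.sect_closed CX.sect_add)

lemma sect_zero: "CX.sect \<zero>\<^bsub>X\<^esub> = \<zero>\<^bsub>P0\<^esub>"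
  by (rule addmap_zero[OF CX.X.M.abelian_group_axioms P0.M.abelian_group_axioms sect_addmap])

text \<open>With the \<open>K\<close>-linear section \<open>s\<close> of \<open>P0 \<rightarrow> X\<close>, \<open>\<delta> a\<close> is the matrix of \<open>x \<mapsto> \<phi> (a s(x) - s(a x))\<close>.\<close>

lemma hom_decompose:
  assumes \<phi>: "\<phi> \<in> lmod_hom R \<Omega> Y"
  shows "\<exists>\<delta> g. derivation \<delta> \<and> g \<in> lmod_hom R P0 Y \<and> (\<forall>w\<in>carrier \<Omega>. \<phi> w = dsum \<delta> w \<oplus>\<^bsub>Y\<^esub> g w)"
proof -
  note \<phi>D = lmod_homD[OF \<phi>, unfolded \<Omega>_ops]
  let ?aug = "augmentation R X"
  have sm: "addmap P0 P0 (\<lambda>w. a \<odot>\<^bsub>P0\<^esub> w)" if "a \<in> carrier R" for a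
    by (rule smult_addmap[OF P0.left_module_axioms that])
  have sd: "a \<odot>\<^bsub>P0\<^esub> (f \<ominus>\<^bsub>P0\<^esub> g) = a \<odot>\<^bsub>P0\<^esub> f \<ominus>\<^bsub>P0\<^esub> a \<odot>\<^bsub>P0\<^esub> g"
    if "a \<in> carrier R" "f \<in> carrier P0" "g \<in> carrier P0" for a f g
    by (rule addmap_diff[OF P0.M.abelian_group_axioms P0.M.abelian_group_axioms sm that(2,3)]) fact
  have ac: "a \<odot>\<^bsub>P0\<^esub> f \<in> carrier P0" if "a \<in> carrier R" "f \<in> carrier P0" for a f
    by (rule P0.lsmult_closed[OF that])
  note sc = CX.sect_closed
  have xc: "a \<odot>\<^bsub>X\<^esub> x \<in> carrier X" if "a \<in> carrier R" "x \<in> carrier X" for a x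
    by (rule CX.X.lsmult_closed[OF that])
  define z where "z a x = a \<odot>\<^bsub>P0\<^esub> CX.sect x \<ominus>\<^bsub>P0\<^esub> CX.sect (a \<odot>\<^bsub>X\<^esub> x)" for a x
  have zP: "z a x \<in> carrier P0" if "a \<in> carrier R" for a x
    unfolding z_def using that by (intro P0.M.minus_closed ac sc)
  have z\<Omega>: "z a x \<in> carrier \<Omega>" if "a \<in> carrier R" "x \<in> carrier X" for a x
  proof -
    have "?aug (z a x) = ?aug (a \<odot>\<^bsub>P0\<^esub> CX.sect x) \<ominus>\<^bsub>X\<^esub> ?aug (CX.sect (a \<odot>\<^bsub>X\<^esub> x))"
      unfolding z_def
      by (rule addmap_diff[OF P0.M.abelian_group_axioms CX.X.M.abelian_group_axioms CX.X.augmentation_addmap ac[OF that(1) sc] sc])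
    also have "\<dots> = \<zero>\<^bsub>X\<^esub>"
      using that xc[OF that] CX.X.augmentation_smult[OF that(1) sc, of x]
      by (simp add: CX.aug_sect CX.X.M.r_neg a_minus_def free_on_simps)
    finally show ?thesis using zP that by (simp add: CX.X.carrier_syzygy)
  qed
  have z_addx: "z a (x \<oplus>\<^bsub>X\<^esub> y) = z a x \<oplus>\<^bsub>P0\<^esub> z a y" if "a \<in> carrier R" "x \<in> carrier X" "y \<in> carrier X" for a x y
    using that by (simp add: z_def CX.sect_add CX.X.lsmult_r_distr P0.lsmult_r_distr sc xc ac P0.M.minus_add_minus)
  have z_adda: "z (a \<oplus> b) x = z a x \<oplus>\<^bsub>P0\<^esub> z b x" if "a \<in> carrier R" "b \<in> carrier R" "x \<in> carrier X" for a b x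
    using that by (simp add: z_def CX.sect_add CX.X.lsmult_l_distr P0.lsmult_l_distr sc xc ac P0.M.minus_add_minus)
  \<comment> \<open>\<open>CX.sect\<close> of \<open>b x\<close>, multiplied by \<open>a\<close>, is
    inserted between the two terms. Applying \<open>\<phi>\<close> turns the identity into the
    product rule for \<open>\<delta>\<close>.\<close>
  have z_mult: "z (a \<otimes> b) x = a \<odot>\<^bsub>P0\<^esub> z b x \<oplus>\<^bsub>P0\<^esub> z a (b \<odot>\<^bsub>X\<^esub> x)"
    if "a \<in> carrier R" "b \<in> carrier R" "x \<in> carrier X" for a b x
    using that by (simp add: z_def sd CX.X.lsmult_assoc P0.lsmult_assoc sc xc ac P0.M.minus_add_telescope)
  have z_smult: "z a (\<eta> c \<odot>\<^bsub>X\<^esub> x) = \<eta> c \<odot>\<^bsub>P0\<^esub> z a x" if "a \<in> carrier R" "x \<in> carrier X" for a c x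
  proof -
    have "a \<odot>\<^bsub>P0\<^esub> (\<eta> c \<odot>\<^bsub>P0\<^esub> CX.sect x) = \<eta> c \<odot>\<^bsub>P0\<^esub> (a \<odot>\<^bsub>P0\<^esub> CX.sect x)"
      using that by (simp add: P0.lsmult_assoc[symmetric] sc \<eta>_central)
    then show ?thesis
      using that by (simp add: z_def CX.smult_comm CX.sect_smult sd sc xc ac)
  qed
  have z_\<eta>: "z (\<eta> c) x = \<zero>\<^bsub>P0\<^esub>" if "x \<in> carrier X" for c x
    using that by (simp add: z_def CX.sect_smult sc ac a_minus_def P0.M.r_neg)
  have "\<forall>a\<in>carrier R. \<exists>m. m \<in> M \<and> (\<forall>x\<in>carrier X. \<phi> (z a x) = app m x)"
  proof
    fix a assume a: "a \<in> carrier R"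
    have "\<exists>m\<in>M. \<forall>x\<in>carrier X. \<phi> (z a x) = app m x"
      by (rule app_ex) (simp_all add: a z_addx z_smult \<phi>D z\<Omega>)
    then show "\<exists>m. m \<in> M \<and> (\<forall>x\<in>carrier X. \<phi> (z a x) = app m x)" by blast
  qed
  then obtain \<delta> where \<delta>M: "\<And>a. a \<in> carrier R \<Longrightarrow> \<delta> a \<in> M"
    and \<delta>: "\<And>a x. \<lbrakk>a \<in> carrier R; x \<in> carrier X\<rbrakk> \<Longrightarrow> app (\<delta> a) x = \<phi> (z a x)"
    unfolding bchoice_iff by (metis (no_types, lifting))
  have \<phi>0: "\<phi> \<zero>\<^bsub>P0\<^esub> = \<zero>\<^bsub>Y\<^esub>"
    using addmap_zero[OF \<Omega>.M.abelian_group_axioms CY.X.M.abelian_group_axioms lmod_hom_addmap[OF \<phi>]]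
    by (simp add: \<Omega>_ops)
  have der: "derivation \<delta>"
    unfolding derivation_def
  proof (intro conjI ballI allI)
    fix a b assume ab: "a \<in> carrier R" "b \<in> carrier R"
    show "\<delta> (a \<oplus> b) = \<delta> a + \<delta> b"
    proof (rule app_inject)
      show "app (\<delta> (a \<oplus> b)) x = app (\<delta> a + \<delta> b) x" if "x \<in> carrier X" for x
        using ab that app_lin(1)[OF \<delta>M[OF ab(1)] \<delta>M[OF ab(2)], of x] by (simp add: \<delta> z_adda \<phi>D z\<Omega>)
    qed (use ab in \<open>simp_all add: \<delta>M\<close>)
    show "\<delta> (a \<otimes> b) = CY.\<rho> a \<star> \<delta> b + \<delta> a \<star> CX.\<rho> b"
    proof (rule app_inject)
      show "app (\<delta> (a \<otimes> b)) x = app (CY.\<rho> a \<star> \<delta> b + \<delta> a \<star> CX.\<rho> b) x" if x: "x \<in> carrier X" for x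
      proof -
        have "app (CY.\<rho> a \<star> \<delta> b + \<delta> a \<star> CX.\<rho> b) x = app (CY.\<rho> a \<star> \<delta> b) x \<oplus>\<^bsub>Y\<^esub> app (\<delta> a \<star> CX.\<rho> b) x"
          by (rule app_lin(1)) (use ab in \<open>simp_all add: \<delta>M\<close>)
        then show ?thesis
          using ab x \<Omega>.lsmult_closed[OF ab(1) z\<Omega>[OF ab(2) x]]
          by (simp add: app_lin \<delta>M \<delta> z_mult \<phi>D z\<Omega> xc \<Omega>_ops)
      qed
    qed (use ab in \<open>simp_all add: \<delta>M\<close>)
  next
    show "\<delta> a \<in> M" if "a \<in> carrier R" for a using \<delta>M that by blast
    show "\<delta> (\<eta> c) = 0" for c
    proof (rule app_inject)
      show "app (\<delta> (\<eta> c)) x = app 0 x" if "x \<in> carrier X" for x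
        using that by (simp only: \<delta> z_\<eta> \<eta>_closed \<phi>0 app_lin(7))
    qed (simp_all add: \<delta>M)
  qed
  \<comment> \<open>The \<open>K\<close>-linear projection of \<open>P0\<close> onto the syzygy
    along the section. It extends \<open>\<phi>\<close> to the additive map
    \<open>\<phi> (T w)\<close> on \<open>P0\<close>, which can be compared with
    \<open>dsum \<delta>\<close> on the elements \<open>fsingle R a x\<close>.\<close>
  define T where "T w = w \<ominus>\<^bsub>P0\<^esub> CX.sect (?aug w)" for w
  have TP: "T w \<in> carrier P0" if "w \<in> carrier P0" for w
    unfolding T_def using that by (intro P0.M.minus_closed sc)
  have T\<Omega>: "T w \<in> carrier \<Omega>" if w: "w \<in> carrier P0" for w
  proof -
    have a: "?aug w \<in> carrier X" by (rule CX.X.augmentation_closed[OF w])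
    have "?aug (T w) = ?aug w \<ominus>\<^bsub>X\<^esub> ?aug (CX.sect (?aug w))"
      unfolding T_def
      by (rule addmap_diff[OF P0.M.abelian_group_axioms CX.X.M.abelian_group_axioms CX.X.augmentation_addmap w sc])
    also have "\<dots> = \<zero>\<^bsub>X\<^esub>" using a by (simp add: CX.aug_sect CX.X.M.r_neg a_minus_def)
    finally show ?thesis using TP[OF w] by (simp add: CX.X.carrier_syzygy)
  qed
  define u where "u x = \<phi> (T (fsingle R \<one> x))" for x
  have s1: "fsingle R a x \<in> carrier P0" if "a \<in> carrier R" "x \<in> carrier X" for a x
    using that by (rule fsingle_closed)
  have uY: "u x \<in> carrier Y" if "x \<in> carrier X" for x
    unfolding u_def by (rule \<phi>D(1)[OF T\<Omega>[OF s1[OF R.one_closed that]]])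
  note fh = free_hom[of u, OF uY]
  let ?g = "fsum R Y (\<lambda>a x. a \<odot>\<^bsub>Y\<^esub> u x)"
  have T_add: "addmap P0 \<Omega> T"
  proof -
    have "addmap P0 P0 T"
      unfolding T_def
      by (intro addmap_minus[OF P0.M.abelian_group_axioms] addmap_comp[OF CX.X.augmentation_addmap sect_addmap])
         (simp add: addmap_def)
    then show ?thesis using T\<Omega> by (simp add: addmap_def \<Omega>_ops)
  qed
  have main: "\<phi> (T w) = dsum \<delta> w \<oplus>\<^bsub>Y\<^esub> ?g w" if w: "w \<in> carrier P0" for w
  proof (rule addmap_free_eq[OF CY.X.M.abelian_group_axioms addmap_comp[OF T_add lmod_hom_addmap[OF \<phi>]] _ _ w])
    show "addmap P0 Y (\<lambda>w. dsum \<delta> w \<oplus>\<^bsub>Y\<^esub> ?g w)"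
      by (rule addmap_add[OF CY.X.M.abelian_group_axioms dsum_addmap[OF der] fh(1)])
    show "\<phi> (T (fsingle R a x)) = dsum \<delta> (fsingle R a x) \<oplus>\<^bsub>Y\<^esub> ?g (fsingle R a x)"
      if a: "a \<in> carrier R" and x: "x \<in> carrier X" for a x
    proof -
      have s: "fsingle R a x = a \<odot>\<^bsub>P0\<^esub> fsingle R \<one> x" using a by (simp add: smult_fsingle)
      have aug1: "?aug (fsingle R \<one> x) = x" using x by (simp add: CX.X.augmentation_fsingle CX.X.lsmult_one)
      have "T (fsingle R a x) = a \<odot>\<^bsub>P0\<^esub> fsingle R \<one> x \<ominus>\<^bsub>P0\<^esub> CX.sect (a \<odot>\<^bsub>X\<^esub> x)"
        using a x by (simp add: T_def CX.X.augmentation_fsingle s[symmetric])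
      \<comment> \<open>With \<open>a\<close> times the section of \<open>x\<close> in the middle,
        the first difference is a multiple of a projected basis element, which gives the linear part
        \<open>?g\<close>, and the second is the defect \<open>z a x\<close>, which gives
        \<open>dsum \<delta>\<close>.\<close>
      also have "\<dots> = (a \<odot>\<^bsub>P0\<^esub> fsingle R \<one> x \<ominus>\<^bsub>P0\<^esub> a \<odot>\<^bsub>P0\<^esub> CX.sect x) \<oplus>\<^bsub>P0\<^esub> z a x"
        unfolding z_def using a x by (intro P0.M.minus_add_telescope[symmetric] ac sc s1) simp_all
      also have "a \<odot>\<^bsub>P0\<^esub> fsingle R \<one> x \<ominus>\<^bsub>P0\<^esub> a \<odot>\<^bsub>P0\<^esub> CX.sect x = a \<odot>\<^bsub>P0\<^esub> T (fsingle R \<one> x)"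
        unfolding T_def aug1 using a x by (intro sd[symmetric] s1 sc) simp_all
      finally have T: "T (fsingle R a x) = a \<odot>\<^bsub>P0\<^esub> T (fsingle R \<one> x) \<oplus>\<^bsub>P0\<^esub> z a x" .
      have t1: "T (fsingle R \<one> x) \<in> carrier \<Omega>" by (rule T\<Omega>[OF s1[OF R.one_closed x]])
      have "\<phi> (T (fsingle R a x)) = a \<odot>\<^bsub>Y\<^esub> u x \<oplus>\<^bsub>Y\<^esub> \<phi> (z a x)"
        using \<phi>D(3)[OF _ z\<Omega>[OF a x], of "a \<odot>\<^bsub>P0\<^esub> T (fsingle R \<one> x)"] \<Omega>.lsmult_closed[OF a t1]
          \<phi>D(4)[OF a t1] by (simp add: T \<Omega>_ops u_def)
      also have "\<dots> = \<phi> (z a x) \<oplus>\<^bsub>Y\<^esub> a \<odot>\<^bsub>Y\<^esub> u x"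
        by (rule CY.X.M.a_comm) (simp_all add: a x uY CY.X.lsmult_closed \<phi>D z\<Omega>)
      finally show ?thesis using a x by (simp add: dsum_fsingle[OF der] fh(2) \<delta>)
    qed
  qed
  have "\<phi> w = dsum \<delta> w \<oplus>\<^bsub>Y\<^esub> restrict ?g (carrier P0) w" if w: "w \<in> carrier \<Omega>" for w
  proof -
    have wP: "w \<in> carrier P0" by (rule \<Omega>_P0[OF w])
    have "?aug w = \<zero>\<^bsub>X\<^esub>" using w by (simp add: CX.X.carrier_syzygy)
    moreover have "\<ominus>\<^bsub>P0\<^esub> \<zero>\<^bsub>P0\<^esub> = \<zero>\<^bsub>P0\<^esub>" by (rule P0.M.minus_equality) (rule P0.M.l_zero P0.M.zero_closed)+
    ultimately have "T w = w" using wP by (simp only: T_def sect_zero a_minus_def P0.M.r_zero)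
    then show ?thesis using main[OF wP] wP by simp
  qed
  then show ?thesis using der fh(3) by blast
qed

lemma dsum_cong:
  assumes "derivation \<delta>" "derivation \<delta>'" "\<And>a. a \<in> carrier R \<Longrightarrow> \<delta> a = \<delta>' a" and w: "w \<in> carrier P0"
  shows "dsum \<delta> w = dsum \<delta>' w"
  by (rule addmap_free_eq[OF CY.X.M.abelian_group_axioms dsum_addmap[OF assms(1)] dsum_addmap[OF assms(2)] _ w])
     (simp add: assms(3) dsum_fsingle[OF assms(1)] dsum_fsingle[OF assms(2)])

lemma dsum_add:
  assumes \<delta>: "derivation \<delta>" "derivation \<delta>'" and w: "w \<in> carrier P0"
  shows "dsum (\<lambda>a. \<delta> a + \<delta>' a) w = dsum \<delta> w \<oplus>\<^bsub>Y\<^esub> dsum \<delta>' w"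
proof -
  note s = derivation_add[OF \<delta>]
  show ?thesis
    by (rule addmap_free_eq[OF CY.X.M.abelian_group_axioms dsum_addmap[OF s] addmap_add[OF CY.X.M.abelian_group_axioms dsum_addmap[OF \<delta>(1)] dsum_addmap[OF \<delta>(2)]] _ w])
       (simp only: dsum_fsingle[OF \<delta>(1)] dsum_fsingle[OF \<delta>(2)] dsum_fsingle[OF s] app_lin(1) derivationD[OF \<delta>(1)] derivationD[OF \<delta>(2)])
qed

lemma dsum_scale:
  assumes \<delta>: "derivation \<delta>" and w: "w \<in> carrier P0"
  shows "dsum (\<lambda>a. mscale c (\<delta> a)) w = \<eta> c \<odot>\<^bsub>Y\<^esub> dsum \<delta> w"
proof -
  note s = derivation_scale[OF \<delta>, of c]
  show ?thesis
    by (rule addmap_free_eq[OF CY.X.M.abelian_group_axioms dsum_addmap[OF s] addmap_comp[OF dsum_addmap[OF \<delta>] smult_addmap[OF CY.X.left_module_axioms \<eta>_closed]] _ w])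
       (simp only: dsum_fsingle[OF \<delta>] dsum_fsingle[OF s] app_lin(3) derivationD[OF \<delta>])
qed

text \<open>The difference \<open>k\<close> of \<open>g\<close> and \<open>dsum \<delta>\<close>
  vanishes on the syzygy, so it depends only on the augmentation. Let \<open>m\<close> be the map
  \<open>x \<mapsto> g (fsingle R \<one> x)\<close>; equating \<open>k\<close> on
  \<open>fsingle R a x\<close> and on \<open>fsingle R \<one> (a x)\<close> shows that
  \<open>\<delta> a\<close> is the commutator with \<open>m\<close>.\<close>

lemma inner_if_dsum_extends:
  assumes \<delta>: "derivation \<delta>" and g: "g \<in> lmod_hom R P0 Y"
    and eq: "\<And>w. w \<in> carrier \<Omega> \<Longrightarrow> dsum \<delta> w = g w"
  shows "\<exists>m\<in>M. \<forall>a\<in>carrier R. \<delta> a = inner_der m a"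
proof -
  note d = derivationD[OF \<delta>]
  note gD = lmod_homD[OF g]
  let ?aug = "augmentation R X"
  have AY: "abelian_group Y" and AP: "abelian_group P0"
    by (rule CY.X.M.abelian_group_axioms P0.M.abelian_group_axioms)+
  define k where "k w = g w \<ominus>\<^bsub>Y\<^esub> dsum \<delta> w" for w
  have ka: "addmap P0 Y k"
    unfolding k_def by (rule addmap_minus[OF AY lmod_hom_addmap[OF g] dsum_addmap[OF \<delta>]])
  have k_eq: "k f = k f'" if f: "f \<in> carrier P0" "f' \<in> carrier P0" "?aug f = ?aug f'" for f f'
  proof (rule CY.X.M.eq_if_minus_zero)
    have "?aug (f \<ominus>\<^bsub>P0\<^esub> f') = \<zero>\<^bsub>X\<^esub>"
      using addmap_diff[OF AP CX.X.M.abelian_group_axioms CX.X.augmentation_addmap f(1,2)]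
        CX.X.augmentation_closed[OF f(2)] f(3)
      by (simp add: CX.X.M.r_neg a_minus_def)
    moreover have "f \<ominus>\<^bsub>P0\<^esub> f' \<in> carrier P0" using f by (intro P0.M.minus_closed)
    ultimately have w: "f \<ominus>\<^bsub>P0\<^esub> f' \<in> carrier \<Omega>" by (simp add: CX.X.carrier_syzygy)
    have "k (f \<ominus>\<^bsub>P0\<^esub> f') = \<zero>\<^bsub>Y\<^esub>"
      using eq[OF w] gD(1)[OF \<Omega>_P0[OF w]] by (simp add: k_def CY.X.M.r_neg a_minus_def)
    then show "k f \<ominus>\<^bsub>Y\<^esub> k f' = \<zero>\<^bsub>Y\<^esub>" using addmap_diff[OF AP AY ka f(1,2)] by simp
  qed (use f addmapD(1)[OF ka] in auto)
  note fc = fsingle_closed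
  have g1: "g (fsingle R a x) = a \<odot>\<^bsub>Y\<^esub> g (fsingle R \<one> x)" if "a \<in> carrier R" "x \<in> carrier X" for a x
    using gD(4)[OF that(1) fc[OF R.one_closed that(2)]] that by (simp add: smult_fsingle)
  have gc: "g (fsingle R \<one> x) \<in> carrier Y" if "x \<in> carrier X" for x
    by (rule gD(1)[OF fc[OF R.one_closed that]])
  have k1: "k (fsingle R a x) = a \<odot>\<^bsub>Y\<^esub> g (fsingle R \<one> x) \<ominus>\<^bsub>Y\<^esub> app (\<delta> a) x" if "a \<in> carrier R" "x \<in> carrier X" for a x
    unfolding k_def g1[OF that] dsum_fsingle[OF \<delta> that] by (rule refl)
  have mz: "y \<ominus>\<^bsub>Y\<^esub> app 0 x = y" if "y \<in> carrier Y" for x y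
  proof -
    have "\<ominus>\<^bsub>Y\<^esub> \<zero>\<^bsub>Y\<^esub> = \<zero>\<^bsub>Y\<^esub>"
      by (rule CY.X.M.minus_equality) (rule CY.X.M.l_zero CY.X.M.zero_closed)+
    then show ?thesis using that by (simp only: app_lin(7) a_minus_def CY.X.M.r_zero)
  qed
  \<comment> \<open>Derivations vanish on scalars, so for scalar coefficients \<open>k\<close>
    agrees with \<open>g\<close>. Comparing elements of equal augmentation then shows that
    \<open>m\<close> is linear over \<open>K\<close>.\<close>
  have k2: "k (fsingle R (\<eta> c) x) = \<eta> c \<odot>\<^bsub>Y\<^esub> g (fsingle R \<one> x)" if "x \<in> carrier X" for c x
    using that gc[OF that] by (simp only: k1 \<eta>_closed d(4) mz CY.X.lsmult_closed)
  have k3: "k (fsingle R \<one> x) = g (fsingle R \<one> x)" if "x \<in> carrier X" for x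
    using that gc[OF that] by (simp only: k1 R.one_closed d(5) mz CY.X.lsmult_closed CY.X.lsmult_one)
  have "\<exists>m\<in>M. \<forall>x\<in>carrier X. g (fsingle R \<one> x) = app m x"
  proof (rule app_ex)
    fix x assume x: "x \<in> carrier X"
    show "g (fsingle R \<one> x) \<in> carrier Y" by (rule gc[OF x])
    show "g (fsingle R \<one> (\<eta> c \<odot>\<^bsub>X\<^esub> x)) = \<eta> c \<odot>\<^bsub>Y\<^esub> g (fsingle R \<one> x)" for c
    proof -
      have cx: "\<eta> c \<odot>\<^bsub>X\<^esub> x \<in> carrier X" by (rule CX.X.lsmult_closed[OF \<eta>_closed x])
      have "k (fsingle R \<one> (\<eta> c \<odot>\<^bsub>X\<^esub> x)) = k (fsingle R (\<eta> c) x)"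
        using x cx by (intro k_eq fc) (simp_all add: CX.X.augmentation_fsingle CX.X.lsmult_one)
      then show ?thesis by (simp only: k2[OF x] k3[OF cx])
    qed
    fix y assume y: "y \<in> carrier X"
    have xy: "x \<oplus>\<^bsub>X\<^esub> y \<in> carrier X" by (rule CX.X.M.a_closed[OF x y])
    have p: "fsingle R \<one> x \<oplus>\<^bsub>P0\<^esub> fsingle R \<one> y \<in> carrier P0"
      using x y by (intro P0.M.a_closed fc) simp_all
    have "?aug (fsingle R \<one> x \<oplus>\<^bsub>P0\<^esub> fsingle R \<one> y) = x \<oplus>\<^bsub>X\<^esub> y"
      using x y addmapD(2)[OF CX.X.augmentation_addmap fc fc, of \<one> x \<one> y]
      by (simp add: CX.X.augmentation_fsingle CX.X.lsmult_one)
    then have "k (fsingle R \<one> (x \<oplus>\<^bsub>X\<^esub> y)) = k (fsingle R \<one> x \<oplus>\<^bsub>P0\<^esub> fsingle R \<one> y)"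
      using xy p by (intro k_eq fc) (simp_all add: CX.X.augmentation_fsingle CX.X.lsmult_one)
    then show "g (fsingle R \<one> (x \<oplus>\<^bsub>X\<^esub> y)) = g (fsingle R \<one> x) \<oplus>\<^bsub>Y\<^esub> g (fsingle R \<one> y)"
      using addmapD(2)[OF ka fc fc, of \<one> x \<one> y] x y xy by (simp only: k3 R.one_closed)
  qed
  then obtain m where m: "m \<in> M" and gm: "\<And>x. x \<in> carrier X \<Longrightarrow> g (fsingle R \<one> x) = app m x" by blast
  have "\<delta> a = inner_der m a" if a: "a \<in> carrier R" for a
  proof (rule app_inject)
    fix x assume x: "x \<in> carrier X"
    have ax: "a \<odot>\<^bsub>X\<^esub> x \<in> carrier X" by (rule CX.X.lsmult_closed[OF a x])
    have "k (fsingle R a x) = k (fsingle R \<one> (a \<odot>\<^bsub>X\<^esub> x))"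
      using x ax a by (intro k_eq fc) (simp_all add: CX.X.augmentation_fsingle CX.X.lsmult_one)
    then have e: "a \<odot>\<^bsub>Y\<^esub> app m x \<ominus>\<^bsub>Y\<^esub> app (\<delta> a) x = app m (a \<odot>\<^bsub>X\<^esub> x)"
      by (simp only: k1[OF a x] k3[OF ax] gm[OF x] gm[OF ax])
    have c: "app m (a \<odot>\<^bsub>X\<^esub> x) \<in> carrier Y" "app (\<delta> a) x \<in> carrier Y" "a \<odot>\<^bsub>Y\<^esub> app m x \<in> carrier Y"
      using m a by (simp_all add: d CY.X.lsmult_closed)
    have "app (\<delta> a + m \<star> CX.\<rho> a) x = app (\<delta> a) x \<oplus>\<^bsub>Y\<^esub> app m (a \<odot>\<^bsub>X\<^esub> x)"
      using m a x by (simp only: app_lin(1) d(1) act_closed app_lin(6))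
    also have "\<dots> = a \<odot>\<^bsub>Y\<^esub> app m x"
      unfolding e[symmetric] a_minus_def using c
      by (simp add: CY.X.M.a_lcomm[of "app (\<delta> a) x"] CY.X.M.r_neg)
    also have "\<dots> = app (CY.\<rho> a \<star> m) x" using a m by (simp add: app_lin)
    also have "CY.\<rho> a \<star> m = inner_der m a + m \<star> CX.\<rho> a" by (simp add: inner_der_def)
    finally show "app (\<delta> a) x = app (inner_der m a) x"
      using c m a x derivationD(1)[OF derivation_inner[OF m] a]
      by (simp add: app_lin(1) d act_closed app_lin(6) del: plus_fun_apply)
  qed (use a m d derivationD(1)[OF derivation_inner[OF m]] in auto)
  then show ?thesis using m by blast
qed

end

locale mpa_pair = coord_pair "mpa Q r q" "mpa_scalar Q r q" X Y U I J \<xi>X \<xi>Y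
  for Q :: "('v, 'e) pre_digraph" and r and q :: "'v \<Rightarrow> 'k::field"
    and X :: "(('v, 'e, 'k) mpa, 'x) module" and Y :: "(('v, 'e, 'k) mpa, 'y) module"
    and U I J :: "'i set" and \<xi>X \<xi>Y +
  fixes vtx :: "'i \<Rightarrow> 'v"
  assumes quiver: "fin_digraph Q" "linear_order_on (arcs (double Q)) r" "\<forall>v\<in>verts Q. q v \<noteq> 0"
    and vertX: "v \<in> verts Q \<Longrightarrow> CX.\<rho> (mpa_vert Q r q v) = mdiag {i \<in> I. vtx i = v}"
    and vertY: "v \<in> verts Q \<Longrightarrow> CY.\<rho> (mpa_vert Q r q v) = mdiag {i \<in> J. vtx i = v}"
    and vtx_verts: "i \<in> I \<Longrightarrow> vtx i \<in> verts Q" "i \<in> J \<Longrightarrow> vtx i \<in> verts Q"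
begin

sublocale mpa_reps Q r q U I CX.\<rho> J CY.\<rho> vtx
  by (intro mpa_reps.intro quiver_reps.intro quiver_algebra_mpa quiver mat_reps_axioms
      quiver_reps_axioms.intro mpa_reps_axioms.intro vertX vertY vtx_verts)

abbreviation "L \<equiv> enum_by r (arcs (double Q))"

definition cocycles :: "('k, 'e darrow \<times> 'i \<times> 'i \<Rightarrow> 'k) module" where
  "cocycles = (fun_space S1)\<lparr>carrier := {D \<in> C1. dprod D L = 0}\<rparr>"

text \<open>The conditions determine the derivation only on the carrier of the algebra. It is
  therefore chosen arbitrarily, and equations between such derivations are proved there
  (\<open>der_eqI\<close>).\<close>

definition der :: "('e darrow \<times> 'i \<times> 'i \<Rightarrow> 'k) \<Rightarrow> ('v, 'e, 'k) mpa \<Rightarrow> 'i \<times> 'i \<Rightarrow> 'k" where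
  "der D = (SOME \<delta>. derivation \<delta> \<and> (\<forall>v\<in>verts Q. \<delta> (mpa_vert Q r q v) = 0) \<and>
     (\<forall>a\<in>arrows. \<delta> (mpa_arrow Q r q a) = blk D a))"

lemma cocycles_simps:
  "D \<in> carrier cocycles \<longleftrightarrow> D \<in> C1 \<and> dprod D L = 0" "add cocycles = (+)"
  "smult cocycles = (\<lambda>c D i. c * D i)"
  by (auto simp: cocycles_def)

lemma der:
  assumes "D \<in> carrier cocycles"
  shows "derivation (der D)" "v \<in> verts Q \<Longrightarrow> der D (mpa_vert Q r q v) = 0"
    "a \<in> arrows \<Longrightarrow> der D (mpa_arrow Q r q a) = blk D a"
  using someI_ex[OF derivation_ex[of D]] assms unfolding cocycles_simps der_def by blast+

lemma der_eqI:
  assumes "D \<in> carrier cocycles" "derivation \<delta>" "\<And>v. v \<in> verts Q \<Longrightarrow> \<delta> (mpa_vert Q r q v) = 0"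
    "\<And>a. a \<in> arrows \<Longrightarrow> \<delta> (mpa_arrow Q r q a) = blk D a" "a \<in> carrier (mpa Q r q)"
  shows "der D a = \<delta> a"
  by (rule derivation_eqI[OF der(1)[OF assms(1)] assms(2) _ _ assms(5)])
     (simp_all add: der[OF assms(1)] assms(3,4))

lemma cocycles_closed:
  assumes "D \<in> carrier cocycles" "E \<in> carrier cocycles"
  shows "D + E \<in> carrier cocycles" "(\<lambda>i. c * D i) \<in> carrier cocycles"
proof -
  show "D + E \<in> carrier cocycles" "(\<lambda>i. c * D i) \<in> carrier cocycles"
    using assms by (auto simp: cocycles_simps dprod_lin carrier_fun_space mscale_simps)
qed

text \<open>If the homomorphism extends to \<open>P0\<close>, then \<open>der D\<close> is inner,
  given by some \<open>m\<close>; since \<open>der D\<close> kills the \<open>e v\<close>, this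
  \<open>m\<close> commutes with them and lies in \<open>C0\<close>. The converse is
  \<open>dsum_inner\<close>.\<close>

lemma coboundary_iff_d0:
  assumes D: "D \<in> carrier cocycles"
  shows "(\<exists>g\<in>lmod_hom (mpa Q r q) P0 Y. \<forall>w\<in>carrier \<Omega>. dsum (der D) w = g w) \<longleftrightarrow> D \<in> d0 ` C0"
proof
  note \<delta> = der[OF D]
  have DC: "D \<in> C1" using D by (simp add: cocycles_simps)
  assume "\<exists>g\<in>lmod_hom (mpa Q r q) P0 Y. \<forall>w\<in>carrier \<Omega>. dsum (der D) w = g w"
  then obtain m where m: "m \<in> M" and i: "\<And>a. a \<in> carrier (mpa Q r q) \<Longrightarrow> der D a = inner_der m a"
    using inner_if_dsum_extends[OF \<delta>(1)] by blast
  have "m \<in> C0"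
    unfolding C0_iff[OF m]
  proof
    fix v assume v: "v \<in> verts Q"
    then have "inner_der m (mpa_vert Q r q v) = 0" using i[OF e_closed[OF v]] \<delta>(2) by simp
    then show "CY.\<rho> (mpa_vert Q r q v) \<star> m = m \<star> CX.\<rho> (mpa_vert Q r q v)"
      by (simp add: inner_der_def)
  qed
  moreover have "D = d0 m"
  proof (rule ext, clarify)
    fix a y x
    have "blk D a = blk (d0 m) a"
    proof (cases "a \<in> arrows")
      case True
      then show ?thesis using \<delta>(3)[OF True] i[OF ar_closed[OF True]] by (simp add: blk_d0)
    next
      case False
      then show ?thesis using DC by (auto simp: d0_def blk_def carrier_fun_space S1_def fun_eq_iff)
    qed
    then show "D (a, y, x) = d0 m (a, y, x)" by (simp add: blk_def fun_eq_iff)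
  qed
  ultimately show "D \<in> d0 ` C0" by blast
next
  assume "D \<in> d0 ` C0"
  then obtain m where m: "m \<in> C0" and Dm: "D = d0 m" by blast
  note mM = C0_M[OF m]
  have "der D a = inner_der m a" if "a \<in> carrier (mpa Q r q)" for a
    by (rule der_eqI[OF D derivation_inner[OF mM] inner_e[OF m] _ that]) (simp_all add: Dm blk_d0)
  then have "dsum (der D) w = fsum (mpa Q r q) Y (\<lambda>a x. a \<odot>\<^bsub>Y\<^esub> app m x) w" if "w \<in> carrier \<Omega>" for w
    using dsum_cong[OF der(1)[OF D] derivation_inner[OF mM] _ \<Omega>_P0[OF that]] dsum_inner[OF mM that] by simp
  then show "\<exists>g\<in>lmod_hom (mpa Q r q) P0 Y. \<forall>w\<in>carrier \<Omega>. dsum (der D) w = g w"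
    using free_hom(3)[of "app m"] mM \<Omega>_P0
    by (intro bexI[of _ "restrict (fsum (mpa Q r q) Y (\<lambda>a x. a \<odot>\<^bsub>Y\<^esub> app m x)) (carrier P0)"]) simp_all
qed

text \<open>Subtracting an inner derivation to make the \<open>e v\<close> vanish changes the
  homomorphism on the syzygy only by one that extends to \<open>P0\<close>
  (\<open>dsum_inner\<close>), and this is absorbed into \<open>g\<close>.\<close>

lemma hom_decompose_normalised:
  assumes \<phi>: "\<phi> \<in> lmod_hom (mpa Q r q) \<Omega> Y"
  shows "\<exists>D\<in>carrier cocycles. \<exists>g\<in>lmod_hom (mpa Q r q) P0 Y. \<forall>w\<in>carrier \<Omega>. \<phi> w = dsum (der D) w \<oplus>\<^bsub>Y\<^esub> g w"
proof -
  obtain \<delta> g where \<delta>: "derivation \<delta>" and g: "g \<in> lmod_hom (mpa Q r q) P0 Y"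
    and eq: "\<And>w. w \<in> carrier \<Omega> \<Longrightarrow> \<phi> w = dsum \<delta> w \<oplus>\<^bsub>Y\<^esub> g w"
    using hom_decompose[OF \<phi>] by blast
  obtain m where m: "m \<in> M" and e: "\<And>v. v \<in> verts Q \<Longrightarrow> \<delta> (mpa_vert Q r q v) = inner_der m (mpa_vert Q r q v)"
    using derivation_normalise[OF \<delta>] by blast
  note im = derivation_inner[OF m]
  define \<delta>' where "\<delta>' a = \<delta> a - inner_der m a" for a
  have \<delta>': "derivation \<delta>'" unfolding \<delta>'_def by (rule derivation_diff[OF \<delta> im])
  have e0: "\<delta>' (mpa_vert Q r q v) = 0" if "v \<in> verts Q" for v using e[OF that] by (simp add: \<delta>'_def)
  define D where "D = (\<lambda>(a, p). if a \<in> arrows then \<delta>' (mpa_arrow Q r q a) p else 0)"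
  have b: "blk D a = \<delta>' (mpa_arrow Q r q a)" if "a \<in> arrows" for a using that by (auto simp: blk_def D_def)
  have "dprod D L = \<delta>' (fprod L)" by (rule derivation_fprod[OF \<delta>' b, symmetric]) (use L in auto)
  also have "\<dots> = 0" unfolding fprod_L by (rule derivation_q_elem[OF \<delta>' e0])
  finally have D: "D \<in> carrier cocycles"
    using derivation_C1[OF \<delta>' e0] by (simp add: cocycles_simps D_def)
  have de: "der D a = \<delta>' a" if "a \<in> carrier (mpa Q r q)" for a
    by (rule der_eqI[OF D \<delta>' e0 _ that]) (simp_all add: b)
  define h where "h = restrict (fsum (mpa Q r q) Y (\<lambda>a x. a \<odot>\<^bsub>Y\<^esub> app m x)) (carrier P0)"
  have h: "h \<in> lmod_hom (mpa Q r q) P0 Y" unfolding h_def by (rule free_hom(3)) (simp add: m)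
  have "\<phi> w = dsum (der D) w \<oplus>\<^bsub>Y\<^esub> (h w \<oplus>\<^bsub>Y\<^esub> g w)" if w: "w \<in> carrier \<Omega>" for w
  proof -
    note wP = \<Omega>_P0[OF w]
    have "(\<lambda>a. \<delta>' a + inner_der m a) = \<delta>" by (simp add: \<delta>'_def)
    then have "dsum \<delta> w = dsum \<delta>' w \<oplus>\<^bsub>Y\<^esub> dsum (inner_der m) w"
      using dsum_add[OF \<delta>' im wP] by simp
    also have "dsum (inner_der m) w = h w" using dsum_inner[OF m w] wP by (simp add: h_def)
    also have "dsum \<delta>' w = dsum (der D) w"
      by (rule dsum_cong[OF \<delta>' der(1)[OF D] _ wP]) (simp add: de)
    finally have "dsum \<delta> w = dsum (der D) w \<oplus>\<^bsub>Y\<^esub> h w" .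
    then show ?thesis
      using eq[OF w] addmapD(1)[OF dsum_addmap[OF der(1)[OF D]] wP] lmod_homD(1)[OF h wP] lmod_homD(1)[OF g wP]
      by (simp add: CY.X.M.a_assoc)
  qed
  moreover have "(\<lambda>w\<in>carrier P0. h w \<oplus>\<^bsub>Y\<^esub> g w) \<in> lmod_hom (mpa Q r q) P0 Y"
    by (rule hom_space_add_closed[OF P0.lmodule_axioms CY.X.lmodule_axioms h g])
  ultimately show ?thesis
    using D \<Omega>_P0 by (intro bexI[of _ D] bexI[of _ "\<lambda>w\<in>carrier P0. h w \<oplus>\<^bsub>Y\<^esub> g w"] ballI) simp_all
qed

text \<open>\<open>Ext1_has_dim\<close> is applied with the cocycles as parameters, so the dimension
  of \<open>Ext1\<close> is that of the cocycles minus that of the image of \<open>d0\<close>, which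
  \<open>dim_count\<close> evaluates.\<close>

theorem Ext_Hom_formula:
  obtains l h h' where "has_dim (Ext1 (mpa Q r q) (mpa_scalar Q r q) X Y) l"
    "has_dim (hom_space (mpa Q r q) (mpa_scalar Q r q) X Y) h"
    "has_dim (hom_space (mpa Q r q) (mpa_scalar Q r q) Y X) h'"
    "int l = int h + int h' + int (card S1) - 2 * int (card S0)"
proof -
  \<comment> \<open>The same coordinates with \<open>X\<close> and \<open>Y\<close> exchanged, to
    read \<open>homs_YX\<close> as a space of homomorphisms from \<open>Y\<close> to
    \<open>X\<close>.\<close>
  interpret op: coord_pair "mpa Q r q" "mpa_scalar Q r q" Y X U J I \<xi>Y \<xi>X
    by (rule coord_pair.intro[OF k_algebra_axioms CY.coord_module_axioms CX.coord_module_axioms])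
  obtain h m p i where hd: "has_dim ((fun_space (J \<times> I))\<lparr>carrier := homs_XY\<rparr>) h"
    "has_dim ((fun_space (I \<times> J))\<lparr>carrier := homs_YX\<rparr>) m"
    "has_dim cocycles p" "has_dim ((fun_space S1)\<lparr>carrier := d0 ` C0\<rparr>) i"
    "int p - int i = int h + int m + int (card S1) - 2 * int (card S0)"
    unfolding cocycles_def by (rule dim_count)
  have H: "has_dim (hom_space (mpa Q r q) (mpa_scalar Q r q) X Y) h"
    by (rule has_dim_hom_space) (use hd(1) in \<open>simp add: hom_mats_def homs_XY_def\<close>)
  have H': "has_dim (hom_space (mpa Q r q) (mpa_scalar Q r q) Y X) m"
    by (rule op.has_dim_hom_space) (use hd(2) in \<open>simp add: op.hom_mats_def homs_YX_def\<close>)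
  define \<Psi> where "\<Psi> D = restrict (dsum (der D)) (carrier \<Omega>)" for D
  obtain k l where k: "has_dim (cocycles\<lparr>carrier := {D \<in> carrier cocycles.
        \<exists>g\<in>lmod_hom (mpa Q r q) P0 Y. \<forall>w\<in>carrier \<Omega>. \<Psi> D w = g w}\<rparr>) k"
    and l: "has_dim (Ext1 (mpa Q r q) (mpa_scalar Q r q) X Y) l" "k + l = p"
  proof (rule Ext1_has_dim[OF hd(3), of \<Psi>])
    show "\<Psi> D \<in> lmod_hom (mpa Q r q) \<Omega> Y" if "D \<in> carrier cocycles" for D
      unfolding \<Psi>_def by (rule dsum_hom[OF der(1)[OF that]])
    show "\<Psi> (D \<oplus>\<^bsub>cocycles\<^esub> E) w = \<Psi> D w \<oplus>\<^bsub>Y\<^esub> \<Psi> E w"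
      if D: "D \<in> carrier cocycles" and E: "E \<in> carrier cocycles" and w: "w \<in> carrier \<Omega>" for D E w
    proof -
      note s = derivation_add[OF der(1)[OF D] der(1)[OF E]]
      have "der (D + E) a = der D a + der E a" if "a \<in> carrier (mpa Q r q)" for a
        by (rule der_eqI[OF cocycles_closed(1)[OF D E] s _ _ that])
           (simp_all only: der[OF D] der[OF E] blk_lin add_0)
      then have "dsum (der (D + E)) w = dsum (\<lambda>a. der D a + der E a) w"
        by (intro dsum_cong[OF der(1)[OF cocycles_closed(1)[OF D E]] s _ \<Omega>_P0[OF w]])
      then show ?thesis
        using w dsum_add[OF der(1)[OF D] der(1)[OF E] \<Omega>_P0[OF w]] by (simp add: \<Psi>_def cocycles_simps)
    qed
    show "\<Psi> (c \<odot>\<^bsub>cocycles\<^esub> D) w = mpa_scalar Q r q c \<odot>\<^bsub>Y\<^esub> \<Psi> D w"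
      if D: "D \<in> carrier cocycles" and w: "w \<in> carrier \<Omega>" for c D w
    proof -
      note s = derivation_scale[OF der(1)[OF D], of c]
      have "der (\<lambda>i. c * D i) a = mscale c (der D a)" if "a \<in> carrier (mpa Q r q)" for a
        by (rule der_eqI[OF cocycles_closed(2)[OF D D] s _ _ that])
           (simp_all only: der[OF D] blk_lin mscale_simps)
      then have "dsum (der (\<lambda>i. c * D i)) w = dsum (\<lambda>a. mscale c (der D a)) w"
        by (intro dsum_cong[OF der(1)[OF cocycles_closed(2)[OF D D]] s _ \<Omega>_P0[OF w]])
      then show ?thesis
        using w dsum_scale[OF der(1)[OF D] \<Omega>_P0[OF w]] by (simp add: \<Psi>_def cocycles_simps)
    qed
    show "\<exists>D\<in>carrier cocycles. \<exists>g\<in>lmod_hom (mpa Q r q) P0 Y. \<forall>w\<in>carrier \<Omega>. \<phi> w = \<Psi> D w \<oplus>\<^bsub>Y\<^esub> g w"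
      if "\<phi> \<in> lmod_hom (mpa Q r q) \<Omega> Y" for \<phi>
      using hom_decompose_normalised[OF that] by (simp add: \<Psi>_def)
  qed
  have "{D \<in> carrier cocycles. \<exists>g\<in>lmod_hom (mpa Q r q) P0 Y. \<forall>w\<in>carrier \<Omega>. \<Psi> D w = g w} = d0 ` C0"
  proof -
    \<comment> \<open>The two maps compose to zero: the inner derivation of \<open>m\<close> kills
      the \<open>e v\<close>, hence the right-hand side of the relation, and its value on the
      product is \<open>dprod (d0 m) L\<close>.\<close>
    have "d0 m \<in> carrier cocycles" if "m \<in> C0" for m
    proof -
      note i = derivation_inner[OF C0_M[OF that]]
      have "dprod (d0 m) L = inner_der m (fprod L)"
        by (rule derivation_fprod[OF i, symmetric]) (use L in \<open>auto simp: blk_d0\<close>)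
      also have "\<dots> = 0" unfolding fprod_L by (rule derivation_q_elem[OF i inner_e[OF that]])
      finally show ?thesis using d0_C1[OF that] by (simp add: cocycles_simps)
    qed
    moreover have "D \<in> d0 ` C0 \<longleftrightarrow> (\<exists>g\<in>lmod_hom (mpa Q r q) P0 Y. \<forall>w\<in>carrier \<Omega>. \<Psi> D w = g w)"
      if "D \<in> carrier cocycles" for D
      using coboundary_iff_d0[OF that] by (simp add: \<Psi>_def)
    ultimately show ?thesis by auto
  qed
  then have "has_dim (cocycles\<lparr>carrier := d0 ` C0\<rparr>) k" using k by simp
  then have "has_dim ((fun_space S1)\<lparr>carrier := d0 ` C0\<rparr>) k" by (simp add: cocycles_def)
  then have "k = i" using hd(4) by (rule has_dim_unique)
  then show thesis using that[OF l(1) H H'] l(2) hd(5) by simp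
qed

end

section \<open>Coordinates adapted to the vertices\<close>

context k_algebra
begin

lemma vectorspace_restrict_scalars:
  assumes "lmodule R X"
  shows "vectorspace class_ring (restrict_scalars \<eta> X)"
proof -
  interpret X: lmodule R X by fact
  have "module class_ring (restrict_scalars \<eta> X)"
  proof (rule module_criteria)
    show "cring (class_ring :: 'k ring)" by (rule fieldE(1)[OF field_class_ring])
    show "\<forall>v\<in>carrier (restrict_scalars \<eta> X). \<exists>neg_v\<in>carrier (restrict_scalars \<eta> X).
        v \<oplus>\<^bsub>restrict_scalars \<eta> X\<^esub> neg_v = \<zero>\<^bsub>restrict_scalars \<eta> X\<^esub>"
      by (auto simp: restrict_scalars_def intro!: bexI[of _ "\<ominus>\<^bsub>X\<^esub> _"] X.M.r_neg)
  qed (auto simp: restrict_scalars_def \<eta>_add \<eta>_mult \<eta>_one X.lsmult_one X.lsmult_closed X.lsmult_l_distr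
      X.lsmult_r_distr X.lsmult_assoc X.M.a_ac)
  then show ?thesis by (simp add: vectorspace_def field_class_ring)
qed

text \<open>The idempotents split \<open>X\<close> into the subspaces \<open>W v\<close>, whose
  coordinates are placed side by side and indexed by pairs \<open>(v, i)\<close>. Injectivity holds
  because the components of \<open>x\<close> add up to \<open>x\<close>, surjectivity because
  components can be prescribed independently. \<open>U\<close> is left open so that two modules can
  be given a common one.\<close>

theorem coordinates_ex:
  fixes e :: "'v \<Rightarrow> 'r" and X :: "('r, 'x) module"
  assumes X: "lmodule R X" and fd: "vectorspace.fin_dim class_ring (restrict_scalars \<eta> X)"
    and V: "finite V" and ec: "\<And>v. v \<in> V \<Longrightarrow> e v \<in> carrier R"
    and ee: "\<And>v w. \<lbrakk>v \<in> V; w \<in> V\<rbrakk> \<Longrightarrow> e v \<otimes> e w = (if v = w then e v else \<zero>)"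
    and sum1: "(\<Oplus>v\<in>V. e v) = \<one>"
  defines "W \<equiv> \<lambda>v. (restrict_scalars \<eta> X)\<lparr>carrier := {e v \<odot>\<^bsub>X\<^esub> x | x. x \<in> carrier X}\<rparr>"
  defines "I \<equiv> {(v, i). v \<in> V \<and> i < vectorspace.dim class_ring (W v)}"
  obtains \<xi> where "\<And>U. \<lbrakk>finite U; I \<subseteq> U\<rbrakk> \<Longrightarrow> coord_module R \<eta> X U I \<xi>"
    "\<And>x v. \<lbrakk>x \<in> carrier X; v \<in> V\<rbrakk> \<Longrightarrow> \<xi> (e v \<odot>\<^bsub>X\<^esub> x) = (\<lambda>i. if fst i = v then \<xi> x i else 0)"
proof -
  interpret X: lmodule R X by fact
  let ?V = "restrict_scalars \<eta> X"
  define d where "d v = vectorspace.dim class_ring (W v)" for v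
  note sc = X.lsmult_closed
  have eex: "e v \<odot>\<^bsub>X\<^esub> (e w \<odot>\<^bsub>X\<^esub> x) = (if v = w then e v \<odot>\<^bsub>X\<^esub> x else \<zero>\<^bsub>X\<^esub>)"
    if "v \<in> V" "w \<in> V" "x \<in> carrier X" for v w x
    using that by (simp add: X.lsmult_assoc[symmetric] ec ee X.lsmult_l_zero)
  have e\<eta>: "e v \<odot>\<^bsub>X\<^esub> (\<eta> c \<odot>\<^bsub>X\<^esub> x) = \<eta> c \<odot>\<^bsub>X\<^esub> (e v \<odot>\<^bsub>X\<^esub> x)" if "v \<in> V" "x \<in> carrier X" for v c x
    using that by (simp add: X.lsmult_assoc[symmetric] \<eta>_central ec)
  have Vd: "has_dim ?V (vectorspace.dim class_ring ?V)"
    using vectorspace_restrict_scalars[OF X] fd by (simp add: has_dim_def)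
  \<comment> \<open>\<open>W v\<close> is the image of multiplication by \<open>e v\<close>, so
    rank-nullity gives it both the vector space structure and a finite dimension.\<close>
  have Wd: "has_dim (W v) (d v)" if v: "v \<in> V" for v
  proof -
    have l: "lin_map ?V (W v) (\<lambda>x. e v \<odot>\<^bsub>X\<^esub> x)"
      by (rule lin_mapI) (auto simp: W_def restrict_scalars_def X.lsmult_r_distr ec v e\<eta>)
    have s: "(\<lambda>x. e v \<odot>\<^bsub>X\<^esub> x) ` carrier ?V = carrier (W v)" by (auto simp: W_def restrict_scalars_def)
    have z: "e v \<odot>\<^bsub>X\<^esub> \<zero>\<^bsub>?V\<^esub> = \<zero>\<^bsub>W v\<^esub>" by (simp add: W_def restrict_scalars_def X.lsmult_r_zero ec v)
    obtain l where "has_dim (W v) l" by (rule has_dim_rank_nullity[OF Vd l s z])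
    then show ?thesis by (simp add: has_dim_def d_def)
  qed
  have "\<forall>v\<in>V. \<exists>\<kappa>. lin_map (W v) (fun_space {..<d v}) \<kappa> \<and> bij_betw \<kappa> (carrier (W v)) (carrier (fun_space {..<d v}))"
    using has_dim_coordinates[OF Wd] by metis
  then obtain \<kappa> :: "'v \<Rightarrow> 'x \<Rightarrow> nat \<Rightarrow> 'k" where \<kappa>: "\<And>v. v \<in> V \<Longrightarrow> lin_map (W v) (fun_space {..<d v}) (\<kappa> v)"
    and bij: "\<And>v. v \<in> V \<Longrightarrow> bij_betw (\<kappa> v) (carrier (W v)) (carrier (fun_space {..<d v}))"
    unfolding bchoice_iff by blast
  have eW: "e v \<odot>\<^bsub>X\<^esub> x \<in> carrier (W v)" if "x \<in> carrier X" for v x using that by (auto simp: W_def)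
  define \<xi> where "\<xi> x = (\<lambda>(v, i). if v \<in> V then \<kappa> v (e v \<odot>\<^bsub>X\<^esub> x) i else 0)" for x
  have \<kappa>_add: "\<kappa> v (e v \<odot>\<^bsub>X\<^esub> (x \<oplus>\<^bsub>X\<^esub> y)) = \<kappa> v (e v \<odot>\<^bsub>X\<^esub> x) + \<kappa> v (e v \<odot>\<^bsub>X\<^esub> y)"
    if "v \<in> V" "x \<in> carrier X" "y \<in> carrier X" for v x y
    using lin_mapD(2)[OF \<kappa>[OF that(1)] eW[OF that(2)] eW[OF that(3)]] that
    by (simp add: X.lsmult_r_distr ec) (simp add: W_def restrict_scalars_def fun_eq_iff)
  have \<kappa>_smult: "\<kappa> v (e v \<odot>\<^bsub>X\<^esub> (\<eta> c \<odot>\<^bsub>X\<^esub> x)) = (\<lambda>i. c * \<kappa> v (e v \<odot>\<^bsub>X\<^esub> x) i)"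
    if "v \<in> V" "x \<in> carrier X" for v c x
    using lin_mapD(3)[OF \<kappa>[OF that(1)] eW[OF that(2)], of c] that
    by (simp add: e\<eta>) (simp add: W_def restrict_scalars_def)
  have zz: "\<kappa> v \<zero>\<^bsub>X\<^esub> i = 0" if "v \<in> V" for v i
    using \<kappa>_smult[OF that X.M.zero_closed, of 0] that
    by (simp add: X.lsmult_r_zero ec \<eta>_zero X.lsmult_l_zero fun_eq_iff)
  have \<xi>c: "\<xi> x \<in> carrier (fun_space I)" if "x \<in> carrier X" for x
    using lin_mapD(1)[OF \<kappa> eW[OF that]] by (auto simp: \<xi>_def I_def carrier_fun_space d_def)
  have inj: "x = y" if xy: "x \<in> carrier X" "y \<in> carrier X" and eq: "\<xi> x = \<xi> y" for x y
  proof -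
    have ev: "e v \<odot>\<^bsub>X\<^esub> x = e v \<odot>\<^bsub>X\<^esub> y" if v: "v \<in> V" for v
    proof (rule inj_onD[OF bij_betw_imp_inj_on[OF bij[OF v]]])
      show "\<kappa> v (e v \<odot>\<^bsub>X\<^esub> x) = \<kappa> v (e v \<odot>\<^bsub>X\<^esub> y)"
      proof
        fix i
        show "\<kappa> v (e v \<odot>\<^bsub>X\<^esub> x) i = \<kappa> v (e v \<odot>\<^bsub>X\<^esub> y) i"
          using fun_cong[OF eq, of "(v, i)"] v by (simp add: \<xi>_def)
      qed
    qed (use xy eW in auto)
    have "(\<Oplus>v\<in>S. e v) \<in> carrier R \<and> (\<Oplus>v\<in>S. e v) \<odot>\<^bsub>X\<^esub> x = (\<Oplus>v\<in>S. e v) \<odot>\<^bsub>X\<^esub> y" if "finite S" "S \<subseteq> V" for S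
      using that
    proof (induction S rule: finite_induct)
      case (insert v S)
      have "(\<Oplus>v\<in>insert v S. e v) = e v \<oplus> (\<Oplus>v\<in>S. e v)"
        by (rule R.finsum_insert) (use insert ec in auto)
      then show ?case using insert ev[of v] xy by (simp add: X.lsmult_l_distr ec)
    qed (simp add: X.lsmult_l_zero xy)
    from this[OF V order_refl] show ?thesis using xy by (simp add: sum1 X.lsmult_one)
  qed
  have surj: "\<exists>x\<in>carrier X. \<xi> x = f" if f: "f \<in> carrier (fun_space I)" for f
  proof -
    have "\<exists>y\<in>carrier X. e v \<odot>\<^bsub>X\<^esub> y = y \<and> \<kappa> v y = (\<lambda>i. f (v, i))" if v: "v \<in> V" for v
    proof -
      have "(\<lambda>i. f (v, i)) \<in> carrier (fun_space {..<d v})"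
        using f by (auto simp: carrier_fun_space I_def d_def)
      then have "(\<lambda>i. f (v, i)) \<in> \<kappa> v ` carrier (W v)" using bij[OF v] by (simp add: bij_betw_def)
      then obtain y where "y \<in> carrier (W v)" "\<kappa> v y = (\<lambda>i. f (v, i))" by auto
      then show ?thesis using v by (intro bexI[of _ y]) (auto simp: W_def eex sc ec)
    qed
    then obtain w where w: "\<And>v. v \<in> V \<Longrightarrow> w v \<in> carrier X" "\<And>v. v \<in> V \<Longrightarrow> e v \<odot>\<^bsub>X\<^esub> w v = w v"
      "\<And>v. v \<in> V \<Longrightarrow> \<kappa> v (w v) = (\<lambda>i. f (v, i))" by metis
    have ew: "e v \<odot>\<^bsub>X\<^esub> w u = (if v = u then w v else \<zero>\<^bsub>X\<^esub>)" if "v \<in> V" "u \<in> V" for u v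
      using eex[OF that w(1)[OF that(2)]] w(2)[OF that(2)] by auto
    have "\<exists>x\<in>carrier X. \<forall>v\<in>V. e v \<odot>\<^bsub>X\<^esub> x = (if v \<in> S then w v else \<zero>\<^bsub>X\<^esub>)" if "finite S" "S \<subseteq> V" for S
      using that
    proof (induction S rule: finite_induct)
      case empty
      then show ?case by (intro bexI[of _ "\<zero>\<^bsub>X\<^esub>"]) (simp_all add: X.lsmult_r_zero ec)
    next
      case (insert u S)
      then obtain x where x: "x \<in> carrier X" "\<forall>v\<in>V. e v \<odot>\<^bsub>X\<^esub> x = (if v \<in> S then w v else \<zero>\<^bsub>X\<^esub>)" by auto
      show ?case
        using insert x
        by (intro bexI[of _ "x \<oplus>\<^bsub>X\<^esub> w u"] ballI) (auto simp: X.lsmult_r_distr ec w ew)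
    qed
    from this[OF V order_refl] obtain x where x: "x \<in> carrier X" "\<And>v. v \<in> V \<Longrightarrow> e v \<odot>\<^bsub>X\<^esub> x = w v" by auto
    have "\<xi> x = f"
      using x w(3) f by (auto simp: \<xi>_def carrier_fun_space I_def fun_eq_iff)
    then show ?thesis using x(1) by blast
  qed
  have "coord_module R \<eta> X U I \<xi>" if U: "finite U" "I \<subseteq> U" for U
  proof (intro coord_module.intro coord_module_axioms.intro k_algebra_axioms X U)
    show "bij_betw \<xi> (carrier X) (carrier (fun_space I))"
      using inj \<xi>c surj by (intro bij_betwI') metis+
    show "\<xi> (x \<oplus>\<^bsub>X\<^esub> y) = \<xi> x + \<xi> y" if "x \<in> carrier X" "y \<in> carrier X" for x y
      using that by (auto simp: \<xi>_def \<kappa>_add fun_eq_iff)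
    show "\<xi> (\<eta> c \<odot>\<^bsub>X\<^esub> x) = mscale c (\<xi> x)" if "x \<in> carrier X" for c x
      using that by (auto simp: \<xi>_def \<kappa>_smult fun_eq_iff mscale_def)
  qed
  moreover have "\<xi> (e v \<odot>\<^bsub>X\<^esub> x) = (\<lambda>i. if fst i = v then \<xi> x i else 0)" if "x \<in> carrier X" "v \<in> V" for x v
    using that by (auto simp: \<xi>_def eex zz fun_eq_iff)
  ultimately show thesis by (rule that)
qed

end

theorem theorem1p6:
  fixes Q :: "('v, 'e) pre_digraph"
    and r :: "'e darrow rel"
    and q :: "'v \<Rightarrow> 'k::field"
    and X :: "(('v, 'e, 'k) mpa, 'x) module"
    and Y :: "(('v, 'e, 'k) mpa, 'y) module"
  assumes "fin_digraph Q"
    and "linear_order_on (arcs (double Q)) r"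
    and "\<forall>v\<in>verts Q. q v \<noteq> 0"
    and "fin_dim_rep Q r q X"
    and "fin_dim_rep Q r q Y"
  shows "vectorspace.fin_dim class_ring (Ext1 (mpa Q r q) (mpa_scalar Q r q) X Y) \<and>
    int (vectorspace.dim class_ring (Ext1 (mpa Q r q) (mpa_scalar Q r q) X Y)) =
      int (vectorspace.dim class_ring (hom_space (mpa Q r q) (mpa_scalar Q r q) X Y))
      + int (vectorspace.dim class_ring (hom_space (mpa Q r q) (mpa_scalar Q r q) Y X))
      - quiver_form Q (\<lambda>v. int (dim_vector Q r q X v)) (\<lambda>v. int (dim_vector Q r q Y v))"
proof -
  let ?L = "mpa Q r q" and ?\<eta> = "mpa_scalar Q r q" and ?e = "mpa_vert Q r q"
  interpret F: fin_digraph Q by fact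
  interpret A: quiver_algebra ?L ?\<eta> Q ?e "mpa_arrow Q r q" "enum_by r (arcs (double Q))"
    "mpa_map Q r q (q_elem Q q)" "mpa_map Q r q (q_elem Q (\<lambda>v. inverse (q v)))"
    by (rule quiver_algebra_mpa) fact+
  define \<alpha> \<beta> where "\<alpha> = dim_vector Q r q X" and "\<beta> = dim_vector Q r q Y"
  \<comment> \<open>The two index sets may overlap. This is harmless, since a matrix from
    \<open>X\<close> to \<open>Y\<close> has its rows in \<open>J\<close> and its columns in
    \<open>I\<close>; the union serves as common index set, and the vertex of a coordinate is its
    first component in both.\<close>
  define I J where "I = {(v, i). v \<in> verts Q \<and> i < \<alpha> v}" and "J = {(v, i). v \<in> verts Q \<and> i < \<beta> v}"
  have fin: "finite {(v, i). v \<in> verts Q \<and> i < n v}" for n :: "'v \<Rightarrow> nat"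
  proof -
    have "{(v, i). v \<in> verts Q \<and> i < n v} = (SIGMA v:verts Q. {..<n v})" by auto
    then show ?thesis by simp
  qed
  have U: "finite (I \<union> J)" "I \<subseteq> I \<union> J" "J \<subseteq> I \<union> J" using fin by (auto simp: I_def J_def)
  \<comment> \<open>Stated for a module with a carrier type of its own, since the types of
    \<open>X\<close> and \<open>Y\<close> differ.\<close>
  have coord: "\<exists>\<xi>. coord_module ?L ?\<eta> Z (I \<union> J) {(v, i). v \<in> verts Q \<and> i < dim_vector Q r q Z v} \<xi> \<and>
      (\<forall>x\<in>carrier Z. \<forall>v\<in>verts Q. \<xi> (?e v \<odot>\<^bsub>Z\<^esub> x) = (\<lambda>i. if fst i = v then \<xi> x i else 0))"
    if Z: "fin_dim_rep Q r q Z" and sub: "{(v, i). v \<in> verts Q \<and> i < dim_vector Q r q Z v} \<subseteq> I \<union> J"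
    for Z :: "(('v, 'e, 'k) mpa, 'z) module"
  proof -
    have X: "lmodule ?L Z" using Z by (simp add: fin_dim_rep_def lmodule_def)
    have fd: "vectorspace.fin_dim class_ring (restrict_scalars ?\<eta> Z)" using Z by (simp add: fin_dim_rep_def)
    let ?I = "{(v, i). v \<in> verts Q \<and>
        i < vectorspace.dim class_ring ((restrict_scalars ?\<eta> Z)\<lparr>carrier := {?e v \<odot>\<^bsub>Z\<^esub> x | x. x \<in> carrier Z}\<rparr>)}"
    have I: "{(v, i). v \<in> verts Q \<and> i < dim_vector Q r q Z v} = ?I"
      by (simp add: dim_vector_def vertex_space_def mpa_vert_def)
    show ?thesis
    proof (rule A.coordinates_ex[OF X fd F.finite_verts A.e_closed A.e_mult mpa_sum_vert[OF assms(1,2)]])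
      fix \<xi>
      assume c: "\<And>U. \<lbrakk>finite U; ?I \<subseteq> U\<rbrakk> \<Longrightarrow> coord_module ?L ?\<eta> Z U ?I \<xi>"
        and e: "\<And>x v. \<lbrakk>x \<in> carrier Z; v \<in> verts Q\<rbrakk> \<Longrightarrow> \<xi> (?e v \<odot>\<^bsub>Z\<^esub> x) = (\<lambda>i. if fst i = v then \<xi> x i else 0)"
      show ?thesis unfolding I using c[OF U(1) sub[unfolded I]] e by blast
    qed
  qed
  obtain \<xi>X where X: "coord_module ?L ?\<eta> X (I \<union> J) I \<xi>X"
    and Xe: "\<And>x v. \<lbrakk>x \<in> carrier X; v \<in> verts Q\<rbrakk> \<Longrightarrow> \<xi>X (?e v \<odot>\<^bsub>X\<^esub> x) = (\<lambda>i. if fst i = v then \<xi>X x i else 0)"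
    using coord[OF assms(4)] U(2) unfolding I_def \<alpha>_def by blast
  obtain \<xi>Y where Y: "coord_module ?L ?\<eta> Y (I \<union> J) J \<xi>Y"
    and Ye: "\<And>x v. \<lbrakk>x \<in> carrier Y; v \<in> verts Q\<rbrakk> \<Longrightarrow> \<xi>Y (?e v \<odot>\<^bsub>Y\<^esub> x) = (\<lambda>i. if fst i = v then \<xi>Y x i else 0)"
    using coord[OF assms(5)] U(3) unfolding J_def \<beta>_def by blast
  interpret X: coord_module ?L ?\<eta> X "I \<union> J" I \<xi>X by (rule X)
  interpret Y: coord_module ?L ?\<eta> Y "I \<union> J" J \<xi>Y by (rule Y)
  have Xm: "X.\<rho> (?e v) = mdiag {i \<in> I. fst i = v}" if v: "v \<in> verts Q" for v
  proof (rule X.\<rho>_mdiag)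
    show "\<xi>X (?e v \<odot>\<^bsub>X\<^esub> x) = (\<lambda>i. if i \<in> {i \<in> I. fst i = v} then \<xi>X x i else 0)" if "x \<in> carrier X" for x
      using Xe[OF that v] X.\<xi>_closed[OF that] by (auto simp: carrier_fun_space fun_eq_iff)
  qed (use v in auto)
  have Ym: "Y.\<rho> (?e v) = mdiag {i \<in> J. fst i = v}" if v: "v \<in> verts Q" for v
  proof (rule Y.\<rho>_mdiag)
    show "\<xi>Y (?e v \<odot>\<^bsub>Y\<^esub> x) = (\<lambda>i. if i \<in> {i \<in> J. fst i = v} then \<xi>Y x i else 0)" if "x \<in> carrier Y" for x
      using Ye[OF that v] Y.\<xi>_closed[OF that] by (auto simp: carrier_fun_space fun_eq_iff)
  qed (use v in auto)
  interpret P: mpa_pair Q r q X Y "I \<union> J" I J \<xi>X \<xi>Y fst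
    by (intro mpa_pair.intro coord_pair.intro mpa_pair_axioms.intro A.k_algebra_axioms X Y assms Xm Ym)
       (auto simp: I_def J_def)
  have fiber: "card {i \<in> {(v, i). v \<in> verts Q \<and> i < n v}. fst i = v} = n v" if "v \<in> verts Q" for v and n :: "'v \<Rightarrow> nat"
  proof -
    have "{i \<in> {(v, i). v \<in> verts Q \<and> i < n v}. fst i = v} = Pair v ` {..<n v}" using that by auto
    then show ?thesis by (simp add: card_image inj_on_def)
  qed
  let ?F = "\<lambda>B v. {i \<in> B. fst i = v}"
  have cardI: "card (?F I v) = \<alpha> v" and cardJ: "card (?F J v) = \<beta> v" if "v \<in> verts Q" for v
    unfolding I_def J_def by (rule fiber[OF that])+
  have finIJ: "finite (?F I v)" "finite (?F J v)" for v using U(1) by auto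
  have "P.S0 = (\<Union>v\<in>verts Q. ?F J v \<times> ?F I v)"
    unfolding P.S0_def by (auto simp: I_def J_def)
  then have "card P.S0 = (\<Sum>v\<in>verts Q. card (?F J v \<times> ?F I v))"
    using finIJ by (simp add: card_UN_disjoint disjoint_iff)
  also have "\<dots> = (\<Sum>v\<in>verts Q. \<alpha> v * \<beta> v)"
    by (rule sum.cong) (simp_all add: card_cartesian_product cardI cardJ)
  finally have S0: "card P.S0 = (\<Sum>v\<in>verts Q. \<alpha> v * \<beta> v)" .
  have "P.S1 = (SIGMA a:arcs (double Q). ?F J (head (double Q) a) \<times> ?F I (tail (double Q) a))"
    unfolding P.S1_def by auto
  then have "card P.S1 = (\<Sum>a\<in>arcs (double Q). card (?F J (head (double Q) a) \<times> ?F I (tail (double Q) a)))"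
    using finIJ F.finite_arcs by (simp add: double_def)
  also have "\<dots> = (\<Sum>a\<in>arcs (double Q). \<beta> (head (double Q) a) * \<alpha> (tail (double Q) a))"
    by (rule sum.cong) (auto simp: card_cartesian_product cardI cardJ double_def)
  \<comment> \<open>An arrow of \<open>Q\<close> and its reverse have head and tail exchanged, which
    yields the two summands of the symmetric form.\<close>
  also have "\<dots> = (\<Sum>a\<in>arcs Q. \<alpha> (head Q a) * \<beta> (tail Q a) + \<alpha> (tail Q a) * \<beta> (head Q a))"
    unfolding sum_arcs_double[OF assms(1)] by (rule sum.cong) (simp_all add: double_def mult.commute)
  finally have S1: "card P.S1 = (\<Sum>a\<in>arcs Q. \<alpha> (head Q a) * \<beta> (tail Q a) + \<alpha> (tail Q a) * \<beta> (head Q a))" .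
  have form: "quiver_form Q (\<lambda>v. int (\<alpha> v)) (\<lambda>v. int (\<beta> v)) = 2 * int (card P.S0) - int (card P.S1)"
    by (simp add: S0 S1 quiver_form_def)
  show ?thesis
    by (rule P.Ext_Hom_formula) (use form in \<open>simp add: has_dim_def \<alpha>_def \<beta>_def\<close>)
qed

end
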